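(* Let $d\geq 2$, let $E$ and $F$ be finite-dimensional vector spaces over $\mathbb{C}$, let $m\ge 1$ be an integer, and let $A:\mathbb{R}^d\times E\to F$ be a function that is a homogeneous polynomial of order $m$ in the first variable and linear in the second variable. Let $A(\partial)$ be the corresponding differential operator from $E$-valued to $F$-valued vector fields on $\mathbb{R}^d$. Let $l$ be any non-zero element of $E^*$ and let $j\in\{1,2,\ldots,d\}$. Then the following two statements are equivalent. 1. There is a constant $C_1>0$ such that for every smooth compactly supported vector field $\varphi:\mathbb{R}^d\to E$ there exists a real-valued function $\Phi\in\mathcal{H}_1(\mathbb{R}^d)$ such that $$I_1[\Phi]\geq \operatorname{Re}\langle \partial_j^{m-1}\varphi, l\rangle \quad\text{and}\quad \|\Phi\|_{\mathcal{H}_1}\leq C_1\|A(\partial)\varphi\|_{L_1}.$$ 2. There is a constant $C_2>0$ such that for every smooth compactly supported vector field $\varphi:\mathbb{R}^d\to E$ and every non-negative Borel measure $\mu$ on $\mathbb{R}^d$ (of locally bounded variation, i.e. finite on bounded sets), $$\operatorname{Re}\int_{\mathbb{R}^d}\langle \partial_j^{m-1}\varphi, l\rangle\,d\mu\leq C_2\,\|A(\partial)\varphi\|_{L_1}\,\|M_1[\mu]\|_{L_\infty}.$$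
   Context: The differential operator generated by $A$ is $A(\partial)f=\mathcal{F}^{-1}\big[A\big(i\xi,\mathcal{F}[f](\xi)\big)\big]$ for sufficiently smooth (e.g. Schwartz) $f:\mathbb{R}^d\to E$, where $\mathcal{F}$ is the Fourier transform; i.e. $A(\partial)$ is the homogeneous constant-coefficient differential operator of order $m$ obtained by substituting $\partial=(\partial_1,\dots,\partial_d)$ for the first variable of $A$. The $L_1$ norm of an $F$-valued field is taken with respect to a fixed norm on $F$. $\langle \partial_j^{m-1}\varphi,l\rangle$ denotes the complex-valued function $x\mapsto l(\partial_j^{m-1}\varphi(x))$, where $\partial_j^{m-1}$ is the $(m-1)$-fold partial derivative in the $j$-th coordinate (the identity if $m=1$). $\mathcal{H}_1=\mathcal{H}_1(\mathbb{R}^d)$ is the real Hardy class, with norm $\|g\|_{\mathcal{H}_1}\asymp\big\|\sup_{t>0}|g*t^{-d}\psi(\cdot/t)|\big\|_{L_1}$ for a fixed $\psi\in C_0^\infty(\mathbb{R}^d)$ with $\int\psi\neq0$. $I_1$ is the Riesz potential of order $1$, $I_1[f]=f*c_1|\cdot|^{1-d}$, where $c_1$ is the constant such that $I_1$ is the Fourier multiplier with symbol $|\xi|^{-1}$. It is well defined on $\mathcal{H}_1$. Inequalities between functions are understood almost everywhere. The fractional maximal function of order $1$ of a measure $\mu$ of locally bounded variation is $M_1[\mu](x)=\sup_{r>0} r^{1-d}|\mu|(\{y:|x-y|\leq r\})$, where $|\mu|$ is the total variation; for non-negative $\mu$, $|\mu|=\mu$. In statement 2 the right-hand side is regarded as $+\infty$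 when $\|M_1[\mu]\|_{L_\infty}=\infty$. The constants $C_1,C_2$ may depend on $d,A,E,F,l,j$, but not on $\varphi,\mu$. *)

theory Defs
  imports "HOL-Probability.Probability"
begin

section \<open>Finite-dimensional complex vector spaces\<close>

text \<open>
  The complex structure is an explicit scalar multiplication extending the real one of the type.
  The norm of the type is a complex norm. Any finite-dimensional complex vector space carries one,
  and the notions of differentiability and smoothness do not depend on it.
\<close>

definition fin_dim_complex_normed ::
    "(complex \<Rightarrow> 'a::real_normed_vector \<Rightarrow> 'a) \<Rightarrow> bool" where
  "fin_dim_complex_normed cscale \<longleftrightarrow>
     (\<exists>B. finite_dimensional_vector_space cscale B) \<and>
     (\<forall>r x. cscale (complex_of_real r) x = r *\<^sub>R x) \<and>
     (\<forall>c x. norm (cscale c x) = cmod c * norm x)"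


section \<open>Partial derivatives and test functions\<close>

definition partial :: "'d::finite \<Rightarrow> (real^'d \<Rightarrow> 'a::real_normed_vector) \<Rightarrow> real^'d \<Rightarrow> 'a" where
  "partial i f x = vector_derivative (\<lambda>t. f (x + t *\<^sub>R axis i 1)) (at 0)"

text \<open>
  All iterated partial derivatives are (totally) differentiable, hence continuous:
  this is the class of infinitely differentiable functions.
\<close>

definition smooth :: "(real^'d::finite \<Rightarrow> 'a::real_normed_vector) \<Rightarrow> bool" where
  "smooth f \<longleftrightarrow> (\<forall>is. foldr partial is f differentiable_on UNIV)"

definition test_function :: "(real^'d::finite \<Rightarrow> 'a::real_normed_vector) \<Rightarrow> bool" where
  "test_function f \<longleftrightarrow> smooth f \<and> compact (closure {x. f x \<noteq> 0})"


section \<open>Homogeneous polynomials\<close>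

text \<open>
  A multi-index is a multiset of coordinates: \<^term>\<open>count \<alpha> i\<close> is its \<open>i\<close>-th entry and
  \<^term>\<open>size \<alpha>\<close> its order.
\<close>

definition monomial :: "'d::finite multiset \<Rightarrow> real^'d \<Rightarrow> real" where
  "monomial \<alpha> \<xi> = (\<Prod>i\<in>UNIV. (\<xi> $ i) ^ count \<alpha> i)"

definition homogeneous_polynomial ::
    "nat \<Rightarrow> (real^'d::finite \<Rightarrow> 'a::real_vector) \<Rightarrow> bool" where
  "homogeneous_polynomial m p \<longleftrightarrow>
     (\<exists>c. \<forall>\<xi>. p \<xi> = (\<Sum>\<alpha>\<in>multisets_of_size UNIV m. monomial \<alpha> \<xi> *\<^sub>R c \<alpha>))"

text \<open>
  The coefficient of \<open>\<xi>\<^sup>\<alpha>\<close>. It is well defined by lemmas \<open>homogeneous_polynomial_coeffs_unique\<close>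
  and \<open>hom_coeff_eq\<close> below.
\<close>

definition hom_coeff ::
    "nat \<Rightarrow> (real^'d::finite \<Rightarrow> 'a::real_vector) \<Rightarrow> 'd multiset \<Rightarrow> 'a" where
  "hom_coeff m p =
     (THE c. (\<forall>\<alpha>. size \<alpha> \<noteq> m \<longrightarrow> c \<alpha> = 0) \<and>
             (\<forall>\<xi>. p \<xi> = (\<Sum>\<alpha>\<in>multisets_of_size UNIV m. monomial \<alpha> \<xi> *\<^sub>R c \<alpha>)))"

lemma in_multisets_of_size_UNIV [simp]: "\<alpha> \<in> multisets_of_size UNIV m \<longleftrightarrow> size \<alpha> = m"
  by (simp add: multisets_of_size_def)

lemma monomial_along_axis_deriv:
  "((\<lambda>t. monomial \<alpha> (\<xi> + t *\<^sub>R axis i 1)) has_vector_derivative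
     real (count \<alpha> i) * monomial (\<alpha> - {#i#}) \<xi>) (at 0)"
proof -
  have eq: "monomial \<alpha> (\<xi> + t *\<^sub>R axis i 1) =
      (\<xi> $ i + t) ^ count \<alpha> i * (\<Prod>k\<in>UNIV - {i}. (\<xi> $ k) ^ count \<alpha> k)" for t
  proof -
    have "monomial \<alpha> (\<xi> + t *\<^sub>R axis i 1) = (\<xi> $ i + t) ^ count \<alpha> i *
        (\<Prod>k\<in>UNIV - {i}. ((\<xi> + t *\<^sub>R axis i 1) $ k) ^ count \<alpha> k)"
      unfolding monomial_def by (subst prod.remove[of UNIV i]) (auto simp: axis_def)
    also have "(\<Prod>k\<in>UNIV - {i}. ((\<xi> + t *\<^sub>R axis i 1) $ k) ^ count \<alpha> k) =
        (\<Prod>k\<in>UNIV - {i}. (\<xi> $ k) ^ count \<alpha> k)"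
      by (rule prod.cong) (auto simp: axis_def)
    finally show ?thesis .
  qed
  have mon: "monomial (\<alpha> - {#i#}) \<xi> =
      (\<xi> $ i) ^ (count \<alpha> i - 1) * (\<Prod>k\<in>UNIV - {i}. (\<xi> $ k) ^ count \<alpha> k)"
    unfolding monomial_def by (subst prod.remove[of UNIV i]) auto
  show ?thesis
    unfolding eq mon has_real_derivative_iff_has_vector_derivative[symmetric]
    by (auto intro!: derivative_eq_intros)
qed

lemma homogeneous_polynomial_zero_coeffs:
  fixes c :: "'d::finite multiset \<Rightarrow> 'a::real_normed_vector"
  assumes "\<And>\<xi>. (\<Sum>\<alpha>\<in>multisets_of_size UNIV m. monomial \<alpha> \<xi> *\<^sub>R c \<alpha>) = 0"
    and "size \<alpha> = m"
  shows "c \<alpha> = 0"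
  using assms
proof (induction m arbitrary: c \<alpha>)
  case 0
  have "multisets_of_size UNIV 0 = {{#} :: 'd multiset}"
    by (auto simp: multisets_of_size_def)
  then show ?case
    using 0 by (auto simp: monomial_def)
next
  case (Suc m)
  obtain i \<beta> where \<alpha>_eq: "\<alpha> = add_mset i \<beta>"
    using size_eq_Suc_imp_eq_union[OF Suc.prems(2)] by blast
  with Suc.prems(2) have \<beta>: "size \<beta> = m"
    by simp
  define c' where "c' \<gamma> = real (Suc (count \<gamma> i)) *\<^sub>R c (add_mset i \<gamma>)" for \<gamma>
  have "(\<Sum>\<gamma>\<in>multisets_of_size UNIV m. monomial \<gamma> \<xi> *\<^sub>R c' \<gamma>) = 0" for \<xi> :: "real^'d"
  proof -
    let ?S = "multisets_of_size (UNIV :: 'd set) (Suc m)"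
    let ?g = "\<lambda>\<alpha>. (real (count \<alpha> i) * monomial (\<alpha> - {#i#}) \<xi>) *\<^sub>R c \<alpha>"
    have "((\<lambda>t. \<Sum>\<alpha>\<in>?S. monomial \<alpha> (\<xi> + t *\<^sub>R axis i 1) *\<^sub>R c \<alpha>) has_vector_derivative
        (\<Sum>\<alpha>\<in>?S. ?g \<alpha>)) (at 0)"
      by (intro has_vector_derivative_sum bounded_linear.has_vector_derivative
          [OF bounded_linear_scaleR_left] monomial_along_axis_deriv)
    moreover have "((\<lambda>t. \<Sum>\<alpha>\<in>?S. monomial \<alpha> (\<xi> + t *\<^sub>R axis i 1) *\<^sub>R c \<alpha>)
        has_vector_derivative 0) (at 0)"
      using Suc.prems(1) by simp
    ultimately have "(\<Sum>\<alpha>\<in>?S. ?g \<alpha>) = 0"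
      using vector_derivative_unique_at by blast
    moreover have "(\<Sum>\<alpha>\<in>?S. ?g \<alpha>) = (\<Sum>\<alpha>\<in>add_mset i ` multisets_of_size UNIV m. ?g \<alpha>)"
    proof (rule sum.mono_neutral_right)
      show "\<forall>\<alpha>\<in>?S - add_mset i ` multisets_of_size UNIV m. ?g \<alpha> = 0"
      proof
        fix \<alpha> assume a: "\<alpha> \<in> ?S - add_mset i ` multisets_of_size UNIV m"
        have "i \<notin># \<alpha>"
        proof
          assume "i \<in># \<alpha>"
          then obtain \<gamma> where "\<alpha> = add_mset i \<gamma>"
            by (meson mset_add)
          with a show False by auto
        qed
        then show "?g \<alpha> = 0"
          by (simp add: not_in_iff)
      qed
    qed auto
    moreover have "\<dots> = (\<Sum>\<gamma>\<in>multisets_of_size UNIV m. monomial \<gamma> \<xi> *\<^sub>R c' \<gamma>)"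
      by (subst sum.reindex) (auto simp: inj_on_def c'_def mult_ac)
    ultimately show ?thesis by simp
  qed
  from Suc.IH[OF this \<beta>] show ?case
    by (simp add: c'_def \<alpha>_eq)
qed

lemma homogeneous_polynomial_coeffs_unique:
  fixes c c' :: "'d::finite multiset \<Rightarrow> 'a::real_normed_vector"
  assumes "\<And>\<xi>. (\<Sum>\<alpha>\<in>multisets_of_size UNIV m. monomial \<alpha> \<xi> *\<^sub>R c \<alpha>) =
                (\<Sum>\<alpha>\<in>multisets_of_size UNIV m. monomial \<alpha> \<xi> *\<^sub>R c' \<alpha>)"
    and "size \<alpha> = m"
  shows "c \<alpha> = c' \<alpha>"
  using homogeneous_polynomial_zero_coeffs[where m=m and c="\<lambda>\<alpha>. c \<alpha> - c' \<alpha>" and \<alpha>=\<alpha>] assms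
  by (simp add: scaleR_diff_right sum_subtractf)

lemma hom_coeff_eq:
  fixes c :: "'d::finite multiset \<Rightarrow> 'a::real_normed_vector"
  assumes p: "\<And>\<xi>. p \<xi> = (\<Sum>\<alpha>\<in>multisets_of_size UNIV m. monomial \<alpha> \<xi> *\<^sub>R c \<alpha>)"
  shows "hom_coeff m p \<alpha> = (if size \<alpha> = m then c \<alpha> else 0)"
proof -
  have "hom_coeff m p = (\<lambda>\<alpha>. if size \<alpha> = m then c \<alpha> else 0)"
    unfolding hom_coeff_def
  proof (rule the_equality)
    show "(\<forall>\<alpha>. size \<alpha> \<noteq> m \<longrightarrow> (if size \<alpha> = m then c \<alpha> else 0) = 0) \<and>
      (\<forall>\<xi>. p \<xi> = (\<Sum>\<alpha>\<in>multisets_of_size UNIV m. monomial \<alpha> \<xi> *\<^sub>R (if size \<alpha> = m then c \<alpha> else 0)))"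
      by (auto simp: p intro!: sum.cong)
  next
    fix c' assume c': "(\<forall>\<alpha>. size \<alpha> \<noteq> m \<longrightarrow> c' \<alpha> = 0) \<and>
      (\<forall>\<xi>. p \<xi> = (\<Sum>\<alpha>\<in>multisets_of_size UNIV m. monomial \<alpha> \<xi> *\<^sub>R c' \<alpha>))"
    then have "c' \<alpha> = c \<alpha>" if "size \<alpha> = m" for \<alpha>
      using homogeneous_polynomial_coeffs_unique[where m=m and c=c' and c'=c and \<alpha>=\<alpha>] that p by metis
    then show "c' = (\<lambda>\<alpha>. if size \<alpha> = m then c \<alpha> else 0)"
      using c' by auto
  qed
  then show ?thesis by simp
qed


section \<open>The differential operator generated by a symbol\<close>

text \<open>
  The order in which the partial derivatives are taken is irrelevant for smooth functions.
\<close>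

definition multi_partial ::
    "'d::finite multiset \<Rightarrow> (real^'d \<Rightarrow> 'a::real_normed_vector) \<Rightarrow> real^'d \<Rightarrow> 'a" where
  "multi_partial \<alpha> f = foldr partial (SOME is. mset is = \<alpha>) f"

definition is_symbol ::
    "(complex \<Rightarrow> 'e::real_normed_vector \<Rightarrow> 'e) \<Rightarrow> (complex \<Rightarrow> 'f::real_normed_vector \<Rightarrow> 'f) \<Rightarrow>
     nat \<Rightarrow> (real^'d::finite \<Rightarrow> 'e \<Rightarrow> 'f) \<Rightarrow> bool" where
  "is_symbol scaleE scaleF m A \<longleftrightarrow>
     (\<forall>e. homogeneous_polynomial m (\<lambda>\<xi>. A \<xi> e)) \<and>
     (\<forall>\<xi>. Vector_Spaces.linear scaleE scaleF (A \<xi>))"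

text \<open>
  Writing \<open>A(\<xi>, e) = \<Sum>\<^bsub>|\<alpha>| = m\<^esub> \<xi>\<^sup>\<alpha> a\<^sub>\<alpha>(e)\<close>, the operator is
  \<open>A(\<partial>)\<phi> = \<Sum>\<^bsub>|\<alpha>| = m\<^esub> a\<^sub>\<alpha>(\<partial>\<^sup>\<alpha>\<phi>)\<close>.
\<close>

definition diff_op ::
    "nat \<Rightarrow> (real^'d::finite \<Rightarrow> 'e::real_normed_vector \<Rightarrow> 'f::real_normed_vector) \<Rightarrow>
     (real^'d \<Rightarrow> 'e) \<Rightarrow> real^'d \<Rightarrow> 'f" where
  "diff_op m A \<phi> x =
     (\<Sum>\<alpha>\<in>multisets_of_size UNIV m. hom_coeff m (\<lambda>\<xi>. A \<xi> (multi_partial \<alpha> \<phi> x)) \<alpha>)"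

definition L1_norm :: "(real^'d::finite \<Rightarrow> 'a::real_normed_vector) \<Rightarrow> ennreal" where
  "L1_norm f = (\<integral>\<^sup>+x. ennreal (norm (f x)) \<partial>lborel)"


section \<open>The real Hardy class\<close>

definition hardy_maximal ::
    "(real^'d::finite \<Rightarrow> complex) \<Rightarrow> (real^'d \<Rightarrow> real) \<Rightarrow> real^'d \<Rightarrow> ennreal" where
  "hardy_maximal \<psi> g x =
     (SUP t\<in>{0<..}. ennreal (cmod
        (LINT y|lborel. complex_of_real (g y) *
           (complex_of_real (t powr (- real CARD('d))) * \<psi> ((1 / t) *\<^sub>R (x - y))))))"

definition hardy_norm ::
    "(real^'d::finite \<Rightarrow> complex) \<Rightarrow> (real^'d \<Rightarrow> real) \<Rightarrow> ennreal" where
  "hardy_norm \<psi> g = (\<integral>\<^sup>+x. hardy_maximal \<psi> g x \<partial>lborel)"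

text \<open>
  A distribution whose maximal function is integrable is an integrable function, so the
  real-valued part of the Hardy class is a class of functions.
\<close>

definition in_hardy :: "(real^'d::finite \<Rightarrow> complex) \<Rightarrow> (real^'d \<Rightarrow> real) \<Rightarrow> bool" where
  "in_hardy \<psi> g \<longleftrightarrow> integrable lborel g \<and> hardy_norm \<psi> g < \<infinity>"


section \<open>Riesz potential and fractional maximal function\<close>

text \<open>
  The kernel of the multiplier \<open>|\<xi>|\<^sup>-\<^sup>s\<close> is
  \<open>\<Gamma>((d - s) / 2) / (2\<^sup>s \<pi>\<^bsup>d/2\<^esup> \<Gamma>(s / 2)) |x|\<^bsup>s - d\<^esup>\<close>, where the Fourier transform has the kernel
  \<open>exp(- i x \<bullet> \<xi>)\<close>, so that differentiation corresponds to multiplication by \<open>i\<xi>\<close>.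
  Here \<open>s = 1\<close> and \<open>\<Gamma>(1 / 2) = \<pi>\<^bsup>1/2\<^esup>\<close>.
\<close>

definition riesz_const :: "nat \<Rightarrow> real" where
  "riesz_const d = Gamma ((real d - 1) / 2) / (2 * pi powr ((real d + 1) / 2))"

definition riesz_potential :: "(real^'d::finite \<Rightarrow> real) \<Rightarrow> real^'d \<Rightarrow> real" where
  "riesz_potential g x =
     (LINT y|lborel. g y * (riesz_const CARD('d) * norm (x - y) powr (1 - real CARD('d))))"

definition locally_finite_borel :: "(real^'d::finite) measure \<Rightarrow> bool" where
  "locally_finite_borel \<mu> \<longleftrightarrow>
     sets \<mu> = sets borel \<and> (\<forall>S\<in>sets borel. bounded S \<longrightarrow> emeasure \<mu> S < \<infinity>)"

definition frac_maximal :: "(real^'d::finite) measure \<Rightarrow> real^'d \<Rightarrow> ennreal" where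
  "frac_maximal \<mu> x =
     (SUP r\<in>{0<..}. ennreal (r powr (1 - real CARD('d))) * emeasure \<mu> (cball x r))"

text \<open>
  The function \<^term>\<open>frac_maximal \<mu>\<close> is lower semicontinuous, hence Borel, so the convention of
  \<^const>\<open>esssup\<close> for non-measurable functions plays no role.
  Since \<open>0 * \<infinity> = 0\<close> in \<^typ>\<open>ennreal\<close>, a bound by a multiple of this norm that is meant to be void
  when the norm is infinite has to be stated under the hypothesis that it is finite.
\<close>

definition frac_maximal_norm :: "(real^'d::finite) measure \<Rightarrow> ennreal" where
  "frac_maximal_norm \<mu> = esssup lborel (frac_maximal \<mu>)"

end

theory Submission
  imports Defs
begin

text \<open>
  For a fixed test field \<open>\<phi>\<close> put \<open>f = Re \<langle>\<partial>\<^sub>j\<^sup>m\<^sup>-\<^sup>1\<phi>, l\<rangle>\<close>, a continuous function of compact support, and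
  \<open>L = \<parallel>A(\<partial>)\<phi>\<parallel>\<close> (norm in \<open>L\<^sub>1\<close>). Statement 1 bounds \<open>inf {\<parallel>\<Phi>\<parallel> : I\<^sub>1\<Phi> \<ge> f}\<close> (norm in \<open>H\<^sub>1\<close>) by a multiple
  of \<open>L\<close>, and statement 2 bounds \<open>sup {\<integral>f d\<mu> : \<mu> \<ge> 0, M\<^sub>1\<mu> \<le> 1}\<close> by a multiple of \<open>L\<close>. These are dual
  extremal problems, and the theorem holds because their values agree up to factors that depend
  only on the dimension and on \<open>\<psi>\<close>. The condition \<open>M\<^sub>1\<mu> \<le> N\<close> is the growth condition
  \<open>\<mu>(B(x,r)) \<le> N r\<^sup>d\<^sup>-\<^sup>1\<close> for all balls (\<open>growth_measure_frac_maximal_norm\<close>).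

  The supremum is at most a multiple of the infimum because \<open>I\<^sub>1\<close> satisfies a trace inequality: if
  \<open>f \<le> I\<^sub>1\<Phi>\<close>, then \<open>\<integral>f\<^sup>+ d\<mu> \<le> C N \<parallel>\<Phi>\<parallel>\<close> (\<open>trace_inequality\<close>). The kernel \<open>|x|\<^sup>1\<^sup>-\<^sup>d\<close> is a sum over \<open>k\<close> of
  Lipschitz bumps at scale \<open>2\<^sup>k\<close> and of height \<open>2\<^sup>k\<^sup>(\<^sup>1\<^sup>-\<^sup>d\<^sup>)\<close>. A Lipschitz bump of scale \<open>s\<close> agrees, up to an
  error of half its height, with a Riemann sum of dilates of \<open>\<psi>\<close> at the finer scale \<open>\<epsilon>s\<close>, and the error
  is again a Lipschitz bump, now at scale \<open>\<epsilon>s\<close>. Iteration turns the pairing of the bump with \<open>\<Phi>\<close> into a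
  geometrically weighted sum of averages of values \<open>(\<Phi> * \<psi>\<^sub>t)(\<xi>)\<close>. The nodes \<open>\<xi>\<close> of the Riemann sums may
  be moved inside tiny dyadic cells, so each value can be replaced by the infimum of the maximal
  function \<open>H\<close> of \<open>\<Phi>\<close> over a cell (\<open>lipschitz_pairing\<close>). After integration against \<open>\<mu>\<close> these infima are
  weighted by the averages \<open>2\<^sup>k\<^sup>(\<^sup>1\<^sup>-\<^sup>d\<^sup>)\<mu>(B(x,D2\<^sup>k))\<close>, for which the growth of \<open>\<mu>\<close> yields a Carleson
  condition, and the Carleson embedding sums all scales to \<open>N \<integral>H = N \<parallel>\<Phi>\<parallel>\<close> (\<open>carleson_embedding\<close>). The freedom
  to choose the nodes thus does the work of the comparison between the vertical and the
  nontangential maximal function.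

  The infimum is at most a multiple of the supremum by linear programming duality on the tree of dyadic
  cells, a Frostman lemma with weights. Give every cell of side \<open>\<ell>\<close> the capacity \<open>\<ell>\<^sup>d\<^sup>-\<^sup>1\<close>. There are a mass
  distribution that respects all capacities and weights \<open>c\<^sub>Q \<ge> 0\<close> on the cells with
  \<open>f \<le> \<Sum> c\<^sub>Q 1\<^sub>Q\<close> and \<open>\<Sum> c\<^sub>Q \<ell>\<^sub>Q\<^sup>d\<^sup>-\<^sup>1 \<le> \<integral>f d\<nu>\<close>, up to a discretisation error that can be made
  as small as desired (\<open>laminar_duality\<close>, \<open>frostman_duality\<close>). Spreading the masses over the smallest
  cells makes \<open>\<nu>\<close> a measure with \<open>M\<^sub>1\<nu>\<close> bounded, so statement 2 controls \<open>\<integral>f d\<nu>\<close>. On the other side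
  there is a function \<open>\<Phi>\<^sub>Q\<close> with \<open>I\<^sub>1\<Phi>\<^sub>Q \<ge> 1\<close> on \<open>Q\<close>, \<open>I\<^sub>1\<Phi>\<^sub>Q \<ge> 0\<close> everywhere and norm at most \<open>C \<ell>\<^sub>Q\<^sup>d\<^sup>-\<^sup>1\<close>
  (\<open>hardy_bump_family\<close>), whence \<open>\<Phi> = \<Sum> c\<^sub>Q \<Phi>\<^sub>Q\<close> is the required majorant
  (\<open>hardy_majorant_from_measure\<close>). The \<open>\<Phi>\<^sub>Q\<close> are rescaled copies of one mean zero combination of Gaussians
  whose potential is a superposition of Gaussians with positive coefficients (\<open>riesz_mother\<close>).
\<close>

section \<open>Affine changes of variables and volumes\<close>

lemma nn_integral_lborel_affine:
  fixes f :: "real^'d::finite \<Rightarrow> ennreal"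
  assumes [measurable]: "f \<in> borel_measurable borel" and c: "c \<noteq> 0"
  shows "(\<integral>\<^sup>+x. f x \<partial>lborel) = ennreal (\<bar>c\<bar> ^ CARD('d)) * (\<integral>\<^sup>+x. f (z + c *\<^sub>R x) \<partial>lborel)"
  by (subst lborel_affine[OF c, of z])
     (simp add: nn_integral_density nn_integral_distr nn_integral_cmult)

lemma integral_lborel_affine:
  fixes f :: "real^'d::finite \<Rightarrow> 'a::{banach, second_countable_topology}"
  assumes [measurable]: "f \<in> borel_measurable borel" and c: "c \<noteq> 0"
  shows "(LINT x|lborel. f x) = (\<bar>c\<bar> ^ CARD('d)) *\<^sub>R (LINT x|lborel. f (z + c *\<^sub>R x))"
  by (subst lborel_affine[OF c, of z])
     (simp add: integral_density integral_distr)

lemma integrable_lborel_affine: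
  fixes f :: "real^'d::finite \<Rightarrow> 'a::{banach, second_countable_topology}"
  assumes f: "integrable lborel f" and c: "c \<noteq> 0"
  shows "integrable lborel (\<lambda>x. f (z + c *\<^sub>R x))"
proof -
  have [measurable]: "f \<in> borel_measurable borel"
    using borel_measurable_integrable[OF f] by simp
  have "ennreal (\<bar>c\<bar> ^ CARD('d)) * (\<integral>\<^sup>+x. ennreal (norm (f (z + c *\<^sub>R x))) \<partial>lborel) < \<infinity>"
    using f unfolding integrable_iff_bounded
    by (subst nn_integral_lborel_affine[symmetric]) (use c in auto)
  then have "(\<integral>\<^sup>+x. ennreal (norm (f (z + c *\<^sub>R x))) \<partial>lborel) < \<infinity>"
    using c by (auto simp: ennreal_mult_less_top ennreal_zero_less_mult_iff)
  then show ?thesis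
    by (intro integrableI_bounded) auto
qed

lemma emeasure_cball_le:
  "r \<ge> 0 \<Longrightarrow> emeasure lborel (cball (x::real^'d::finite) r) \<le> ennreal ((2 * r) ^ CARD('d))"
proof -
  assume r: "r \<ge> 0"
  have "cball x r \<subseteq> cbox (\<chi> i. x $ i - r) (\<chi> i. x $ i + r)"
  proof
    fix y assume "y \<in> cball x r"
    then have "\<bar>(x - y) $ i\<bar> \<le> r" for i
      using component_le_norm_cart[of "x - y" i] by (auto simp: dist_norm)
    then show "y \<in> cbox (\<chi> i. x $ i - r) (\<chi> i. x $ i + r)"
      by (auto simp: mem_box_cart abs_le_iff algebra_simps)
  qed
  then have "emeasure lborel (cball x r) \<le> emeasure lborel (cbox (\<chi> i. x $ i - r) (\<chi> i. x $ i + r))"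
    by (intro emeasure_mono) auto
  also have "\<dots> = ennreal ((2 * r) ^ CARD('d))"
  proof -
    have *: "\<And>b. b \<in> Basis \<Longrightarrow> (\<chi> i. x $ i - r) \<bullet> b \<le> (\<chi> i. x $ i + r) \<bullet> b \<and> ((\<chi> i. x $ i + r) - (\<chi> i. x $ i - r)) \<bullet> b = 2 * r"
      using r by (auto simp: Basis_vec_def inner_axis)
    then show ?thesis
      by (subst emeasure_lborel_cbox) auto
  qed
  finally show ?thesis .
qed

lemma measure_cball_le:
  "r \<ge> 0 \<Longrightarrow> measure lborel (cball (x::real^'d::finite) r) \<le> (2 * r) ^ CARD('d)"
  using emeasure_cball_le[of r x] unfolding measure_def
  by (simp add: enn2real_leI)

lemma norm_integral_le_on_cball:
  fixes f :: "real^'d::finite \<Rightarrow> 'a::{banach, second_countable_topology}"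
  assumes "\<And>x. x \<in> cball y r \<Longrightarrow> norm (f x) \<le> C" "\<And>x. x \<notin> cball y r \<Longrightarrow> f x = 0"
    and "r \<ge> 0"
  shows "norm (LINT x|lborel. f x) \<le> C * (2 * r) ^ CARD('d)"
proof -
  have C: "C \<ge> 0"
    using assms(1)[of y] assms(3) norm_ge_zero[of "f y"] by (auto simp del: norm_ge_zero)
  have "norm (LINT x|lborel. f x) \<le> (LINT x|lborel. norm (f x))"
    by (rule integral_norm_bound)
  also have "\<dots> \<le> (LINT x|lborel. C * indicator (cball y r) x)"
  proof (rule integral_mono')
    show "integrable lborel (\<lambda>x. C * indicator (cball y r) x)"
      using emeasure_lborel_cball_finite[of y r]
      by (intro integrable_mult_right integrable_real_indicator) auto
  qed (use assms C in \<open>auto simp: indicator_def\<close>)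
  also have "\<dots> = C * measure lborel (cball y r)"
    by simp
  also have "\<dots> \<le> C * (2 * r) ^ CARD('d)"
    by (intro mult_left_mono measure_cball_le assms C)
  finally show ?thesis .
qed

section \<open>Discrete approximation by dilates of one kernel\<close>

text \<open>
  The properties of a test function that enter the argument. The quantitative form makes the
  constant in the trace inequality an explicit function of \<open>K\<close>, \<open>R\<close>, the dimension and \<open>\<integral>\<psi>\<close>.
\<close>

locale hardy_kernel =
  fixes \<psi> :: "real^'d::finite \<Rightarrow> complex" and K R :: real
  assumes psi_bound: "\<And>x. norm (\<psi> x) \<le> K"
    and psi_lipschitz: "\<And>x y. norm (\<psi> x - \<psi> y) \<le> K * norm (x - y)"
    and psi_support: "\<And>x. norm x > R \<Longrightarrow> \<psi> x = 0"
    and R_pos: "R > 0"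
begin

definition dil :: "real \<Rightarrow> real^'d \<Rightarrow> complex" where
  "dil t x = complex_of_real (t powr (- real CARD('d))) * \<psi> ((1 / t) *\<^sub>R x)"

lemma K_nonneg: "K \<ge> 0"
  using psi_bound[of 0] norm_ge_zero[of "\<psi> 0"] by linarith

lemma dil_bound: "norm (dil t x) \<le> K * t powr (- real CARD('d))"
  unfolding dil_def norm_mult mult.commute[of K]
  by (rule mult_mono) (auto simp: psi_bound)

lemma dil_lipschitz:
  assumes "t > 0"
  shows "norm (dil t x - dil t y) \<le> K * t powr (- real CARD('d)) * (norm (x - y) / t)"
proof -
  have "norm (dil t x - dil t y) = t powr (- real CARD('d)) * norm (\<psi> ((1 / t) *\<^sub>R x) - \<psi> ((1 / t) *\<^sub>R y))"
    by (simp add: dil_def right_diff_distrib[symmetric] norm_mult)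
  also have "\<dots> \<le> t powr (- real CARD('d)) * (K * norm ((1 / t) *\<^sub>R x - (1 / t) *\<^sub>R y))"
    by (intro mult_left_mono psi_lipschitz) auto
  also have "norm ((1 / t) *\<^sub>R x - (1 / t) *\<^sub>R y) = norm (x - y) / t"
    using assms by (simp add: scaleR_diff_right[symmetric])
  finally show ?thesis by (simp add: mult_ac)
qed

lemma dil_support: "t > 0 \<Longrightarrow> norm x > t * R \<Longrightarrow> dil t x = 0"
  using psi_support[of "(1 / t) *\<^sub>R x"] by (simp add: dil_def field_simps)

lemma psi_continuous: "continuous_on UNIV \<psi>"
  using psi_lipschitz K_nonneg
  by (intro lipschitz_on_continuous_on[of K]) (auto simp: lipschitz_on_def dist_norm)

lemma psi_measurable [measurable]: "\<psi> \<in> borel_measurable borel"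
  by (intro borel_measurable_continuous_onI psi_continuous)

lemma dil_continuous: "continuous_on UNIV (dil t)"
  unfolding dil_def
  by (intro continuous_intros continuous_on_compose2[OF psi_continuous]) auto

lemma dil_measurable [measurable]: "dil t \<in> borel_measurable borel"
  by (intro borel_measurable_continuous_onI dil_continuous)

lemma integral_dil:
  assumes "t > 0"
  shows "(LINT x|lborel. dil t (x - y)) = (LINT x|lborel. \<psi> x)"
proof -
  have "(LINT x|lborel. dil t (x - y)) = (t ^ CARD('d)) *\<^sub>R (LINT x|lborel. dil t (y + t *\<^sub>R x - y))"
    using integral_lborel_affine[of "\<lambda>x. dil t (x - y)" t y] assms by simp
  also have "\<dots> = (LINT x|lborel. (t ^ CARD('d)) *\<^sub>R dil t (t *\<^sub>R x))"
    by simp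
  also have "(\<lambda>x. (t ^ CARD('d)) *\<^sub>R dil t (t *\<^sub>R x)) = \<psi>"
    using assms by (auto simp: dil_def fun_eq_iff powr_minus powr_realpow
        scaleR_conv_of_real[where 'a=complex])
  finally show ?thesis .
qed

lemma integrable_dil:
  assumes "t > 0"
  shows "integrable lborel (\<lambda>x. dil t (x - y))"
proof (rule Bochner_Integration.integrable_bound)
  show "integrable lborel (\<lambda>x. K * t powr (- real CARD('d)) * indicator (cball y (t * R)) x)"
    using emeasure_lborel_cball_finite[of y "t * R"]
    by (intro integrable_mult_right integrable_real_indicator) auto
  show "AE x in lborel. norm (dil t (x - y)) \<le> norm (K * t powr (- real CARD('d)) * indicator (cball y (t * R)) x)"
  proof (rule AE_I2)
    fix x show "norm (dil t (x - y)) \<le> norm (K * t powr (- real CARD('d)) * indicator (cball y (t * R)) x)"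
      using dil_bound[of t "x - y"] dil_support[OF assms, of "x - y"] K_nonneg
      by (auto simp: indicator_def dist_norm norm_minus_commute not_le)
  qed
qed auto

text \<open>
  Since \<open>\<integral>\<psi>\<^sub>t(x - y) dx = \<integral>\<psi>\<close>, this is a Riemann sum for \<open>g(y)\<close>: the convolution of \<open>g\<close> with
  \<open>\<psi>\<^sub>t / \<integral>\<psi>\<close>, reflected, in which \<open>x\<close> is replaced by a node \<open>\<xi>(x)\<close>. The map \<open>\<xi>\<close> is meant to be
  constant on small cells and is kept free in order to place the nodes where the maximal
  function of \<open>\<Phi>\<close> is small.
\<close>

definition approximant :: "(real^'d \<Rightarrow> real^'d) \<Rightarrow> real \<Rightarrow> (real^'d \<Rightarrow> complex) \<Rightarrow> real^'d \<Rightarrow> complex" where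
  "approximant \<xi> t g y = (LINT x|lborel. g (\<xi> x) * dil t (\<xi> x - y)) / (LINT x|lborel. \<psi> x)"

lemma integrable_approximant:
  assumes [measurable]: "\<xi> \<in> borel_measurable borel" "g \<in> borel_measurable borel"
    and "t > 0" "\<And>x. norm (\<xi> x - x) \<le> t" "\<And>x. norm (g x) \<le> a"
  shows "integrable lborel (\<lambda>x. g (\<xi> x) * dil t (\<xi> x - y))"
proof (rule Bochner_Integration.integrable_bound)
  have a: "a \<ge> 0"
    using assms(5)[of 0] norm_ge_zero[of "g 0"] by linarith
  show "integrable lborel (\<lambda>x. a * (K * t powr (- real CARD('d))) * indicator (cball y (t * (R + 1))) x)"
    using emeasure_lborel_cball_finite[of y "t * (R + 1)"]
    by (intro integrable_mult_right integrable_real_indicator) auto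
  show "AE x in lborel. norm (g (\<xi> x) * dil t (\<xi> x - y)) \<le> norm (a * (K * t powr (- real CARD('d))) * indicator (cball y (t * (R + 1))) x)"
  proof (rule AE_I2)
    fix x
    have *: "norm (g (\<xi> x) * dil t (\<xi> x - y)) \<le> a * (K * t powr (- real CARD('d)))"
      unfolding norm_mult by (intro mult_mono assms dil_bound a norm_ge_zero)
    show "norm (g (\<xi> x) * dil t (\<xi> x - y)) \<le> norm (a * (K * t powr (- real CARD('d))) * indicator (cball y (t * (R + 1))) x)"
    proof (cases "x \<in> cball y (t * (R + 1))")
      case True then show ?thesis using * K_nonneg a by auto
    next
      case False
      then have "t * R + t < norm (x - y)" by (simp add: dist_norm norm_minus_commute algebra_simps)
      also have "norm (x - y) \<le> norm (\<xi> x - y) + t"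
        using norm_triangle_ineq4[of "\<xi> x - y" "\<xi> x - x"] assms(4)[of x] by simp
      finally show ?thesis using dil_support[OF assms(3), of "\<xi> x - y"] by simp
    qed
  qed
qed measurable

text \<open>
  The integrand of an approximant lives on a ball of radius \<open>t(R + 1)\<close> and the dilate has height at most
  \<open>K t\<^sup>-\<^sup>d\<close>. The product of this height with the volume of the cube around the ball does not depend on \<open>t\<close>.
\<close>

definition Q :: real where
  "Q = K * (2 * (R + 1)) ^ CARD('d) / norm (LINT x|lborel. \<psi> x)"

lemma Q_nonneg: "Q \<ge> 0"
  unfolding Q_def using K_nonneg R_pos by auto

lemma Q_scaling:
  assumes "t > 0"
  shows "K * t powr (- real CARD('d)) * (2 * (t * (R + 1))) ^ CARD('d) / norm (LINT x|lborel. \<psi> x) = Q"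
proof -
  have "t powr (- real CARD('d)) * (2 * (t * (R + 1))) ^ CARD('d) = (2 * (R + 1)) ^ CARD('d)"
    using assms unfolding power_mult_distrib by (simp add: powr_minus powr_realpow)
  then show ?thesis by (simp add: Q_def mult.assoc)
qed

text \<open>
  On the support of the dilate, \<open>g(\<xi> x)\<close> differs from \<open>g(y)\<close> by the Lipschitz constant of \<open>g\<close>
  times \<open>t(R + 2) = \<epsilon>s(R + 2)\<close>, and moving the node by \<open>\<epsilon>t\<close> changes the dilate by the fraction \<open>\<epsilon>\<close>
  of its height. Both errors carry a factor \<open>\<epsilon>\<close>.
\<close>

lemma approximant_error_sup:
  assumes c0: "(LINT x|lborel. \<psi> x) \<noteq> 0"
    and [measurable]: "\<xi> \<in> borel_measurable borel" "g \<in> borel_measurable borel"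
    and s: "s > 0" and e: "0 < \<epsilon>" "\<epsilon> \<le> 1" and t: "t = \<epsilon> * s"
    and xi: "\<And>x. norm (\<xi> x - x) \<le> \<epsilon> * t"
    and ga: "\<And>x. norm (g x) \<le> a"
    and gl: "\<And>x y. norm (g x - g y) \<le> B * a / s * norm (x - y)" and B: "B \<ge> 0"
  shows "norm (g y - approximant \<xi> t g y) \<le> Q * \<epsilon> * (B * (R + 2) + 1) * a"
proof -
  have a: "a \<ge> 0" using ga[of 0] norm_ge_zero[of "g 0"] by linarith
  have t0: "t > 0" using t s e by simp
  have xi': "norm (\<xi> x - x) \<le> t" for x
    using xi[of x] e t0 mult_right_mono[of \<epsilon> 1 t] by linarith
  define c where "c = (LINT x|lborel. \<psi> x)"
  have c0: "c \<noteq> 0" using assms(1) by (simp add: c_def)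
  let ?F = "\<lambda>x. g y * dil t (x - y) - g (\<xi> x) * dil t (\<xi> x - y)"
  let ?T = "K * t powr (- real CARD('d))"
  have "(LINT x|lborel. ?F x) = g y * c - (LINT x|lborel. g (\<xi> x) * dil t (\<xi> x - y))"
    using integral_dil[OF t0, of y] integrable_dil[OF t0, of y]
    by (subst Bochner_Integration.integral_diff)
       (auto intro!: integrable_approximant[OF _ _ t0 xi' ga] simp: c_def)
  then have eq: "g y - approximant \<xi> t g y = (LINT x|lborel. ?F x) / c"
    unfolding approximant_def c_def[symmetric] using c0 by (simp add: field_simps)
  have "norm (LINT x|lborel. ?F x) \<le> (?T * \<epsilon> * (B * (R + 2) + 1) * a) * (2 * (t * (R + 1))) ^ CARD('d)"
  proof (rule norm_integral_le_on_cball)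
    fix x assume x: "x \<in> cball y (t * (R + 1))"
    have "norm (y - \<xi> x) \<le> t * (R + 1) + t"
      using x xi'[of x] norm_triangle_ineq[of "y - x" "x - \<xi> x"]
      by (simp add: dist_norm norm_minus_commute)
    then have gg: "norm (g y - g (\<xi> x)) \<le> B * a / s * (t * (R + 2))"
      using B a s by (intro order_trans[OF gl] mult_left_mono) (auto simp: algebra_simps)
    \<comment> \<open>The first term compares the values of g, the second one the positions of the node.\<close>
    have "?F x = (g y - g (\<xi> x)) * dil t (x - y) + g (\<xi> x) * (dil t (x - y) - dil t (\<xi> x - y))"
      by (simp add: algebra_simps)
    then have "norm (?F x) \<le> norm (g y - g (\<xi> x)) * norm (dil t (x - y)) + norm (g (\<xi> x)) * norm (dil t (x - y) - dil t (\<xi> x - y))"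
      by (metis norm_mult norm_triangle_ineq)
    also have "\<dots> \<le> (B * a / s * (t * (R + 2))) * ?T + a * (?T * \<epsilon>)"
    proof (intro add_mono mult_mono gg dil_bound ga norm_ge_zero a)
      have "norm (dil t (x - y) - dil t (\<xi> x - y)) \<le> ?T * (norm (x - y - (\<xi> x - y)) / t)"
        by (rule dil_lipschitz[OF t0])
      also have "norm (x - y - (\<xi> x - y)) / t \<le> \<epsilon>"
        using xi[of x] t0 by (simp add: norm_minus_commute field_simps)
      finally show "norm (dil t (x - y) - dil t (\<xi> x - y)) \<le> ?T * \<epsilon>"
        using K_nonneg by (simp add: mult_left_mono)
    qed (use B a s t0 R_pos in auto)
    also have "\<dots> = ?T * \<epsilon> * (B * (R + 2) + 1) * a"
      using s by (simp add: t field_simps)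
    finally show "norm (?F x) \<le> ?T * \<epsilon> * (B * (R + 2) + 1) * a" .
  next
    fix x assume "x \<notin> cball y (t * (R + 1))"
    then have *: "t * R + t < norm (x - y)" by (simp add: dist_norm norm_minus_commute algebra_simps)
    also have "norm (x - y) \<le> norm (\<xi> x - y) + t"
      using norm_triangle_ineq4[of "\<xi> x - y" "\<xi> x - x"] xi'[of x] by simp
    finally show "?F x = 0"
      using dil_support[OF t0, of "\<xi> x - y"] dil_support[OF t0, of "x - y"] * t0 by simp
  qed (use t0 R_pos in auto)
  then have "norm (g y - approximant \<xi> t g y) \<le> (?T * \<epsilon> * (B * (R + 2) + 1) * a) * (2 * (t * (R + 1))) ^ CARD('d) / norm c"
    unfolding eq by (simp add: norm_divide divide_right_mono)
  also have "\<dots> = (?T * (2 * (t * (R + 1))) ^ CARD('d) / norm c) * \<epsilon> * (B * (R + 2) + 1) * a"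
    by (simp add: mult_ac)
  also have "\<dots> = Q * \<epsilon> * (B * (R + 2) + 1) * a"
    using Q_scaling[OF t0] by (simp add: c_def)
  finally show ?thesis .
qed

text \<open>
  The approximant inherits its regularity from the dilates and not from \<open>g\<close>: its Lipschitz
  constant is the one of a bump of height \<open>a\<close> at scale \<open>t\<close>, however rough \<open>\<xi>\<close> is.
\<close>

lemma approximant_lipschitz:
  assumes [measurable]: "\<xi> \<in> borel_measurable borel" "g \<in> borel_measurable borel"
    and t0: "t > 0"
    and xi: "\<And>x. norm (\<xi> x - x) \<le> t"
    and ga: "\<And>x. norm (g x) \<le> a"
  shows "norm (approximant \<xi> t g y - approximant \<xi> t g y') \<le> 2 * Q * a / t * norm (y - y')"
proof -
  have a: "a \<ge> 0" using ga[of 0] norm_ge_zero[of "g 0"] by linarith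
  define c where "c = (LINT x|lborel. \<psi> x)"
  let ?T = "K * t powr (- real CARD('d))"
  define D where "D x = dil t (\<xi> x - y) - dil t (\<xi> x - y')" for x
  define D1 where "D1 x = indicator (cball y (t * (R + 1))) x *\<^sub>R (g (\<xi> x) * D x)" for x
  define D2 where "D2 x = indicator (- cball y (t * (R + 1))) x *\<^sub>R (g (\<xi> x) * D x)" for x
  have int: "integrable lborel (\<lambda>x. g (\<xi> x) * D x)"
    unfolding D_def right_diff_distrib
    by (intro Bochner_Integration.integrable_diff integrable_approximant[OF _ _ t0 xi ga]) auto
  have i1: "integrable lborel D1" and i2: "integrable lborel D2"
    unfolding D1_def D2_def using int by (auto intro!: integrable_mult_indicator)
  have "(LINT x|lborel. g (\<xi> x) * D x) = (LINT x|lborel. D1 x + D2 x)"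
    by (intro Bochner_Integration.integral_cong) (auto simp: D1_def D2_def indicator_def)
  also have "\<dots> = (LINT x|lborel. D1 x) + (LINT x|lborel. D2 x)"
    by (rule Bochner_Integration.integral_add[OF i1 i2])
  finally have split: "(LINT x|lborel. g (\<xi> x) * D x) = (LINT x|lborel. D1 x) + (LINT x|lborel. D2 x)" .
  have Db: "norm (g (\<xi> x) * D x) \<le> a * (?T * (norm (y - y') / t))" for x
  proof -
    have "norm (D x) \<le> ?T * (norm (\<xi> x - y - (\<xi> x - y')) / t)"
      unfolding D_def by (rule dil_lipschitz[OF t0])
    then show ?thesis
      unfolding norm_mult using ga a by (intro mult_mono) (auto simp: norm_minus_commute)
  qed
  have far: "dil t (\<xi> x - z) = 0" if "x \<notin> cball z (t * (R + 1))" for x z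
  proof -
    have "t * R + t < norm (x - z)" using that by (simp add: dist_norm norm_minus_commute algebra_simps)
    also have "norm (x - z) \<le> norm (\<xi> x - z) + t"
      using norm_triangle_ineq4[of "\<xi> x - z" "\<xi> x - x"] xi[of x] by simp
    finally show ?thesis using dil_support[OF t0, of "\<xi> x - z"] by simp
  qed
  have n1: "norm (LINT x|lborel. D1 x) \<le> (a * (?T * (norm (y - y') / t))) * (2 * (t * (R + 1))) ^ CARD('d)"
    using Db t0 R_pos by (intro norm_integral_le_on_cball[where y=y]) (auto simp: D1_def)
  have n2: "norm (LINT x|lborel. D2 x) \<le> (a * (?T * (norm (y - y') / t))) * (2 * (t * (R + 1))) ^ CARD('d)"
  proof (rule norm_integral_le_on_cball[where y=y'])
    show "norm (D2 x) \<le> a * (?T * (norm (y - y') / t))" for x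
      using Db[of x] a K_nonneg t0 by (auto simp: D2_def indicator_def)
    show "D2 x = 0" if "x \<notin> cball y' (t * (R + 1))" for x
      using far[OF that] far[of x y] by (auto simp: D2_def indicator_def D_def)
  qed (use t0 R_pos in auto)
  have "approximant \<xi> t g y - approximant \<xi> t g y' = (LINT x|lborel. g (\<xi> x) * D x) / c"
    unfolding approximant_def c_def[symmetric] D_def right_diff_distrib
    by (subst Bochner_Integration.integral_diff)
       (auto intro!: integrable_approximant[OF _ _ t0 xi ga] simp: diff_divide_distrib)
  then have "norm (approximant \<xi> t g y - approximant \<xi> t g y') \<le> (norm (LINT x|lborel. D1 x) + norm (LINT x|lborel. D2 x)) / norm c"
    using split by (simp add: norm_divide divide_right_mono norm_triangle_ineq)
  also have "\<dots> \<le> (2 * ((a * (?T * (norm (y - y') / t))) * (2 * (t * (R + 1))) ^ CARD('d))) / norm c"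
    using add_mono[OF n1 n2] by (intro divide_right_mono) (auto simp only: mult_2 norm_ge_zero)
  also have "\<dots> = 2 * (?T * (2 * (t * (R + 1))) ^ CARD('d) / norm c) * a / t * norm (y - y')"
    by (simp add: mult_ac)
  also have "\<dots> = 2 * Q * a / t * norm (y - y')"
    using Q_scaling[OF t0] by (simp add: c_def)
  finally show ?thesis .
qed

lemma approximant_support:
  assumes t0: "t > 0"
    and xi: "\<And>x. norm (\<xi> x - x) \<le> t"
    and g: "\<And>x. x \<notin> cball z r \<Longrightarrow> g x = 0" and y: "y \<notin> cball z (r + t * R)"
  shows "approximant \<xi> t g y = 0"
proof -
  have "g (\<xi> x) * dil t (\<xi> x - y) = 0" for x
  proof (cases "\<xi> x \<in> cball z r")
    case True
    then have "norm (\<xi> x - y) > t * R"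
      using y norm_triangle_ineq4[of "\<xi> x - z" "\<xi> x - y"] by (auto simp: dist_norm norm_minus_commute)
    then show ?thesis using dil_support[OF t0] by simp
  qed (use g in auto)
  then have "(\<lambda>x. g (\<xi> x) * dil t (\<xi> x - y)) = (\<lambda>_. 0)"
    by auto
  then show ?thesis by (simp only: approximant_def) simp
qed

lemma approximant_continuous:
  assumes "\<xi> \<in> borel_measurable borel" "g \<in> borel_measurable borel"
    and "t > 0" "\<And>x. norm (\<xi> x - x) \<le> t" "\<And>x. norm (g x) \<le> a"
  shows "continuous_on UNIV (approximant \<xi> t g)"
proof -
  have a: "a \<ge> 0" using assms(5)[of 0] norm_ge_zero[of "g 0"] by linarith
  show ?thesis
    using approximant_lipschitz[OF assms] a Q_nonneg assms(3)
    by (intro lipschitz_on_continuous_on[of "2 * Q * a / t"]) (auto simp: lipschitz_on_def dist_norm)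
qed

text \<open>
  By Fubini, pairing \<open>\<Phi>\<close> with the Riemann sum samples \<open>\<Phi> * \<psi>\<^sub>t\<close> at the nodes. This is how
  the maximal function at the nodes, and only there, enters the estimate.
\<close>

lemma approximant_pairing:
  fixes \<Phi> :: "real^'d \<Rightarrow> real"
  assumes [measurable]: "\<xi> \<in> borel_measurable borel" "g \<in> borel_measurable borel"
    and t: "t > 0" and xi: "\<And>x. norm (\<xi> x - x) \<le> t" and ga: "\<And>x. norm (g x) \<le> a"
    and \<Phi>: "integrable lborel \<Phi>"
  shows "(LINT y|lborel. approximant \<xi> t g y * complex_of_real (\<Phi> y)) =
    (LINT x|lborel. g (\<xi> x) * (LINT y|lborel. complex_of_real (\<Phi> y) * dil t (\<xi> x - y))) / (LINT x|lborel. \<psi> x)"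
proof -
  have [measurable]: "\<Phi> \<in> borel_measurable borel"
    using borel_measurable_integrable[OF \<Phi>] by simp
  have a: "a \<ge> 0" using ga[of 0] norm_ge_zero[of "g 0"] by linarith
  define C where "C = a * (K * t powr (- real CARD('d))) * (2 * (t * (R + 1))) ^ CARD('d)"
  let ?f = "\<lambda>y x. complex_of_real (\<Phi> y) * (g (\<xi> x) * dil t (\<xi> x - y))"
  have int1: "integrable lborel (\<lambda>x. g (\<xi> x) * dil t (\<xi> x - y))" for y
    by (rule integrable_approximant[OF _ _ t xi ga]) auto
  have C: "(LINT x|lborel. norm (g (\<xi> x) * dil t (\<xi> x - y))) \<le> C" for y
  proof -
    have "norm (LINT x|lborel. norm (g (\<xi> x) * dil t (\<xi> x - y))) \<le> C"
      unfolding C_def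
    proof (rule norm_integral_le_on_cball[where y=y])
      show "norm (norm (g (\<xi> x) * dil t (\<xi> x - y))) \<le> a * (K * t powr (- real CARD('d)))" for x
        unfolding norm_mult real_norm_def abs_mult abs_norm_cancel
        by (intro mult_mono ga dil_bound a norm_ge_zero)
    next
      fix x assume "x \<notin> cball y (t * (R + 1))"
      then have "t * R + t < norm (x - y)" by (simp add: dist_norm norm_minus_commute algebra_simps)
      also have "norm (x - y) \<le> norm (\<xi> x - y) + t"
        using norm_triangle_ineq4[of "\<xi> x - y" "\<xi> x - x"] xi[of x] by simp
      finally show "norm (g (\<xi> x) * dil t (\<xi> x - y)) = 0"
        using dil_support[OF t, of "\<xi> x - y"] by simp
    qed (use t R_pos in auto)
    then show ?thesis by simp
  qed
  have int: "integrable (lborel \<Otimes>\<^sub>M lborel) (\<lambda>(y, x). ?f y x)"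
  proof (rule lborel_pair.Fubini_integrable)
    show "integrable lborel (\<lambda>y. LINT x|lborel. norm (case (y, x) of (y, x) \<Rightarrow> ?f y x))"
    proof (rule Bochner_Integration.integrable_bound)
      show "integrable lborel (\<lambda>y. C * norm (\<Phi> y))"
        using \<Phi> by simp
      show "AE y in lborel. norm (LINT x|lborel. norm (case (y, x) of (y, x) \<Rightarrow> ?f y x)) \<le> norm (C * norm (\<Phi> y))"
      proof (rule AE_I2)
        fix y
        have "(LINT x|lborel. norm (case (y, x) of (y, x) \<Rightarrow> ?f y x)) = \<bar>\<Phi> y\<bar> * (LINT x|lborel. norm (g (\<xi> x) * dil t (\<xi> x - y)))"
          by (simp add: norm_mult)
        moreover have "0 \<le> (LINT x|lborel. norm (g (\<xi> x) * dil t (\<xi> x - y)))"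
          by (rule integral_nonneg_AE) auto
        moreover have "0 \<le> C" using C[of y] calculation(2) by linarith
        ultimately show "norm (LINT x|lborel. norm (case (y, x) of (y, x) \<Rightarrow> ?f y x)) \<le> norm (C * norm (\<Phi> y))"
          using C[of y] by (auto simp: abs_mult mult.commute[of C] intro!: mult_left_mono)
      qed
    qed measurable
    show "AE y in lborel. integrable lborel (\<lambda>x. case (y, x) of (y, x) \<Rightarrow> ?f y x)"
      using int1 by auto
  qed measurable
  have "(LINT y|lborel. approximant \<xi> t g y * complex_of_real (\<Phi> y)) =
      (LINT y|lborel. (LINT x|lborel. ?f y x) / (LINT x|lborel. \<psi> x))"
    unfolding approximant_def by (intro Bochner_Integration.integral_cong) auto
  also have "\<dots> = (LINT y|lborel. (LINT x|lborel. ?f y x)) / (LINT x|lborel. \<psi> x)"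
    by simp
  also have "(LINT y|lborel. (LINT x|lborel. ?f y x)) = (LINT x|lborel. (LINT y|lborel. ?f y x))"
    by (rule lborel_pair.Fubini_integral[symmetric]) (use int in simp)
  also have "(\<lambda>x. LINT y|lborel. ?f y x) = (\<lambda>x. g (\<xi> x) * (LINT y|lborel. complex_of_real (\<Phi> y) * dil t (\<xi> x - y)))"
    by (subst integral_mult_right_zero[symmetric]) (simp add: mult_ac)
  finally show ?thesis .
qed

lemma hardy_maximal_ge:
  "t > 0 \<Longrightarrow> ennreal (cmod (LINT y|lborel. complex_of_real (\<Phi> y) * dil t (x - y))) \<le> hardy_maximal \<psi> \<Phi> x"
  unfolding hardy_maximal_def dil_def by (rule SUP_upper) auto

lemma ennreal_norm_integral_le:
  fixes f :: "'a \<Rightarrow> 'b::{banach, second_countable_topology}"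
  shows "ennreal (norm (integral\<^sup>L M f)) \<le> (\<integral>\<^sup>+x. ennreal (norm (f x)) \<partial>M)"
  by (cases "integrable M f") (auto simp: integral_norm_bound_ennreal not_integrable_integral_eq)

lemma approximant_pairing_bound:
  fixes \<Phi> :: "real^'d \<Rightarrow> real"
  assumes [measurable]: "\<xi> \<in> borel_measurable borel" "g \<in> borel_measurable borel"
    and t: "t > 0" and xi: "\<And>x. norm (\<xi> x - x) \<le> t" and ga: "\<And>x. norm (g x) \<le> a"
    and gz: "\<And>x. x \<notin> cball z r \<Longrightarrow> g x = 0" and r': "r + t \<le> r'"
    and \<Phi>: "integrable lborel \<Phi>"
    and H [measurable]: "(\<lambda>x. hardy_maximal \<psi> \<Phi> (\<xi> x)) \<in> borel_measurable borel"
  shows "ennreal (cmod (LINT y|lborel. approximant \<xi> t g y * complex_of_real (\<Phi> y))) \<le>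
    ennreal (a / norm (LINT x|lborel. \<psi> x)) * (\<integral>\<^sup>+x. hardy_maximal \<psi> \<Phi> (\<xi> x) * indicator (cball z r') x \<partial>lborel)"
proof -
  have a: "a \<ge> 0" using ga[of 0] norm_ge_zero[of "g 0"] by linarith
  let ?c = "LINT x|lborel. \<psi> x"
  let ?G = "\<lambda>x. g (\<xi> x) * (LINT y|lborel. complex_of_real (\<Phi> y) * dil t (\<xi> x - y))"
  have "ennreal (cmod (LINT y|lborel. approximant \<xi> t g y * complex_of_real (\<Phi> y))) = ennreal (cmod (LINT x|lborel. ?G x / ?c))"
    using approximant_pairing[OF _ _ t xi ga \<Phi>] by simp
  also have "\<dots> \<le> (\<integral>\<^sup>+x. ennreal (norm (?G x / ?c)) \<partial>lborel)"
    by (rule ennreal_norm_integral_le)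
  also have "\<dots> \<le> (\<integral>\<^sup>+x. ennreal (a / norm ?c) * (hardy_maximal \<psi> \<Phi> (\<xi> x) * indicator (cball z r') x) \<partial>lborel)"
  proof (rule nn_integral_mono)
    fix x
    show "ennreal (norm (?G x / ?c)) \<le> ennreal (a / norm ?c) * (hardy_maximal \<psi> \<Phi> (\<xi> x) * indicator (cball z r') x)"
    proof (cases "\<xi> x \<in> cball z r")
      case True
      have "x \<in> cball z r'"
        using True xi[of x] r' norm_triangle_ineq4[of "\<xi> x - z" "\<xi> x - x"] by (auto simp: dist_norm norm_minus_commute)
      moreover have "ennreal (norm (?G x / ?c)) \<le> ennreal (a / norm ?c) * ennreal (cmod (LINT y|lborel. complex_of_real (\<Phi> y) * dil t (\<xi> x - y)))"
        using a ga by (subst ennreal_mult[symmetric]) (auto simp: norm_mult norm_divide intro!: ennreal_leI divide_right_mono mult_right_mono)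
      moreover have "\<dots> \<le> ennreal (a / norm ?c) * hardy_maximal \<psi> \<Phi> (\<xi> x)"
        by (intro mult_left_mono hardy_maximal_ge t) auto
      ultimately show ?thesis by (simp add: order_trans)
    next
      case False
      then show ?thesis using gz by simp
    qed
  qed
  also have "\<dots> = ennreal (a / norm ?c) * (\<integral>\<^sup>+x. hardy_maximal \<psi> \<Phi> (\<xi> x) * indicator (cball z r') x \<partial>lborel)"
    using H by (intro nn_integral_cmult) (auto intro!: borel_measurable_times_ennreal borel_measurable_indicator)
  finally show ?thesis .
qed

text \<open>
  The error of the approximation has half the height of \<open>g\<close> and satisfies, at the scale
  \<open>t = \<epsilon>s\<close>, the same Lipschitz condition with the same \<open>B\<close>: the old bump contributes \<open>\<epsilon>B\<close> and
  the approximant \<open>2Q\<close>, and \<open>\<epsilon> \<le> 1/4\<close>, \<open>Q \<le> B/8\<close> give \<open>\<epsilon>B + 2Q \<le> B/2\<close>. So the step can be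
  repeated on the error, with new nodes each time, and the contributions decay like \<open>2\<^sup>-\<^sup>j\<close>.
  The supports grow by a geometric series of radii, which is absorbed in \<open>r'\<close>.
\<close>

lemma pairing_iteration:
  fixes \<Phi> :: "real^'d \<Rightarrow> real"
  assumes c0: "(LINT x|lborel. \<psi> x) \<noteq> 0"
    and B: "B \<ge> 8 * Q" and e: "0 < \<epsilon>" "\<epsilon> \<le> 1 / 4" "Q * \<epsilon> * (B * (R + 2) + 1) \<le> 1 / 2"
    and \<Phi>: "integrable lborel \<Phi>"
    and "\<And>j. \<xi> j \<in> borel_measurable borel"
    and "\<And>j x. norm (\<xi> j x - x) \<le> \<epsilon> * (\<epsilon> ^ Suc j * s)"
    and "\<And>j. (\<lambda>x. hardy_maximal \<psi> \<Phi> (\<xi> j x)) \<in> borel_measurable borel"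
    and "g \<in> borel_measurable borel" "\<And>x. norm (g x) \<le> a"
    and "\<And>x y. norm (g x - g y) \<le> B * a / s * norm (x - y)"
    and "\<And>x. x \<notin> cball z r \<Longrightarrow> g x = 0" and "s > 0" and "r + (R + 2) * s \<le> r'"
  shows "ennreal (cmod (LINT y|lborel. g y * complex_of_real (\<Phi> y))) \<le>
    (\<Sum>j<J. ennreal (a / norm (LINT x|lborel. \<psi> x) * (1 / 2) ^ j) * (\<integral>\<^sup>+x. hardy_maximal \<psi> \<Phi> (\<xi> j x) * indicator (cball z r') x \<partial>lborel))
    + ennreal ((1 / 2) ^ J * a * (LINT x|lborel. \<bar>\<Phi> x\<bar>))"
  using assms(7-)
proof (induction J arbitrary: \<xi> g a s r)
  case 0
  have [measurable]: "\<Phi> \<in> borel_measurable borel"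
    using borel_measurable_integrable[OF \<Phi>] by simp
  note [measurable] = "0.prems"(4)
  have "norm (LINT y|lborel. g y * complex_of_real (\<Phi> y)) \<le> (LINT y|lborel. norm (g y * complex_of_real (\<Phi> y)))"
    by (rule integral_norm_bound)
  also have "\<dots> \<le> (LINT y|lborel. a * \<bar>\<Phi> y\<bar>)"
    using "0.prems"(5) \<Phi> order_trans[OF norm_ge_zero "0.prems"(5)]
    by (intro integral_mono') (auto simp: norm_mult intro: mult_right_mono)
  finally show ?case by (auto intro: ennreal_leI)
next
  case (Suc J)
  note [measurable] = Suc.prems(1,4)
  note ga = Suc.prems(5) and s = Suc.prems(8)
  have [measurable]: "\<Phi> \<in> borel_measurable borel"
    using borel_measurable_integrable[OF \<Phi>] by simp
  have a: "a \<ge> 0" using ga[of 0] norm_ge_zero[of "g 0"] by linarith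
  have B0: "B \<ge> 0" using B Q_nonneg by linarith
  \<comment> \<open>The terms of index zero come from the approximant S; the error E is handled by the
    induction hypothesis at the scale t and with half the height.\<close>
  define t where "t = \<epsilon> * s"
  have t0: "t > 0" using e s by (simp add: t_def)
  have ts: "t \<le> s" using mult_right_mono[of \<epsilon> 1 s] e s by (simp add: t_def)
  have xi: "norm (\<xi> 0 x - x) \<le> \<epsilon> * t" for x
    using Suc.prems(2)[of 0 x] by (simp add: t_def)
  have xi': "norm (\<xi> 0 x - x) \<le> t" for x
    using xi[of x] mult_right_mono[of \<epsilon> 1 t] t0 e by linarith
  define S where "S = approximant (\<xi> 0) t g"
  define E where "E x = g x - S x" for x
  have S_cont: "continuous_on UNIV S"
    unfolding S_def by (rule approximant_continuous[OF _ _ t0 xi' ga]) auto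
  have [measurable]: "S \<in> borel_measurable borel"
    by (rule borel_measurable_continuous_onI[OF S_cont])
  have [measurable]: "E \<in> borel_measurable borel"
    unfolding E_def by measurable
  have Ea: "norm (E x) \<le> a / 2" for x
  proof -
    have "norm (E x) \<le> Q * \<epsilon> * (B * (R + 2) + 1) * a"
      unfolding E_def S_def using e
      by (intro approximant_error_sup[OF c0 _ _ s _ _ t_def xi ga Suc.prems(6) B0]) auto
    also have "\<dots> \<le> 1 / 2 * a"
      by (intro mult_right_mono e a)
    finally show ?thesis by simp
  qed
  have El: "norm (E x - E y) \<le> B * (a / 2) / t * norm (x - y)" for x y
  proof -
    have "E x - E y = (g x - g y) - (S x - S y)" by (simp add: E_def)
    then have "norm (E x - E y) \<le> norm (g x - g y) + norm (S x - S y)"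
      by (metis norm_triangle_ineq4)
    also have "\<dots> \<le> B * a / s * norm (x - y) + 2 * Q * a / t * norm (x - y)"
      unfolding S_def by (intro add_mono Suc.prems(6) approximant_lipschitz[OF _ _ t0 xi' ga]) auto
    also have "\<dots> = (\<epsilon> * B + 2 * Q) * (a / t * norm (x - y))"
      using e s by (simp add: t_def field_simps)
    also have "\<dots> \<le> (B / 2) * (a / t * norm (x - y))"
    proof (intro mult_right_mono)
      have "\<epsilon> * B \<le> 1 / 4 * B" using e B0 by (intro mult_right_mono) auto
      then show "\<epsilon> * B + 2 * Q \<le> B / 2" using B by linarith
    qed (use a t0 in auto)
    finally show ?thesis by (simp add: mult_ac)
  qed
  have Ez: "E x = 0" if "x \<notin> cball z (r + t * R)" for x
  proof -
    have "x \<notin> cball z r"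
      using that mult_pos_pos[OF t0 R_pos] unfolding mem_cball by linarith
    then show ?thesis
      unfolding E_def S_def using Suc.prems(7) approximant_support[OF t0 xi' Suc.prems(7) that] by simp
  qed
  have IH: "ennreal (cmod (LINT y|lborel. E y * complex_of_real (\<Phi> y))) \<le>
    (\<Sum>j<J. ennreal ((a / 2) / norm (LINT x|lborel. \<psi> x) * (1 / 2) ^ j) * (\<integral>\<^sup>+x. hardy_maximal \<psi> \<Phi> (\<xi> (Suc j) x) * indicator (cball z r') x \<partial>lborel))
    + ennreal ((1 / 2) ^ J * (a / 2) * (LINT x|lborel. \<bar>\<Phi> x\<bar>))"
  proof (rule Suc.IH[where s=t and r="r + t * R" and \<xi>="\<lambda>j. \<xi> (Suc j)"])
    show "norm (\<xi> (Suc j) x - x) \<le> \<epsilon> * (\<epsilon> ^ Suc j * t)" for j x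
      using Suc.prems(2)[of "Suc j" x] by (simp add: t_def mult_ac)
    have "t * (2 * R + 2) \<le> s * (R + 2)"
    proof -
      have "t \<le> s / 2" using mult_right_mono[of \<epsilon> "1/2" s] e s by (simp add: t_def)
      then have "t * (2 * R + 2) \<le> (s / 2) * (2 * R + 2)" using R_pos by (intro mult_right_mono) auto
      also have "\<dots> \<le> s * (R + 2)" using s by (simp add: algebra_simps)
      finally show ?thesis .
    qed
    then show "r + t * R + (R + 2) * t \<le> r'"
      using Suc.prems(9) by (simp add: algebra_simps)
  qed (use Suc.prems(1,3) Ea El Ez t0 in auto)
  have Sb: "ennreal (cmod (LINT y|lborel. S y * complex_of_real (\<Phi> y))) \<le>
    ennreal (a / norm (LINT x|lborel. \<psi> x)) * (\<integral>\<^sup>+x. hardy_maximal \<psi> \<Phi> (\<xi> 0 x) * indicator (cball z r') x \<partial>lborel)"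
    unfolding S_def
  proof (rule approximant_pairing_bound[OF _ _ t0 xi' ga Suc.prems(7) _ \<Phi>])
    have "R * s > 0" using R_pos s by simp
    then show "r + t \<le> r'"
      using ts s Suc.prems(9) by (simp add: distrib_right)
  qed (use Suc.prems(3) in auto)
  have bdint: "integrable lborel (\<lambda>y. u y * complex_of_real (\<Phi> y))"
    if [measurable]: "u \<in> borel_measurable borel" and u: "\<And>y. norm (u y) \<le> M" for u M
  proof (rule Bochner_Integration.integrable_bound)
    show "integrable lborel (\<lambda>y. M * \<bar>\<Phi> y\<bar>)" using \<Phi> by simp
    have "M \<ge> 0" using u[of 0] norm_ge_zero[of "u 0"] by linarith
    then show "AE y in lborel. norm (u y * complex_of_real (\<Phi> y)) \<le> norm (M * \<bar>\<Phi> y\<bar>)"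
      using u by (intro AE_I2) (auto simp: norm_mult abs_mult intro!: mult_right_mono)
  qed measurable
  have Sa: "norm (S x) \<le> a + a / 2" for x
    using Ea[of x] ga[of x] norm_triangle_ineq4[of "g x" "E x"] by (simp add: E_def)
  have "(LINT y|lborel. g y * complex_of_real (\<Phi> y)) = (LINT y|lborel. S y * complex_of_real (\<Phi> y) + E y * complex_of_real (\<Phi> y))"
    by (simp add: E_def algebra_simps)
  also have "\<dots> = (LINT y|lborel. S y * complex_of_real (\<Phi> y)) + (LINT y|lborel. E y * complex_of_real (\<Phi> y))"
    by (intro Bochner_Integration.integral_add bdint[OF _ Sa] bdint[OF _ Ea]) auto
  finally have "cmod (LINT y|lborel. g y * complex_of_real (\<Phi> y)) \<le> cmod (LINT y|lborel. S y * complex_of_real (\<Phi> y)) + cmod (LINT y|lborel. E y * complex_of_real (\<Phi> y))"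
    by (simp only: norm_triangle_ineq)
  then have "ennreal (cmod (LINT y|lborel. g y * complex_of_real (\<Phi> y))) \<le> ennreal (cmod (LINT y|lborel. S y * complex_of_real (\<Phi> y))) + ennreal (cmod (LINT y|lborel. E y * complex_of_real (\<Phi> y)))"
    by (subst ennreal_plus[symmetric]) (auto intro!: ennreal_leI simp del: ennreal_plus)
  also note add_mono[OF Sb IH]
  finally show ?case
    by (subst sum.lessThan_Suc_shift) (simp add: add.assoc mult_ac)
qed

end

section \<open>Dyadic cells\<close>

definition cell :: "int \<Rightarrow> real^'d::finite \<Rightarrow> 'd \<Rightarrow> int" where
  "cell i x = (\<lambda>c. \<lfloor>x $ c / 2 powi i\<rfloor>)"

lemma cell_Suc_eq: "cell i x = cell i y \<Longrightarrow> cell (i + 1) x = cell (i + 1) y"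
proof -
  assume *: "cell i x = cell i y"
  have "\<lfloor>a / 2 powi (i + 1)\<rfloor> = \<lfloor>a / 2 powi i\<rfloor> div 2" for a :: real
    using floor_divide_real_eq_div[of 2 "a / 2 powi i"] by (simp add: power_int_add mult.commute)
  with * show ?thesis
    by (auto simp: cell_def fun_eq_iff)
qed

lemma cell_mono: "cell i x = cell i y \<Longrightarrow> i \<le> j \<Longrightarrow> cell j x = cell j y"
proof -
  assume *: "cell i x = cell i y" and "i \<le> j"
  from \<open>i \<le> j\<close> show ?thesis
    by (induction j rule: int_ge_induct) (use * cell_Suc_eq in auto)
qed

lemma cell_measurable [measurable]: "cell i \<in> borel \<rightarrow>\<^sub>M count_space (UNIV :: ('d::finite \<Rightarrow> int) set)"
proof (subst measurable_count_space_eq2_countable, safe)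
  fix n :: "'d \<Rightarrow> int"
  have "cell i -` {n} \<inter> space borel = {x :: real^'d. \<forall>c. \<lfloor>x $ c / 2 powi i\<rfloor> = n c}"
    by (auto simp: cell_def fun_eq_iff)
  also have "\<dots> \<in> sets borel"
    by measurable
  finally show "cell i -` {n} \<inter> space borel \<in> sets borel" .
qed auto

lemma norm_diff_le_of_cell_eq:
  fixes x y :: "real^'d::finite"
  assumes "cell i x = cell i y"
  shows "norm (x - y) \<le> real CARD('d) * 2 powi i"
proof -
  have "norm (x - y) \<le> (\<Sum>c\<in>UNIV. \<bar>(x - y) $ c\<bar>)"
    by (rule norm_le_l1_cart)
  also have "\<dots> \<le> (\<Sum>c\<in>(UNIV :: 'd set). 2 powi i)"
  proof (rule sum_mono)
    fix c
    have "\<lfloor>x $ c / 2 powi i\<rfloor> = \<lfloor>y $ c / 2 powi i\<rfloor>"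
      using assms by (auto simp: cell_def fun_eq_iff)
    then have "\<bar>x $ c / 2 powi i - y $ c / 2 powi i\<bar> \<le> 1"
      by linarith
    then show "\<bar>(x - y) $ c\<bar> \<le> 2 powi i"
      by (simp add: diff_divide_distrib[symmetric] abs_divide divide_le_eq)
  qed
  also have "\<dots> = real CARD('d) * 2 powi i"
    by simp
  finally show ?thesis .
qed

lemma emeasure_cell:
  "emeasure lborel {x :: real^'d::finite. cell i x = n} = ennreal ((2 powi i) ^ CARD('d))"
proof -
  define s :: real where "s = 2 powi i"
  have s: "s > 0" by (simp add: s_def)
  define a b :: "real^'d" where "a = (\<chi> c. s * n c)" and "b = (\<chi> c. s * (n c + 1))"
  have mem: "cell i x = n \<longleftrightarrow> (\<forall>c. s * n c \<le> x $ c \<and> x $ c < s * (n c + 1))" for x :: "real^'d"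
    using s by (simp add: cell_def fun_eq_iff s_def[symmetric] floor_eq_iff pos_le_divide_eq pos_divide_less_eq mult.commute)
  have 1: "emeasure lborel (box a b) = ennreal (s ^ CARD('d))" "emeasure lborel (cbox a b) = ennreal (s ^ CARD('d))"
  proof -
    have *: "\<And>v. v \<in> Basis \<Longrightarrow> a \<bullet> v \<le> b \<bullet> v \<and> (b - a) \<bullet> v = s"
      using s by (auto simp: Basis_vec_def inner_axis a_def b_def algebra_simps)
    show "emeasure lborel (box a b) = ennreal (s ^ CARD('d))" "emeasure lborel (cbox a b) = ennreal (s ^ CARD('d))"
      using * by (subst emeasure_lborel_box emeasure_lborel_cbox; auto)+
  qed
  have meas: "{x :: real^'d. cell i x = n} \<in> sets borel"
    using measurable_sets[OF cell_measurable, of "{n}" i] by (simp add: vimage_def)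
  show ?thesis
  proof (rule antisym)
    have "emeasure lborel {x. cell i x = n} \<le> emeasure lborel (cbox a b)"
      using meas by (intro emeasure_mono) (auto simp: mem mem_box_cart a_def b_def less_imp_le)
    then show "emeasure lborel {x. cell i x = n} \<le> ennreal ((2 powi i) ^ CARD('d))"
      using 1 by (simp add: s_def)
    have "emeasure lborel (box a b) \<le> emeasure lborel {x. cell i x = n}"
      using meas by (intro emeasure_mono) (auto simp: mem mem_box_cart a_def b_def less_imp_le)
    then show "ennreal ((2 powi i) ^ CARD('d)) \<le> emeasure lborel {x. cell i x = n}"
      using 1 by (simp add: s_def)
  qed
qed

text \<open>
  These infima are constant on cells of level \<open>i\<close>, hence measurable for every function \<open>H\<close>, and they decrease
  when \<open>i\<close> grows. Both properties are needed for the Carleson embedding.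
\<close>

definition cell_inf :: "(real^'d::finite \<Rightarrow> ennreal) \<Rightarrow> int \<Rightarrow> real^'d \<Rightarrow> ennreal" where
  "cell_inf H i x = (INF y\<in>{y. cell i y = cell i x}. H y)"

lemma cell_inf_measurable [measurable]: "cell_inf H i \<in> borel_measurable borel"
proof -
  have "(\<lambda>x. (\<lambda>n. INF y\<in>{y. cell i y = n}. H y) (cell i x)) \<in> borel_measurable borel"
    by measurable
  then show ?thesis by (simp add: cell_inf_def[abs_def])
qed

lemma cell_inf_le: "cell_inf H i x \<le> H x"
  unfolding cell_inf_def by (rule INF_lower) auto

lemma cell_inf_cong: "cell i x = cell i y \<Longrightarrow> cell_inf H i x = cell_inf H i y"
  by (simp add: cell_inf_def)

lemma cell_inf_antimono: "i \<le> j \<Longrightarrow> cell_inf H j x \<le> cell_inf H i x"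
  unfolding cell_inf_def by (rule INF_superset_mono) (auto dest: cell_mono)

section \<open>Carleson embedding\<close>

text \<open>
  The factor \<open>(2D)\<^sup>d\<close> bounds the volume of a ball of radius \<open>D\<close>. The factor \<open>(D + d)\<^sup>d\<^sup>-\<^sup>1\<close> is the growth
  of a measure on a ball of radius \<open>D + d\<close>, which covers a unit cell that meets a ball of radius \<open>D\<close>.
\<close>

definition carleson_const :: "nat \<Rightarrow> real \<Rightarrow> real" where
  "carleson_const d D = (2 * D) ^ d * (D + real d) ^ (d - 1)"

text \<open>
  For \<open>N\<close> equal to the essential supremum of \<open>M\<^sub>1\<mu>\<close> this is the hypothesis of the
  second statement. Balls with arbitrary centres are allowed, so that the condition is invariant under translations.
\<close>

locale growth_measure =
  fixes \<mu> :: "(real^'d::finite) measure" and N :: ennreal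
  assumes sets_mu [measurable_cong]: "sets \<mu> = sets borel"
    and growth: "\<And>x r. r > 0 \<Longrightarrow> emeasure \<mu> (cball x r) \<le> N * ennreal (r ^ (CARD('d) - 1))"
    and N_finite: "N < \<infinity>"
begin

lemma space_mu [simp]: "space \<mu> = UNIV"
  using sets_eq_imp_space_eq[OF sets_mu] by simp

lemma emeasure_cball_finite: "emeasure \<mu> (cball x r) < \<infinity>"
proof -
  have "emeasure \<mu> (cball x r) \<le> emeasure \<mu> (cball x (max r 1))"
    by (intro emeasure_mono) (auto simp: sets_mu)
  also have "\<dots> \<le> N * ennreal ((max r 1) ^ (CARD('d) - 1))"
    by (rule growth) auto
  also have "\<dots> < \<infinity>"
    using N_finite by (simp add: ennreal_mult_less_top)
  finally show ?thesis .
qed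

lemma sigma_finite_mu: "sigma_finite_measure \<mu>"
proof
  let ?A = "range (\<lambda>n::nat. cball (0::real^'d) (real n))"
  have "\<Union>?A = UNIV"
    by (auto simp: real_arch_simple)
  moreover have "emeasure \<mu> a \<noteq> \<infinity>" if "a \<in> ?A" for a
    using that emeasure_cball_finite less_top by auto
  ultimately show "\<exists>A. countable A \<and> A \<subseteq> sets \<mu> \<and> \<Union>A = space \<mu> \<and> (\<forall>a\<in>A. emeasure \<mu> a \<noteq> \<infinity>)"
    by (intro exI[of _ ?A]) (auto simp: sets_mu)
qed

sublocale sigma_finite_measure \<mu> by (rule sigma_finite_mu)

sublocale leb_pair: pair_sigma_finite lborel \<mu> ..

lemma ball_indicator_measurable:
  "(\<lambda>(x, y). indicator (cball x r) y :: ennreal) \<in> borel_measurable (borel \<Otimes>\<^sub>M borel :: ((real^'d) \<times> (real^'d)) measure)"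
proof -
  have "closed {p :: (real^'d) \<times> (real^'d). dist (fst p) (snd p) \<le> r}"
    by (intro closed_Collect_le continuous_intros)
  then have "{p :: (real^'d) \<times> (real^'d). dist (fst p) (snd p) \<le> r} \<in> sets (borel \<Otimes>\<^sub>M borel)"
    unfolding borel_prod by (rule borel_closed)
  then have "indicator {p :: (real^'d) \<times> (real^'d). dist (fst p) (snd p) \<le> r} \<in> borel_measurable (borel \<Otimes>\<^sub>M borel :: ((real^'d) \<times> (real^'d)) measure)"
    by (intro borel_measurable_indicator) auto
  also have "indicator {p :: (real^'d) \<times> (real^'d). dist (fst p) (snd p) \<le> r} = (\<lambda>(x, y). indicator (cball x r) y :: ennreal)"
    by (auto simp: indicator_def fun_eq_iff)
  finally show ?thesis .
qed

text \<open>
  Fubini for the symmetric relation \<open>|x - y| \<le> r\<close>.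
\<close>

lemma nn_integral_ball_swap:
  fixes \<phi> :: "real^'d \<Rightarrow> ennreal"
  assumes [measurable]: "\<phi> \<in> borel_measurable borel"
  shows "(\<integral>\<^sup>+x. \<phi> x * emeasure \<mu> (cball x r) \<partial>lborel) = (\<integral>\<^sup>+y. (\<integral>\<^sup>+x. \<phi> x * indicator (cball y r) x \<partial>lborel) \<partial>\<mu>)"
proof -
  note [measurable] = ball_indicator_measurable
  have m: "(\<lambda>(x, y). \<phi> x * indicator (cball x r) y) \<in> borel_measurable (lborel \<Otimes>\<^sub>M \<mu>)"
  proof -
    have "(\<lambda>p. \<phi> (fst p) * (case p of (x, y) \<Rightarrow> indicator (cball x r) y)) \<in> borel_measurable (borel \<Otimes>\<^sub>M borel)"
      by (intro borel_measurable_times_ennreal ball_indicator_measurable measurable_compose[OF measurable_fst assms])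
    also have "borel_measurable (borel \<Otimes>\<^sub>M borel) = (borel_measurable (lborel \<Otimes>\<^sub>M \<mu>) :: ((real^'d) \<times> (real^'d) \<Rightarrow> ennreal) set)"
      by (intro measurable_cong_sets sets_pair_measure_cong) (auto simp: sets_mu)
    finally show ?thesis by (simp add: case_prod_beta')
  qed
  have "(\<integral>\<^sup>+x. \<phi> x * emeasure \<mu> (cball x r) \<partial>lborel) = (\<integral>\<^sup>+x. (\<integral>\<^sup>+y. \<phi> x * indicator (cball x r) y \<partial>\<mu>) \<partial>lborel)"
    by (intro nn_integral_cong, subst nn_integral_cmult) (auto simp: sets_mu)
  also have "\<dots> = (\<integral>\<^sup>+y. (\<integral>\<^sup>+x. \<phi> x * indicator (cball x r) y \<partial>lborel) \<partial>\<mu>)"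
    by (rule leb_pair.Fubini'[symmetric]) (rule m)
  also have "\<dots> = (\<integral>\<^sup>+y. (\<integral>\<^sup>+x. \<phi> x * indicator (cball y r) x \<partial>lborel) \<partial>\<mu>)"
    by (intro nn_integral_cong) (auto simp: indicator_def dist_commute)
  finally show ?thesis .
qed

lemma ball_integral_measurable:
  fixes \<phi> :: "real^'d \<Rightarrow> ennreal"
  assumes [measurable]: "\<phi> \<in> borel_measurable borel"
  shows "(\<lambda>y. \<integral>\<^sup>+x. \<phi> x * indicator (cball y r) x \<partial>lborel) \<in> borel_measurable borel"
proof (rule lborel.borel_measurable_nn_integral)
  have "(\<lambda>p. \<phi> (snd p) * (case p of (x, y) \<Rightarrow> indicator (cball x r) y)) \<in> borel_measurable (borel \<Otimes>\<^sub>M borel)"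
    by (intro borel_measurable_times_ennreal ball_indicator_measurable measurable_compose[OF measurable_snd assms])
  also have "borel_measurable (borel \<Otimes>\<^sub>M borel) = (borel_measurable (borel \<Otimes>\<^sub>M lborel) :: ((real^'d) \<times> (real^'d) \<Rightarrow> ennreal) set)"
    by (intro measurable_cong_sets sets_pair_measure_cong) auto
  finally show "(\<lambda>(y, x). \<phi> x * indicator (cball y r) x) \<in> borel_measurable (borel \<Otimes>\<^sub>M lborel)"
    by (simp add: case_prod_beta')
qed

lemma cball_measure_measurable [measurable]: "(\<lambda>x. emeasure \<mu> (cball x r)) \<in> borel_measurable borel"
proof -
  have "(\<lambda>x. \<integral>\<^sup>+y. indicator (cball x (r)) y \<partial>\<mu>) \<in> borel_measurable borel"
  proof (rule borel_measurable_nn_integral)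
    have "borel_measurable (borel \<Otimes>\<^sub>M borel) = (borel_measurable (borel \<Otimes>\<^sub>M \<mu>) :: ((real^'d) \<times> (real^'d) \<Rightarrow> ennreal) set)"
      by (intro measurable_cong_sets sets_pair_measure_cong) (auto simp: sets_mu)
    then show "(\<lambda>(x, y). indicator (cball x (r)) y :: ennreal) \<in> borel_measurable (borel \<Otimes>\<^sub>M \<mu>)"
      using ball_indicator_measurable by auto
  qed
  then show ?thesis by (simp add: sets_mu)
qed

text \<open>
  A function that is constant on cells of side \<open>S = 2\<^sup>l\<close> sees only the average of \<open>\<mu>\<close> at scale
  \<open>S\<close>. Passing from balls of radius \<open>Ds\<close> to balls of radius about \<open>S\<close>
  multiplies the inner integral by at most \<open>(s/S)\<^sup>d\<close>, while the normalisations and the growth of \<open>\<mu>\<close> at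
  scale \<open>S\<close> give \<open>(S/s)\<^sup>d\<^sup>-\<^sup>1\<close>. The product is the gain \<open>s/S\<close>, which is summable over the
  scales below \<open>S\<close>.
\<close>

lemma carleson_fine:
  fixes \<phi> :: "real^'d \<Rightarrow> ennreal"
  assumes [measurable]: "\<phi> \<in> borel_measurable borel"
    and const: "\<And>x y. cell l x = cell l y \<Longrightarrow> \<phi> x = \<phi> y"
    and k: "k \<le> l" and D: "D > 0"
  shows "(\<integral>\<^sup>+x. \<phi> x * (ennreal (1 / (2 powi k) ^ (CARD('d) - 1)) * emeasure \<mu> (cball x (D * 2 powi k))) \<partial>lborel)
    \<le> ennreal (carleson_const CARD('d) D * 2 powi (k - l)) * N * (\<integral>\<^sup>+x. \<phi> x \<partial>lborel)"
proof -
  define s S :: real where "s = 2 powi k" and "S = 2 powi l"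
  have sS: "0 < s" "s \<le> S" "0 < S"
    using k by (auto simp: s_def S_def intro: power_int_increasing)
  define D' where "D' = D + CARD('d)"
  have D': "D' > 0" using D by (simp add: D'_def)
  define \<Psi> where "\<Psi> y = (\<integral>\<^sup>+x. \<phi> x * indicator (cball y (D' * S)) x \<partial>lborel)" for y
  have [measurable]: "\<Psi> \<in> borel_measurable borel"
    unfolding \<Psi>_def by (rule ball_integral_measurable) measurable
  \<comment> \<open>The cell of x lies in the ball of radius D'S around y, and \<phi> is constant on it.\<close>
  have loc: "\<phi> x * ennreal (S ^ CARD('d)) \<le> \<Psi> y" if x: "x \<in> cball y (D * s)" for x y
  proof -
    have m: "{x' :: real^'d. cell l x' = cell l x} \<in> sets borel"
      using measurable_sets[OF cell_measurable, of "{cell l x}" l] by (simp add: vimage_def)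
    have "\<phi> x * ennreal (S ^ CARD('d)) = (\<integral>\<^sup>+x'. \<phi> x * indicator {x'. cell l x' = cell l x} x' \<partial>lborel)"
      using m by (subst nn_integral_cmult) (auto simp: emeasure_cell S_def)
    also have "\<dots> \<le> \<Psi> y"
      unfolding \<Psi>_def
    proof (rule nn_integral_mono)
      fix x' :: "real^'d"
      show "\<phi> x * indicator {x'. cell l x' = cell l x} x' \<le> \<phi> x' * indicator (cball y (D' * S)) x'"
      proof (cases "cell l x' = cell l x")
        case True
        have "dist y x' \<le> dist y x + dist x x'" by (rule dist_triangle)
        also have "dist y x \<le> D * S"
          using x mult_left_mono[of s S D] sS D unfolding mem_cball by linarith
        also have "dist x x' \<le> CARD('d) * S"
          using norm_diff_le_of_cell_eq[OF True] by (simp add: S_def dist_norm norm_minus_commute)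
        finally show ?thesis using True const[OF True] by (auto simp: D'_def algebra_simps)
      qed auto
    qed
    finally show ?thesis .
  qed
  have "(\<integral>\<^sup>+x. \<phi> x * indicator (cball y (D * s)) x \<partial>lborel) \<le> ennreal ((2 * D) ^ CARD('d) * (s / S) ^ CARD('d)) * \<Psi> y" for y
  proof -
    have "(\<integral>\<^sup>+x. \<phi> x * indicator (cball y (D * s)) x \<partial>lborel) \<le> (\<integral>\<^sup>+x. (ennreal (1 / S ^ CARD('d)) * \<Psi> y) * indicator (cball y (D * s)) x \<partial>lborel)"
    proof (rule nn_integral_mono)
      fix x :: "real^'d"
      show "\<phi> x * indicator (cball y (D * s)) x \<le> (ennreal (1 / S ^ CARD('d)) * \<Psi> y) * indicator (cball y (D * s)) x"
      proof (cases "x \<in> cball y (D * s)")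
        case True
        have "\<phi> x = ennreal (1 / S ^ CARD('d)) * (\<phi> x * ennreal (S ^ CARD('d)))"
          using sS by (simp add: mult.left_commute ennreal_mult[symmetric])
        also have "\<dots> \<le> ennreal (1 / S ^ CARD('d)) * \<Psi> y"
          by (intro mult_left_mono loc True) auto
        finally show ?thesis using True by simp
      qed auto
    qed
    also have "\<dots> = ennreal (1 / S ^ CARD('d)) * \<Psi> y * emeasure lborel (cball y (D * s))"
      by (rule nn_integral_cmult_indicator) auto
    also have "\<dots> \<le> ennreal (1 / S ^ CARD('d)) * \<Psi> y * ennreal ((2 * (D * s)) ^ CARD('d))"
      using D sS by (intro mult_left_mono emeasure_cball_le) auto
    also have "\<dots> = ennreal ((2 * D) ^ CARD('d) * (s / S) ^ CARD('d)) * \<Psi> y"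
    proof -
      have "ennreal ((2 * D) ^ CARD('d) * (s / S) ^ CARD('d)) = ennreal (1 / S ^ CARD('d)) * ennreal ((2 * (D * s)) ^ CARD('d))"
        using D sS by (subst ennreal_mult[symmetric]) (auto simp: power_mult_distrib power_divide)
      then show ?thesis by (simp add: mult_ac)
    qed
    finally show ?thesis .
  qed
  note ball_int = this
  have "(\<integral>\<^sup>+x. \<phi> x * emeasure \<mu> (cball x (D * s)) \<partial>lborel) = (\<integral>\<^sup>+y. (\<integral>\<^sup>+x. \<phi> x * indicator (cball y (D * s)) x \<partial>lborel) \<partial>\<mu>)"
    by (rule nn_integral_ball_swap) measurable
  also have "\<dots> \<le> (\<integral>\<^sup>+y. ennreal ((2 * D) ^ CARD('d) * (s / S) ^ CARD('d)) * \<Psi> y \<partial>\<mu>)"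
    by (intro nn_integral_mono ball_int)
  also have "\<dots> = ennreal ((2 * D) ^ CARD('d) * (s / S) ^ CARD('d)) * (\<integral>\<^sup>+y. \<Psi> y \<partial>\<mu>)"
    by (rule nn_integral_cmult) measurable
  also have "(\<integral>\<^sup>+y. \<Psi> y \<partial>\<mu>) = (\<integral>\<^sup>+x. \<phi> x * emeasure \<mu> (cball x (D' * S)) \<partial>lborel)"
    unfolding \<Psi>_def by (rule nn_integral_ball_swap[symmetric]) measurable
  also have "\<dots> \<le> (\<integral>\<^sup>+x. (N * ennreal ((D' * S) ^ (CARD('d) - 1))) * \<phi> x \<partial>lborel)"
    by (subst mult.commute) (intro nn_integral_mono mult_right_mono growth, use D' sS in auto)
  also have "\<dots> = (N * ennreal ((D' * S) ^ (CARD('d) - 1))) * (\<integral>\<^sup>+x. \<phi> x \<partial>lborel)"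
    by (rule nn_integral_cmult) measurable
  finally have main: "(\<integral>\<^sup>+x. \<phi> x * emeasure \<mu> (cball x (D * s)) \<partial>lborel) \<le>
     ennreal ((2 * D) ^ CARD('d) * (s / S) ^ CARD('d)) * ((N * ennreal ((D' * S) ^ (CARD('d) - 1))) * (\<integral>\<^sup>+x. \<phi> x \<partial>lborel))"
    by (simp add: mult_left_mono)
  have "(\<integral>\<^sup>+x. \<phi> x * (ennreal (1 / s ^ (CARD('d) - 1)) * emeasure \<mu> (cball x (D * s))) \<partial>lborel)
     = (\<integral>\<^sup>+x. ennreal (1 / s ^ (CARD('d) - 1)) * (\<phi> x * emeasure \<mu> (cball x (D * s))) \<partial>lborel)"
    by (simp add: mult.left_commute)
  also have "\<dots> = ennreal (1 / s ^ (CARD('d) - 1)) * (\<integral>\<^sup>+x. \<phi> x * emeasure \<mu> (cball x (D * s)) \<partial>lborel)"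
    by (rule nn_integral_cmult) measurable
  also have "\<dots> \<le> ennreal (1 / s ^ (CARD('d) - 1)) * (ennreal ((2 * D) ^ CARD('d) * (s / S) ^ CARD('d)) * ((N * ennreal ((D' * S) ^ (CARD('d) - 1))) * (\<integral>\<^sup>+x. \<phi> x \<partial>lborel)))"
    by (intro mult_left_mono main) auto
  also have "\<dots> = (ennreal (1 / s ^ (CARD('d) - 1)) * (ennreal ((2 * D) ^ CARD('d) * (s / S) ^ CARD('d)) * ennreal ((D' * S) ^ (CARD('d) - 1)))) * N * (\<integral>\<^sup>+x. \<phi> x \<partial>lborel)"
    by (simp add: mult_ac)
  also have "ennreal (1 / s ^ (CARD('d) - 1)) * (ennreal ((2 * D) ^ CARD('d) * (s / S) ^ CARD('d)) * ennreal ((D' * S) ^ (CARD('d) - 1)))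
     = ennreal (1 / s ^ (CARD('d) - 1) * ((2 * D) ^ CARD('d) * (s / S) ^ CARD('d) * (D' * S) ^ (CARD('d) - 1)))"
  proof -
    have "0 \<le> 1 / s ^ (CARD('d) - 1)" "0 \<le> (2 * D) ^ CARD('d) * (s / S) ^ CARD('d)" "0 \<le> (D' * S) ^ (CARD('d) - 1)"
      using D sS D' by (auto intro!: mult_nonneg_nonneg zero_le_power)
    then show ?thesis by (simp only: ennreal_mult mult_nonneg_nonneg)
  qed
  also have "1 / s ^ (CARD('d) - 1) * ((2 * D) ^ CARD('d) * (s / S) ^ CARD('d) * (D' * S) ^ (CARD('d) - 1)) = carleson_const CARD('d) D * 2 powi (k - l)"
  proof -
    obtain n where n: "CARD('d) = Suc n" using zero_less_card_finite gr0_implies_Suc by blast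
    have "2 powi (k - l) = s / S" by (simp add: s_def S_def power_int_diff)
    moreover have "1 / s ^ n * ((2 * D) ^ Suc n * (s / S) ^ Suc n * (D' * S) ^ n) = (2 * D) ^ Suc n * D' ^ n * (s / S)"
      using sS by (simp add: power_divide power_mult_distrib)
    ultimately show ?thesis
      by (simp add: carleson_const_def D'_def n)
  qed
  finally show ?thesis by (simp add: s_def)
qed

end

text \<open>
  A decreasing sequence \<open>h\<^sub>i\<close> of functions that are constant on cells is a sum of increments, each of
  which occurs in \<open>h\<^sub>i\<close> for all levels \<open>i\<close> up to some level \<open>n\<close> and is constant on cells of level \<open>n\<close>. It is
  therefore enough to know the inequality for one function used at all levels up to \<open>n\<close>, which is the first
  hypothesis. The induction splits off the function with the largest index.
\<close>

lemma carleson_abel: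
  fixes h :: "int \<Rightarrow> real^'d::finite \<Rightarrow> ennreal" and A :: "int \<Rightarrow> real^'d \<Rightarrow> ennreal"
  assumes "\<And>\<phi> n. \<phi> \<in> borel_measurable borel \<Longrightarrow> (\<And>x y. cell (l0 + int n) x = cell (l0 + int n) y \<Longrightarrow> \<phi> x = \<phi> y) \<Longrightarrow>
      (\<Sum>i\<le>n. \<integral>\<^sup>+x. \<phi> x * A (l0 + int i) x \<partial>lborel) \<le> C * (\<integral>\<^sup>+x. \<phi> x \<partial>lborel)"
    and A [measurable]: "\<And>i. A i \<in> borel_measurable borel"
    and "\<And>i. h i \<in> borel_measurable borel"
    and "\<And>i x y. cell i x = cell i y \<Longrightarrow> h i x = h i y"
    and "\<And>i j x. i \<le> j \<Longrightarrow> h j x \<le> h i x"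
  shows "(\<Sum>i\<le>n. \<integral>\<^sup>+x. h (l0 + int i) x * A (l0 + int i) x \<partial>lborel) \<le> C * (\<integral>\<^sup>+x. h l0 x \<partial>lborel)"
  using assms(3-)
proof (induction n arbitrary: h)
  case 0
  have "(\<Sum>i\<le>0. \<integral>\<^sup>+x. h l0 x * A (l0 + int i) x \<partial>lborel) \<le> C * (\<integral>\<^sup>+x. h l0 x \<partial>lborel)"
  proof (rule assms(1))
    show "h l0 x = h l0 y" if "cell (l0 + int 0) x = cell (l0 + int 0) y" for x y
      using that by (intro "0.prems"(2)) simp
  qed (rule "0.prems")
  then show ?case by simp
next
  case (Suc n)
  note [measurable] = Suc.prems(1)
  define c where "c = h (l0 + int (Suc n))"
  have [measurable]: "c \<in> borel_measurable borel" by (simp add: c_def)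
  define h' where "h' i x = (if i \<le> l0 + int n then h i x - c x else 0)" for i x
  have [measurable]: "h' i \<in> borel_measurable borel" for i
    unfolding h'_def by (cases "i \<le> l0 + int n") auto
  have IH: "(\<Sum>i\<le>n. \<integral>\<^sup>+x. h' (l0 + int i) x * A (l0 + int i) x \<partial>lborel) \<le> C * (\<integral>\<^sup>+x. h' l0 x \<partial>lborel)"
  proof (rule Suc.IH)
    show "h' i x = h' i y" if "cell i x = cell i y" for i x y
    proof (cases "i \<le> l0 + int n")
      case True
      have "h i x = h i y" "c x = c y"
        using True by (auto simp: c_def intro!: Suc.prems(2) intro: that cell_mono[OF that])
      then show ?thesis by (simp add: h'_def)
    qed (simp add: h'_def)
    show "h' j x \<le> h' i x" if "i \<le> j" for i j x
      using Suc.prems(3)[OF that] that by (auto simp: h'_def intro: ennreal_minus_mono)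
  qed measurable
  have sum: "h i x = h' i x + c x" if "i \<le> l0 + int n" for i x
    using that Suc.prems(3)[of i "l0 + int (Suc n)" x] by (auto simp: h'_def c_def diff_add_cancel_ennreal)
  have "(\<Sum>i\<le>Suc n. \<integral>\<^sup>+x. h (l0 + int i) x * A (l0 + int i) x \<partial>lborel) =
      (\<Sum>i\<le>n. \<integral>\<^sup>+x. h' (l0 + int i) x * A (l0 + int i) x + c x * A (l0 + int i) x \<partial>lborel) + (\<integral>\<^sup>+x. c x * A (l0 + int (Suc n)) x \<partial>lborel)"
    by (simp add: sum distrib_right) (simp add: c_def)
  also have "\<dots> = (\<Sum>i\<le>n. \<integral>\<^sup>+x. h' (l0 + int i) x * A (l0 + int i) x \<partial>lborel) + (\<Sum>i\<le>Suc n. \<integral>\<^sup>+x. c x * A (l0 + int i) x \<partial>lborel)"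
    by (simp add: nn_integral_add sum.distrib add.assoc)
  also have "\<dots> \<le> C * (\<integral>\<^sup>+x. h' l0 x \<partial>lborel) + C * (\<integral>\<^sup>+x. c x \<partial>lborel)"
    by (intro add_mono IH assms(1)) (auto simp: c_def intro: Suc.prems)
  also have "\<dots> = C * (\<integral>\<^sup>+x. h l0 x \<partial>lborel)"
    by (simp add: sum[of l0] nn_integral_add distrib_left)
  finally show ?case .
qed

lemma sum_min_geometric_le: "(\<Sum>r\<le>n. min 1 (2 ^ m / 2 ^ r)) \<le> (real m + 2)"
proof (induction m arbitrary: n)
  case 0
  have "(\<Sum>r\<le>n. min 1 (2 ^ 0 / 2 ^ r)) = (\<Sum>r\<le>n. (1 / 2) ^ r :: real)"
    by (intro sum.cong) (auto simp: power_one_over divide_le_eq)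
  also have "\<dots> \<le> 2"
    by (induction n) (simp_all add: sum_gp0)
  finally show ?case by simp
next
  case (Suc m)
  have "(\<Sum>r\<le>n. min 1 (2 ^ Suc m / 2 ^ r)) \<le> (\<Sum>r\<le>Suc n. min 1 (2 ^ Suc m / 2 ^ r :: real))"
    by (intro sum_mono2) auto
  also have "\<dots> = min 1 (2 ^ Suc m) + (\<Sum>r\<le>n. min 1 (2 ^ m / 2 ^ r))"
    by (subst sum.atMost_Suc_shift) simp
  also have "\<dots> \<le> 1 + (real m + 2)"
    by (intro add_mono Suc.IH) simp
  finally show ?case by simp
qed

context growth_measure begin

definition ball_average :: "real \<Rightarrow> int \<Rightarrow> real^'d \<Rightarrow> ennreal" where
  "ball_average D k x = ennreal (1 / (2 powi k) ^ (CARD('d) - 1)) * emeasure \<mu> (cball x (D * 2 powi k))"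

lemma ball_average_measurable [measurable]: "ball_average D k \<in> borel_measurable borel"
  unfolding ball_average_def by measurable

lemma carleson_const_ge: "D \<ge> 1 \<Longrightarrow> D ^ (CARD('d) - 1) \<le> carleson_const CARD('d) D"
proof -
  assume D: "D \<ge> 1"
  have "1 * D ^ (CARD('d) - 1) \<le> (2 * D) ^ CARD('d) * (D + CARD('d)) ^ (CARD('d) - 1)"
    using D by (intro mult_mono power_mono one_le_power) auto
  then show ?thesis by (simp add: carleson_const_def)
qed

text \<open>
  The direct bound by growth. It serves for the scales above that of the
  test function, where \<open>carleson_fine\<close> is not available.
\<close>

lemma ball_average_le:
  assumes D: "D \<ge> 1"
  shows "ball_average D k x \<le> ennreal (carleson_const CARD('d) D) * N"
proof -
  have "ball_average D k x \<le> ennreal (1 / (2 powi k) ^ (CARD('d) - 1)) * (N * ennreal ((D * 2 powi k) ^ (CARD('d) - 1)))"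
    unfolding ball_average_def using D by (intro mult_left_mono growth) auto
  also have "\<dots> = (ennreal (1 / (2 powi k) ^ (CARD('d) - 1)) * ennreal ((D * 2 powi k) ^ (CARD('d) - 1))) * N"
    by (simp add: mult_ac)
  also have "ennreal (1 / (2 powi k) ^ (CARD('d) - 1)) * ennreal ((D * 2 powi k) ^ (CARD('d) - 1)) = ennreal (D ^ (CARD('d) - 1))"
    using D by (subst ennreal_mult[symmetric]) (auto simp: power_mult_distrib)
  also have "\<dots> * N \<le> ennreal (carleson_const CARD('d) D) * N"
    by (intro mult_right_mono ennreal_leI carleson_const_ge D) auto
  finally show ?thesis .
qed

text \<open>
  Between the scale of the cells and the scale of the average there is a gap of \<open>m\<close> levels. The levels \<open>i\<close>
  with \<open>i + m\<close> below \<open>n\<close> form a geometric series, and the remaining ones, at most \<open>m\<close> of them, contribute a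
  constant each. Linear growth in \<open>m\<close> is what makes the sum over the gaps converge later.
\<close>

lemma carleson_condition:
  fixes \<phi> :: "real^'d \<Rightarrow> ennreal"
  assumes [measurable]: "\<phi> \<in> borel_measurable borel"
    and const: "\<And>x y. cell (l0 + int n) x = cell (l0 + int n) y \<Longrightarrow> \<phi> x = \<phi> y"
    and D: "D \<ge> 1"
  shows "(\<Sum>i\<le>n. \<integral>\<^sup>+x. \<phi> x * ball_average D (l0 + int i + int m) x \<partial>lborel)
    \<le> ennreal (carleson_const CARD('d) D * (real m + 2)) * N * (\<integral>\<^sup>+x. \<phi> x \<partial>lborel)"
proof -
  have C0: "carleson_const CARD('d) D \<ge> 0"
    using D by (simp add: carleson_const_def)
  have "(\<Sum>i\<le>n. \<integral>\<^sup>+x. \<phi> x * ball_average D (l0 + int i + int m) x \<partial>lborel)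
    \<le> (\<Sum>i\<le>n. ennreal (carleson_const CARD('d) D * min 1 (2 ^ m / 2 ^ (n - i))) * (N * (\<integral>\<^sup>+x. \<phi> x \<partial>lborel)))"
  proof (rule sum_mono)
    fix i assume "i \<in> {..n}"
    then have i: "i \<le> n" by simp
    show "(\<integral>\<^sup>+x. \<phi> x * ball_average D (l0 + int i + int m) x \<partial>lborel) \<le> ennreal (carleson_const CARD('d) D * min 1 (2 ^ m / 2 ^ (n - i))) * (N * (\<integral>\<^sup>+x. \<phi> x \<partial>lborel))"
    proof (cases "m \<le> n - i")
      case True
      have "2 powi (l0 + int i + int m - (l0 + int n)) = (2 ^ m / 2 ^ (n - i) :: real)"
      proof -
        have e: "l0 + int i + int m - (l0 + int n) = int m - int (n - i)" using i by simp
        show ?thesis unfolding e by (subst power_int_diff) auto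
      qed
      moreover have "(2 ^ m / 2 ^ (n - i) :: real) \<le> 1"
        using True by (simp add: divide_le_eq)
      moreover have "(\<integral>\<^sup>+x. \<phi> x * ball_average D (l0 + int i + int m) x \<partial>lborel) \<le> ennreal (carleson_const CARD('d) D * 2 powi (l0 + int i + int m - (l0 + int n))) * N * (\<integral>\<^sup>+x. \<phi> x \<partial>lborel)"
        unfolding ball_average_def using True i D by (intro carleson_fine const) auto
      ultimately show ?thesis by (simp add: mult.assoc min_absorb2)
    next
      case False
      then have "(1::real) \<le> 2 ^ m / 2 ^ (n - i)"
        by (simp add: le_divide_eq)
      then have m1: "min 1 (2 ^ m / 2 ^ (n - i)) = (1::real)" by simp
      have "(\<integral>\<^sup>+x. \<phi> x * ball_average D (l0 + int i + int m) x \<partial>lborel) \<le> (\<integral>\<^sup>+x. (ennreal (carleson_const CARD('d) D) * N) * \<phi> x \<partial>lborel)"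
        by (subst mult.commute) (intro nn_integral_mono mult_right_mono ball_average_le D, auto)
      also have "\<dots> = ennreal (carleson_const CARD('d) D) * N * (\<integral>\<^sup>+x. \<phi> x \<partial>lborel)"
        by (rule nn_integral_cmult) measurable
      finally show ?thesis unfolding m1 by (simp add: mult.assoc)
    qed
  qed
  also have "\<dots> = (\<Sum>i\<le>n. ennreal (carleson_const CARD('d) D * min 1 (2 ^ m / 2 ^ (n - i)))) * (N * (\<integral>\<^sup>+x. \<phi> x \<partial>lborel))"
    by (rule sum_distrib_right[symmetric])
  also have "(\<Sum>i\<le>n. ennreal (carleson_const CARD('d) D * min 1 (2 ^ m / 2 ^ (n - i)))) = ennreal (carleson_const CARD('d) D * (\<Sum>i\<le>n. min 1 (2 ^ m / 2 ^ (n - i))))"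
    using C0 by (subst sum_ennreal) (auto simp: sum_distrib_left)
  also have "(\<Sum>i\<le>n. min 1 (2 ^ m / 2 ^ (n - i)) :: real) = (\<Sum>r\<le>n. min 1 (2 ^ m / 2 ^ r))"
    by (rule sum.reindex_bij_witness[of _ "\<lambda>i. n - i" "\<lambda>i. n - i"]) auto
  also have "ennreal (carleson_const CARD('d) D * (\<Sum>r\<le>n. min 1 (2 ^ m / 2 ^ r))) \<le> ennreal (carleson_const CARD('d) D * (real m + 2))"
    using C0 by (intro ennreal_leI mult_left_mono sum_min_geometric_le) auto
  finally show ?thesis by (simp add: mult.assoc mult_right_mono)
qed

text \<open>
  Replacing \<open>H\<close> by its infimum over cells costs nothing on the right-hand side, since the infimum
  of the finest level is below \<open>H\<close> pointwise.
\<close>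

lemma carleson_embedding:
  fixes H :: "real^'d \<Rightarrow> ennreal"
  assumes D: "D \<ge> 1"
  shows "(\<Sum>i\<le>n. \<integral>\<^sup>+x. cell_inf H (l0 + int i) x * ball_average D (l0 + int i + int m) x \<partial>lborel)
    \<le> ennreal (carleson_const CARD('d) D * (real m + 2)) * N * (\<integral>\<^sup>+x. H x \<partial>lborel)"
proof -
  have "(\<Sum>i\<le>n. \<integral>\<^sup>+x. cell_inf H (l0 + int i) x * ball_average D (l0 + int i + int m) x \<partial>lborel)
    \<le> ennreal (carleson_const CARD('d) D * (real m + 2)) * N * (\<integral>\<^sup>+x. cell_inf H l0 x \<partial>lborel)"
  proof (rule carleson_abel[where A="\<lambda>i. ball_average D (i + int m)"])
    show "(\<Sum>i\<le>n. \<integral>\<^sup>+x. \<phi> x * ball_average D (l0 + int i + int m) x \<partial>lborel)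
      \<le> ennreal (carleson_const CARD('d) D * (real m + 2)) * N * (\<integral>\<^sup>+x. \<phi> x \<partial>lborel)"
      if "\<phi> \<in> borel_measurable borel" "\<And>x y. cell (l0 + int n) x = cell (l0 + int n) y \<Longrightarrow> \<phi> x = \<phi> y" for \<phi> n
      using that D by (rule carleson_condition)
  qed (rule ball_average_measurable cell_inf_measurable cell_inf_antimono cell_inf_cong, assumption?)+
  also have "\<dots> \<le> ennreal (carleson_const CARD('d) D * (real m + 2)) * N * (\<integral>\<^sup>+x. H x \<partial>lborel)"
    by (intro mult_left_mono nn_integral_mono cell_inf_le) auto
  finally show ?thesis .
qed

end

text \<open>
  The majorant of the potential of \<open>\<Phi>\<close>, with \<open>H\<close> its maximal function. The index \<open>i - K\<close> is the level
  of the layer of the kernel, \<open>j\<close> the step of the iteration that resolves this layer. At step \<open>j\<close> with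
  \<open>\<epsilon> = 2\<^sup>-\<^sup>L\<close> the nodes move in cells that are \<open>(j + 3)L\<close> levels finer than the layer.
\<close>

definition tent_bound :: "(real^'d::finite \<Rightarrow> ennreal) \<Rightarrow> real \<Rightarrow> nat \<Rightarrow> nat \<Rightarrow> real^'d \<Rightarrow> ennreal" where
  "tent_bound H D L K y = (\<Sum>i\<le>2*K. \<Sum>j. ennreal ((1/2)^j * (1 / (2 powi (int i - int K)) ^ (CARD('d) - 1))) *
     (\<integral>\<^sup>+x. cell_inf H (int i - int K - int ((j + 3) * L)) x * indicator (cball y (D * 2 powi (int i - int K))) x \<partial>lborel))"

text \<open>
  With the weights \<open>2\<^sup>-\<^sup>j\<close> this leaves the convergent series with ratio \<open>3/4\<close>.
\<close>

lemma Suc_le_geometric: "real j + 1 \<le> 2 * (3/2) ^ j"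
proof (induction j)
  case (Suc j)
  have "(1 :: real) \<le> (3/2) ^ j" by (rule one_le_power) simp
  with Suc.IH show ?case unfolding power_Suc of_nat_Suc by linarith
qed simp

context growth_measure begin

lemma tent_term_measurable:
  fixes H :: "real^'d \<Rightarrow> ennreal"
  shows "(\<lambda>y. c * (\<integral>\<^sup>+x. cell_inf H i x * indicator (cball y r) x \<partial>lborel)) \<in> borel_measurable borel"
proof (rule borel_measurable_times_ennreal)
  show "(\<lambda>y. \<integral>\<^sup>+x. cell_inf H i x * indicator (cball y r) x \<partial>lborel) \<in> borel_measurable borel"
    by (rule ball_integral_measurable) (rule cell_inf_measurable)
qed simp

lemma tent_bound_measurable [measurable]:
  fixes H :: "real^'d \<Rightarrow> ennreal"
  shows "tent_bound H D L K \<in> borel_measurable borel"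
  unfolding tent_bound_def
  by (intro borel_measurable_sum borel_measurable_suminf_order tent_term_measurable)

text \<open>
  Exchanging the integrations turns the balls around \<open>y\<close> into the averages of \<open>\<mu>\<close>. For fixed \<open>j\<close> the sum over
  the layers is the Carleson embedding with the gap \<open>(j + 3)L\<close>, so that it remains to sum
  \<open>2\<^sup>-\<^sup>j((j + 3)L + 2)\<close>. The bound does not depend on the number of layers.
\<close>

lemma nn_integral_tent_bound:
  fixes H :: "real^'d \<Rightarrow> ennreal"
  assumes D: "D \<ge> 1"
  shows "(\<integral>\<^sup>+y. tent_bound H D L K y \<partial>\<mu>) \<le> ennreal (8 * carleson_const CARD('d) D * (3 * real L + 2)) * N * (\<integral>\<^sup>+x. H x \<partial>lborel)"
proof -
  have C0: "carleson_const CARD('d) D \<ge> 0"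
    using D by (simp add: carleson_const_def)
  let ?I = "\<integral>\<^sup>+x. H x \<partial>lborel"
  let ?g = "\<lambda>i j y. ennreal ((1/2)^j * (1 / (2 powi (int i - int K)) ^ (CARD('d) - 1))) *
     (\<integral>\<^sup>+x. cell_inf H (int i - int K - int ((j + 3) * L)) x * indicator (cball y (D * 2 powi (int i - int K))) x \<partial>lborel)"
  have meas [measurable]: "?g i j \<in> borel_measurable borel" for i j
    by (rule tent_term_measurable)
  have eq: "(\<integral>\<^sup>+y. ?g i j y \<partial>\<mu>) = ennreal ((1/2)^j) * (\<integral>\<^sup>+x. cell_inf H ((- int K - int ((j + 3) * L)) + int i) x * ball_average D ((- int K - int ((j + 3) * L)) + int i + int ((j + 3) * L)) x \<partial>lborel)" for i j
  proof -
    let ?s = "2 powi (int i - int K) :: real"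
    have ix: "(- int K - int ((j + 3) * L)) + int i + int ((j + 3) * L) = int i - int K" "(- int K - int ((j + 3) * L)) + int i = int i - int K - int ((j + 3) * L)" by auto
    have "(\<integral>\<^sup>+y. ?g i j y \<partial>\<mu>) = ennreal ((1/2)^j * (1 / ?s ^ (CARD('d) - 1))) * (\<integral>\<^sup>+y. (\<integral>\<^sup>+x. cell_inf H (int i - int K - int ((j + 3) * L)) x * indicator (cball y (D * ?s)) x \<partial>lborel) \<partial>\<mu>)"
      by (rule nn_integral_cmult)
         (simp add: ball_integral_measurable[OF cell_inf_measurable] measurable_cong_sets[OF sets_mu refl])
    also have "(\<integral>\<^sup>+y. (\<integral>\<^sup>+x. cell_inf H (int i - int K - int ((j + 3) * L)) x * indicator (cball y (D * ?s)) x \<partial>lborel) \<partial>\<mu>) = (\<integral>\<^sup>+x. cell_inf H (int i - int K - int ((j + 3) * L)) x * emeasure \<mu> (cball x (D * ?s)) \<partial>lborel)"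
      by (rule nn_integral_ball_swap[symmetric]) measurable
    also have "ennreal ((1/2)^j * (1 / ?s ^ (CARD('d) - 1))) * \<dots> = ennreal ((1/2)^j) * (ennreal (1 / ?s ^ (CARD('d) - 1)) * \<dots>)"
      by (subst ennreal_mult) (auto simp: mult.assoc)
    also have "ennreal (1 / ?s ^ (CARD('d) - 1)) * (\<integral>\<^sup>+x. cell_inf H (int i - int K - int ((j + 3) * L)) x * emeasure \<mu> (cball x (D * ?s)) \<partial>lborel) = (\<integral>\<^sup>+x. ennreal (1 / ?s ^ (CARD('d) - 1)) * (cell_inf H (int i - int K - int ((j + 3) * L)) x * emeasure \<mu> (cball x (D * ?s))) \<partial>lborel)"
      by (rule nn_integral_cmult[symmetric]) measurable
    finally show ?thesis
      unfolding ix by (simp add: ball_average_def mult.left_commute)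
  qed
  have "(\<integral>\<^sup>+y. tent_bound H D L K y \<partial>\<mu>) = (\<Sum>i\<le>2*K. \<Sum>j. \<integral>\<^sup>+y. ?g i j y \<partial>\<mu>)"
    unfolding tent_bound_def
    by (simp only: nn_integral_sum nn_integral_suminf borel_measurable_suminf_order meas measurable_cong_sets[OF sets_mu refl])
  also have "\<dots> = (\<Sum>j. \<Sum>i\<le>2*K. \<integral>\<^sup>+y. ?g i j y \<partial>\<mu>)"
    by (rule suminf_sum[symmetric]) auto
  also have "\<dots> \<le> (\<Sum>j. ennreal (8 * carleson_const CARD('d) D * (3 * real L + 2) / 4 * (3/4)^j) * (N * ?I))"
  proof (rule suminf_le)
    fix j
    have "(\<Sum>i\<le>2*K. \<integral>\<^sup>+y. ?g i j y \<partial>\<mu>) \<le> ennreal ((1/2)^j) * (ennreal (carleson_const CARD('d) D * (real ((j + 3) * L) + 2)) * N * ?I)"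
      unfolding eq sum_distrib_left[symmetric] by (intro mult_left_mono carleson_embedding D) auto
    also have "\<dots> = ennreal ((1/2)^j * (carleson_const CARD('d) D * (real ((j + 3) * L) + 2))) * (N * ?I)"
      using C0 by (subst (2) ennreal_mult) (auto simp: mult.assoc)
    also have "\<dots> \<le> ennreal (8 * carleson_const CARD('d) D * (3 * real L + 2) / 4 * (3/4)^j) * (N * ?I)"
    proof (intro mult_right_mono ennreal_leI)
      have "real ((j + 3) * L) + 2 \<le> (3 * real L + 2) * (real j + 1)"
        by (simp add: algebra_simps)
      also have "\<dots> \<le> (3 * real L + 2) * (2 * (3/2) ^ j)"
        by (intro mult_left_mono Suc_le_geometric) auto
      finally have "(1/2)^j * (carleson_const CARD('d) D * (real ((j + 3) * L) + 2)) \<le> (1/2)^j * (carleson_const CARD('d) D * ((3 * real L + 2) * (2 * (3/2) ^ j)))"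
        using C0 by (intro mult_left_mono) auto
      also have "\<dots> = carleson_const CARD('d) D * (3 * real L + 2) * 2 * ((1/2)^j * (3/2)^j)"
        by (simp add: mult_ac)
      also have "(1/2)^j * (3/2)^j = (3/4 :: real)^j"
        by (simp add: power_mult_distrib[symmetric])
      also have "carleson_const CARD('d) D * (3 * real L + 2) * 2 * (3/4)^j = 8 * carleson_const CARD('d) D * (3 * real L + 2) / 4 * (3/4)^j"
        by simp
      finally show "(1/2)^j * (carleson_const CARD('d) D * (real ((j + 3) * L) + 2)) \<le> 8 * carleson_const CARD('d) D * (3 * real L + 2) / 4 * (3/4)^j" .
    qed auto
    finally show "(\<Sum>i\<le>2*K. \<integral>\<^sup>+y. ?g i j y \<partial>\<mu>) \<le> ennreal (8 * carleson_const CARD('d) D * (3 * real L + 2) / 4 * (3/4)^j) * (N * ?I)" .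
  qed auto
  also have "\<dots> = (\<Sum>j. ennreal (8 * carleson_const CARD('d) D * (3 * real L + 2) / 4 * (3/4)^j)) * (N * ?I)"
    by (rule ennreal_suminf_multc)
  also have "(\<Sum>j. ennreal (8 * carleson_const CARD('d) D * (3 * real L + 2) / 4 * (3/4)^j)) = ennreal (8 * carleson_const CARD('d) D * (3 * real L + 2) / 4 * (1 / (1 - 3/4)))"
    using C0 by (intro suminf_ennreal_eq sums_mult geometric_sums) auto
  also have "8 * carleson_const CARD('d) D * (3 * real L + 2) / 4 * (1 / (1 - 3/4)) = 8 * carleson_const CARD('d) D * (3 * real L + 2)"
    by simp
  finally show ?thesis by (simp add: mult.assoc)
qed

end

section \<open>Pointwise domination of the Riesz potential\<close>

lemma two_powi_diff_nat: "(2::real) powi (k - int n) = 2 powi k * (1/2) ^ n"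
  by (subst power_int_diff) (auto simp: power_one_over)

text \<open>
  One point is chosen in each cell. Since there are countably many cells, \<open>\<xi>\<close> and \<open>H \<circ> \<xi>\<close> are
  measurable whatever \<open>H\<close> is.
\<close>

lemma exists_near_infimum_selection:
  fixes H :: "real^'d::finite \<Rightarrow> ennreal"
  assumes "\<theta> > 0"
  obtains \<xi> where "\<xi> \<in> borel_measurable borel" "(\<lambda>x. H (\<xi> x)) \<in> borel_measurable borel"
    "\<And>x. cell i (\<xi> x) = cell i x" "\<And>x. H (\<xi> x) \<le> cell_inf H i x + ennreal \<theta>"
proof -
  define X where "X n = (SOME y. cell i y = n \<and> H y \<le> (INF y\<in>{y. cell i y = n}. H y) + ennreal \<theta>)" for n
  define \<xi> where "\<xi> x = X (cell i x)" for x
  have X: "cell i (\<xi> x) = cell i x \<and> H (\<xi> x) \<le> cell_inf H i x + ennreal \<theta>" for x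
    unfolding \<xi>_def X_def cell_inf_def
  proof (rule someI_ex)
    let ?I = "INF y\<in>{y. cell i y = cell i x}. H y"
    show "\<exists>y. cell i y = cell i x \<and> H y \<le> ?I + ennreal \<theta>"
    proof (cases "?I = \<infinity>")
      case True
      then show ?thesis by (intro exI[of _ x]) (simp only: True, simp)
    next
      case False
      have "?I < ?I + ennreal \<theta>"
        using False assms
        by (cases ?I) (auto simp: ennreal_plus[symmetric] ennreal_less_iff simp del: ennreal_plus)
      then obtain y where "cell i y = cell i x" "H y < ?I + ennreal \<theta>"
        unfolding INF_less_iff by auto
      then show ?thesis by (intro exI[of _ y]) auto
    qed
  qed
  show ?thesis
  proof (rule that)
    show "\<xi> \<in> borel_measurable borel"
      unfolding \<xi>_def by (rule measurable_compose[OF cell_measurable]) simp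
    show "(\<lambda>x. H (\<xi> x)) \<in> borel_measurable borel"
      unfolding \<xi>_def by (rule measurable_compose[OF cell_measurable]) simp
  qed (use X in auto)
qed

lemma inverse_power_lipschitz:
  fixes p q s :: real
  assumes "s > 0" "p \<ge> s" "q \<ge> s"
  shows "\<bar>1 / p ^ n - 1 / q ^ n\<bar> \<le> real n / s ^ (n + 1) * \<bar>p - q\<bar>"
proof (induction n)
  case (Suc n)
  have p: "p > 0" "q > 0" using assms by auto
  have "1 / p ^ Suc n - 1 / q ^ Suc n = (1 / p) * (1 / p ^ n - 1 / q ^ n) + (1 / q ^ n) * ((1 / (p * q)) * (q - p))"
    using p by (simp add: field_simps)
  then have "\<bar>1 / p ^ Suc n - 1 / q ^ Suc n\<bar> \<le> \<bar>(1 / p) * (1 / p ^ n - 1 / q ^ n)\<bar> + \<bar>(1 / q ^ n) * ((1 / (p * q)) * (q - p))\<bar>"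
    by (metis abs_triangle_ineq)
  also have "\<dots> = (1 / p) * \<bar>1 / p ^ n - 1 / q ^ n\<bar> + (1 / q ^ n) * ((1 / (p * q)) * \<bar>p - q\<bar>)"
    using p by (simp add: abs_mult abs_minus_commute)
  also have "\<dots> \<le> (1 / s) * (real n / s ^ (n + 1) * \<bar>p - q\<bar>) + (1 / s ^ n) * ((1 / (s * s)) * \<bar>p - q\<bar>)"
    using assms by (intro add_mono mult_mono Suc.IH divide_left_mono mult_right_mono power_mono) auto
  also have "\<dots> = real (Suc n) / s ^ (Suc n + 1) * \<bar>p - q\<bar>"
    using assms by (simp add: field_simps)
  finally show ?case .
qed simp

definition trunc_kernel :: "real \<Rightarrow> real^'d::finite \<Rightarrow> real" where
  "trunc_kernel s x = 1 / (max (norm x) s) ^ (CARD('d) - 1)"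

lemma trunc_kernel_lipschitz:
  fixes x y :: "real^'d::finite"
  assumes "s > 0"
  shows "\<bar>trunc_kernel s x - trunc_kernel s y\<bar> \<le> real CARD('d) / s ^ CARD('d) * norm (x - y)"
proof -
  have "\<bar>trunc_kernel s x - trunc_kernel s y\<bar> \<le> real (CARD('d) - 1) / s ^ (CARD('d) - 1 + 1) * \<bar>max (norm x) s - max (norm y) s\<bar>"
    unfolding trunc_kernel_def by (rule inverse_power_lipschitz) (use assms in auto)
  also have "\<dots> \<le> real CARD('d) / s ^ CARD('d) * norm (x - y)"
  proof -
    have "\<bar>max (norm x) s - max (norm y) s\<bar> \<le> \<bar>norm x - norm y\<bar>" by (auto simp: max_def)
    also have "\<dots> \<le> norm (x - y)" by (rule norm_triangle_ineq3)
    finally show ?thesis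
      using assms by (intro mult_mono) (auto intro!: divide_right_mono)
  qed
  finally show ?thesis .
qed

lemma trunc_kernel_antimono: "0 < s \<Longrightarrow> s \<le> t \<Longrightarrow> trunc_kernel t x \<le> trunc_kernel s x"
  unfolding trunc_kernel_def by (intro divide_left_mono power_mono) auto

lemma trunc_kernel_bounds: "0 < s \<Longrightarrow> 0 \<le> trunc_kernel s x" "0 < s \<Longrightarrow> trunc_kernel s (x :: real^'d::finite) \<le> 1 / s ^ (CARD('d) - 1)"
  unfolding trunc_kernel_def by (auto intro!: divide_left_mono power_mono)

lemma trunc_kernel_measurable [measurable]: "trunc_kernel s \<in> borel_measurable borel"
  unfolding trunc_kernel_def[abs_def] by measurable

text \<open>
  Consecutive truncations differ only inside the ball of radius \<open>2\<^sup>k\<^sup>+\<^sup>1\<close>, so this is a Lipschitz bump at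
  scale \<open>2\<^sup>k\<close>, and the sum over all \<open>k\<close> telescopes to the kernel \<open>|x|\<^sup>1\<^sup>-\<^sup>d\<close>.
\<close>

definition layer :: "int \<Rightarrow> real^'d::finite \<Rightarrow> real" where
  "layer k x = trunc_kernel (2 powi k) x - trunc_kernel (2 powi (k + 1)) x"

lemma layer_measurable [measurable]: "layer k \<in> borel_measurable borel"
  unfolding layer_def[abs_def] by measurable

lemma layer_nonneg: "layer k x \<ge> 0"
  unfolding layer_def using trunc_kernel_antimono[of "2 powi k" "2 powi (k+1)" x] by (simp add: power_int_increasing)

lemma layer_le: "layer k (x :: real^'d::finite) \<le> 1 / (2 powi k) ^ (CARD('d) - 1)"
  unfolding layer_def using trunc_kernel_bounds(1)[of "2 powi (k+1)" x] trunc_kernel_bounds(2)[of "2 powi k" x] by simp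

lemma layer_support: "norm x > 2 * 2 powi k \<Longrightarrow> layer k x = 0"
proof -
  assume *: "norm x > 2 * 2 powi k"
  have "2 powi (k + 1) = 2 * (2 powi k :: real)" by (simp add: power_int_add)
  moreover have "(0::real) < 2 powi k" by simp
  ultimately have "max (norm x) (2 powi k) = norm x" "max (norm x) (2 powi (k + 1)) = norm x"
    using * by linarith+
  then show ?thesis by (simp add: layer_def trunc_kernel_def)
qed

lemma layer_lipschitz:
  "\<bar>layer k (x :: real^'d::finite) - layer k y\<bar> \<le> (2 * real CARD('d)) * (1 / (2 powi k) ^ (CARD('d) - 1)) / 2 powi k * norm (x - y)"
proof -
  let ?s = "2 powi k :: real"
  have s: "?s > 0" by simp
  have s2: "2 powi (k + 1) = 2 * ?s" by (simp add: power_int_add)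
  have "\<bar>layer k x - layer k y\<bar> \<le> \<bar>trunc_kernel ?s x - trunc_kernel ?s y\<bar> + \<bar>trunc_kernel (2 * ?s) x - trunc_kernel (2 * ?s) y\<bar>"
    unfolding layer_def s2 by linarith
  also have "\<dots> \<le> real CARD('d) / ?s ^ CARD('d) * norm (x - y) + real CARD('d) / (2 * ?s) ^ CARD('d) * norm (x - y)"
    by (intro add_mono trunc_kernel_lipschitz) auto
  also have "\<dots> \<le> real CARD('d) / ?s ^ CARD('d) * norm (x - y) + real CARD('d) / ?s ^ CARD('d) * norm (x - y)"
    by (intro add_mono mult_right_mono divide_left_mono power_mono) auto
  also have "\<dots> = (2 * real CARD('d)) * (1 / ?s ^ (CARD('d) - 1)) / ?s * norm (x - y)"
    by (cases "CARD('d)") (auto simp: field_simps)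
  finally show ?thesis .
qed

lemma sum_layers: "(\<Sum>i\<le>2*K. layer (int i - int K) x) = trunc_kernel (2 powi (- int K)) x - trunc_kernel (2 powi (int K + 1)) x"
proof -
  have "(\<Sum>i\<le>n. layer (int i - int K) x) = trunc_kernel (2 powi (- int K)) x - trunc_kernel (2 powi (int n - int K + 1)) x" for n
    by (induction n) (simp_all add: layer_def algebra_simps)
  from this[of "2*K"] show ?thesis by simp
qed

context hardy_kernel begin

text \<open>
  Nodes within \<open>\<theta>\<close> of the infimum of the maximal function over their cells are fed into
  \<open>pairing_iteration\<close> with \<open>\<epsilon> = 2\<^sup>-\<^sup>L\<close>. At step \<open>j\<close> a node may move by \<open>\<epsilon>\<^sup>j\<^sup>+\<^sup>2 2\<^sup>k\<close>, and the cells of level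
  \<open>k - (j + 3)L\<close> have diameter at most \<open>d \<epsilon>\<^sup>j\<^sup>+\<^sup>3 2\<^sup>k\<close>; the additional power of \<open>\<epsilon>\<close> pays for the factor \<open>d\<close>.
  Then \<open>\<theta>\<close> tends to zero and the number of steps to infinity.
\<close>

lemma lipschitz_pairing:
  fixes \<Phi> :: "real^'d \<Rightarrow> real"
  assumes c0: "(LINT x|lborel. \<psi> x) \<noteq> 0"
    and B: "B \<ge> 8 * Q"
    and L: "(1/2)^L \<le> (1 / 4 :: real)" "Q * (1/2)^L * (B * (R + 2) + 1) \<le> 1 / 2" "real CARD('d) * (1/2)^L \<le> 1"
    and \<Phi>: "integrable lborel \<Phi>"
    and g: "g \<in> borel_measurable borel" "\<And>x. norm (g x) \<le> a"
    "\<And>x y. norm (g x - g y) \<le> B * a / 2 powi k * norm (x - y)"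
    "\<And>x. x \<notin> cball z r \<Longrightarrow> g x = 0" "r + (R + 2) * 2 powi k \<le> r'"
  shows "ennreal (cmod (LINT y|lborel. g y * complex_of_real (\<Phi> y))) \<le>
    (\<Sum>j. ennreal (a / norm (LINT x|lborel. \<psi> x) * (1 / 2) ^ j) * (\<integral>\<^sup>+x. cell_inf (hardy_maximal \<psi> \<Phi>) (k - int ((j + 3) * L)) x * indicator (cball z r') x \<partial>lborel))"
    (is "?lhs \<le> (\<Sum>j. ennreal (?b * _ ^ j) * ?T j)")
proof (rule ennreal_le_epsilon)
  fix e :: real assume e: "e > 0"
  have a: "a \<ge> 0" using g(2)[of 0] norm_ge_zero[of "g 0"] by linarith
  define s :: real where "s = 2 powi k"
  have s: "s > 0" by (simp add: s_def)
  define V where "V = measure lborel (cball z r')"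
  have V: "emeasure lborel (cball z r') = ennreal V"
    unfolding V_def using emeasure_lborel_cball_finite[of z r'] by (simp add: emeasure_eq_ennreal_measure less_top[symmetric])
  have V0: "V \<ge> 0" by (simp add: V_def)
  have b0: "?b \<ge> 0" using a by simp
  \<comment> \<open>The selection error contributes at most \<theta> times the volume V, with total weight 2 ?b;
    the summand 1 keeps M positive when ?b or V vanishes.\<close>
  define M where "M = 2 * ?b * V + 1"
  have M: "M > 0" unfolding M_def using b0 V0 by (intro add_nonneg_pos mult_nonneg_nonneg) auto
  define \<theta> where "\<theta> = e / 2 / M"
  have \<theta>: "\<theta> > 0" using e M by (simp add: \<theta>_def)
  have "\<forall>j. \<exists>\<xi>. \<xi> \<in> borel_measurable borel \<and> (\<lambda>x. hardy_maximal \<psi> \<Phi> (\<xi> x)) \<in> borel_measurable borel \<and>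
     (\<forall>x. cell (k - int ((j + 3) * L)) (\<xi> x) = cell (k - int ((j + 3) * L)) x) \<and>
     (\<forall>x. hardy_maximal \<psi> \<Phi> (\<xi> x) \<le> cell_inf (hardy_maximal \<psi> \<Phi>) (k - int ((j + 3) * L)) x + ennreal \<theta>)"
    using exists_near_infimum_selection[OF \<theta>] by metis
  then obtain \<xi> where \<xi>: "\<And>j. \<xi> j \<in> borel_measurable borel" "\<And>j. (\<lambda>x. hardy_maximal \<psi> \<Phi> (\<xi> j x)) \<in> borel_measurable borel"
     "\<And>j x. cell (k - int ((j + 3) * L)) (\<xi> j x) = cell (k - int ((j + 3) * L)) x"
     "\<And>j x. hardy_maximal \<psi> \<Phi> (\<xi> j x) \<le> cell_inf (hardy_maximal \<psi> \<Phi>) (k - int ((j + 3) * L)) x + ennreal \<theta>"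
    by metis
  \<comment> \<open>The remainder after J steps is smaller than e / 2; the summand 1 makes A positive.\<close>
  define A where "A = a * (LINT x|lborel. \<bar>\<Phi> x\<bar>) + 1"
  have A: "A > 0" unfolding A_def using a by (intro add_nonneg_pos mult_nonneg_nonneg integral_nonneg_AE) auto
  obtain J where "(1/2)^J < e / 2 / A"
    using real_arch_pow_inv[of "e / 2 / A" "1/2"] e A by auto
  then have "(1/2)^J * A < e / 2"
    using A by (simp add: pos_less_divide_eq)
  then have J: "(1/2)^J * a * (LINT x|lborel. \<bar>\<Phi> x\<bar>) \<le> e / 2"
  proof -
    have "(1/2)^J * A = (1/2)^J * a * (LINT x|lborel. \<bar>\<Phi> x\<bar>) + (1/2)^J"
      by (simp add: A_def algebra_simps)
    moreover have "(0::real) \<le> (1/2)^J" by simp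
    ultimately show ?thesis using \<open>(1/2)^J * A < e / 2\<close> by linarith
  qed
  have level_bound: "(\<integral>\<^sup>+x. hardy_maximal \<psi> \<Phi> (\<xi> j x) * indicator (cball z r') x \<partial>lborel) \<le> ?T j + ennreal (\<theta> * V)" for j
  proof -
    have "(\<integral>\<^sup>+x. hardy_maximal \<psi> \<Phi> (\<xi> j x) * indicator (cball z r') x \<partial>lborel) \<le>
      (\<integral>\<^sup>+x. cell_inf (hardy_maximal \<psi> \<Phi>) (k - int ((j + 3) * L)) x * indicator (cball z r') x + ennreal \<theta> * indicator (cball z r') x \<partial>lborel)"
      unfolding distrib_right[symmetric] by (intro nn_integral_mono mult_right_mono \<xi>) auto
    also have "\<dots> = ?T j + (\<integral>\<^sup>+x. ennreal \<theta> * indicator (cball z r') x \<partial>lborel)"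
      by (rule nn_integral_add) (auto intro!: borel_measurable_times_ennreal borel_measurable_indicator cell_inf_measurable)
    also have "(\<integral>\<^sup>+x. ennreal \<theta> * indicator (cball z r') x \<partial>lborel) = ennreal (\<theta> * V)"
      using \<theta> V0 by (subst nn_integral_cmult_indicator) (auto simp: V ennreal_mult)
    finally show ?thesis .
  qed
  have "?lhs \<le> (\<Sum>j<J. ennreal (?b * (1 / 2) ^ j) * (\<integral>\<^sup>+x. hardy_maximal \<psi> \<Phi> (\<xi> j x) * indicator (cball z r') x \<partial>lborel))
    + ennreal ((1 / 2) ^ J * a * (LINT x|lborel. \<bar>\<Phi> x\<bar>))"
  proof (rule pairing_iteration[OF c0 B _ L(1) L(2) \<Phi> \<xi>(1) _ \<xi>(2) g(1,2) _ g(4) s])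
    show "norm (\<xi> j x - x) \<le> (1/2)^L * (((1/2)^L) ^ Suc j * s)" for j x
    proof -
      have "norm (\<xi> j x - x) \<le> real CARD('d) * 2 powi (k - int ((j + 3) * L))"
        by (rule norm_diff_le_of_cell_eq) (rule \<xi>)
      also have "2 powi (k - int ((j + 3) * L)) = s * (1/2) ^ ((j + 3) * L)"
        unfolding s_def by (rule two_powi_diff_nat)
      also have "(1/2 :: real) ^ ((j + 3) * L) = (1/2)^L * ((1/2)^L * ((1/2)^L) ^ Suc j)"
        proof -
          have e: "(j + 3) * L = L + (L + (L + L * j))" by (simp add: add_mult_distrib)
          show ?thesis unfolding e by (simp add: power_add power_mult)
        qed
      also have "real CARD('d) * (s * ((1/2)^L * ((1/2)^L * ((1/2)^L) ^ Suc j))) = (real CARD('d) * (1/2)^L) * ((1/2)^L * (((1/2)^L) ^ Suc j * s))"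
        by (simp add: mult_ac)
      also have "\<dots> \<le> 1 * ((1/2)^L * (((1/2)^L) ^ Suc j * s))"
        using s by (intro mult_right_mono L) auto
      finally show ?thesis by simp
    qed
  qed (use g(3,5) in \<open>auto simp: s_def\<close>)
  also have "\<dots> \<le> (\<Sum>j<J. ennreal (?b * (1 / 2) ^ j) * ?T j + ennreal (?b * (1 / 2) ^ j) * ennreal (\<theta> * V)) + ennreal (e / 2)"
    unfolding distrib_left[symmetric]
    by (intro add_mono sum_mono mult_left_mono level_bound ennreal_leI J) auto
  also have "\<dots> = (\<Sum>j<J. ennreal (?b * (1 / 2) ^ j) * ?T j) + (\<Sum>j<J. ennreal (?b * (1 / 2) ^ j)) * ennreal (\<theta> * V) + ennreal (e / 2)"
    by (simp add: sum.distrib sum_distrib_right)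
  also have "\<dots> \<le> (\<Sum>j. ennreal (?b * (1 / 2) ^ j) * ?T j) + ennreal (e / 2) + ennreal (e / 2)"
  proof (intro add_mono order_refl)
    show "(\<Sum>j<J. ennreal (?b * (1 / 2) ^ j) * ?T j) \<le> (\<Sum>j. ennreal (?b * (1 / 2) ^ j) * ?T j)"
      by (intro sum_le_suminf) auto
    have "(\<Sum>j<J. ennreal (?b * (1 / 2) ^ j)) = ennreal (?b * (\<Sum>j<J. (1 / 2) ^ j))"
      using a by (subst sum_ennreal) (auto simp: sum_distrib_left)
    also have "\<dots> \<le> ennreal (?b * 2)"
    proof (intro ennreal_leI mult_left_mono b0)
      show "(\<Sum>j<J. (1 / 2) ^ j) \<le> (2::real)"
        by (simp add: sum_gp_strict)
    qed
    finally have "(\<Sum>j<J. ennreal (?b * (1 / 2) ^ j)) * ennreal (\<theta> * V) \<le> ennreal (?b * 2) * ennreal (\<theta> * V)"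
      by (rule mult_right_mono) auto
    also have "\<dots> = ennreal (?b * 2 * (\<theta> * V))"
    proof (rule ennreal_mult[symmetric])
      show "0 \<le> ?b * 2" using b0 by (intro mult_nonneg_nonneg) auto
    qed (use V0 \<theta> in auto)
    also have "\<dots> \<le> ennreal (e / 2)"
    proof (rule ennreal_leI)
      have "?b * 2 * (\<theta> * V) = (2 * ?b * V) * \<theta>" by simp
      also have "\<dots> \<le> M * \<theta>" using \<theta> by (intro mult_right_mono) (auto simp: M_def)
      also have "\<dots> = e / 2" using M by (simp add: \<theta>_def)
      finally show "?b * 2 * (\<theta> * V) \<le> e / 2" .
    qed
    finally show "(\<Sum>j<J. ennreal (?b * (1 / 2) ^ j)) * ennreal (\<theta> * V) \<le> ennreal (e / 2)" .
  qed
  also have "\<dots> = (\<Sum>j. ennreal (?b * (1 / 2) ^ j) * ?T j) + ennreal e"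
    using e by (simp add: add.assoc ennreal_plus[symmetric] del: ennreal_plus)
  finally show "?lhs \<le> (\<Sum>j. ennreal (?b * (1 / 2) ^ j) * ?T j) + ennreal e" .
qed

lemma layer_pairing:
  fixes \<Phi> :: "real^'d \<Rightarrow> real"
  assumes c0: "(LINT x|lborel. \<psi> x) \<noteq> 0"
    and B: "B \<ge> 8 * Q" "B \<ge> 2 * real CARD('d)"
    and L: "(1/2)^L \<le> (1 / 4 :: real)" "Q * (1/2)^L * (B * (R + 2) + 1) \<le> 1 / 2" "real CARD('d) * (1/2)^L \<le> 1"
    and \<Phi>: "integrable lborel \<Phi>"
  shows "ennreal \<bar>LINT x|lborel. \<Phi> x * layer k (x - y)\<bar> \<le>
    ennreal (1 / norm (LINT x|lborel. \<psi> x)) * (\<Sum>j. ennreal ((1 / 2) ^ j * (1 / (2 powi k) ^ (CARD('d) - 1))) *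
       (\<integral>\<^sup>+x. cell_inf (hardy_maximal \<psi> \<Phi>) (k - int ((j + 3) * L)) x * indicator (cball y ((R + 4) * 2 powi k)) x \<partial>lborel))"
proof -
  let ?c = "norm (LINT x|lborel. \<psi> x)"
  let ?a = "1 / (2 powi k) ^ (CARD('d) - 1) :: real"
  let ?g = "\<lambda>x. complex_of_real (layer k (x - y))"
  let ?T = "\<lambda>j. (\<integral>\<^sup>+x. cell_inf (hardy_maximal \<psi> \<Phi>) (k - int ((j + 3) * L)) x * indicator (cball y ((R + 4) * 2 powi k)) x \<partial>lborel)"
  have "ennreal \<bar>LINT x|lborel. \<Phi> x * layer k (x - y)\<bar> = ennreal (cmod (complex_of_real (LINT x|lborel. \<Phi> x * layer k (x - y))))"
    by (simp only: norm_of_real)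
  also have "complex_of_real (LINT x|lborel. \<Phi> x * layer k (x - y)) = (LINT x|lborel. ?g x * complex_of_real (\<Phi> x))"
    by (subst integral_complex_of_real[symmetric]) (simp add: mult.commute)
  also have "ennreal (cmod (LINT x|lborel. ?g x * complex_of_real (\<Phi> x))) \<le> (\<Sum>j. ennreal (?a / ?c * (1 / 2) ^ j) * ?T j)"
  proof (rule lipschitz_pairing[OF c0 B(1) L \<Phi>])
    show "cmod (?g x) \<le> ?a" for x
      using layer_le[of k "x - y"] layer_nonneg[of k "x - y"] by simp
    show "cmod (?g u - ?g v) \<le> B * ?a / 2 powi k * norm (u - v)" for u v
    proof -
      have "cmod (?g u - ?g v) = \<bar>layer k (u - y) - layer k (v - y)\<bar>"
        by (simp only: norm_of_real of_real_diff[symmetric])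
      also have "\<dots> \<le> (2 * real CARD('d)) * ?a / 2 powi k * norm ((u - y) - (v - y))"
        by (rule layer_lipschitz)
      also have "\<dots> \<le> B * ?a / 2 powi k * norm (u - v)"
        using B by (intro mult_mono divide_right_mono) auto
      finally show ?thesis .
    qed
    show "?g x = 0" if "x \<notin> cball y (2 * 2 powi k)" for x
      using that layer_support[of k "x - y"] by (simp add: dist_norm norm_minus_commute)
    show "2 * 2 powi k + (R + 2) * 2 powi k \<le> (R + 4) * 2 powi k"
      by (simp add: algebra_simps)
  qed measurable
  also have "(\<lambda>j. ennreal (?a / ?c * (1 / 2) ^ j) * ?T j) = (\<lambda>j. ennreal (1 / ?c) * (ennreal ((1 / 2) ^ j * ?a) * ?T j))"
  proof
    fix j
    have "ennreal (?a / ?c * (1 / 2) ^ j) = ennreal (1 / ?c) * ennreal ((1 / 2) ^ j * ?a)"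
      by (subst ennreal_mult[symmetric]) (auto simp: mult_ac)
    then show "ennreal (?a / ?c * (1 / 2) ^ j) * ?T j = ennreal (1 / ?c) * (ennreal ((1 / 2) ^ j * ?a) * ?T j)"
      by (simp only: mult.assoc)
  qed
  also have "(\<Sum>j. ennreal (1 / ?c) * (ennreal ((1 / 2) ^ j * ?a) * ?T j)) = ennreal (1 / ?c) * (\<Sum>j. ennreal ((1 / 2) ^ j * ?a) * ?T j)"
    by (rule ennreal_suminf_cmult)
  finally show ?thesis .
qed

lemma truncated_riesz_bound:
  fixes \<Phi> :: "real^'d \<Rightarrow> real"
  assumes c0: "(LINT x|lborel. \<psi> x) \<noteq> 0"
    and B: "B \<ge> 8 * Q" "B \<ge> 2 * real CARD('d)"
    and L: "(1/2)^L \<le> (1 / 4 :: real)" "Q * (1/2)^L * (B * (R + 2) + 1) \<le> 1 / 2" "real CARD('d) * (1/2)^L \<le> 1"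
    and \<Phi>: "integrable lborel \<Phi>"
  shows "ennreal \<bar>LINT x|lborel. \<Phi> x * (trunc_kernel (2 powi (- int n)) (x - y) - trunc_kernel (2 powi (int n + 1)) (x - y))\<bar>
     \<le> ennreal (1 / norm (LINT x|lborel. \<psi> x)) * tent_bound (hardy_maximal \<psi> \<Phi>) (R + 4) L n y"
proof -
  have int: "integrable lborel (\<lambda>x. \<Phi> x * layer k (x - y))" for k
  proof (rule Bochner_Integration.integrable_bound)
    show "integrable lborel (\<lambda>x. \<Phi> x * (1 / (2 powi k) ^ (CARD('d) - 1)))" using \<Phi> by simp
    have [measurable]: "\<Phi> \<in> borel_measurable borel"
      using borel_measurable_integrable[OF \<Phi>] by simp
    show "(\<lambda>x. \<Phi> x * layer k (x - y)) \<in> borel_measurable lborel" by measurable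
    have "\<bar>layer k (x - y)\<bar> \<le> \<bar>1 / (2 powi k) ^ (CARD('d) - 1)\<bar>" for x
      using layer_le[of k "x - y"] layer_nonneg[of k "x - y"] by simp
    then show "AE x in lborel. norm (\<Phi> x * layer k (x - y)) \<le> norm (\<Phi> x * (1 / (2 powi k) ^ (CARD('d) - 1)))"
      unfolding real_norm_def abs_mult[of "\<Phi> _"] by (intro AE_I2 mult_left_mono abs_ge_zero)
  qed
  have "(LINT x|lborel. \<Phi> x * (trunc_kernel (2 powi (- int n)) (x - y) - trunc_kernel (2 powi (int n + 1)) (x - y))) = (LINT x|lborel. (\<Sum>i\<le>2*n. \<Phi> x * layer (int i - int n) (x - y)))"
    by (simp only: sum_layers sum_distrib_left[symmetric])
  also have "\<dots> = (\<Sum>i\<le>2*n. LINT x|lborel. \<Phi> x * layer (int i - int n) (x - y))"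
    by (rule Bochner_Integration.integral_sum) (rule int)
  finally have "ennreal \<bar>LINT x|lborel. \<Phi> x * (trunc_kernel (2 powi (- int n)) (x - y) - trunc_kernel (2 powi (int n + 1)) (x - y))\<bar>
     \<le> ennreal (\<Sum>i\<le>2*n. \<bar>LINT x|lborel. \<Phi> x * layer (int i - int n) (x - y)\<bar>)"
    by (simp only: ennreal_leI sum_abs)
  also have "\<dots> = (\<Sum>i\<le>2*n. ennreal \<bar>LINT x|lborel. \<Phi> x * layer (int i - int n) (x - y)\<bar>)"
    by (rule sum_ennreal[symmetric]) auto
  also have "\<dots> \<le> ennreal (1 / norm (LINT x|lborel. \<psi> x)) * tent_bound (hardy_maximal \<psi> \<Phi>) (R + 4) L n y"
    unfolding tent_bound_def sum_distrib_left
    by (intro sum_mono layer_pairing[OF c0 B L \<Phi>])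
  finally show ?thesis .
qed

end

lemma riesz_const_pos: "d \<ge> 2 \<Longrightarrow> riesz_const d > 0"
  unfolding riesz_const_def by (intro divide_pos_pos Gamma_real_pos mult_pos_pos) auto

lemma riesz_kernel_eq:
  "x \<noteq> 0 \<Longrightarrow> norm (x :: real^'d::finite) powr (1 - real CARD('d)) = 1 / norm x ^ (CARD('d) - 1)"
proof -
  assume x: "x \<noteq> 0"
  have "1 - real CARD('d) = - real (CARD('d) - 1)" by (simp add: of_nat_diff Suc_leI)
  moreover have "0 < norm x" using x by simp
  ultimately show ?thesis by (simp only: powr_minus powr_realpow inverse_eq_divide)
qed

lemma trunc_kernel_le: "0 < s \<Longrightarrow> x \<noteq> 0 \<Longrightarrow> trunc_kernel s x \<le> norm (x :: real^'d::finite) powr (1 - real CARD('d))"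
  by (simp add: riesz_kernel_eq trunc_kernel_def) (intro divide_left_mono power_mono, auto)

text \<open>
  The lower truncation removes the singularity and the upper one the tail, where \<open>d \<ge> 2\<close> makes the kernel
  vanish at infinity. Since the truncated kernels stay between \<open>0\<close> and the kernel, convergence is dominated as
  soon as the potential converges absolutely at \<open>y\<close>.
\<close>

lemma riesz_potential_limit:
  fixes \<Phi> :: "real^'d::finite \<Rightarrow> real"
  assumes d: "CARD('d) \<ge> 2" and [measurable]: "\<Phi> \<in> borel_measurable borel"
    and int: "integrable lborel (\<lambda>x. \<Phi> x * (riesz_const CARD('d) * norm (y - x) powr (1 - real CARD('d))))"
  shows "(\<lambda>K. riesz_const CARD('d) * (LINT x|lborel. \<Phi> x * (trunc_kernel (2 powi (- int K)) (x - y) - trunc_kernel (2 powi (int K + 1)) (x - y)))) \<longlonglongrightarrow> riesz_potential \<Phi> y"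
proof -
  let ?rc = "riesz_const CARD('d)"
  have rc: "?rc > 0" using d by (rule riesz_const_pos)
  let ?t = "\<lambda>K x. trunc_kernel (2 powi (- int K)) (x - y) - trunc_kernel (2 powi (int K + 1)) (x - y)"
  have "(\<lambda>K. LINT x|lborel. \<Phi> x * (?rc * ?t K x)) \<longlonglongrightarrow> (LINT x|lborel. \<Phi> x * (?rc * norm (y - x) powr (1 - real CARD('d))))"
  proof (rule integral_dominated_convergence[where w="\<lambda>x. norm (\<Phi> x * (?rc * norm (y - x) powr (1 - real CARD('d))))"])
    show "AE x in lborel. (\<lambda>K. \<Phi> x * (?rc * ?t K x)) \<longlonglongrightarrow> \<Phi> x * (?rc * norm (y - x) powr (1 - real CARD('d)))"
      using AE_lborel_singleton[of y]
    proof eventually_elim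
      case (elim x)
      define r where "r = norm (x - y)"
      have r: "r > 0" using elim by (simp add: r_def)
      have p: "2 powi (- int K) = (1/2 :: real) ^ K" "2 powi (int K + 1) = (2 :: real) ^ (K + 1)" for K
        by (simp_all add: power_int_minus power_one_over power_int_add inverse_eq_divide)
      have l1: "(\<lambda>K. max r ((1/2) ^ K)) \<longlonglongrightarrow> max r 0"
        by (intro tendsto_max tendsto_const LIMSEQ_realpow_zero) auto
      have "(\<lambda>K. 1 / (max r ((1/2) ^ K)) ^ (CARD('d) - 1)) \<longlonglongrightarrow> 1 / (max r 0) ^ (CARD('d) - 1)"
        by (intro tendsto_intros l1) (use r in auto)
      then have t1: "(\<lambda>K. trunc_kernel (2 powi (- int K)) (x - y)) \<longlonglongrightarrow> norm (y - x) powr (1 - real CARD('d))"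
        using r elim by (subst riesz_kernel_eq) (auto simp: trunc_kernel_def p r_def norm_minus_commute)
      have t2: "(\<lambda>K. trunc_kernel (2 powi (int K + 1)) (x - y)) \<longlonglongrightarrow> 0"
      proof (rule tendsto_sandwich[of "\<lambda>_. 0" _ _ "\<lambda>K. (1/2) ^ K"])
        show "\<forall>\<^sub>F K in sequentially. trunc_kernel (2 powi (int K + 1)) (x - y) \<le> (1/2) ^ K"
        proof (rule always_eventually, rule allI)
          fix K
          have "trunc_kernel (2 powi (int K + 1)) (x - y) \<le> 1 / (2 powi (int K + 1)) ^ (CARD('d) - 1)"
            by (rule trunc_kernel_bounds) simp
          also have "(2::real) ^ K \<le> (2 ^ (K + 1)) ^ (CARD('d) - 1)"
          proof -
            have "(2::real) ^ K \<le> (2 ^ (K + 1)) ^ 1" by simp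
            also have "\<dots> \<le> (2 ^ (K + 1)) ^ (CARD('d) - 1)"
              using d by (intro power_increasing one_le_power) auto
            finally show ?thesis .
          qed
          then have "1 / (2 powi (int K + 1)) ^ (CARD('d) - 1) \<le> 1 / (2::real) ^ K"
            unfolding p by (intro divide_left_mono) auto
          finally show "trunc_kernel (2 powi (int K + 1)) (x - y) \<le> (1/2) ^ K" by (simp add: power_one_over)
        qed
        show "\<forall>\<^sub>F K in sequentially. 0 \<le> trunc_kernel (2 powi (int K + 1)) (x - y)"
          by (rule always_eventually, rule allI, rule trunc_kernel_bounds) simp
      qed (auto intro: LIMSEQ_realpow_zero)
      have "(\<lambda>K. \<Phi> x * (?rc * ?t K x)) \<longlonglongrightarrow> \<Phi> x * (?rc * (norm (y - x) powr (1 - real CARD('d)) - 0))"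
        by (intro tendsto_mult tendsto_const tendsto_diff t1 t2)
      then show ?case by simp
    qed
    show "AE x in lborel. norm (\<Phi> x * (?rc * ?t K x)) \<le> norm (\<Phi> x * (?rc * norm (y - x) powr (1 - real CARD('d))))" for K
      using AE_lborel_singleton[of y]
    proof eventually_elim
      case (elim x)
      have "2 powi (- int K) \<le> (2 powi (int K + 1) :: real)" by (rule power_int_increasing) auto
      then have "0 \<le> ?t K x"
        using trunc_kernel_antimono[of "2 powi (- int K)" "2 powi (int K + 1)" "x - y"] by simp
      moreover have "?t K x \<le> norm (y - x) powr (1 - real CARD('d))"
        using trunc_kernel_le[of "2 powi (- int K)" "x - y"] trunc_kernel_bounds(1)[of "2 powi (int K + 1)" "x - y"] elim
        by (simp add: norm_minus_commute)
      ultimately have "\<bar>?t K x\<bar> \<le> \<bar>norm (y - x) powr (1 - real CARD('d))\<bar>" by simp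
      then show ?case
        unfolding real_norm_def abs_mult using rc by (intro mult_left_mono abs_ge_zero)
    qed
    show "integrable lborel (\<lambda>x. norm (\<Phi> x * (?rc * norm (y - x) powr (1 - real CARD('d)))))"
      using int by (rule integrable_norm)
  qed measurable
  moreover have "?rc * (LINT x|lborel. \<Phi> x * ?t K x) = (LINT x|lborel. \<Phi> x * (?rc * ?t K x))" for K
    by (subst integral_mult_right_zero[symmetric]) (simp only: mult.left_commute)
  ultimately show ?thesis
    unfolding riesz_potential_def by (simp only:)
qed

context hardy_kernel begin

text \<open>
  A limes inferior instead of a supremum over \<open>K\<close>: it suffices for the pointwise bound and is compatible with
  Fatou's lemma, which yields the integral bound.
\<close>

definition riesz_majorant :: "(real^'d \<Rightarrow> real) \<Rightarrow> nat \<Rightarrow> real^'d \<Rightarrow> ennreal" where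
  "riesz_majorant \<Phi> L y = liminf (\<lambda>K. ennreal (riesz_const CARD('d) / norm (LINT x|lborel. \<psi> x)) *
      tent_bound (hardy_maximal \<psi> \<Phi>) (R + 4) L K y)"

lemma riesz_potential_le_majorant:
  fixes \<Phi> :: "real^'d \<Rightarrow> real"
  assumes d: "CARD('d) \<ge> 2" and c0: "(LINT x|lborel. \<psi> x) \<noteq> 0"
    and B: "B \<ge> 8 * Q" "B \<ge> 2 * real CARD('d)"
    and L: "(1/2)^L \<le> (1 / 4 :: real)" "Q * (1/2)^L * (B * (R + 2) + 1) \<le> 1 / 2" "real CARD('d) * (1/2)^L \<le> 1"
    and \<Phi>: "integrable lborel \<Phi>"
  shows "ennreal (riesz_potential \<Phi> y) \<le> riesz_majorant \<Phi> L y"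
proof (cases "integrable lborel (\<lambda>x. \<Phi> x * (riesz_const CARD('d) * norm (y - x) powr (1 - real CARD('d))))")
  case False
  \<comment> \<open>A divergent integral has the value 0.\<close>
  then have "riesz_potential \<Phi> y = 0"
    unfolding riesz_potential_def by (rule not_integrable_integral_eq)
  then show ?thesis by simp
next
  case True
  let ?rc = "riesz_const CARD('d)"
  have rc: "?rc > 0" using d by (rule riesz_const_pos)
  let ?u = "\<lambda>K. LINT x|lborel. \<Phi> x * (trunc_kernel (2 powi (- int K)) (x - y) - trunc_kernel (2 powi (int K + 1)) (x - y))"
  have "(\<lambda>K. ?rc * ?u K) \<longlonglongrightarrow> riesz_potential \<Phi> y"
    using borel_measurable_integrable[OF \<Phi>] by (intro riesz_potential_limit d True) simp
  then have "(\<lambda>K. ennreal (?rc * ?u K)) \<longlonglongrightarrow> ennreal (riesz_potential \<Phi> y)"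
    by (rule tendsto_ennrealI)
  then have "ennreal (riesz_potential \<Phi> y) = liminf (\<lambda>K. ennreal (?rc * ?u K))"
    by (rule lim_imp_Liminf[symmetric, rotated]) simp
  also have "\<dots> \<le> riesz_majorant \<Phi> L y"
    unfolding riesz_majorant_def
  proof (rule Liminf_mono, rule always_eventually, rule allI)
    fix n
    have "ennreal (?rc * ?u n) \<le> ennreal (?rc * \<bar>?u n\<bar>)"
      using rc by (intro ennreal_leI mult_left_mono) auto
    also have "\<dots> = ennreal ?rc * ennreal \<bar>?u n\<bar>"
      using rc by (intro ennreal_mult) auto
    also have "\<dots> \<le> ennreal ?rc * (ennreal (1 / norm (LINT x|lborel. \<psi> x)) * tent_bound (hardy_maximal \<psi> \<Phi>) (R + 4) L n y)"
      by (intro mult_left_mono truncated_riesz_bound[OF c0 B L \<Phi>]) auto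
    also have "\<dots> = ennreal (?rc / norm (LINT x|lborel. \<psi> x)) * tent_bound (hardy_maximal \<psi> \<Phi>) (R + 4) L n y"
      using rc by (simp add: mult.assoc[symmetric] ennreal_mult[symmetric])
    finally show "ennreal (?rc * ?u n) \<le> \<dots>" .
  qed
  finally show ?thesis .
qed

text \<open>
  The constant \<open>B\<close> is chosen first, and \<open>2\<^sup>-\<^sup>L\<close> must be small in comparison with \<open>Q\<close>, \<open>B\<close>, \<open>R\<close> and \<open>d\<close>.
\<close>

lemma exists_scale_parameters:
  obtains B L where "B \<ge> 8 * Q" "B \<ge> 2 * real CARD('d)" "(1/2)^L \<le> (1 / 4 :: real)"
    "Q * (1/2)^L * (B * (R + 2) + 1) \<le> 1 / 2" "real CARD('d) * (1/2)^L \<le> 1"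
proof -
  define B where "B = 8 * Q + 2 * real CARD('d)"
  define M where "M = 2 * Q * (B * (R + 2) + 1) + real CARD('d) + 4"
  have B: "B \<ge> 0" using Q_nonneg by (simp add: B_def)
  have QB: "Q * (B * (R + 2) + 1) \<ge> 0" using B Q_nonneg R_pos by (intro mult_nonneg_nonneg) auto
  have M: "M > 0" using QB unfolding M_def by (simp add: mult.assoc)
  obtain L where "(1/2)^L < 1 / M"
    using real_arch_pow_inv[of "1 / M" "1/2"] M by auto
  then have L: "M * (1/2)^L < 1" using M by (simp add: pos_less_divide_eq mult.commute)
  have p: "(0::real) < (1/2)^L" by simp
  have le: "X * (1/2)^L \<le> 1" if "X \<le> M" for X
    using mult_right_mono[OF that, of "(1/2)^L"] L p by linarith
  show ?thesis
  proof (rule that[of B L])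
    show "(1/2)^L \<le> (1 / 4 :: real)"
      using le[of 4] QB by (simp add: M_def mult.assoc)
    show "Q * (1/2)^L * (B * (R + 2) + 1) \<le> 1 / 2"
      using le[of "2 * (Q * (B * (R + 2) + 1))"] by (simp add: M_def mult_ac)
    show "real CARD('d) * (1/2)^L \<le> 1"
      using le[of "real CARD('d)"] QB by (simp add: M_def mult.assoc)
  qed (use Q_nonneg in \<open>auto simp: B_def\<close>)
qed

end

section \<open>The trace inequality\<close>

lemma growth_measure_shift:
  assumes "growth_measure \<mu> N"
  shows "growth_measure (distr \<mu> borel (\<lambda>y. y + z)) N"
proof -
  interpret growth_measure \<mu> N by (rule assms)
  show ?thesis
  proof
    fix x :: "real^'a" and r :: real assume r: "r > 0"
    have "(\<lambda>y. y + z) -` cball x r = cball (x - z) r"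
      by (auto simp: dist_norm algebra_simps)
    then have "emeasure (distr \<mu> borel (\<lambda>y. y + z)) (cball x r) = emeasure \<mu> (cball (x - z) r)"
      by (subst emeasure_distr) auto
    also have "\<dots> \<le> N * ennreal (r ^ (CARD('a) - 1))"
      by (rule growth[OF r])
    finally show "emeasure (distr \<mu> borel (\<lambda>y. y + z)) (cball x r) \<le> N * ennreal (r ^ (CARD('a) - 1))" .
  qed (use N_finite in auto)
qed

lemma lborel_AE_shift:
  fixes y :: "real^'d::finite"
  assumes "AE x in lborel. P x"
  shows "AE z in lborel. P (y + z)"
proof -
  obtain S where S: "{x. \<not> P x} \<subseteq> S" "S \<in> sets borel" "emeasure lborel S = 0"
  proof -
    obtain S where "{x \<in> space lborel. \<not> P x} \<subseteq> S" "emeasure lborel S = 0" "S \<in> sets lborel"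
      by (rule AE_E[OF assms])
    then show thesis by (intro that[of S]) simp_all
  qed
  have "(\<integral>\<^sup>+z. indicator S (y + z) \<partial>lborel) = (\<integral>\<^sup>+z. indicator S z \<partial>lborel)"
    using nn_integral_lborel_affine[of "indicator S" 1 y] S by simp
  then have zero: "(\<integral>\<^sup>+z. indicator S (y + z) \<partial>lborel) = 0"
    using S by simp
  have "(\<lambda>z. indicator S (y + z) :: ennreal) \<in> borel_measurable lborel"
    using S(2) by (intro measurable_compose[where f="\<lambda>z. y + z" and g="indicator S" and N=borel]) auto
  from nn_integral_0_iff_AE[OF this] zero have "AE z in lborel. indicator S (y + z) = (0 :: ennreal)"
    by simp
  then show ?thesis
    by eventually_elim (use S in \<open>auto simp: indicator_eq_0_iff\<close>)
qed

context growth_measure begin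

text \<open>
  An inequality that holds almost everywhere with respect to Lebesgue measure says nothing about a singular
  \<open>\<mu>\<close>. It does hold at \<open>\<mu>\<close>-almost every point of a generic small translate of \<open>\<mu>\<close>, and by uniform
  continuity the integral of \<open>f\<close> hardly changes under small translations. Averaging over
  the translations proves the bound, because the hypothesis on \<open>F\<close> is uniform in \<open>z\<close>.
\<close>

lemma nn_integral_le_of_shifts:
  fixes f :: "real^'d \<Rightarrow> real" and F :: "real^'d \<Rightarrow> ennreal"
  assumes f: "continuous_on UNIV f" and supp: "\<And>x. x \<notin> cball 0 \<rho> \<Longrightarrow> f x = 0"
    and [measurable]: "F \<in> borel_measurable borel"
    and le: "AE x in lborel. ennreal (f x) \<le> F x"
    and F: "\<And>z. (\<integral>\<^sup>+y. F (y + z) \<partial>\<mu>) \<le> B"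
  shows "(\<integral>\<^sup>+y. ennreal (f y) \<partial>\<mu>) \<le> B"
proof (rule ennreal_le_epsilon)
  fix e :: real assume e: "e > 0"
  have [measurable]: "f \<in> borel_measurable borel"
    using f by (rule borel_measurable_continuous_onI)
  have [measurable]: "cball (0::real^'d) r \<in> sets borel" for r by simp
  define m where "m = measure \<mu> (cball 0 \<rho>)"
  have m: "emeasure \<mu> (cball 0 \<rho>) = ennreal m"
    unfolding m_def using emeasure_cball_finite[of 0 \<rho>] by (simp add: emeasure_eq_ennreal_measure less_top[symmetric])
  have m0: "m \<ge> 0" by (simp add: m_def)
  \<comment> \<open>An oscillation of w on the ball of measure m costs at most e.\<close>
  define w where "w = e / (m + 1)"
  have w: "w > 0" "w * m \<le> e" using e m0 by (auto simp: w_def divide_simps)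
  have "uniformly_continuous_on (cball 0 (\<rho> + 1)) f"
    by (intro compact_uniformly_continuous continuous_on_subset[OF f]) auto
  then obtain \<delta>0 where \<delta>0: "\<delta>0 > 0" "\<And>x y. x \<in> cball 0 (\<rho> + 1) \<Longrightarrow> y \<in> cball 0 (\<rho> + 1) \<Longrightarrow> dist y x < \<delta>0 \<Longrightarrow> dist (f y) (f x) < w"
    unfolding uniformly_continuous_on_def using w(1) by meson
  define \<delta> where "\<delta> = min (\<delta>0 / 2) 1"
  have \<delta>: "\<delta> > 0" "\<delta> < \<delta>0" "\<delta> \<le> 1" using \<delta>0(1) by (auto simp: \<delta>_def)
  have key: "ennreal (f y) \<le> ennreal (f (y + z)) + ennreal w * indicator (cball 0 \<rho>) y" if z: "z \<in> cball (0::real^'d) \<delta>" for y z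
  proof (cases "y \<in> cball 0 \<rho>")
    case True
    then have "y + z \<in> cball 0 (\<rho> + 1)" "y \<in> cball 0 (\<rho> + 1)"
      using z \<delta> norm_triangle_ineq[of y z] by auto
    moreover have "dist y (y + z) < \<delta>0" using z \<delta> by (simp add: dist_norm)
    ultimately have "f y \<le> max 0 (f (y + z)) + w" using \<delta>0(2)[of "y + z" y] by (auto simp: dist_real_def)
    then have "ennreal (f y) \<le> ennreal (max 0 (f (y + z))) + ennreal w"
      using w by (subst ennreal_plus[symmetric]) (auto intro!: ennreal_leI simp del: ennreal_plus)
    then show ?thesis using True by (simp add: max_def ennreal_neg split: if_splits)
  qed (simp add: supp)
  define V where "V = emeasure lborel (cball (0::real^'d) \<delta>)"
  have V: "V \<noteq> 0" "V \<noteq> \<infinity>"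
  proof -
    have "0 < emeasure lborel (ball (0::real^'d) \<delta>)"
      using \<delta> by (simp add: emeasure_ball ennreal_zero_less_mult_iff unit_ball_vol_pos)
    also have "\<dots> \<le> V" unfolding V_def by (intro emeasure_mono ball_subset_cball) auto
    finally show "V \<noteq> 0" by simp
    show "V \<noteq> \<infinity>" unfolding V_def using emeasure_lborel_cball_finite[of 0 \<delta>] by (simp add: less_top)
  qed
  have meas1: "(\<lambda>(z, y). h (y + z) * indicator (cball (0::real^'d) \<delta>) z) \<in> borel_measurable (lborel \<Otimes>\<^sub>M \<mu>)"
    if "h \<in> borel_measurable borel" for h :: "real^'d \<Rightarrow> ennreal"
  proof -
    have h: "(\<lambda>p. h (snd p + fst p) * indicator (cball (0::real^'d) \<delta>) (fst p)) \<in> borel_measurable (borel \<Otimes>\<^sub>M borel)"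
    proof (rule borel_measurable_times_ennreal)
      have "(\<lambda>p. snd p + fst p) \<in> borel_measurable (borel \<Otimes>\<^sub>M borel :: ((real^'d) \<times> (real^'d)) measure)"
        by measurable
      from measurable_compose[OF this that]
      show "(\<lambda>p. h (snd p + fst p)) \<in> borel_measurable (borel \<Otimes>\<^sub>M borel :: ((real^'d) \<times> (real^'d)) measure)" .
      have "(indicator (cball (0::real^'d) \<delta>) :: real^'d \<Rightarrow> ennreal) \<in> borel_measurable borel"
        by (rule borel_measurable_indicator) simp
      then show "(\<lambda>p. indicator (cball (0::real^'d) \<delta>) (fst p) :: ennreal) \<in> borel_measurable (borel \<Otimes>\<^sub>M borel :: ((real^'d) \<times> (real^'d)) measure)"
        by (rule measurable_compose[OF measurable_fst])
    qed
    have "borel_measurable (borel \<Otimes>\<^sub>M borel) = (borel_measurable (lborel \<Otimes>\<^sub>M \<mu>) :: ((real^'d) \<times> (real^'d) \<Rightarrow> ennreal) set)"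
      by (intro measurable_cong_sets sets_pair_measure_cong) (auto simp: sets_mu)
    from h[unfolded this] show ?thesis by (simp only: case_prod_beta')
  qed
  have swap: "(\<integral>\<^sup>+z. (\<integral>\<^sup>+y. h (y + z) * indicator (cball (0::real^'d) \<delta>) z \<partial>\<mu>) \<partial>lborel) = (\<integral>\<^sup>+y. (\<integral>\<^sup>+z. h (y + z) * indicator (cball (0::real^'d) \<delta>) z \<partial>lborel) \<partial>\<mu>)"
    if "h \<in> borel_measurable borel" for h :: "real^'d \<Rightarrow> ennreal"
    by (rule leb_pair.Fubini'[symmetric]) (rule meas1[OF that])
  have "(\<integral>\<^sup>+y. ennreal (f y) \<partial>\<mu>) * V = (\<integral>\<^sup>+z. (\<integral>\<^sup>+y. ennreal (f y) \<partial>\<mu>) * indicator (cball (0::real^'d) \<delta>) z \<partial>lborel)"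
    unfolding V_def by (rule nn_integral_cmult_indicator[symmetric]) auto
  also have "\<dots> \<le> (\<integral>\<^sup>+z. (\<integral>\<^sup>+y. ennreal (f (y + z)) * indicator (cball (0::real^'d) \<delta>) z \<partial>\<mu>) + ennreal e * indicator (cball (0::real^'d) \<delta>) z \<partial>lborel)"
  proof (rule nn_integral_mono)
    fix z :: "real^'d"
    show "(\<integral>\<^sup>+y. ennreal (f y) \<partial>\<mu>) * indicator (cball (0::real^'d) \<delta>) z \<le> (\<integral>\<^sup>+y. ennreal (f (y + z)) * indicator (cball (0::real^'d) \<delta>) z \<partial>\<mu>) + ennreal e * indicator (cball (0::real^'d) \<delta>) z"
    proof (cases "z \<in> cball (0::real^'d) \<delta>")
      case True
      have "(\<integral>\<^sup>+y. ennreal (f y) \<partial>\<mu>) \<le> (\<integral>\<^sup>+y. ennreal (f (y + z)) + ennreal w * indicator (cball 0 \<rho>) y \<partial>\<mu>)"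
        by (intro nn_integral_mono key True)
      also have "\<dots> = (\<integral>\<^sup>+y. ennreal (f (y + z)) \<partial>\<mu>) + (\<integral>\<^sup>+y. ennreal w * indicator (cball 0 \<rho>) y \<partial>\<mu>)"
        by (rule nn_integral_add) measurable
      also have "(\<integral>\<^sup>+y. ennreal w * indicator (cball 0 \<rho>) y \<partial>\<mu>) = ennreal w * ennreal m"
        by (subst nn_integral_cmult_indicator) (auto simp: m sets_mu)
      also have "ennreal w * ennreal m \<le> ennreal e"
        using w m0 by (simp add: ennreal_mult[symmetric] ennreal_leI)
      finally show ?thesis using True by (simp add: add_left_mono)
    qed simp
  qed
  also have "\<dots> = (\<integral>\<^sup>+z. (\<integral>\<^sup>+y. ennreal (f (y + z)) * indicator (cball (0::real^'d) \<delta>) z \<partial>\<mu>) \<partial>lborel) + ennreal e * V"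
  proof (subst nn_integral_add)
    show "(\<lambda>z. \<integral>\<^sup>+y. ennreal (f (y + z)) * indicator (cball (0::real^'d) \<delta>) z \<partial>\<mu>) \<in> borel_measurable lborel"
      by (rule borel_measurable_nn_integral) (rule meas1[of "\<lambda>y. ennreal (f y)"], measurable)
  qed (auto simp: V_def nn_integral_cmult_indicator)
  also have "(\<integral>\<^sup>+z. (\<integral>\<^sup>+y. ennreal (f (y + z)) * indicator (cball (0::real^'d) \<delta>) z \<partial>\<mu>) \<partial>lborel) = (\<integral>\<^sup>+y. (\<integral>\<^sup>+z. ennreal (f (y + z)) * indicator (cball (0::real^'d) \<delta>) z \<partial>lborel) \<partial>\<mu>)"
    by (rule swap) measurable
  also have "\<dots> \<le> (\<integral>\<^sup>+y. (\<integral>\<^sup>+z. F (y + z) * indicator (cball (0::real^'d) \<delta>) z \<partial>lborel) \<partial>\<mu>)"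
  proof (rule nn_integral_mono, rule nn_integral_mono_AE)
    fix y :: "real^'d"
    show "AE z in lborel. ennreal (f (y + z)) * indicator (cball (0::real^'d) \<delta>) z \<le> F (y + z) * indicator (cball (0::real^'d) \<delta>) z"
      using lborel_AE_shift[OF le, of y] by eventually_elim (intro mult_right_mono, auto)
  qed
  also have "\<dots> = (\<integral>\<^sup>+z. (\<integral>\<^sup>+y. F (y + z) * indicator (cball (0::real^'d) \<delta>) z \<partial>\<mu>) \<partial>lborel)"
    by (rule swap[symmetric]) measurable
  also have "\<dots> \<le> (\<integral>\<^sup>+z. B * indicator (cball (0::real^'d) \<delta>) z \<partial>lborel)"
  proof (rule nn_integral_mono)
    fix z :: "real^'d"
    show "(\<integral>\<^sup>+y. F (y + z) * indicator (cball (0::real^'d) \<delta>) z \<partial>\<mu>) \<le> B * indicator (cball (0::real^'d) \<delta>) z"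
      using F[of z] by (cases "z \<in> cball (0::real^'d) \<delta>") auto
  qed
  also have "\<dots> = B * V"
    unfolding V_def by (rule nn_integral_cmult_indicator) auto
  finally have "(\<integral>\<^sup>+y. ennreal (f y) \<partial>\<mu>) * V \<le> (B + ennreal e) * V"
    by (simp add: distrib_right)
  then have "((\<integral>\<^sup>+y. ennreal (f y) \<partial>\<mu>) * V) / V \<le> ((B + ennreal e) * V) / V"
    by (rule divide_right_mono_ennreal)
  then show "(\<integral>\<^sup>+y. ennreal (f y) \<partial>\<mu>) \<le> B + ennreal e"
    using V by (simp add: ennreal_mult_divide_eq)
qed

end

context hardy_kernel begin

lemma nn_integral_riesz_majorant:
  fixes \<Phi> :: "real^'d \<Rightarrow> real"
  assumes "growth_measure \<mu> N"
  shows "(\<integral>\<^sup>+y. riesz_majorant \<Phi> L y \<partial>\<mu>) \<le>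
    ennreal (riesz_const CARD('d) / norm (LINT x|lborel. \<psi> x)) * (ennreal (8 * carleson_const CARD('d) (R + 4) * (3 * real L + 2)) * N * hardy_norm \<psi> \<Phi>)"
proof -
  interpret growth_measure \<mu> N by (rule assms)
  let ?k = "ennreal (riesz_const CARD('d) / norm (LINT x|lborel. \<psi> x))"
  have "(\<integral>\<^sup>+y. riesz_majorant \<Phi> L y \<partial>\<mu>) \<le> liminf (\<lambda>n. \<integral>\<^sup>+y. ?k * tent_bound (hardy_maximal \<psi> \<Phi>) (R + 4) L n y \<partial>\<mu>)"
    unfolding riesz_majorant_def by (rule nn_integral_liminf) measurable
  also have "\<dots> \<le> liminf (\<lambda>n::nat. ?k * (ennreal (8 * carleson_const CARD('d) (R + 4) * (3 * real L + 2)) * N * hardy_norm \<psi> \<Phi>))"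
  proof (rule Liminf_mono, rule always_eventually, rule allI)
    fix n
    have "(\<integral>\<^sup>+y. ?k * tent_bound (hardy_maximal \<psi> \<Phi>) (R + 4) L n y \<partial>\<mu>) = ?k * (\<integral>\<^sup>+y. tent_bound (hardy_maximal \<psi> \<Phi>) (R + 4) L n y \<partial>\<mu>)"
      by (rule nn_integral_cmult) measurable
    also have "\<dots> \<le> ?k * (ennreal (8 * carleson_const CARD('d) (R + 4) * (3 * real L + 2)) * N * hardy_norm \<psi> \<Phi>)"
      unfolding hardy_norm_def using R_pos by (intro mult_left_mono nn_integral_tent_bound) auto
    finally show "(\<integral>\<^sup>+y. ?k * tent_bound (hardy_maximal \<psi> \<Phi>) (R + 4) L n y \<partial>\<mu>) \<le> \<dots>" .
  qed
  also have "\<dots> = ?k * (ennreal (8 * carleson_const CARD('d) (R + 4) * (3 * real L + 2)) * N * hardy_norm \<psi> \<Phi>)"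
    by (rule Liminf_const) simp
  finally show ?thesis .
qed

text \<open>
  The pointwise majorant is integrated against all translates of \<open>\<mu>\<close>, which satisfy the same growth
  condition.
\<close>

lemma trace_inequality:
  assumes d: "CARD('d) \<ge> 2" and c0: "(LINT x|lborel. \<psi> x) \<noteq> 0"
  shows "\<exists>C>0. \<forall>(\<mu> :: (real^'d) measure) N (\<Phi> :: real^'d \<Rightarrow> real) (f :: real^'d \<Rightarrow> real) \<rho>.
    growth_measure \<mu> N \<longrightarrow> integrable lborel \<Phi> \<longrightarrow> continuous_on UNIV f \<longrightarrow>
    (\<forall>x. x \<notin> cball 0 \<rho> \<longrightarrow> f x = 0) \<longrightarrow> (AE x in lborel. f x \<le> riesz_potential \<Phi> x) \<longrightarrow>
    (\<integral>\<^sup>+y. ennreal (f y) \<partial>\<mu>) \<le> ennreal C * hardy_norm \<psi> \<Phi> * N"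
proof -
  obtain B L where BL: "B \<ge> 8 * Q" "B \<ge> 2 * real CARD('d)" "(1/2)^L \<le> (1 / 4 :: real)"
    "Q * (1/2)^L * (B * (R + 2) + 1) \<le> 1 / 2" "real CARD('d) * (1/2)^L \<le> 1"
    by (rule exists_scale_parameters)
  define C1 where "C1 = riesz_const CARD('d) / norm (LINT x|lborel. \<psi> x)"
  define C2 where "C2 = 8 * carleson_const CARD('d) (R + 4) * (3 * real L + 2)"
  have C1: "C1 > 0" unfolding C1_def using c0 riesz_const_pos[OF d] by simp
  define C where "C = max 1 (C1 * C2)"
  show ?thesis
  proof (intro exI[of _ C] conjI allI impI)
    fix \<mu> :: "(real^'d) measure" and N and \<Phi> f :: "real^'d \<Rightarrow> real" and \<rho>
    assume g: "growth_measure \<mu> N" and \<Phi>: "integrable lborel \<Phi>" and f: "continuous_on UNIV f"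
      and supp: "\<forall>x. x \<notin> cball 0 \<rho> \<longrightarrow> f x = 0" and le: "AE x in lborel. f x \<le> riesz_potential \<Phi> x"
    interpret growth_measure \<mu> N by (rule g)
    have meas: "riesz_majorant \<Phi> L \<in> borel_measurable borel"
      unfolding riesz_majorant_def[abs_def] by measurable
    show "(\<integral>\<^sup>+y. ennreal (f y) \<partial>\<mu>) \<le> ennreal C * hardy_norm \<psi> \<Phi> * N"
    proof (rule nn_integral_le_of_shifts[OF f supp[rule_format] meas])
      show "AE x in lborel. ennreal (f x) \<le> riesz_majorant \<Phi> L x"
        using le by eventually_elim (rule order_trans[OF ennreal_leI riesz_potential_le_majorant[OF d c0 BL \<Phi>]])
      fix z
      have "(\<integral>\<^sup>+y. riesz_majorant \<Phi> L (y + z) \<partial>\<mu>) = (\<integral>\<^sup>+y. riesz_majorant \<Phi> L y \<partial>distr \<mu> borel (\<lambda>y. y + z))"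
        by (subst nn_integral_distr) (auto intro: meas)
      also have "\<dots> \<le> ennreal C1 * (ennreal C2 * N * hardy_norm \<psi> \<Phi>)"
        unfolding C1_def C2_def by (intro nn_integral_riesz_majorant growth_measure_shift g)
      also have "\<dots> = ennreal (C1 * C2) * hardy_norm \<psi> \<Phi> * N"
        using C1 by (subst ennreal_mult') (auto simp: mult_ac)
      also have "\<dots> \<le> ennreal C * hardy_norm \<psi> \<Phi> * N"
        by (intro mult_right_mono ennreal_leI) (auto simp: C_def)
      finally show "(\<integral>\<^sup>+y. riesz_majorant \<Phi> L (y + z) \<partial>\<mu>) \<le> \<dots>" .
    qed
  qed (simp add: C_def)
qed

end

section \<open>Maximal functions of decaying functions with vanishing mean\<close>

definition decay :: "real \<Rightarrow> real^'d::finite \<Rightarrow> real" where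
  "decay a x = max 1 (norm x) powr (- (real CARD('d) + a))"

lemma decay_measurable [measurable]: "decay a \<in> borel_measurable borel"
  unfolding decay_def[abs_def] by measurable

lemma decay_pos: "decay a x > 0"
  by (simp add: decay_def)

lemma powr_minus_divide: "0 < a \<Longrightarrow> 0 < b \<Longrightarrow> (a / b) powr (- q) = b powr q * a powr (- (q::real))"
  by (simp add: powr_divide powr_minus field_simps)

lemma ennreal_le_suminf: "(f :: nat \<Rightarrow> ennreal) k \<le> (\<Sum>j. f j)"
  using sum_le_suminf[of f "{k}"] by simp

text \<open>
  On the dyadic shell with \<open>2\<^sup>k\<^sup>-\<^sup>1 \<le> max 1 |x| \<le> 2\<^sup>k\<close> the function is comparable to the \<open>k\<close>-th term. The volumes
  of the balls grow like \<open>2\<^sup>k\<^sup>d\<close>, so the terms have summable integrals for \<open>a > 0\<close>.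
\<close>

lemma decay_le_shells:
  fixes x :: "real^'d::finite"
  assumes a: "a > 0"
  shows "ennreal (decay a x) \<le> (\<Sum>k. ennreal (2 powr (real CARD('d) + a) * (2 powr (- (real CARD('d) + a))) ^ k) * indicator (cball 0 (2 ^ k)) x)"
proof -
  let ?p = "real CARD('d) + a"
  have p: "?p > 0" using a by simp
  define k where "k = nat \<lceil>log 2 (max 1 (norm x))\<rceil>"
  have m: "max 1 (norm x) \<ge> 1" by simp
  have l0: "log 2 (max 1 (norm x)) \<ge> 0" using m by (simp add: zero_le_log_cancel_iff)
  have k1: "log 2 (max 1 (norm x)) \<le> real k" unfolding k_def using l0 by linarith
  have k2: "real k \<le> log 2 (max 1 (norm x)) + 1" unfolding k_def using l0 by linarith
  have "max 1 (norm x) \<le> 2 powr real k"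
    using k1 m by (simp add: log_le_iff)
  then have x: "x \<in> cball 0 (2 ^ k)" by (simp add: powr_realpow)
  have "2 powr (real k - 1) \<le> max 1 (norm x)"
    using k2 m by (subst le_log_iff[symmetric]) auto
  then have "max 1 (norm x) powr (- ?p) \<le> (2 powr (real k - 1)) powr (- ?p)"
    using p by (intro powr_mono2') auto
  also have "\<dots> = 2 powr ?p * (2 powr (- ?p)) ^ k"
    by (simp add: powr_powr powr_add[symmetric] powr_realpow[symmetric] algebra_simps)
  finally have "ennreal (decay a x) \<le> ennreal (2 powr ?p * (2 powr (- ?p)) ^ k) * indicator (cball 0 (2 ^ k)) x"
    using x by (simp add: decay_def ennreal_leI)
  also have "\<dots> \<le> (\<Sum>k. ennreal (2 powr ?p * (2 powr (- ?p)) ^ k) * indicator (cball 0 (2 ^ k)) x)"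
    by (rule ennreal_le_suminf)
  finally show ?thesis .
qed

lemma nn_integral_decay_finite:
  assumes a: "a > 0"
  shows "(\<integral>\<^sup>+x. ennreal (decay a (x :: real^'d::finite)) \<partial>lborel) < \<infinity>"
proof -
  let ?p = "real CARD('d) + a"
  have [measurable]: "cball (0::real^'d) r \<in> sets borel" for r by simp
  have "(\<integral>\<^sup>+x. ennreal (decay a (x :: real^'d)) \<partial>lborel) \<le> (\<integral>\<^sup>+x. (\<Sum>k. ennreal (2 powr ?p * (2 powr (- ?p)) ^ k) * indicator (cball 0 (2 ^ k)) (x :: real^'d)) \<partial>lborel)"
    by (intro nn_integral_mono decay_le_shells a)
  also have "\<dots> = (\<Sum>k. \<integral>\<^sup>+x. ennreal (2 powr ?p * (2 powr (- ?p)) ^ k) * indicator (cball 0 (2 ^ k)) (x :: real^'d) \<partial>lborel)"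
    by (rule nn_integral_suminf) measurable
  also have "\<dots> \<le> (\<Sum>k. ennreal (2 powr ?p * 2 ^ CARD('d) * (2 powr (- a)) ^ k))"
  proof (intro suminf_le summableI)
    fix k
    have "(\<integral>\<^sup>+x. ennreal (2 powr ?p * (2 powr (- ?p)) ^ k) * indicator (cball 0 (2 ^ k)) (x :: real^'d) \<partial>lborel) = ennreal (2 powr ?p * (2 powr (- ?p)) ^ k) * emeasure lborel (cball (0 :: real^'d) (2 ^ k))"
      by (rule nn_integral_cmult_indicator) auto
    also have "\<dots> \<le> ennreal (2 powr ?p * (2 powr (- ?p)) ^ k) * ennreal ((2 * 2 ^ k) ^ CARD('d))"
      by (intro mult_left_mono emeasure_cball_le) auto
    also have "\<dots> = ennreal (2 powr ?p * (2 powr (- ?p)) ^ k * (2 * 2 ^ k) ^ CARD('d))"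
      by (rule ennreal_mult[symmetric]) auto
    also have "2 powr ?p * (2 powr (- ?p)) ^ k * (2 * 2 ^ k) ^ CARD('d) = 2 powr ?p * 2 ^ CARD('d) * ((2 powr (- ?p)) ^ k * (2 ^ CARD('d)) ^ k)"
      by (simp add: power_mult_distrib power_mult[symmetric] mult.commute[of k])
    also have "(2 powr (- ?p)) ^ k * (2 ^ CARD('d)) ^ k = (2 powr (- a)) ^ k"
    proof -
      have "2 powr (- ?p) * 2 ^ CARD('d) = 2 powr (- ?p) * 2 powr real CARD('d)"
        by (simp add: powr_realpow)
      also have "\<dots> = 2 powr (- a)"
        unfolding powr_add[symmetric] by simp
      finally show ?thesis by (simp only: power_mult_distrib[symmetric])
    qed
    finally show "(\<integral>\<^sup>+x. ennreal (2 powr ?p * (2 powr (- ?p)) ^ k) * indicator (cball 0 (2 ^ k)) (x :: real^'d) \<partial>lborel) \<le> ennreal (2 powr ?p * 2 ^ CARD('d) * (2 powr (- a)) ^ k)" .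
  qed
  also have "\<dots> = ennreal (2 powr ?p * 2 ^ CARD('d) * (1 / (1 - 2 powr (- a))))"
  proof (intro suminf_ennreal_eq sums_mult geometric_sums)
    have "2 powr (- a) < 2 powr (0::real)" using a by (intro powr_less_mono) auto
    then show "norm (2 powr (- a)) < (1::real)" by simp
  qed auto
  also have "\<dots> < \<infinity>" by simp
  finally show ?thesis .
qed

lemma integrable_decay: "a > 0 \<Longrightarrow> integrable lborel (decay a :: real^'d::finite \<Rightarrow> real)"
  using nn_integral_decay_finite[of a] by (intro integrableI_bounded) (auto simp: decay_pos less_imp_le)

context hardy_kernel begin

lemma integrable_mult_dil:
  fixes \<Phi> :: "real^'d \<Rightarrow> real"
  assumes \<Phi>: "integrable lborel \<Phi>"
  shows "integrable lborel (\<lambda>y. complex_of_real (\<Phi> y) * dil t (x - y))"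
proof (rule Bochner_Integration.integrable_bound)
  show "integrable lborel (\<lambda>y. \<Phi> y * (K * t powr (- real CARD('d))))" using \<Phi> by simp
  have [measurable]: "\<Phi> \<in> borel_measurable borel" using borel_measurable_integrable[OF \<Phi>] by simp
  show "(\<lambda>y. complex_of_real (\<Phi> y) * dil t (x - y)) \<in> borel_measurable lborel" by measurable
  show "AE y in lborel. norm (complex_of_real (\<Phi> y) * dil t (x - y)) \<le> norm (\<Phi> y * (K * t powr (- real CARD('d))))"
  proof (rule AE_I2)
    fix y
    have "norm (complex_of_real (\<Phi> y) * dil t (x - y)) \<le> \<bar>\<Phi> y\<bar> * (K * t powr (- real CARD('d)))"
      unfolding norm_mult norm_of_real by (intro mult_left_mono dil_bound) auto
    also have "\<dots> = norm (\<Phi> y * (K * t powr (- real CARD('d))))"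
      using K_nonneg by (simp add: abs_mult)
    finally show "norm (complex_of_real (\<Phi> y) * dil t (x - y)) \<le> \<dots>" .
  qed
qed

lemma hardy_maximal_eq: "hardy_maximal \<psi> \<Phi> x = (SUP t\<in>{0<..}. ennreal (cmod (LINT y|lborel. complex_of_real (\<Phi> y) * dil t (x - y))))"
  by (simp add: hardy_maximal_def dil_def)

lemma average_bound_local:
  fixes \<Phi> :: "real^'d \<Rightarrow> real"
  assumes t: "t > 0" and M: "\<And>y. norm (x - y) \<le> t * R \<Longrightarrow> \<bar>\<Phi> y\<bar> \<le> M"
  shows "cmod (LINT y|lborel. complex_of_real (\<Phi> y) * dil t (x - y)) \<le> M * (K * (2 * R) ^ CARD('d))"
proof -
  have M0: "M \<ge> 0" using M[of x] t R_pos by (auto intro: order_trans[OF abs_ge_zero])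
  have "cmod (LINT y|lborel. complex_of_real (\<Phi> y) * dil t (x - y)) \<le> (M * (K * t powr (- real CARD('d)))) * (2 * (t * R)) ^ CARD('d)"
  proof (rule norm_integral_le_on_cball[where y=x])
    show "cmod (complex_of_real (\<Phi> y) * dil t (x - y)) \<le> M * (K * t powr (- real CARD('d)))" if "y \<in> cball x (t * R)" for y
      using that M0 unfolding norm_mult norm_of_real by (intro mult_mono M dil_bound) (auto simp: dist_norm)
    show "complex_of_real (\<Phi> y) * dil t (x - y) = 0" if "y \<notin> cball x (t * R)" for y
      using that dil_support[OF t, of "x - y"] by (simp add: dist_norm)
  qed (use t R_pos in auto)
  also have "\<dots> = M * (K * (2 * R) ^ CARD('d)) * (t powr (- real CARD('d)) * t ^ CARD('d))"
    by (simp add: power_mult_distrib mult_ac)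
  also have "t powr (- real CARD('d)) * t ^ CARD('d) = 1"
    using t by (simp add: powr_minus powr_realpow)
  finally show ?thesis by simp
qed

text \<open>
  Because of the vanishing mean, \<open>\<psi>\<^sub>t(x - y)\<close> may be replaced by \<open>\<psi>\<^sub>t(x - y) - \<psi>\<^sub>t(x)\<close>. This difference is
  bounded by the Lipschitz estimate for \<open>|y| \<le> t\<close> and trivially for \<open>|y| > t\<close>, and the power \<open>(|y|/t)\<^sup>1\<^sup>/\<^sup>4\<close>
  interpolates between the two. A moment of small order is used because the functions to be treated have no first moment.
\<close>

lemma average_bound_global:
  fixes \<Phi> :: "real^'d \<Rightarrow> real"
  assumes t: "t > 0" and \<Phi>: "integrable lborel \<Phi>" and mean: "(LINT x|lborel. \<Phi> x) = 0"
    and mom: "integrable lborel (\<lambda>y. \<bar>\<Phi> y\<bar> * norm y powr (1/4))"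
  shows "cmod (LINT y|lborel. complex_of_real (\<Phi> y) * dil t (x - y)) \<le>
     2 * K * t powr (- (real CARD('d) + 1/4)) * (LINT y|lborel. \<bar>\<Phi> y\<bar> * norm y powr (1/4))"
proof -
  let ?T = "K * t powr (- real CARD('d))"
  have "(LINT y|lborel. complex_of_real (\<Phi> y) * dil t (x - y)) = (LINT y|lborel. complex_of_real (\<Phi> y) * dil t (x - y)) - (LINT y|lborel. complex_of_real (\<Phi> y) * dil t x)"
    using mean by simp
  also have "\<dots> = (LINT y|lborel. complex_of_real (\<Phi> y) * dil t (x - y) - complex_of_real (\<Phi> y) * dil t x)"
    using \<Phi> by (intro Bochner_Integration.integral_diff[symmetric] integrable_mult_dil integrable_mult_left) auto
  finally have "cmod (LINT y|lborel. complex_of_real (\<Phi> y) * dil t (x - y)) \<le> (LINT y|lborel. cmod (complex_of_real (\<Phi> y) * dil t (x - y) - complex_of_real (\<Phi> y) * dil t x))"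
    by (simp only: integral_norm_bound)
  also have "\<dots> \<le> (LINT y|lborel. (2 * K * t powr (- (real CARD('d) + 1/4))) * (\<bar>\<Phi> y\<bar> * norm y powr (1/4)))"
  proof (rule integral_mono')
    fix y
    have "cmod (dil t (x - y) - dil t x) \<le> 2 * ?T * (norm y / t) powr (1/4)"
    proof (cases "norm y \<le> t")
      case True
      have "cmod (dil t (x - y) - dil t x) \<le> ?T * (norm (x - y - x) / t)"
        by (rule dil_lipschitz[OF t])
      also have "norm (x - y - x) / t = (norm y / t) powr 1" using t by simp
      also have "\<dots> \<le> (norm y / t) powr (1/4)"
        using True t by (intro powr_mono') auto
      also have "?T * (norm y / t) powr (1/4) \<le> 2 * ?T * (norm y / t) powr (1/4)"
        using K_nonneg by (intro mult_right_mono) auto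
      finally show ?thesis using K_nonneg by (simp add: mult_left_mono)
    next
      case False
      have "cmod (dil t (x - y) - dil t x) \<le> cmod (dil t (x - y)) + cmod (dil t x)"
        by (rule norm_triangle_ineq4)
      also have "\<dots> \<le> 2 * ?T * 1"
        using dil_bound[of t "x - y"] dil_bound[of t x] by simp
      also have "\<dots> \<le> 2 * ?T * (norm y / t) powr (1/4)"
        using False t K_nonneg by (intro mult_left_mono ge_one_powr_ge_zero) auto
      finally show ?thesis .
    qed
    then have "cmod (complex_of_real (\<Phi> y) * dil t (x - y) - complex_of_real (\<Phi> y) * dil t x) \<le> \<bar>\<Phi> y\<bar> * (2 * ?T * (norm y / t) powr (1/4))"
      unfolding right_diff_distrib[symmetric] norm_mult norm_of_real by (intro mult_left_mono) auto
    also have "2 * ?T * (norm y / t) powr (1/4) = 2 * K * t powr (- (real CARD('d) + 1/4)) * norm y powr (1/4)"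
    proof -
      have "t powr (- (real CARD('d) + 1/4)) = t powr (- real CARD('d)) / t powr (1/4)"
        by (simp add: powr_diff[symmetric] algebra_simps)
      then show ?thesis using t by (simp add: powr_divide)
    qed
    finally show "cmod (complex_of_real (\<Phi> y) * dil t (x - y) - complex_of_real (\<Phi> y) * dil t x) \<le> (2 * K * t powr (- (real CARD('d) + 1/4))) * (\<bar>\<Phi> y\<bar> * norm y powr (1/4))"
      by (simp add: mult_ac)
  qed (use mom K_nonneg in auto)
  also have "\<dots> = 2 * K * t powr (- (real CARD('d) + 1/4)) * (LINT y|lborel. \<bar>\<Phi> y\<bar> * norm y powr (1/4))"
    by simp
  finally show ?thesis .
qed

text \<open>
  For \<open>tR\<close> below \<open>|x|/2\<close> the average only sees values of \<open>\<Phi>\<close> at points comparable to \<open>x\<close>, and for larger \<open>t\<close>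
  the cancellation gives \<open>t\<^sup>-\<^sup>d\<^sup>-\<^sup>1\<^sup>/\<^sup>4\<close>, which is at most a multiple of \<open>|x|\<^sup>-\<^sup>d\<^sup>-\<^sup>1\<^sup>/\<^sup>4\<close>. The exponent drops from \<open>1/2\<close> to
  \<open>1/4\<close> so that the moment of order \<open>1/4\<close> is finite. In particular \<open>\<Phi>\<close> belongs to the Hardy class.
\<close>

lemma hardy_maximal_le_decay:
  fixes \<Phi> :: "real^'d \<Rightarrow> real"
  assumes meas [measurable]: "\<Phi> \<in> borel_measurable borel" and bound: "\<And>x. \<bar>\<Phi> x\<bar> \<le> C * decay (1/2) x"
    and mean: "(LINT x|lborel. \<Phi> x) = 0"
  obtains C' where "C' \<ge> 0" "\<And>x. hardy_maximal \<psi> \<Phi> x \<le> ennreal (C' * decay (1/4) x)"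
proof -
  have C0: "C \<ge> 0"
  proof -
    have "0 \<le> C * decay (1/2) (0 :: real^'d)" using bound[of 0] by (rule order_trans[OF abs_ge_zero])
    then show ?thesis using decay_pos[of "1/2" "0 :: real^'d"] by (simp add: zero_le_mult_iff)
  qed
  have \<Phi>: "integrable lborel \<Phi>"
    by (rule Bochner_Integration.integrable_bound[of _ "\<lambda>x. C * decay (1/2) x"])
       (use bound C0 in \<open>auto intro!: integrable_decay AE_I2 order_trans[OF bound]\<close>)
  have mult: "decay (1/2) y * norm y powr (1/4) \<le> decay (1/4) y" for y :: "real^'d"
  proof -
    have "decay (1/2) y * norm y powr (1/4) \<le> decay (1/2) y * max 1 (norm y) powr (1/4)"
      by (intro mult_left_mono powr_mono2) (auto simp: decay_def)
    also have "\<dots> = decay (1/4) y"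
      by (simp add: decay_def powr_add[symmetric] algebra_simps)
    finally show ?thesis .
  qed
  have momb: "\<bar>\<Phi> y\<bar> * norm y powr (1/4) \<le> C * decay (1/4) y" for y
  proof -
    have "\<bar>\<Phi> y\<bar> * norm y powr (1/4) \<le> (C * decay (1/2) y) * norm y powr (1/4)"
      by (intro mult_right_mono bound) auto
    also have "\<dots> \<le> C * decay (1/4) y"
      using mult_left_mono[OF mult C0, of y] by (simp add: mult.assoc)
    finally show ?thesis .
  qed
  have mom: "integrable lborel (\<lambda>y. \<bar>\<Phi> y\<bar> * norm y powr (1/4))"
    by (rule Bochner_Integration.integrable_bound[of _ "\<lambda>x. C * decay (1/4) x"])
       (auto intro!: integrable_decay AE_I2 order_trans[OF momb])
  define M where "M = (LINT y|lborel. \<bar>\<Phi> y\<bar> * norm y powr (1/4))"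
  have M0: "M \<ge> 0" unfolding M_def by (intro integral_nonneg_AE AE_I2) auto
  define A where "A = K * (2 * R) ^ CARD('d)"
  have A0: "A \<ge> 0" using K_nonneg R_pos by (simp add: A_def)
  let ?p = "real CARD('d) + 1/4"
  let ?q = "real CARD('d) + 1/2"
  define C' where "C' = C * 2 powr ?q * A + 2 * K * (2 * R) powr ?p * M"
  have t1: "C * A \<le> C * 2 powr ?q * A"
  proof -
    have "1 \<le> 2 powr ?q" by (rule ge_one_powr_ge_zero) auto
    then have "C * 1 * A \<le> C * 2 powr ?q * A" using C0 A0 by (intro mult_right_mono mult_left_mono)
    then show ?thesis by simp
  qed
  have t2: "0 \<le> 2 * K * (2 * R) powr ?p * M" using K_nonneg M0 by simp
  have C'1: "C * 2 powr ?q * A \<le> C'" "C * A \<le> C'" using t1 t2 unfolding C'_def by linarith+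
  have C'2: "2 * K * (2 * R) powr ?p * M \<le> C'" using C0 A0 by (simp add: C'_def)
  have avg: "cmod (LINT y|lborel. complex_of_real (\<Phi> y) * dil t (x - y)) \<le> C' * decay (1/4) x" if t: "t > 0" for t x
  proof (cases "norm x \<le> 1")
    case True
    have "\<bar>\<Phi> y\<bar> \<le> C" for y
    proof -
      have "max 1 (norm y) powr (- ?q) \<le> 1 powr (- ?q)"
        by (intro powr_mono2') auto
      then have "C * decay (1/2) y \<le> C * 1" using C0 unfolding decay_def by (intro mult_left_mono) auto
      then show ?thesis using bound[of y] by simp
    qed
    then have "cmod (LINT y|lborel. complex_of_real (\<Phi> y) * dil t (x - y)) \<le> C * A"
      unfolding A_def by (rule average_bound_local[OF t])
    also have "C * A \<le> C' * decay (1/4) x"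
      using True C'1 by (simp add: decay_def max_absorb1)
    finally show ?thesis .
  next
    case False
    then have x1: "norm x > 1" by simp
    have dx: "decay (1/4) x = norm x powr (- ?p)" using x1 by (simp add: decay_def max_absorb2)
    show ?thesis
    proof (cases "2 * (t * R) \<le> norm x")
      case near: True
      have "\<bar>\<Phi> y\<bar> \<le> C * 2 powr ?q * decay (1/4) x" if y: "norm (x - y) \<le> t * R" for y
      proof -
        have "norm x / 2 \<le> norm y"
          using near y norm_triangle_ineq[of "x - y" y] by simp
        then have "max 1 (norm y) powr (- ?q) \<le> (norm x / 2) powr (- ?q)"
          using x1 by (intro powr_mono2') auto
        also have "\<dots> = 2 powr ?q * norm x powr (- ?q)"
          using x1 by (intro powr_minus_divide) auto
        also have "\<dots> \<le> 2 powr ?q * norm x powr (- ?p)"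
          using x1 by (intro mult_left_mono powr_mono) auto
        finally have "C * decay (1/2) y \<le> C * (2 powr ?q * norm x powr (- ?p))"
          unfolding decay_def using C0 by (rule mult_left_mono)
        then show ?thesis using bound[of y] dx by (simp add: mult.assoc)
      qed
      then have "cmod (LINT y|lborel. complex_of_real (\<Phi> y) * dil t (x - y)) \<le> (C * 2 powr ?q * decay (1/4) x) * A"
        unfolding A_def by (rule average_bound_local[OF t])
      also have "\<dots> = (C * 2 powr ?q * A) * decay (1/4) x" by (simp add: mult_ac)
      also have "\<dots> \<le> C' * decay (1/4) x"
        by (intro mult_right_mono C'1 less_imp_le[OF decay_pos])
      finally show ?thesis .
    next
      case far: False
      have "cmod (LINT y|lborel. complex_of_real (\<Phi> y) * dil t (x - y)) \<le> 2 * K * t powr (- ?p) * M"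
        unfolding M_def by (rule average_bound_global[OF t \<Phi> mean mom])
      also have "t powr (- ?p) \<le> (norm x / (2 * R)) powr (- ?p)"
        using far x1 R_pos by (intro powr_mono2') (auto simp: field_simps)
      then have "2 * K * t powr (- ?p) * M \<le> 2 * K * (norm x / (2 * R)) powr (- ?p) * M"
        using K_nonneg M0 by (intro mult_right_mono mult_left_mono) auto
      also have "(norm x / (2 * R)) powr (- ?p) = (2 * R) powr ?p * decay (1/4) x"
        unfolding dx using x1 R_pos by (intro powr_minus_divide) auto
      also have "2 * K * ((2 * R) powr ?p * decay (1/4) x) * M = (2 * K * (2 * R) powr ?p * M) * decay (1/4) x"
        by (simp add: mult_ac)
      also have "\<dots> \<le> C' * decay (1/4) x"
        by (intro mult_right_mono C'2 less_imp_le[OF decay_pos])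
      finally show ?thesis .
    qed
  qed
  show ?thesis
  proof (rule that[of C'])
    show "C' \<ge> 0" using C'2 t2 by linarith
    show "hardy_maximal \<psi> \<Phi> x \<le> ennreal (C' * decay (1/4) x)" for x
      unfolding hardy_maximal_eq by (intro SUP_least ennreal_leI avg) auto
  qed
qed

end

section \<open>The heat semigroup and the Riesz potential\<close>

text \<open>
  The heat kernel in the parametrisation \<open>s = 4 \<times>\<close> time, without the constant that would give it integral one;
  its integral is \<open>heat_mass\<close> for every \<open>s > 0\<close>.
\<close>

definition heat :: "real \<Rightarrow> real^'d::finite \<Rightarrow> real" where
  "heat s x = s powr (- (real CARD('d) / 2)) * exp (- (norm x)\<^sup>2 / s)"

lemma heat_measurable [measurable]: "(\<lambda>p. heat (f p) (g p)) \<in> borel_measurable M"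
  if [measurable]: "f \<in> borel_measurable M" "g \<in> borel_measurable M"
  for g :: "'m \<Rightarrow> real^'d::finite"
  unfolding heat_def by measurable

lemma heat_nonneg [simp]: "heat s x \<ge> 0"
  by (simp add: heat_def)

lemma heat_pos: "s > 0 \<Longrightarrow> heat s x > 0"
  by (simp add: heat_def)

lemma exp_minus_le_powr: "u > 0 \<Longrightarrow> g > 0 \<Longrightarrow> exp (- u) \<le> g powr g * u powr (- (g::real))"
proof -
  assume ug: "u > 0" "g > 0"
  have "u / g \<le> exp (u / g)" using exp_ge_add_one_self[of "u / g"] by linarith
  then have "(u / g) powr g \<le> exp (u / g) powr g" using ug by (intro powr_mono2) auto
  also have "\<dots> = exp u" using ug by (simp add: powr_def)
  finally have "(u / g) powr g \<le> exp u" .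
  then have "exp (- u) \<le> inverse ((u / g) powr g)"
    using ug by (simp add: exp_minus le_imp_inverse_le)
  also have "\<dots> = (u / g) powr (- g)" by (simp add: powr_minus)
  also have "\<dots> = g powr g * u powr (- g)" using ug by (rule powr_minus_divide)
  finally show ?thesis .
qed

definition heat_const :: "nat \<Rightarrow> real" where
  "heat_const d = max 1 (((real d + 1/2) / 2) powr ((real d + 1/2) / 2))"

text \<open>
  With \<open>\<gamma> = (d + 1/2)/2\<close>, the inequality \<open>exp(-u) \<le> \<gamma>\<^sup>\<gamma> u\<^sup>-\<^sup>\<gamma>\<close> at \<open>u = |x|\<^sup>2/s\<close> gives the power \<open>|x|\<^sup>-\<^sup>d\<^sup>-\<^sup>1\<^sup>/\<^sup>2\<close> at the
  price of \<open>s\<^sup>1\<^sup>/\<^sup>4\<close>. That price is still integrable against \<open>s\<^sup>-\<^sup>3\<^sup>/\<^sup>2\<close> at infinity, as \<open>heat_tail_le\<close> requires.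
\<close>

lemma heat_le_decay:
  assumes s: "s \<ge> 1"
  shows "heat s (x :: real^'d::finite) \<le> heat_const CARD('d) * s powr (1/4) * decay (1/2) x"
proof (cases "norm x \<le> 1")
  case True
  have "s powr (- (real CARD('d) / 2)) \<le> s powr 0"
    using s by (intro powr_mono) auto
  then have "heat s x \<le> 1 * 1"
    unfolding heat_def using s by (intro mult_mono) auto
  also have "\<dots> \<le> heat_const CARD('d) * s powr (1/4)"
    using s by (intro mult_mono) (auto simp: heat_const_def intro!: ge_one_powr_ge_zero)
  finally show ?thesis using True by (simp add: decay_def max_absorb1)
next
  case False
  define g where "g = (real CARD('d) + 1/2) / 2"
  have g: "g > 0" by (simp add: g_def)
  have x: "norm x > 1" using False by simp
  have "exp (- ((norm x)\<^sup>2 / s)) \<le> g powr g * ((norm x)\<^sup>2 / s) powr (- g)"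
    using x s g by (intro exp_minus_le_powr divide_pos_pos) auto
  also have "((norm x)\<^sup>2 / s) powr (- g) = s powr g * ((norm x)\<^sup>2) powr (- g)"
    using x s by (intro powr_minus_divide) auto
  also have "((norm x)\<^sup>2) powr (- g) = norm x powr (- (real CARD('d) + 1/2))"
  proof -
    have "((norm x)\<^sup>2) powr (- g) = (norm x powr 2) powr (- g)" using x by simp
    also have "\<dots> = norm x powr (2 * (- g))" by (rule powr_powr)
    also have "2 * (- g) = - (real CARD('d) + 1/2)" by (simp add: g_def field_simps)
    finally show ?thesis .
  qed
  also have "\<dots> = decay (1/2) x" using x by (simp add: decay_def max_absorb2)
  finally have "heat s x \<le> s powr (- (real CARD('d) / 2)) * (g powr g * (s powr g * decay (1/2) x))"
    unfolding heat_def by (intro mult_left_mono) auto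
  also have "\<dots> = g powr g * (s powr (- (real CARD('d) / 2)) * s powr g) * decay (1/2) x" by (simp add: mult_ac)
  also have "s powr (- (real CARD('d) / 2)) * s powr g = s powr (1/4)"
    unfolding powr_add[symmetric] by (simp add: g_def field_simps)
  also have "g powr g * s powr (1/4) * decay (1/2) x \<le> heat_const CARD('d) * s powr (1/4) * decay (1/2) x"
    by (intro mult_right_mono less_imp_le[OF decay_pos]) (auto simp: heat_const_def g_def)
  finally show ?thesis .
qed

definition heat_mass :: "'d::finite itself \<Rightarrow> ennreal" where
  "heat_mass _ = (\<integral>\<^sup>+x. ennreal (heat 1 (x :: real^'d)) \<partial>lborel)"

lemma heat_mass_finite: "heat_mass TYPE('d::finite) < \<infinity>"
proof -
  have "heat_mass TYPE('d) \<le> (\<integral>\<^sup>+x. ennreal (heat_const CARD('d)) * ennreal (decay (1/2) (x :: real^'d)) \<partial>lborel)"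
    unfolding heat_mass_def
  proof (intro nn_integral_mono)
    fix x :: "real^'d"
    have "ennreal (heat 1 x) \<le> ennreal (heat_const CARD('d) * decay (1/2) x)"
      using heat_le_decay[of 1 x] by (intro ennreal_leI) simp
    then show "ennreal (heat 1 x) \<le> ennreal (heat_const CARD('d)) * ennreal (decay (1/2) x)"
      by (simp add: ennreal_mult' heat_const_def)
  qed
  also have "\<dots> = ennreal (heat_const CARD('d)) * (\<integral>\<^sup>+x. ennreal (decay (1/2) (x :: real^'d)) \<partial>lborel)"
    by (rule nn_integral_cmult) measurable
  also have "\<dots> < \<infinity>"
    using nn_integral_decay_finite[where 'd='d, of "1/2"] by (simp add: ennreal_mult_less_top)
  finally show ?thesis .
qed

lemma heat_mass_pos: "heat_mass TYPE('d::finite) > 0"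
proof (rule ccontr)
  assume "\<not> heat_mass TYPE('d) > 0"
  then have "(\<integral>\<^sup>+x. ennreal (heat 1 (x :: real^'d)) \<partial>lborel) = 0" by (simp add: heat_mass_def)
  then have "AE x in lborel. ennreal (heat 1 (x :: real^'d)) = 0"
    by (subst (asm) nn_integral_0_iff_AE) measurable
  then have "AE x in (lborel :: (real^'d) measure). False"
  proof eventually_elim
    case (elim x)
    then show False using heat_pos[of 1 x] by (simp add: ennreal_eq_0_iff)
  qed
  then have "emeasure (lborel :: (real^'d) measure) UNIV = 0"
    by (simp add: AE_iff_measurable[where N=UNIV])
  then show False by simp
qed

lemma nn_integral_heat:
  assumes s: "s > 0"
  shows "(\<integral>\<^sup>+x. ennreal (heat s (x - z :: real^'d::finite)) \<partial>lborel) = heat_mass TYPE('d)"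
proof -
  have "(\<integral>\<^sup>+x. ennreal (heat s (x - z :: real^'d)) \<partial>lborel) = ennreal (\<bar>sqrt s\<bar> ^ CARD('d)) * (\<integral>\<^sup>+x. ennreal (heat s (z + sqrt s *\<^sub>R x - z :: real^'d)) \<partial>lborel)"
    using s by (intro nn_integral_lborel_affine) auto
  also have "\<dots> = (\<integral>\<^sup>+x. ennreal (\<bar>sqrt s\<bar> ^ CARD('d)) * ennreal (heat s (z + sqrt s *\<^sub>R x - z :: real^'d)) \<partial>lborel)"
    by (rule nn_integral_cmult[symmetric]) measurable
  also have "\<dots> = heat_mass TYPE('d)"
    unfolding heat_mass_def
  proof (rule nn_integral_cong)
    fix x :: "real^'d"
    have "\<bar>sqrt s\<bar> ^ CARD('d) = s powr (real CARD('d) / 2)"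
      using s by (simp add: powr_half_sqrt[symmetric] powr_powr powr_realpow[symmetric])
    then have "\<bar>sqrt s\<bar> ^ CARD('d) * heat s (z + sqrt s *\<^sub>R x - z) = heat 1 x"
      using s by (simp add: heat_def power_mult_distrib powr_minus)
    then show "ennreal (\<bar>sqrt s\<bar> ^ CARD('d)) * ennreal (heat s (z + sqrt s *\<^sub>R x - z)) = ennreal (heat 1 x)"
      by (subst ennreal_mult[symmetric]) auto
  qed
  finally show ?thesis .
qed

text \<open>
  Completing the square in \<open>|y|\<^sup>2/s + |x - y|\<^sup>2/r\<close>. Integration over \<open>y\<close> gives the semigroup law.
\<close>

lemma heat_product:
  fixes x y :: "real^'d::finite"
  assumes s: "s > 0" and r: "r > 0"
  shows "heat s y * heat r (x - y) = heat (s + r) x * heat (s * r / (s + r)) (y - (s / (s + r)) *\<^sub>R x)"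
proof -
  let ?q = "s * r / (s + r)"
  have sr: "s + r > 0" using s r by simp
  have p: "s powr e * r powr e = (s + r) powr e * ?q powr e" for e
    using s r by (simp add: powr_mult[symmetric])
  have e: "- (norm y)\<^sup>2 / s + - (norm (x - y))\<^sup>2 / r = - (norm x)\<^sup>2 / (s + r) + - (norm (y - (s / (s + r)) *\<^sub>R x))\<^sup>2 / ?q"
  proof -
    define X Y Z where "X = x \<bullet> x" and "Y = y \<bullet> y" and "Z = x \<bullet> y"
    have 1: "(norm (x - y))\<^sup>2 = X - 2 * Z + Y" "(norm x)\<^sup>2 = X" "(norm y)\<^sup>2 = Y"
      by (simp_all add: power2_norm_eq_inner inner_diff_left inner_diff_right X_def Y_def Z_def inner_commute)
    have 2: "(norm (y - (s / (s + r)) *\<^sub>R x))\<^sup>2 = Y - 2 * (s / (s + r)) * Z + (s / (s + r))\<^sup>2 * X"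
      unfolding power2_norm_eq_inner X_def Y_def Z_def
      by (simp add: inner_diff_left inner_diff_right inner_commute power2_eq_square)
    have nz: "s \<noteq> 0" "r \<noteq> 0" "s + r \<noteq> 0" using s r by auto
    show ?thesis unfolding 1 2 using nz by (simp add: divide_simps power2_eq_square) (simp add: algebra_simps)
  qed
  have "heat s y * heat r (x - y) = (s powr (- (real CARD('d) / 2)) * r powr (- (real CARD('d) / 2))) * exp (- (norm y)\<^sup>2 / s + - (norm (x - y))\<^sup>2 / r)"
    unfolding heat_def exp_add by (simp only: mult_ac)
  also have "\<dots> = heat (s + r) x * heat ?q (y - (s / (s + r)) *\<^sub>R x)"
    unfolding p e unfolding heat_def exp_add by (simp only: mult_ac)
  finally show ?thesis .
qed

lemma heat_convolution:
  fixes x :: "real^'d::finite"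
  assumes s: "s > 0" and r: "r > 0"
  shows "(\<integral>\<^sup>+y. ennreal (heat s y) * ennreal (heat r (x - y)) \<partial>lborel) = heat_mass TYPE('d) * ennreal (heat (s + r) x)"
proof -
  have "(\<integral>\<^sup>+y. ennreal (heat s y) * ennreal (heat r (x - y)) \<partial>lborel) = (\<integral>\<^sup>+y. ennreal (heat (s + r) x) * ennreal (heat (s * r / (s + r)) (y - (s / (s + r)) *\<^sub>R x)) \<partial>lborel)"
    using heat_product[OF s r] by (intro nn_integral_cong) (simp add: ennreal_mult[symmetric])
  also have "\<dots> = ennreal (heat (s + r) x) * (\<integral>\<^sup>+y. ennreal (heat (s * r / (s + r)) (y - (s / (s + r)) *\<^sub>R x)) \<partial>lborel)"
    by (rule nn_integral_cmult) measurable
  also have "(\<integral>\<^sup>+y. ennreal (heat (s * r / (s + r)) (y - (s / (s + r)) *\<^sub>R x)) \<partial>lborel) = heat_mass TYPE('d)"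
    using s r by (intro nn_integral_heat) auto
  finally show ?thesis by (simp add: mult.commute)
qed

lemma nn_integral_three_halves: "(\<integral>\<^sup>+s. ennreal (1 / (2 * s * sqrt s)) * indicator {1..} s \<partial>lborel) = 1"
proof -
  have "(\<integral>\<^sup>+s. ennreal (1 / (2 * s * sqrt s)) * indicator {1..} s \<partial>lborel) = ennreal (0 - (- 1 / sqrt 1))"
  proof (rule nn_integral_FTC_atLeast[where F="\<lambda>s. - 1 / sqrt s"])
    show "((\<lambda>s. - 1 / sqrt s) has_real_derivative 1 / (2 * s * sqrt s)) (at s)" if "1 \<le> s" for s
      using that by (auto intro!: derivative_eq_intros simp: field_simps)
    show "((\<lambda>s. - 1 / sqrt s) \<longlongrightarrow> 0) at_top" by real_asymp
  qed auto
  then show ?thesis by simp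
qed

lemma nn_integral_five_quarters: "(\<integral>\<^sup>+s. ennreal (s powr (- 5/4)) * indicator {1..} s \<partial>lborel) = 4"
proof -
  have "(\<integral>\<^sup>+s. ennreal (s powr (- 5/4)) * indicator {1..} s \<partial>lborel) = ennreal (0 - (- 4 * 1 powr (- 1/4)))"
  proof (rule nn_integral_FTC_atLeast[where F="\<lambda>s. - 4 * s powr (- 1/4)"])
    show "((\<lambda>s. - 4 * s powr (- 1/4)) has_real_derivative s powr (- 5/4)) (at s)" if "1 \<le> s" for s
      using that by (auto intro!: derivative_eq_intros)
    show "((\<lambda>s::real. - 4 * s powr (- 1/4)) \<longlongrightarrow> 0) at_top" by real_asymp
  qed auto
  then show ?thesis by simp
qed

text \<open>
  The weight of the Gaussian of parameter \<open>\<rho>\<close> in the potential of the tail integral below.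
  An antiderivative is \<open>-(1/\<rho>) sqrt((\<rho> - s)/s)\<close>.
\<close>

lemma nn_integral_arcsine:
  assumes \<rho>: "\<rho> > 1"
  shows "(\<integral>\<^sup>+s. ennreal (1 / (2 * s * sqrt s) * (1 / sqrt (\<rho> - s))) * indicator {1..\<rho>} s \<partial>lborel) = ennreal (sqrt (\<rho> - 1) / \<rho>)"
proof -
  have "((\<lambda>s. 1 / (2 * s * sqrt s) * (1 / sqrt (\<rho> - s))) has_integral (- (1 / \<rho>) * sqrt ((\<rho> - \<rho>) / \<rho>) - - (1 / \<rho>) * sqrt ((\<rho> - 1) / 1))) {1..\<rho>}"
  proof (rule fundamental_theorem_of_calculus_interior)
    show "continuous_on {1..\<rho>} (\<lambda>s. - (1 / \<rho>) * sqrt ((\<rho> - s) / s))"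
      by (intro continuous_intros) auto
    show "((\<lambda>s. - (1 / \<rho>) * sqrt ((\<rho> - s) / s)) has_vector_derivative 1 / (2 * s * sqrt s) * (1 / sqrt (\<rho> - s))) (at s)" if "s \<in> {1<..<\<rho>}" for s
    proof -
      have s: "s > 0" "\<rho> - s > 0" using that by auto
      have q: "sqrt ((\<rho> - s) / s) = sqrt (\<rho> - s) / sqrt s" by (rule real_sqrt_divide)
      have p: "(\<rho> - s) / s > 0" using s by simp
      have D: "((\<lambda>s. (\<rho> - s) / s) has_real_derivative - (\<rho> / s\<^sup>2)) (at s)"
        using s by (auto intro!: derivative_eq_intros simp: field_simps power2_eq_square)
      have "((\<lambda>s. - (1 / \<rho>) * sqrt ((\<rho> - s) / s)) has_real_derivative - (1 / \<rho>) * (inverse (sqrt ((\<rho> - s) / s)) / 2 * (- (\<rho> / s\<^sup>2)))) (at s)"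
        by (intro DERIV_cmult DERIV_chain2[where f=sqrt, OF DERIV_real_sqrt[OF p] D])
      also have "- (1 / \<rho>) * (inverse (sqrt ((\<rho> - s) / s)) / 2 * (- (\<rho> / s\<^sup>2))) = sqrt s / (2 * s\<^sup>2 * sqrt (\<rho> - s))"
        unfolding q using s \<rho> by (simp add: field_simps)
      also have "\<dots> = 1 / (2 * s * sqrt s) * (1 / sqrt (\<rho> - s))"
        using s by (simp add: field_simps power2_eq_square)
      finally show ?thesis by (simp add: has_real_derivative_iff_has_vector_derivative)
    qed
  qed (use \<rho> in auto)
  then have "((\<lambda>s. 1 / (2 * s * sqrt s) * (1 / sqrt (\<rho> - s))) has_integral (sqrt (\<rho> - 1) / \<rho>)) {1..\<rho>}" by simp
  then show ?thesis
    by (intro nn_integral_has_integral_lebesgue') auto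
qed

text \<open>
  The singularity at \<open>1\<close> is of order \<open>(\<rho> - 1)\<^sup>-\<^sup>1\<^sup>/\<^sup>2\<close> and the decay at infinity of order \<open>\<rho>\<^sup>-\<^sup>3\<^sup>/\<^sup>2\<close>.
\<close>

lemma nn_integral_arctan_finite: "(\<integral>\<^sup>+\<rho>. ennreal (1 / (\<rho> * sqrt (\<rho> - 1))) * indicator {1<..} \<rho> \<partial>lborel) < \<infinity>"
proof -
  have i1: "(\<integral>\<^sup>+\<rho>. ennreal (1 / sqrt (\<rho> - 1)) * indicator {1..2} \<rho> \<partial>lborel) = ennreal 2"
  proof (intro nn_integral_has_integral_lebesgue')
    have "((\<lambda>\<rho>. 1 / sqrt (\<rho> - 1)) has_integral (2 * sqrt (2 - 1) - 2 * sqrt (1 - 1))) {1..2}"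
    proof (rule fundamental_theorem_of_calculus_interior)
      show "((\<lambda>\<rho>. 2 * sqrt (\<rho> - 1)) has_vector_derivative 1 / sqrt (\<rho> - 1)) (at \<rho>)" if "\<rho> \<in> {1<..<2}" for \<rho>
        using that unfolding has_real_derivative_iff_has_vector_derivative[symmetric]
        by (auto intro!: derivative_eq_intros simp: field_simps)
    qed (auto intro!: continuous_intros)
    then show "((\<lambda>\<rho>. 1 / sqrt (\<rho> - 1)) has_integral 2) {1..2}" by simp
  qed auto
  have "(\<integral>\<^sup>+\<rho>. ennreal (1 / (\<rho> * sqrt (\<rho> - 1))) * indicator {1<..} \<rho> \<partial>lborel) \<le>
    (\<integral>\<^sup>+\<rho>. ennreal (1 / sqrt (\<rho> - 1)) * indicator {1..2} \<rho> + 4 * (ennreal (1 / (2 * \<rho> * sqrt \<rho>)) * indicator {1..} \<rho>) \<partial>lborel)"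
  proof (rule nn_integral_mono)
    fix \<rho> :: real
    show "ennreal (1 / (\<rho> * sqrt (\<rho> - 1))) * indicator {1<..} \<rho> \<le> ennreal (1 / sqrt (\<rho> - 1)) * indicator {1..2} \<rho> + 4 * (ennreal (1 / (2 * \<rho> * sqrt \<rho>)) * indicator {1..} \<rho>)"
    proof (cases "1 < \<rho>")
      case True
      show ?thesis
      proof (cases "\<rho> \<le> 2")
        case True
        have "1 / (\<rho> * sqrt (\<rho> - 1)) \<le> 1 / sqrt (\<rho> - 1)"
          using \<open>1 < \<rho>\<close> by (intro divide_left_mono) auto
        then have "ennreal (1 / (\<rho> * sqrt (\<rho> - 1))) * indicator {1<..} \<rho> \<le> ennreal (1 / sqrt (\<rho> - 1)) * indicator {1..2} \<rho> + 0"
          using True \<open>1 < \<rho>\<close> by (simp add: ennreal_leI)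
        also have "\<dots> \<le> ennreal (1 / sqrt (\<rho> - 1)) * indicator {1..2} \<rho> + 4 * (ennreal (1 / (2 * \<rho> * sqrt \<rho>)) * indicator {1..} \<rho>)"
          by (rule add_left_mono) simp
        finally show ?thesis .
      next
        case False
        have "sqrt \<rho> \<le> sqrt (4 * (\<rho> - 1))" using False by (intro real_sqrt_le_mono) auto
        also have "\<dots> = 2 * sqrt (\<rho> - 1)" by (subst real_sqrt_mult) simp
        finally have "1 / (\<rho> * sqrt (\<rho> - 1)) \<le> 4 * (1 / (2 * \<rho> * sqrt \<rho>))"
          using False by (simp add: field_simps)
        then have "ennreal (1 / (\<rho> * sqrt (\<rho> - 1))) \<le> ennreal (4 * (1 / (2 * \<rho> * sqrt \<rho>)))"
          by (rule ennreal_leI)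
        also have "\<dots> = 4 * ennreal (1 / (2 * \<rho> * sqrt \<rho>))"
          using False by (subst ennreal_mult) auto
        finally show ?thesis using False by simp
      qed
    qed simp
  qed
  also have "\<dots> = (\<integral>\<^sup>+\<rho>. ennreal (1 / sqrt (\<rho> - 1)) * indicator {1..2} \<rho> \<partial>lborel) + 4 * (\<integral>\<^sup>+\<rho>. ennreal (1 / (2 * \<rho> * sqrt \<rho>)) * indicator {1..} \<rho> \<partial>lborel)"
    by (subst nn_integral_add) (auto simp: nn_integral_cmult)
  also have "\<dots> < \<infinity>"
    unfolding i1 nn_integral_three_halves by simp
  finally show ?thesis .
qed

lemma indicator_greaterThan_measurable [measurable (raw)]:
  fixes f g :: "'m \<Rightarrow> real"
  assumes [measurable]: "f \<in> borel_measurable M" "g \<in> borel_measurable M"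
  shows "(\<lambda>p. indicator {f p<..} (g p) :: ennreal) \<in> borel_measurable M"
  unfolding indicator_def greaterThan_iff by measurable

definition subord_const :: "nat \<Rightarrow> ennreal" where
  "subord_const d = (\<integral>\<^sup>+r. ennreal (1 / sqrt r * r powr (- (real d / 2)) * exp (- 1 / r)) * indicator {0<..} r \<partial>lborel)"

lemma subord_const_finite: "d \<ge> 2 \<Longrightarrow> subord_const d < \<infinity>"
proof -
  assume d: "d \<ge> 2"
  define g where "g = (real d + 1) / 2"
  have g: "g > 0" by (simp add: g_def)
  have le: "ennreal (1 / sqrt r * r powr (- (real d / 2)) * exp (- 1 / r)) * indicator {0<..} r \<le> ennreal (g powr g) * indicator {0..1} r + 2 * (ennreal (1 / (2 * r * sqrt r)) * indicator {1..} r)" for r :: real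
  proof (cases "r > 0")
    case r: True
    have sq: "1 / sqrt r = r powr (- (1/2))" using r by (simp add: powr_minus powr_half_sqrt inverse_eq_divide)
    have w: "1 / sqrt r * r powr (- (real d / 2)) = r powr (- g)"
    proof -
      have "- (1/2) + - (real d / 2) = - g" by (simp add: g_def add_divide_distrib)
      then show ?thesis unfolding sq powr_add[symmetric] by simp
    qed
    show ?thesis
    proof (cases "r \<le> 1")
      case True
      have "exp (- (1 / r)) \<le> g powr g * (1 / r) powr (- g)"
        using r g by (intro exp_minus_le_powr) auto
      also have "(1 / r) powr (- g) = r powr g" using r by (subst powr_minus_divide) auto
      finally have "r powr (- g) * exp (- 1 / r) \<le> r powr (- g) * (g powr g * r powr g)"
        by (intro mult_left_mono) auto
      also have "\<dots> = g powr g" using r by (simp add: powr_minus)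
      finally have "ennreal (1 / sqrt r * r powr (- (real d / 2)) * exp (- 1 / r)) \<le> ennreal (g powr g) + 0"
        unfolding w by (simp add: ennreal_leI)
      also have "\<dots> \<le> ennreal (g powr g) + 2 * (ennreal (1 / (2 * r * sqrt r)) * indicator {1..} r)"
        by (rule add_left_mono) simp
      finally show ?thesis using r True by simp
    next
      case False
      have "r powr (- g) \<le> r powr (- (3/2))" using False d by (intro powr_mono) (auto simp: g_def)
      also have "\<dots> = 1 / (r * sqrt r)"
      proof -
        have "r powr (3/2) = r powr 1 * r powr (1/2)" unfolding powr_add[symmetric] by simp
        then show ?thesis using r by (simp add: powr_minus powr_half_sqrt inverse_eq_divide)
      qed
      also have "exp (- 1 / r) \<le> 1" using r by simp
      ultimately have "r powr (- g) * exp (- 1 / r) \<le> 1 / (r * sqrt r) * 1"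
        using r by (intro mult_mono) auto
      also have "\<dots> = 2 * (1 / (2 * r * sqrt r))" by simp
      finally have "ennreal (1 / sqrt r * r powr (- (real d / 2)) * exp (- 1 / r)) \<le> ennreal (2 * (1 / (2 * r * sqrt r)))"
        unfolding w by (rule ennreal_leI)
      also have "\<dots> = 2 * ennreal (1 / (2 * r * sqrt r))" using r by (subst ennreal_mult) auto
      finally show ?thesis using False by simp
    qed
  qed simp
  have "subord_const d \<le> (\<integral>\<^sup>+r. ennreal (g powr g) * indicator {0..1} r + 2 * (ennreal (1 / (2 * r * sqrt r)) * indicator {1..} r) \<partial>lborel)"
    unfolding subord_const_def by (intro nn_integral_mono le)
  also have "\<dots> = (\<integral>\<^sup>+r. ennreal (g powr g) * indicator {0..1::real} r \<partial>lborel) + 2 * (\<integral>\<^sup>+r. ennreal (1 / (2 * r * sqrt r)) * indicator {1..} r \<partial>lborel)"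
    by (subst nn_integral_add) (auto simp: nn_integral_cmult)
  also have "\<dots> < \<infinity>"
    unfolding nn_integral_three_halves by (subst nn_integral_cmult_indicator) auto
  finally show ?thesis .
qed

lemma subord_const_pos: "subord_const d > 0"
proof (rule ccontr)
  assume "\<not> subord_const d > 0"
  then have "(\<integral>\<^sup>+r. ennreal (1 / sqrt r * r powr (- (real d / 2)) * exp (- 1 / r)) * indicator {0<..} r \<partial>lborel) = 0" by (simp add: subord_const_def)
  then have "AE r in lborel. ennreal (1 / sqrt r * r powr (- (real d / 2)) * exp (- 1 / r)) * indicator {0<..} r = 0"
    by (subst (asm) nn_integral_0_iff_AE) measurable
  then have "AE r in lborel. r \<notin> {0<..<1::real}"
  proof eventually_elim
    case (elim r)
    show ?case
    proof
      assume r: "r \<in> {0<..<1}"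
      then have "1 / sqrt r * r powr (- (real d / 2)) * exp (- 1 / r) > 0" by simp
      then show False using elim r by (simp add: ennreal_eq_0_iff)
    qed
  qed
  then have "emeasure lborel {0<..<1::real} = 0"
    by (subst (asm) AE_iff_measurable[where N="{0<..<1}"]) auto
  then show False by simp
qed

text \<open>
  The substitution \<open>r \<mapsto> |x|\<^sup>2 r\<close>: the Riesz kernel is a superposition of heat kernels, the inverse
  Fourier transform of \<open>|\<xi>|\<^sup>-\<^sup>1 = c \<integral> t\<^sup>-\<^sup>1\<^sup>/\<^sup>2 exp(-t|\<xi>|\<^sup>2) dt\<close>.
\<close>

lemma subordination:
  fixes x :: "real^'d::finite"
  assumes x: "x \<noteq> 0"
  shows "(\<integral>\<^sup>+r. ennreal (1 / sqrt r * heat r x) * indicator {0<..} r \<partial>lborel) = subord_const CARD('d) * ennreal (norm x powr (1 - real CARD('d)))"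
proof -
  define c where "c = (norm x)\<^sup>2"
  have c: "c > 0" using x by (simp add: c_def)
  let ?e = "real CARD('d) / 2"
  have "(\<integral>\<^sup>+r. ennreal (1 / sqrt r * heat r x) * indicator {0<..} r \<partial>lborel) = \<bar>c\<bar> * (\<integral>\<^sup>+r. ennreal (1 / sqrt (0 + c * r) * heat (0 + c * r) x) * indicator {0<..} (0 + c * r) \<partial>lborel)"
    using c by (intro nn_integral_real_affine) auto
  also have "\<dots> = (\<integral>\<^sup>+r. ennreal c * (ennreal (1 / sqrt (0 + c * r) * heat (0 + c * r) x) * indicator {0<..} (0 + c * r)) \<partial>lborel)"
    using c by (subst nn_integral_cmult) auto
  also have "\<dots> = (\<integral>\<^sup>+r. ennreal (norm x powr (1 - real CARD('d))) * (ennreal (1 / sqrt r * r powr (- ?e) * exp (- 1 / r)) * indicator {0<..} r) \<partial>lborel)"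
  proof (rule nn_integral_cong)
    fix r :: real
    show "ennreal c * (ennreal (1 / sqrt (0 + c * r) * heat (0 + c * r) x) * indicator {0<..} (0 + c * r)) = ennreal (norm x powr (1 - real CARD('d))) * (ennreal (1 / sqrt r * r powr (- ?e) * exp (- 1 / r)) * indicator {0<..} r)"
    proof (cases "r > 0")
      case True
      have h: "heat (c * r) x = c powr (- ?e) * r powr (- ?e) * exp (- 1 / r)"
        using c True by (simp add: heat_def powr_mult c_def[symmetric])
      have sc: "sqrt (c * r) = norm x * sqrt r"
        by (simp add: real_sqrt_mult c_def)
      have "c powr (- ?e) = (norm x powr 2) powr (- ?e)" using x by (simp add: c_def)
      also have "\<dots> = norm x powr (2 * (- ?e))" by (rule powr_powr)
      also have "2 * (- ?e) = - real CARD('d)" by simp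
      finally have pc: "c powr (- ?e) = norm x powr (- real CARD('d))" .
      have "norm x powr (1 - real CARD('d)) = norm x powr 1 * norm x powr (- real CARD('d))"
        unfolding powr_add[symmetric] by simp
      then have px: "norm x powr (1 - real CARD('d)) = norm x * norm x powr (- real CARD('d))" by simp
      have "c * (1 / sqrt (c * r) * heat (c * r) x) = norm x powr (1 - real CARD('d)) * (1 / sqrt r * r powr (- ?e) * exp (- 1 / r))"
        unfolding h sc pc px using x True by (simp add: c_def power2_eq_square)
      then show ?thesis
        using True c by (simp add: ennreal_mult'[symmetric] del: times_divide_eq_left times_divide_eq_right)
    next
      case False
      then have "\<not> 0 < c * r" using c by (simp add: zero_less_mult_iff)
      then show ?thesis using False by simp
    qed
  qed
  also have "\<dots> = ennreal (norm x powr (1 - real CARD('d))) * subord_const CARD('d)"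
    unfolding subord_const_def by (rule nn_integral_cmult) measurable
  finally show ?thesis by (simp add: mult.commute)
qed

text \<open>
  The potential of a nonnegative function, without its constant and with values in \<open>[0, \<infinity>]\<close>, so that
  Fubini needs no integrability.
\<close>

definition riesz_nn :: "(real^'d::finite \<Rightarrow> ennreal) \<Rightarrow> real^'d \<Rightarrow> ennreal" where
  "riesz_nn u x = (\<integral>\<^sup>+y. u y * ennreal (norm (x - y) powr (1 - real CARD('d))) \<partial>lborel)"

text \<open>
  By subordination and the semigroup law, the potential of the heat kernel at \<open>s\<close> is the superposition of the
  heat kernels at \<open>\<rho> > s\<close> with weight \<open>(\<rho> - s)\<^sup>-\<^sup>1\<^sup>/\<^sup>2\<close>.
\<close>

lemma riesz_nn_heat:
  fixes x :: "real^'d::finite"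
  assumes s: "s > 0"
  shows "subord_const CARD('d) * riesz_nn (\<lambda>y. ennreal (heat s y)) x =
    heat_mass TYPE('d) * (\<integral>\<^sup>+\<rho>. ennreal (1 / sqrt (\<rho> - s) * heat \<rho> x) * indicator {s<..} \<rho> \<partial>lborel)"
proof -
  have "subord_const CARD('d) * riesz_nn (\<lambda>y. ennreal (heat s y)) x = (\<integral>\<^sup>+y. subord_const CARD('d) * (ennreal (heat s y) * ennreal (norm (x - y) powr (1 - real CARD('d)))) \<partial>lborel)"
    unfolding riesz_nn_def by (rule nn_integral_cmult[symmetric]) measurable
  also have "\<dots> = (\<integral>\<^sup>+y. (\<integral>\<^sup>+r. ennreal (heat s y) * (ennreal (1 / sqrt r * heat r (x - y)) * indicator {0<..} r) \<partial>lborel) \<partial>lborel)"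
  proof (rule nn_integral_cong_AE)
    show "AE y in lborel. subord_const CARD('d) * (ennreal (heat s y) * ennreal (norm (x - y) powr (1 - real CARD('d)))) = (\<integral>\<^sup>+r. ennreal (heat s y) * (ennreal (1 / sqrt r * heat r (x - y)) * indicator {0<..} r) \<partial>lborel)"
      using AE_lborel_singleton[of x]
    proof eventually_elim
      case (elim y)
      then have "x - y \<noteq> 0" by simp
      note sub = subordination[OF this]
      have "(\<integral>\<^sup>+r. ennreal (heat s y) * (ennreal (1 / sqrt r * heat r (x - y)) * indicator {0<..} r) \<partial>lborel) = ennreal (heat s y) * (\<integral>\<^sup>+r. ennreal (1 / sqrt r * heat r (x - y)) * indicator {0<..} r \<partial>lborel)"
        by (rule nn_integral_cmult) measurable
      then show ?case unfolding sub by (simp only: mult_ac)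
    qed
  qed
  also have "\<dots> = (\<integral>\<^sup>+r. (\<integral>\<^sup>+y. ennreal (heat s y) * (ennreal (1 / sqrt r * heat r (x - y)) * indicator {0<..} r) \<partial>lborel) \<partial>lborel)"
  proof -
    show ?thesis by (rule lborel_pair.Fubini') measurable
  qed
  also have "\<dots> = (\<integral>\<^sup>+r. heat_mass TYPE('d) * (ennreal (1 / sqrt r * heat (s + r) x) * indicator {0<..} r) \<partial>lborel)"
  proof (rule nn_integral_cong)
    fix r :: real
    show "(\<integral>\<^sup>+y. ennreal (heat s y) * (ennreal (1 / sqrt r * heat r (x - y)) * indicator {0<..} r) \<partial>lborel) = heat_mass TYPE('d) * (ennreal (1 / sqrt r * heat (s + r) x) * indicator {0<..} r)"
    proof (cases "r > 0")
      case True
      have m: "ennreal (1 / sqrt r * z) = ennreal (1 / sqrt r) * ennreal z" for z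
        using True by (intro ennreal_mult') auto
      have "(\<integral>\<^sup>+y. ennreal (heat s y) * (ennreal (1 / sqrt r * heat r (x - y)) * indicator {0<..} r) \<partial>lborel) = (\<integral>\<^sup>+y. ennreal (1 / sqrt r) * (ennreal (heat s y) * ennreal (heat r (x - y))) \<partial>lborel)"
        using True unfolding m by (intro nn_integral_cong) (simp add: mult_ac)
      also have "\<dots> = ennreal (1 / sqrt r) * (\<integral>\<^sup>+y. ennreal (heat s y) * ennreal (heat r (x - y)) \<partial>lborel)"
        by (rule nn_integral_cmult) measurable
      also have "\<dots> = ennreal (1 / sqrt r) * (heat_mass TYPE('d) * ennreal (heat (s + r) x))"
        unfolding heat_convolution[OF s True] ..
      finally show ?thesis using True unfolding m by (simp add: mult_ac)
    qed simp
  qed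
  also have "\<dots> = heat_mass TYPE('d) * (\<integral>\<^sup>+r. ennreal (1 / sqrt r * heat (s + r) x) * indicator {0<..} r \<partial>lborel)"
    by (rule nn_integral_cmult) measurable
  also have "(\<integral>\<^sup>+r. ennreal (1 / sqrt r * heat (s + r) x) * indicator {0<..} r \<partial>lborel) = (\<integral>\<^sup>+\<rho>. ennreal (1 / sqrt (\<rho> - s) * heat \<rho> x) * indicator {s<..} \<rho> \<partial>lborel)"
  proof -
    have "(\<integral>\<^sup>+\<rho>. ennreal (1 / sqrt (\<rho> - s) * heat \<rho> x) * indicator {s<..} \<rho> \<partial>lborel) = ennreal \<bar>1\<bar> * (\<integral>\<^sup>+r. ennreal (1 / sqrt (s + 1 * r - s) * heat (s + 1 * r) x) * indicator {s<..} (s + 1 * r) \<partial>lborel)"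
      by (rule nn_integral_real_affine) auto
    also have "\<dots> = (\<integral>\<^sup>+r. ennreal (1 / sqrt r * heat (s + r) x) * indicator {0<..} r \<partial>lborel)"
      by (simp, intro nn_integral_cong) (auto simp: indicator_def)
    finally show ?thesis by simp
  qed
  finally show ?thesis .
qed

definition heat_tail :: "real^'d::finite \<Rightarrow> ennreal" where
  "heat_tail x = (\<integral>\<^sup>+s. ennreal (1 / (2 * s * sqrt s)) * ennreal (heat s x) * indicator {1..} s \<partial>lborel)"

lemma heat_tail_measurable [measurable]: "heat_tail \<in> borel_measurable borel"
  unfolding heat_tail_def[abs_def] by measurable

lemma riesz_nn_heat_tail:
  fixes x :: "real^'d::finite"
  shows "subord_const CARD('d) * riesz_nn heat_tail x =
    heat_mass TYPE('d) * (\<integral>\<^sup>+\<rho>. ennreal (sqrt (\<rho> - 1) / \<rho> * heat \<rho> x) * indicator {1<..} \<rho> \<partial>lborel)"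
proof -
  let ?w = "\<lambda>s. ennreal (1 / (2 * s * sqrt s)) * indicator {1..} s"
  let ?k = "\<lambda>y. ennreal (norm (x - y) powr (1 - real CARD('d)))"
  have "riesz_nn heat_tail x = (\<integral>\<^sup>+y. (\<integral>\<^sup>+s. ?w s * (ennreal (heat s y) * ?k y) \<partial>lborel) \<partial>lborel)"
    unfolding riesz_nn_def heat_tail_def
    by (intro nn_integral_cong, subst nn_integral_multc[symmetric]) (auto intro!: nn_integral_cong simp: mult_ac)
  also have "\<dots> = (\<integral>\<^sup>+s. (\<integral>\<^sup>+y. ?w s * (ennreal (heat s y) * ?k y) \<partial>lborel) \<partial>lborel)"
  proof -
    show ?thesis by (rule lborel_pair.Fubini') measurable
  qed
  also have "\<dots> = (\<integral>\<^sup>+s. ?w s * riesz_nn (\<lambda>y. ennreal (heat s y)) x \<partial>lborel)"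
    unfolding riesz_nn_def by (intro nn_integral_cong nn_integral_cmult) measurable
  finally have "subord_const CARD('d) * riesz_nn heat_tail x = subord_const CARD('d) * (\<integral>\<^sup>+s. ?w s * riesz_nn (\<lambda>y. ennreal (heat s y)) x \<partial>lborel)"
    by simp
  also have "\<dots> = (\<integral>\<^sup>+s. subord_const CARD('d) * (?w s * riesz_nn (\<lambda>y. ennreal (heat s y)) x) \<partial>lborel)"
    by (rule nn_integral_cmult[symmetric]) (unfold riesz_nn_def, measurable)
  also have "\<dots> = (\<integral>\<^sup>+s. heat_mass TYPE('d) * (\<integral>\<^sup>+\<rho>. ?w s * (ennreal (1 / sqrt (\<rho> - s) * heat \<rho> x) * indicator {s<..} \<rho>) \<partial>lborel) \<partial>lborel)"
  proof (rule nn_integral_cong)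
    fix s :: real
    show "subord_const CARD('d) * (?w s * riesz_nn (\<lambda>y. ennreal (heat s y)) x) = heat_mass TYPE('d) * (\<integral>\<^sup>+\<rho>. ?w s * (ennreal (1 / sqrt (\<rho> - s) * heat \<rho> x) * indicator {s<..} \<rho>) \<partial>lborel)"
    proof (cases "s \<ge> 1")
      case True
      have "(\<integral>\<^sup>+\<rho>. ?w s * (ennreal (1 / sqrt (\<rho> - s) * heat \<rho> x) * indicator {s<..} \<rho>) \<partial>lborel) = ?w s * (\<integral>\<^sup>+\<rho>. ennreal (1 / sqrt (\<rho> - s) * heat \<rho> x) * indicator {s<..} \<rho> \<partial>lborel)"
        by (rule nn_integral_cmult) measurable
      moreover have "subord_const CARD('d) * (?w s * riesz_nn (\<lambda>y. ennreal (heat s y)) x) = ?w s * (subord_const CARD('d) * riesz_nn (\<lambda>y. ennreal (heat s y)) x)"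
        by (simp only: mult_ac)
      ultimately show ?thesis
        using riesz_nn_heat[of s x] True by (simp only: mult_ac)
    qed simp
  qed
  also have "\<dots> = heat_mass TYPE('d) * (\<integral>\<^sup>+s. (\<integral>\<^sup>+\<rho>. ?w s * (ennreal (1 / sqrt (\<rho> - s) * heat \<rho> x) * indicator {s<..} \<rho>) \<partial>lborel) \<partial>lborel)"
    by (rule nn_integral_cmult) measurable
  also have "(\<integral>\<^sup>+s. (\<integral>\<^sup>+\<rho>. ?w s * (ennreal (1 / sqrt (\<rho> - s) * heat \<rho> x) * indicator {s<..} \<rho>) \<partial>lborel) \<partial>lborel) = (\<integral>\<^sup>+\<rho>. (\<integral>\<^sup>+s. ?w s * (ennreal (1 / sqrt (\<rho> - s) * heat \<rho> x) * indicator {s<..} \<rho>) \<partial>lborel) \<partial>lborel)"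
    by (rule lborel_pair.Fubini') measurable
  also have "\<dots> = (\<integral>\<^sup>+\<rho>. ennreal (sqrt (\<rho> - 1) / \<rho> * heat \<rho> x) * indicator {1<..} \<rho> \<partial>lborel)"
  proof (rule nn_integral_cong)
    fix \<rho> :: real
    show "(\<integral>\<^sup>+s. ?w s * (ennreal (1 / sqrt (\<rho> - s) * heat \<rho> x) * indicator {s<..} \<rho>) \<partial>lborel) = ennreal (sqrt (\<rho> - 1) / \<rho> * heat \<rho> x) * indicator {1<..} \<rho>"
    proof (cases "\<rho> > 1")
      case True
      have "(\<integral>\<^sup>+s. ?w s * (ennreal (1 / sqrt (\<rho> - s) * heat \<rho> x) * indicator {s<..} \<rho>) \<partial>lborel) = (\<integral>\<^sup>+s. ennreal (heat \<rho> x) * (ennreal (1 / (2 * s * sqrt s) * (1 / sqrt (\<rho> - s))) * indicator {1..\<rho>} s) \<partial>lborel)"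
      proof (rule nn_integral_cong)
        fix s :: real
        show "?w s * (ennreal (1 / sqrt (\<rho> - s) * heat \<rho> x) * indicator {s<..} \<rho>) = ennreal (heat \<rho> x) * (ennreal (1 / (2 * s * sqrt s) * (1 / sqrt (\<rho> - s))) * indicator {1..\<rho>} s)"
        proof (cases "1 \<le> s \<and> s < \<rho>")
          case True
          then have "0 \<le> 1 / (2 * s * sqrt s)" "0 \<le> 1 / sqrt (\<rho> - s)" by auto
          then show ?thesis
            using True by (simp add: ennreal_mult mult_ac del: times_divide_eq_left times_divide_eq_right divide_divide_eq_left divide_divide_eq_right)
        next
          case False
          then have "s < 1 \<or> s = \<rho> \<or> s > \<rho>" by auto
          then show ?thesis by (auto simp: indicator_def)
        qed
      qed
      also have "\<dots> = ennreal (heat \<rho> x) * ennreal (sqrt (\<rho> - 1) / \<rho>)"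
        by (subst nn_integral_cmult) (use nn_integral_arcsine[OF True] in auto)
      also have "\<dots> = ennreal (sqrt (\<rho> - 1) / \<rho> * heat \<rho> x)"
        using True by (subst ennreal_mult[symmetric]) (auto simp: mult.commute)
      finally show ?thesis using True by simp
    next
      case False
      then have z: "?w s * (ennreal (1 / sqrt (\<rho> - s) * heat \<rho> x) * indicator {s<..} \<rho>) = 0" for s
        by (auto simp: indicator_def)
      show ?thesis unfolding z using False by simp
    qed
  qed
  finally show ?thesis .
qed

lemma heat_const_ge_1: "heat_const d \<ge> 1"
  by (simp add: heat_const_def)

lemma heat_tail_le: "heat_tail (x :: real^'d::finite) \<le> ennreal (2 * heat_const CARD('d) * decay (1/2) x)"
proof -
  let ?C = "heat_const CARD('d) * decay (1/2) x"
  have C: "?C \<ge> 0" using heat_const_ge_1[of "CARD('d)"] decay_pos[of "1/2" x] by (intro mult_nonneg_nonneg) auto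
  have "heat_tail x \<le> (\<integral>\<^sup>+s. ennreal (?C / 2) * (ennreal (s powr (- 5/4)) * indicator {1..} s) \<partial>lborel)"
    unfolding heat_tail_def
  proof (rule nn_integral_mono)
    fix s :: real
    show "ennreal (1 / (2 * s * sqrt s)) * ennreal (heat s x) * indicator {1..} s \<le> ennreal (?C / 2) * (ennreal (s powr (- 5/4)) * indicator {1..} s)"
    proof (cases "s \<ge> 1")
      case True
      have p: "1 / (s * sqrt s) * s powr (1/4) = s powr (- 5/4)"
      proof -
        have "1 / (s * sqrt s) = s powr (- 3/2)"
        proof -
          have "s powr (3/2) = s powr 1 * s powr (1/2)" unfolding powr_add[symmetric] by simp
          then show ?thesis using True by (simp add: powr_minus powr_half_sqrt inverse_eq_divide)
        qed
        then have "1 / (s * sqrt s) * s powr (1/4) = s powr (- 3/2 + 1/4)" unfolding powr_add by simp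
        then show ?thesis by simp
      qed
      have "1 / (2 * s * sqrt s) * heat s x \<le> 1 / (2 * s * sqrt s) * (heat_const CARD('d) * s powr (1/4) * decay (1/2) x)"
        using True by (intro mult_left_mono heat_le_decay) auto
      also have "\<dots> = ?C / 2 * (1 / (s * sqrt s) * s powr (1/4))" by (simp add: mult_ac)
      finally have "1 / (2 * s * sqrt s) * heat s x \<le> ?C / 2 * s powr (- 5/4)" unfolding p .
      then have "ennreal (1 / (2 * s * sqrt s) * heat s x) \<le> ennreal (?C / 2 * s powr (- 5/4))" by (rule ennreal_leI)
      then show ?thesis using True C
        by (subst (asm) (1 2) ennreal_mult) auto
    qed simp
  qed
  also have "\<dots> = ennreal (?C / 2) * 4"
    by (subst nn_integral_cmult) (use nn_integral_five_quarters in auto)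
  also have "\<dots> = ennreal (?C / 2 * 4)"
    using C by (subst ennreal_mult) auto
  finally show ?thesis by (simp add: mult.assoc)
qed

lemma nn_integral_heat_tail: "(\<integral>\<^sup>+x. heat_tail (x :: real^'d::finite) \<partial>lborel) = heat_mass TYPE('d)"
proof -
  have "(\<integral>\<^sup>+x. heat_tail (x :: real^'d) \<partial>lborel) = (\<integral>\<^sup>+s. (\<integral>\<^sup>+x. ennreal (1 / (2 * s * sqrt s)) * ennreal (heat s (x :: real^'d)) * indicator {1..} s \<partial>lborel) \<partial>lborel)"
    unfolding heat_tail_def by (rule lborel_pair.Fubini') measurable
  also have "\<dots> = (\<integral>\<^sup>+s. heat_mass TYPE('d) * (ennreal (1 / (2 * s * sqrt s)) * indicator {1..} s) \<partial>lborel)"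
  proof (rule nn_integral_cong)
    fix s :: real
    show "(\<integral>\<^sup>+x. ennreal (1 / (2 * s * sqrt s)) * ennreal (heat s (x :: real^'d)) * indicator {1..} s \<partial>lborel) = heat_mass TYPE('d) * (ennreal (1 / (2 * s * sqrt s)) * indicator {1..} s)"
    proof (cases "s \<ge> 1")
      case True
      have "(\<integral>\<^sup>+x. ennreal (1 / (2 * s * sqrt s)) * ennreal (heat s (x :: real^'d)) \<partial>lborel) = ennreal (1 / (2 * s * sqrt s)) * (\<integral>\<^sup>+x. ennreal (heat s (x :: real^'d)) \<partial>lborel)"
        by (rule nn_integral_cmult) measurable
      then show ?thesis using True nn_integral_heat[of s "0 :: real^'d"] by (simp add: mult.commute)
    qed simp
  qed
  also have "\<dots> = heat_mass TYPE('d) * 1"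
    by (subst nn_integral_cmult) (use nn_integral_three_halves in auto)
  finally show ?thesis by simp
qed

text \<open>
  The function \<open>p\<^sub>1 - \<integral> p\<^sub>s dm(s)\<close> for the heat kernels \<open>p\<^sub>s\<close> and the probability measure
  \<open>dm = ds/(2s\<^sup>3\<^sup>/\<^sup>2)\<close> on \<open>[1, \<infinity>)\<close>. All \<open>p\<^sub>s\<close> have the same integral, so it has mean zero, as a
  function in the Hardy class must. A compactly supported function could not serve: if its potential were
  nonnegative, the odd dipole term at infinity would vanish, and the potential would be integrable with the integral
  \<open>0\<close>, the limit of the Fourier transform divided by \<open>|\<xi>|\<close> at the origin. In the potential the Gaussian of parameter \<open>\<rho>\<close> gets the coefficient
  \<open>(\<rho> - 1)\<^sup>-\<^sup>1\<^sup>/\<^sup>2 - (\<rho> - 1)\<^sup>1\<^sup>/\<^sup>2/\<rho> = 1/(\<rho>(\<rho> - 1)\<^sup>1\<^sup>/\<^sup>2) > 0\<close>.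
\<close>

definition mother :: "real^'d::finite \<Rightarrow> real" where
  "mother x = heat 1 x - enn2real (heat_tail x)"

lemma mother_measurable [measurable]: "mother \<in> borel_measurable borel"
  unfolding mother_def[abs_def] by measurable

lemma heat_tail_finite: "heat_tail x < \<infinity>"
  using heat_tail_le[of x] by (auto intro: le_less_trans)

lemma heat_tail_eq: "heat_tail x = ennreal (enn2real (heat_tail x))"
  using heat_tail_finite[of x] by (simp add: ennreal_enn2real_if less_top)

lemma mother_decay: "\<bar>mother (x :: real^'d::finite)\<bar> \<le> 3 * heat_const CARD('d) * decay (1/2) x"
proof -
  have "heat 1 x \<le> heat_const CARD('d) * decay (1/2) x"
    using heat_le_decay[of 1 x] by simp
  moreover have "enn2real (heat_tail x) \<le> 2 * heat_const CARD('d) * decay (1/2) x"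
    using heat_tail_le[of x] heat_const_ge_1[of "CARD('d)"] less_imp_le[OF decay_pos[of "1/2" x]] by (intro enn2real_leI) auto
  moreover have "0 \<le> heat 1 x" "0 \<le> enn2real (heat_tail x)" by auto
  ultimately show ?thesis unfolding mother_def by linarith
qed

text \<open>
  Splits a pairing with \<open>mother\<close> into its two nonnegative parts, for which the integrals in
  \<open>[0, \<infinity>]\<close> are known.
\<close>

lemma integral_nn_pair:
  fixes k :: "real^'d::finite \<Rightarrow> real"
  assumes [measurable]: "k \<in> borel_measurable borel" and k: "\<And>y. k y \<ge> 0"
    and fin: "(\<integral>\<^sup>+y. ennreal (heat 1 y) * ennreal (k y) \<partial>lborel) < \<infinity>" "(\<integral>\<^sup>+y. heat_tail y * ennreal (k y) \<partial>lborel) < \<infinity>"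
  shows "integrable lborel (\<lambda>y. mother y * k y)"
    "(LINT y|lborel. mother y * k y) = enn2real (\<integral>\<^sup>+y. ennreal (heat 1 y) * ennreal (k y) \<partial>lborel) - enn2real (\<integral>\<^sup>+y. heat_tail y * ennreal (k y) \<partial>lborel)"
proof -
  have e1: "ennreal (heat 1 y) * ennreal (k y) = ennreal (heat 1 y * k y)" for y
    by (rule ennreal_mult[symmetric]) (auto simp: k)
  have e2: "heat_tail y * ennreal (k y) = ennreal (enn2real (heat_tail y) * k y)" for y
    by (subst heat_tail_eq) (rule ennreal_mult[symmetric], auto simp: k)
  have i1: "integrable lborel (\<lambda>y. heat 1 y * k y)"
    using fin(1) unfolding e1 by (intro integrableI_nonneg) (auto simp: k)
  have i2: "integrable lborel (\<lambda>y. enn2real (heat_tail y) * k y)"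
    using fin(2) unfolding e2 by (intro integrableI_nonneg) (auto simp: k)
  have eq: "(\<lambda>y. mother y * k y) = (\<lambda>y. heat 1 y * k y - enn2real (heat_tail y) * k y)"
    by (auto simp: mother_def left_diff_distrib)
  show "integrable lborel (\<lambda>y. mother y * k y)"
    unfolding eq by (rule Bochner_Integration.integrable_diff[OF i1 i2])
  have "(LINT y|lborel. mother y * k y) = (LINT y|lborel. heat 1 y * k y) - (LINT y|lborel. enn2real (heat_tail y) * k y)"
    unfolding eq by (rule Bochner_Integration.integral_diff[OF i1 i2])
  also have "(LINT y|lborel. heat 1 y * k y) = enn2real (\<integral>\<^sup>+y. ennreal (heat 1 y * k y) \<partial>lborel)"
    by (rule integral_eq_nn_integral) (auto simp: k)
  also have "(LINT y|lborel. enn2real (heat_tail y) * k y) = enn2real (\<integral>\<^sup>+y. ennreal (enn2real (heat_tail y) * k y) \<partial>lborel)"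
    by (rule integral_eq_nn_integral) (auto simp: k)
  finally show "(LINT y|lborel. mother y * k y) = enn2real (\<integral>\<^sup>+y. ennreal (heat 1 y) * ennreal (k y) \<partial>lborel) - enn2real (\<integral>\<^sup>+y. heat_tail y * ennreal (k y) \<partial>lborel)"
    unfolding e1 e2 .
qed

lemma mother_mean: "(LINT x|lborel. mother (x :: real^'d::finite)) = 0"
proof -
  have h: "(\<integral>\<^sup>+y. ennreal (heat 1 (y :: real^'d)) * ennreal 1 \<partial>lborel) = heat_mass TYPE('d)"
    by (simp add: heat_mass_def)
  have t: "(\<integral>\<^sup>+y. heat_tail (y :: real^'d) * ennreal 1 \<partial>lborel) = heat_mass TYPE('d)"
    using nn_integral_heat_tail by simp
  have "(LINT y|lborel. mother (y :: real^'d) * 1) = 0"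
    by (subst integral_nn_pair(2)) (use h t heat_mass_finite[where 'd='d] in auto)
  then show ?thesis by simp
qed

text \<open>
  The difference of the formulas for the two parts of \<open>mother\<close>. In both the Gaussian of parameter \<open>\<rho>\<close> has an
  explicit weight, and \<open>(\<rho> - 1)\<^sup>-\<^sup>1\<^sup>/\<^sup>2 = (\<rho> - 1)\<^sup>1\<^sup>/\<^sup>2/\<rho> + 1/(\<rho>(\<rho> - 1)\<^sup>1\<^sup>/\<^sup>2)\<close>.
\<close>

lemma riesz_mother:
  fixes x :: "real^'d::finite"
  assumes d: "CARD('d) \<ge> 2"
  shows "integrable lborel (\<lambda>y. mother y * (riesz_const CARD('d) * norm (x - y) powr (1 - real CARD('d))))"
    and "riesz_potential mother x = riesz_const CARD('d) * (enn2real (heat_mass TYPE('d)) / enn2real (subord_const CARD('d)) *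
       enn2real (\<integral>\<^sup>+\<rho>. ennreal (1 / (\<rho> * sqrt (\<rho> - 1)) * heat \<rho> x) * indicator {1<..} \<rho> \<partial>lborel))"
    and "(\<integral>\<^sup>+\<rho>. ennreal (1 / (\<rho> * sqrt (\<rho> - 1)) * heat \<rho> x) * indicator {1<..} \<rho> \<partial>lborel) < \<infinity>"
proof -
  let ?rc = "riesz_const CARD('d)"
  let ?S = "subord_const CARD('d)" and ?J = "heat_mass TYPE('d)"
  let ?k = "\<lambda>y. norm (x - y) powr (1 - real CARD('d))"
  define A where "A = riesz_nn (\<lambda>y. ennreal (heat 1 y)) x"
  define B where "B = riesz_nn heat_tail x"
  define E where "E = (\<integral>\<^sup>+\<rho>. ennreal (1 / (\<rho> * sqrt (\<rho> - 1)) * heat \<rho> x) * indicator {1<..} \<rho> \<partial>lborel)"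
  have S: "?S < \<infinity>" "?S > 0" using subord_const_finite[OF d] subord_const_pos by auto
  have J: "?J < \<infinity>" "?J > 0" by (rule heat_mass_finite heat_mass_pos)+
  have sum: "?S * A = ?S * B + ?J * E"
  proof -
    have "?S * A = ?J * (\<integral>\<^sup>+\<rho>. ennreal (1 / sqrt (\<rho> - 1) * heat \<rho> x) * indicator {1<..} \<rho> \<partial>lborel)"
      unfolding A_def by (rule riesz_nn_heat) simp
    also have "(\<integral>\<^sup>+\<rho>. ennreal (1 / sqrt (\<rho> - 1) * heat \<rho> x) * indicator {1<..} \<rho> \<partial>lborel) =
       (\<integral>\<^sup>+\<rho>. ennreal (sqrt (\<rho> - 1) / \<rho> * heat \<rho> x) * indicator {1<..} \<rho> + ennreal (1 / (\<rho> * sqrt (\<rho> - 1)) * heat \<rho> x) * indicator {1<..} \<rho> \<partial>lborel)"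
    proof (rule nn_integral_cong)
      fix \<rho> :: real
      show "ennreal (1 / sqrt (\<rho> - 1) * heat \<rho> x) * indicator {1<..} \<rho> = ennreal (sqrt (\<rho> - 1) / \<rho> * heat \<rho> x) * indicator {1<..} \<rho> + ennreal (1 / (\<rho> * sqrt (\<rho> - 1)) * heat \<rho> x) * indicator {1<..} \<rho>"
      proof (cases "\<rho> > 1")
        case True
        define q where "q = sqrt (\<rho> - 1)"
        have q: "q > 0" "q * q = \<rho> - 1" using True by (auto simp: q_def)
        have "q / \<rho> + 1 / (\<rho> * q) = (q * q + 1) / (\<rho> * q)"
          using q True by (simp add: field_simps)
        also have "\<dots> = 1 / q" using q True by simp
        finally have e: "1 / q * heat \<rho> x = q / \<rho> * heat \<rho> x + 1 / (\<rho> * q) * heat \<rho> x"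
          by (simp only: distrib_right[symmetric])
        have "ennreal (1 / q * heat \<rho> x) = ennreal (q / \<rho> * heat \<rho> x) + ennreal (1 / (\<rho> * q) * heat \<rho> x)"
          unfolding e using q True by (intro ennreal_plus mult_nonneg_nonneg) auto
        then show ?thesis using True by (simp only: q_def) simp
      qed simp
    qed
    also have "\<dots> = (\<integral>\<^sup>+\<rho>. ennreal (sqrt (\<rho> - 1) / \<rho> * heat \<rho> x) * indicator {1<..} \<rho> \<partial>lborel) + E"
      unfolding E_def by (rule nn_integral_add) measurable
    finally show ?thesis
      unfolding B_def riesz_nn_heat_tail by (simp only: distrib_left)
  qed
  have A_fin: "A < \<infinity>"
  proof -
    have le: "ennreal (1 / sqrt (\<rho> - 1) * heat \<rho> x) * indicator {1<..} \<rho> \<le> ennreal (1 / (\<rho> * sqrt (\<rho> - 1))) * indicator {1<..} \<rho>" for \<rho> :: real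
    proof (cases "\<rho> > 1")
      case True
      have "\<rho> powr (- (real CARD('d) / 2)) \<le> \<rho> powr (- 1)"
        using True d by (intro powr_mono) auto
      then have "heat \<rho> x \<le> \<rho> powr (- 1) * 1"
        unfolding heat_def using True by (intro mult_mono) auto
      then have "1 / sqrt (\<rho> - 1) * heat \<rho> x \<le> 1 / sqrt (\<rho> - 1) * (1 / \<rho>)"
        using True by (intro mult_left_mono) (auto simp: powr_minus inverse_eq_divide)
      also have "\<dots> = 1 / (\<rho> * sqrt (\<rho> - 1))" by simp
      finally show ?thesis using True by (simp add: ennreal_leI)
    qed simp
    have "?S * A = ?J * (\<integral>\<^sup>+\<rho>. ennreal (1 / sqrt (\<rho> - 1) * heat \<rho> x) * indicator {1<..} \<rho> \<partial>lborel)"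
      unfolding A_def by (rule riesz_nn_heat) simp
    also have "\<dots> \<le> ?J * (\<integral>\<^sup>+\<rho>. ennreal (1 / (\<rho> * sqrt (\<rho> - 1))) * indicator {1<..} \<rho> \<partial>lborel)"
      by (intro mult_left_mono nn_integral_mono le) auto
    also have "\<dots> < \<infinity>"
      using nn_integral_arctan_finite J by (simp add: ennreal_mult_less_top)
    finally have "?S * A < \<infinity>" .
    then show ?thesis using S by (auto simp: ennreal_mult_less_top)
  qed
  have SA: "?S * A < \<infinity>" using S A_fin by (simp add: ennreal_mult_less_top)
  then have "?S * B < \<infinity>" "?J * E < \<infinity>" unfolding sum by simp_all
  then have B_fin: "B < \<infinity>" and E_fin: "E < \<infinity>"
    using S J by (auto simp: ennreal_mult_less_top)
  then show "(\<integral>\<^sup>+\<rho>. ennreal (1 / (\<rho> * sqrt (\<rho> - 1)) * heat \<rho> x) * indicator {1<..} \<rho> \<partial>lborel) < \<infinity>"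
    by (simp add: E_def)
  have "enn2real (?S * A) = enn2real (?S * B) + enn2real (?J * E)"
    unfolding sum using \<open>?S * B < \<infinity>\<close> \<open>?J * E < \<infinity>\<close> by (simp add: enn2real_plus less_top)
  then have "enn2real ?S * enn2real A = enn2real ?S * enn2real B + enn2real ?J * enn2real E"
    by (simp only: enn2real_mult)
  moreover have "enn2real ?S > 0" using S by (simp add: enn2real_positive_iff)
  ultimately have diff: "enn2real A - enn2real B = enn2real ?J / enn2real ?S * enn2real E"
    by (simp add: field_simps)
  have fin: "(\<integral>\<^sup>+y. ennreal (heat 1 y) * ennreal (?k y) \<partial>lborel) < \<infinity>" "(\<integral>\<^sup>+y. heat_tail y * ennreal (?k y) \<partial>lborel) < \<infinity>"
    using A_fin B_fin by (simp_all add: A_def B_def riesz_nn_def)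
  have int: "integrable lborel (\<lambda>y. mother y * ?k y)"
    by (rule integral_nn_pair[OF _ _ fin]) auto
  have val: "(LINT y|lborel. mother y * ?k y) = enn2real A - enn2real B"
    unfolding A_def B_def riesz_nn_def by (rule integral_nn_pair[OF _ _ fin]) auto
  show "integrable lborel (\<lambda>y. mother y * (?rc * ?k y))"
    using integrable_mult_right[OF int, of ?rc] by (simp only: mult.left_commute)
  have "riesz_potential mother x = (LINT y|lborel. ?rc * (mother y * ?k y))"
    unfolding riesz_potential_def by (simp only: mult.left_commute)
  also have "\<dots> = ?rc * (enn2real A - enn2real B)"
    by (simp add: val)
  finally show "riesz_potential mother x = ?rc * (enn2real ?J / enn2real ?S * enn2real (\<integral>\<^sup>+\<rho>. ennreal (1 / (\<rho> * sqrt (\<rho> - 1)) * heat \<rho> x) * indicator {1<..} \<rho> \<partial>lborel))"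
    unfolding diff E_def .
qed

lemma riesz_mother_nonneg:
  fixes x :: "real^'d::finite"
  assumes d: "CARD('d) \<ge> 2"
  shows "riesz_potential mother x \<ge> 0"
  unfolding riesz_mother(2)[OF d] using riesz_const_pos[OF d] by (intro mult_nonneg_nonneg divide_nonneg_nonneg) auto

text \<open>
  The Gaussians with parameter in \<open>[2, 3]\<close> alone are bounded below on the ball.
\<close>

lemma riesz_mother_lower:
  assumes d: "CARD('d::finite) \<ge> 2"
  obtains c where "c > 0" "\<And>x :: real^'d. norm x \<le> D \<Longrightarrow> riesz_potential mother x \<ge> c"
proof -
  define e0 where "e0 = 1 / (3 * sqrt 2) * (3 powr (- (real CARD('d) / 2)) * exp (- D\<^sup>2 / 2))"
  have e0: "e0 > 0" by (simp add: e0_def)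
  define c where "c = riesz_const CARD('d) * (enn2real (heat_mass TYPE('d)) / enn2real (subord_const CARD('d)) * e0)"
  have SJ: "enn2real (subord_const CARD('d)) > 0" "enn2real (heat_mass TYPE('d)) > 0"
    using subord_const_finite[OF d] subord_const_pos[of "CARD('d)"] heat_mass_finite[where 'd='d] heat_mass_pos[where 'd='d] by (simp_all add: enn2real_positive_iff)
  show ?thesis
  proof (rule that)
    show "c > 0" unfolding c_def using SJ e0 riesz_const_pos[OF d] by simp
    fix x :: "real^'d" assume x: "norm x \<le> D"
    let ?E = "\<integral>\<^sup>+\<rho>. ennreal (1 / (\<rho> * sqrt (\<rho> - 1)) * heat \<rho> x) * indicator {1<..} \<rho> \<partial>lborel"
    have "ennreal e0 = (\<integral>\<^sup>+\<rho>. ennreal e0 * indicator {2..3::real} \<rho> \<partial>lborel)"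
      by (subst nn_integral_cmult_indicator) auto
    also have "\<dots> \<le> ?E"
    proof (rule nn_integral_mono)
      fix \<rho> :: real
      show "ennreal e0 * indicator {2..3} \<rho> \<le> ennreal (1 / (\<rho> * sqrt (\<rho> - 1)) * heat \<rho> x) * indicator {1<..} \<rho>"
      proof (cases "\<rho> \<in> {2..3}")
        case True
        have "e0 \<le> 1 / (\<rho> * sqrt (\<rho> - 1)) * heat \<rho> x"
          unfolding e0_def heat_def
        proof (intro mult_mono)
          show "1 / (3 * sqrt 2) \<le> 1 / (\<rho> * sqrt (\<rho> - 1))"
            using True by (intro divide_left_mono mult_mono real_sqrt_le_mono mult_pos_pos) auto
          show "3 powr (- (real CARD('d) / 2)) \<le> \<rho> powr (- (real CARD('d) / 2))"
            using True by (intro powr_mono2') auto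
          have "(norm x)\<^sup>2 / \<rho> \<le> D\<^sup>2 / 2"
            using True x by (intro frac_le power_mono) auto
          then show "exp (- D\<^sup>2 / 2) \<le> exp (- (norm x)\<^sup>2 / \<rho>)" by simp
        qed (use True in auto)
        then show ?thesis using True by (simp add: ennreal_leI)
      qed simp
    qed
    finally have "enn2real (ennreal e0) \<le> enn2real ?E"
      using riesz_mother(3)[OF d, of x] by (intro enn2real_mono) auto
    then have "e0 \<le> enn2real ?E" using e0 by simp
    then show "riesz_potential mother x \<ge> c"
      unfolding riesz_mother(2)[OF d] c_def using SJ riesz_const_pos[OF d]
      by (intro mult_left_mono) auto
  qed
qed

section \<open>Bumps whose Riesz potential is nonnegative\<close>

text \<open>
  The kernel of \<open>I\<^sub>1\<close> is homogeneous of degree \<open>1 - d\<close>, so the potential commutes with the similarity up to a factor \<open>l\<close>.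
\<close>

lemma riesz_rescale:
  fixes u :: "real^'d::finite \<Rightarrow> real"
  assumes [measurable]: "u \<in> borel_measurable borel" and l: "l > 0"
  shows "riesz_potential (\<lambda>y. k * u ((1 / l) *\<^sub>R (y - z))) x = k * l * riesz_potential u ((1 / l) *\<^sub>R (x - z))"
    and "integrable lborel (\<lambda>w. u w * (riesz_const CARD('d) * norm ((1 / l) *\<^sub>R (x - z) - w) powr (1 - real CARD('d)))) \<Longrightarrow>
      integrable lborel (\<lambda>y. k * u ((1 / l) *\<^sub>R (y - z)) * (riesz_const CARD('d) * norm (x - y) powr (1 - real CARD('d))))"
proof -
  let ?rc = "riesz_const CARD('d)" and ?e = "1 - real CARD('d)"
  define v where "v = (1 / l) *\<^sub>R (x - z)"
  have kern: "norm (x - (z + l *\<^sub>R w)) powr ?e = l powr ?e * norm (v - w) powr ?e" for w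
  proof -
    have "x - (z + l *\<^sub>R w) = l *\<^sub>R (v - w)" using l by (simp add: v_def algebra_simps)
    then show ?thesis using l by (simp add: powr_mult)
  qed
  have ll: "l ^ CARD('d) * l powr ?e = l"
    using l by (simp add: powr_realpow[symmetric] powr_add[symmetric])
  have "riesz_potential (\<lambda>y. k * u ((1 / l) *\<^sub>R (y - z))) x = (\<bar>l\<bar> ^ CARD('d)) *\<^sub>R (LINT w|lborel. k * u ((1 / l) *\<^sub>R (z + l *\<^sub>R w - z)) * (?rc * norm (x - (z + l *\<^sub>R w)) powr ?e))"
    unfolding riesz_potential_def using l by (intro integral_lborel_affine) auto
  also have "\<dots> = l ^ CARD('d) * (LINT w|lborel. (k * l powr ?e) * (u w * (?rc * norm (v - w) powr ?e)))"
    using l unfolding kern by (simp add: mult_ac)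
  also have "\<dots> = l ^ CARD('d) * ((k * l powr ?e) * riesz_potential u v)"
    unfolding riesz_potential_def by simp
  also have "\<dots> = k * (l ^ CARD('d) * l powr ?e) * riesz_potential u v"
    by (simp only: mult_ac)
  finally show "riesz_potential (\<lambda>y. k * u ((1 / l) *\<^sub>R (y - z))) x = k * l * riesz_potential u ((1 / l) *\<^sub>R (x - z))"
    unfolding ll v_def .
  assume "integrable lborel (\<lambda>w. u w * (?rc * norm ((1 / l) *\<^sub>R (x - z) - w) powr ?e))"
  then have "integrable lborel (\<lambda>w. (k * l powr ?e) * (u w * (?rc * norm (v - w) powr ?e)))"
    unfolding v_def by (rule integrable_mult_right)
  then have "integrable lborel (\<lambda>y. (k * l powr ?e) * (u (- (1 / l) *\<^sub>R z + (1 / l) *\<^sub>R y) * (?rc * norm (v - (- (1 / l) *\<^sub>R z + (1 / l) *\<^sub>R y)) powr ?e)))"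
    using l by (intro integrable_lborel_affine) auto
  also have "(\<lambda>y. (k * l powr ?e) * (u (- (1 / l) *\<^sub>R z + (1 / l) *\<^sub>R y) * (?rc * norm (v - (- (1 / l) *\<^sub>R z + (1 / l) *\<^sub>R y)) powr ?e))) =
     (\<lambda>y. k * u ((1 / l) *\<^sub>R (y - z)) * (?rc * norm (x - y) powr ?e))"
  proof
    fix y
    have "- (1 / l) *\<^sub>R z + (1 / l) *\<^sub>R y = (1 / l) *\<^sub>R (y - z)" by (simp add: scaleR_diff_right)
    moreover have "z + l *\<^sub>R ((1 / l) *\<^sub>R (y - z)) = y" using l by simp
    then have "norm (x - y) powr ?e = l powr ?e * norm (v - (1 / l) *\<^sub>R (y - z)) powr ?e"
      using kern[of "(1 / l) *\<^sub>R (y - z)"] by simp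
    ultimately show "(k * l powr ?e) * (u (- (1 / l) *\<^sub>R z + (1 / l) *\<^sub>R y) * (?rc * norm (v - (- (1 / l) *\<^sub>R z + (1 / l) *\<^sub>R y)) powr ?e)) =
       k * u ((1 / l) *\<^sub>R (y - z)) * (?rc * norm (x - y) powr ?e)"
      by (simp only: mult_ac)
  qed
  finally show "integrable lborel (\<lambda>y. k * u ((1 / l) *\<^sub>R (y - z)) * (?rc * norm (x - y) powr ?e))" .
qed

context hardy_kernel begin

text \<open>
  The family of averages over all \<open>t > 0\<close> is invariant under translations and dilations.
\<close>

lemma hardy_maximal_rescale:
  fixes u :: "real^'d \<Rightarrow> real"
  assumes [measurable]: "u \<in> borel_measurable borel" and l: "l > 0" and k: "k \<ge> 0"
  shows "hardy_maximal \<psi> (\<lambda>y. k * u ((1 / l) *\<^sub>R (y - z))) x \<le> ennreal k * hardy_maximal \<psi> u ((1 / l) *\<^sub>R (x - z))"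
  unfolding hardy_maximal_eq[of "\<lambda>y. k * u ((1 / l) *\<^sub>R (y - z))"]
proof (rule SUP_least)
  fix t :: real assume "t \<in> {0<..}"
  then have t: "t > 0" by simp
  define v where "v = (1 / l) *\<^sub>R (x - z)"
  have kern: "complex_of_real (l ^ CARD('d)) * dil t (x - (z + l *\<^sub>R w)) = dil (t / l) (v - w)" for w
  proof -
    have e: "(1 / t) *\<^sub>R (x - (z + l *\<^sub>R w)) = (1 / (t / l)) *\<^sub>R (v - w)" using l t by (simp add: v_def algebra_simps)
    have "l ^ CARD('d) * t powr (- real CARD('d)) = (t / l) powr (- real CARD('d))"
      using l t by (subst powr_minus_divide) (auto simp: powr_realpow)
    then show ?thesis unfolding dil_def e by (simp only: mult.assoc[symmetric] of_real_mult[symmetric])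
  qed
  have "(LINT y|lborel. complex_of_real (k * u ((1 / l) *\<^sub>R (y - z))) * dil t (x - y)) =
     (\<bar>l\<bar> ^ CARD('d)) *\<^sub>R (LINT w|lborel. complex_of_real (k * u ((1 / l) *\<^sub>R (z + l *\<^sub>R w - z))) * dil t (x - (z + l *\<^sub>R w)))"
    using l by (intro integral_lborel_affine) auto
  also have "\<dots> = (LINT w|lborel. complex_of_real (l ^ CARD('d)) * (complex_of_real (k * u w) * dil t (x - (z + l *\<^sub>R w))))"
    using l by (subst integral_mult_right_zero) (simp add: scaleR_conv_of_real[where 'a=complex])
  also have "\<dots> = (LINT w|lborel. complex_of_real k * (complex_of_real (u w) * dil (t / l) (v - w)))"
    unfolding kern[symmetric] by (intro Bochner_Integration.integral_cong refl) (simp add: mult_ac)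
  also have "\<dots> = complex_of_real k * (LINT w|lborel. complex_of_real (u w) * dil (t / l) (v - w))"
    by (rule integral_mult_right_zero)
  finally have "ennreal (cmod (LINT y|lborel. complex_of_real (k * u ((1 / l) *\<^sub>R (y - z))) * dil t (x - y))) =
     ennreal k * ennreal (cmod (LINT w|lborel. complex_of_real (u w) * dil (t / l) (v - w)))"
    using k by (simp add: norm_mult ennreal_mult)
  also have "\<dots> \<le> ennreal k * hardy_maximal \<psi> u v"
    using t l by (intro mult_left_mono hardy_maximal_ge) auto
  finally show "ennreal (cmod (LINT y|lborel. complex_of_real (k * u ((1 / l) *\<^sub>R (y - z))) * dil t (x - y))) \<le> ennreal k * hardy_maximal \<psi> u ((1 / l) *\<^sub>R (x - z))"
    unfolding v_def .
qed

text \<open>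
  Rescaled copies of \<open>mother\<close>, normalised to potential at least \<open>1\<close> on the ball. The height \<open>1/l\<close> times the volume
  \<open>l\<^sup>d\<close> gives the norm \<open>l\<^sup>d\<^sup>-\<^sup>1\<close>. The radius \<open>d l\<close> is the bound for the diameter of a cell of side \<open>l\<close> in
  \<open>norm_diff_le_of_cell_eq\<close>. The functions \<open>G\<close> are measurable majorants of the maximal functions, so that sums
  of bumps can be integrated term by term.
\<close>

lemma hardy_bump_family:
  assumes d: "CARD('d) \<ge> 2"
  obtains C :: real and \<Phi> :: "real^'d \<Rightarrow> real \<Rightarrow> real^'d \<Rightarrow> real" and G :: "real^'d \<Rightarrow> real \<Rightarrow> real^'d \<Rightarrow> ennreal"
  where "C > 0"
    "\<And>z l. l > 0 \<Longrightarrow> integrable lborel (\<Phi> z l)"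
    "\<And>z l x. l > 0 \<Longrightarrow> integrable lborel (\<lambda>y. \<Phi> z l y * (riesz_const CARD('d) * norm (x - y) powr (1 - real CARD('d))))"
    "\<And>z l x. l > 0 \<Longrightarrow> riesz_potential (\<Phi> z l) x \<ge> 0"
    "\<And>z l x. l > 0 \<Longrightarrow> norm (x - z) \<le> real CARD('d) * l \<Longrightarrow> riesz_potential (\<Phi> z l) x \<ge> 1"
    "\<And>z l x. l > 0 \<Longrightarrow> hardy_maximal \<psi> (\<Phi> z l) x \<le> G z l x"
    "\<And>z l. G z l \<in> borel_measurable borel"
    "\<And>z l. l > 0 \<Longrightarrow> (\<integral>\<^sup>+x. G z l x \<partial>lborel) \<le> ennreal (C * l ^ (CARD('d) - 1))"
proof -
  obtain c where c: "c > 0" "\<And>x :: real^'d. norm x \<le> real CARD('d) \<Longrightarrow> riesz_potential mother x \<ge> c"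
    using riesz_mother_lower[OF d] by metis
  obtain C' where C': "C' \<ge> 0" "\<And>x. hardy_maximal \<psi> mother x \<le> ennreal (C' * decay (1/4) x)"
    by (rule hardy_maximal_le_decay[OF mother_measurable mother_decay mother_mean]) (rule that)
  define I where "I = (\<integral>\<^sup>+x. ennreal (decay (1/4) (x :: real^'d)) \<partial>lborel)"
  have I: "I < \<infinity>" unfolding I_def by (rule nn_integral_decay_finite) simp
  define C where "C = C' / c * enn2real I + 1"
  have C: "C > 0" unfolding C_def using C' c by (intro add_nonneg_pos mult_nonneg_nonneg) auto
  define \<Phi> :: "real^'d \<Rightarrow> real \<Rightarrow> real^'d \<Rightarrow> real" where "\<Phi> z l y = (1 / (c * l)) * mother ((1 / l) *\<^sub>R (y - z))" for z l y
  define G :: "real^'d \<Rightarrow> real \<Rightarrow> real^'d \<Rightarrow> ennreal" where "G z l x = ennreal (1 / (c * l)) * ennreal (C' * decay (1/4) ((1 / l) *\<^sub>R (x - z)))" for z l x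
  have \<Phi>_eq: "\<Phi> z l = (\<lambda>y. (1 / (c * l)) * mother ((1 / l) *\<^sub>R (y - z)))" for z l
    by (auto simp: \<Phi>_def)
  have G_meas [measurable]: "G z l \<in> borel_measurable borel" for z l
    unfolding G_def[abs_def] by measurable
  show ?thesis
  proof (rule that[of C \<Phi> G])
    fix z :: "real^'d" and l :: real assume l: "l > 0"
    have int: "integrable lborel (mother :: real^'d \<Rightarrow> real)"
    proof (rule Bochner_Integration.integrable_bound)
      show "integrable lborel (\<lambda>x :: real^'d. 3 * heat_const CARD('d) * decay (1/2) x)"
        by (intro integrable_mult_right integrable_decay) simp
      show "AE x :: real^'d in lborel. norm (mother x) \<le> norm (3 * heat_const CARD('d) * decay (1/2) x)"
        by (intro AE_I2) (simp, metis abs_ge_self mother_decay order_trans)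
    qed simp
    have "integrable lborel (\<lambda>y. mother (- (1 / l) *\<^sub>R z + (1 / l) *\<^sub>R y))"
      using l by (intro integrable_lborel_affine int) auto
    then show "integrable lborel (\<Phi> z l)"
      unfolding \<Phi>_eq by (intro integrable_mult_right) (simp add: scaleR_diff_right)
    fix x :: "real^'d"
    show "integrable lborel (\<lambda>y. \<Phi> z l y * (riesz_const CARD('d) * norm (x - y) powr (1 - real CARD('d))))"
      unfolding \<Phi>_eq using l by (intro riesz_rescale(2) riesz_mother(1) d) auto
    have r: "riesz_potential (\<Phi> z l) x = 1 / c * riesz_potential mother ((1 / l) *\<^sub>R (x - z))"
      unfolding \<Phi>_eq by (subst riesz_rescale(1)) (use l in auto)
    show "riesz_potential (\<Phi> z l) x \<ge> 0"
      unfolding r using c riesz_mother_nonneg[OF d] by (intro mult_nonneg_nonneg) auto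
    show "riesz_potential (\<Phi> z l) x \<ge> 1" if "norm (x - z) \<le> real CARD('d) * l"
    proof -
      have "norm ((1 / l) *\<^sub>R (x - z)) \<le> real CARD('d)" using that l by (simp add: divide_le_eq)
      from c(2)[OF this] show ?thesis unfolding r using c(1) by (simp add: le_divide_eq)
    qed
    have "hardy_maximal \<psi> (\<Phi> z l) x \<le> ennreal (1 / (c * l)) * hardy_maximal \<psi> mother ((1 / l) *\<^sub>R (x - z))"
      unfolding \<Phi>_eq using l c by (intro hardy_maximal_rescale) auto
    also have "\<dots> \<le> G z l x" unfolding G_def by (intro mult_left_mono C') auto
    finally show "hardy_maximal \<psi> (\<Phi> z l) x \<le> G z l x" .
    have "(\<integral>\<^sup>+x. G z l x \<partial>lborel) = ennreal (\<bar>l\<bar> ^ CARD('d)) * (\<integral>\<^sup>+w. G z l (z + l *\<^sub>R w) \<partial>lborel)"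
      using l by (intro nn_integral_lborel_affine) auto
    also have "(\<integral>\<^sup>+w. G z l (z + l *\<^sub>R w) \<partial>lborel) = (\<integral>\<^sup>+w. ennreal (1 / (c * l) * C') * ennreal (decay (1/4) (w :: real^'d)) \<partial>lborel)"
    proof (rule nn_integral_cong)
      fix w :: "real^'d"
      have "ennreal (C' * decay (1/4) w) = ennreal C' * ennreal (decay (1/4) w)"
        using C' less_imp_le[OF decay_pos[of "1/4" w]] by (intro ennreal_mult) auto
      moreover have "ennreal (1 / (c * l) * C') = ennreal (1 / (c * l)) * ennreal C'"
        using C' c l by (intro ennreal_mult) auto
      moreover have "(1 / l) *\<^sub>R (z + l *\<^sub>R w - z) = w" using l by simp
      ultimately show "G z l (z + l *\<^sub>R w) = ennreal (1 / (c * l) * C') * ennreal (decay (1/4) w)"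
        unfolding G_def by (simp only: mult.assoc)
    qed
    also have "\<dots> = ennreal (1 / (c * l) * C') * I"
      unfolding I_def by (rule nn_integral_cmult) measurable
    also have "I = ennreal (enn2real I)" using I by (simp add: ennreal_enn2real_if less_top)
    also have "ennreal (\<bar>l\<bar> ^ CARD('d)) * (ennreal (1 / (c * l) * C') * ennreal (enn2real I)) = ennreal (l ^ CARD('d) * (1 / (c * l) * C' * enn2real I))"
      using l c C' by (simp add: ennreal_mult[symmetric])
    also have "l ^ CARD('d) * (1 / (c * l) * C' * enn2real I) = (C' / c * enn2real I) * l ^ (CARD('d) - 1)"
      using l c by (cases "CARD('d)") (auto simp: field_simps)
    also have "ennreal \<dots> \<le> ennreal (C * l ^ (CARD('d) - 1))"
      using l by (intro ennreal_leI mult_right_mono) (auto simp: C_def)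
    finally show "(\<integral>\<^sup>+x. G z l x \<partial>lborel) \<le> ennreal (C * l ^ (CARD('d) - 1))" .
  qed (use C in auto)
qed

end

section \<open>Linear programming duality on a tree\<close>

text \<open>
  The maps \<open>pi i\<close> describe nested partitions of \<open>X\<close>, fine to coarse, and \<open>\<kappa> i\<close> is the capacity of each part of level
  \<open>i\<close>. A mass distribution \<open>\<mu>\<close> that respects all capacities is feasible for one linear program, a cover of
  \<open>f\<close> by weighted parts for the dual one, and the last clause says that there is no duality gap.

  The proof is a greedy induction. Remove a point \<open>x0\<close> where \<open>f\<close> is minimal, subtract \<open>f x0\<close> everywhere, and
  solve the problem on the remaining points. Then give \<open>x0\<close> as much mass as the capacities admit, so that every point lies in
  a tight part. The maximal tight parts form a partition, because nested parts either contain each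
  other or are disjoint. Adding the weight \<open>f x0\<close> to each of them
  covers the subtracted constant exactly once, and by tightness this costs \<open>f x0\<close> times the total mass, which is also what the
  subtracted constant contributes to \<open>\<Sum> f \<mu>\<close>. The third clause of the conclusion, tightness, is what the
  induction needs about the smaller problem.
\<close>

lemma laminar_duality:
  fixes pi :: "nat \<Rightarrow> 'x \<Rightarrow> 'b" and \<kappa> :: "nat \<Rightarrow> real" and f :: "'x \<Rightarrow> real"
  assumes "finite X" and refine: "\<And>i x y. pi i x = pi i y \<Longrightarrow> pi (Suc i) x = pi (Suc i) y"
    and \<kappa>: "\<And>i. \<kappa> i \<ge> 0" and "\<And>x. x \<in> X \<Longrightarrow> f x \<ge> 0"
  shows "\<exists>\<mu> c. (\<forall>x\<in>X. \<mu> x \<ge> 0) \<and> (\<forall>i\<le>n. \<forall>b. (\<Sum>x\<in>{x\<in>X. pi i x = b}. \<mu> x) \<le> \<kappa> i) \<and>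
     (\<forall>x\<in>X. \<exists>i\<le>n. (\<Sum>y\<in>{y\<in>X. pi i y = pi i x}. \<mu> y) = \<kappa> i) \<and>
     (\<forall>i b. c i b \<ge> (0::real)) \<and> (\<forall>i b. b \<notin> pi i ` X \<longrightarrow> c i b = 0) \<and>
     (\<forall>x\<in>X. f x \<le> (\<Sum>i\<le>n. c i (pi i x))) \<and>
     (\<Sum>i\<le>n. \<Sum>b\<in>pi i ` X. c i b * \<kappa> i) \<le> (\<Sum>x\<in>X. f x * \<mu> x)"
  using assms(1,4)
proof (induction "card X" arbitrary: X f rule: less_induct)
  case less
  note fin = less.prems(1) and f0 = less.prems(2)
  show ?case
  proof (cases "X = {}")
    case True
    then show ?thesis using \<kappa> by (intro exI[of _ "\<lambda>_. 0"]) auto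
  next
    case False
    define x0 where "x0 = arg_min_on f X"
    have x0: "x0 \<in> X" "\<And>x. x \<in> X \<Longrightarrow> f x0 \<le> f x"
      using False fin arg_min_if_finite[of X f] by (auto simp: x0_def not_less)
    define X' where "X' = X - {x0}"
    have X: "X = insert x0 X'" "x0 \<notin> X'" "finite X'" using x0 fin by (auto simp: X'_def)
    have "card X' < card X" using X by simp
    moreover have "f x - f x0 \<ge> 0" if "x \<in> X'" for x using x0(2)[of x] that X by simp
    ultimately have "\<exists>\<mu> c. (\<forall>x\<in>X'. \<mu> x \<ge> 0) \<and> (\<forall>i\<le>n. \<forall>b. (\<Sum>x\<in>{x\<in>X'. pi i x = b}. \<mu> x) \<le> \<kappa> i) \<and>
       (\<forall>x\<in>X'. \<exists>i\<le>n. (\<Sum>y\<in>{y\<in>X'. pi i y = pi i x}. \<mu> y) = \<kappa> i) \<and>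
       (\<forall>i b. c i b \<ge> (0::real)) \<and> (\<forall>i b. b \<notin> pi i ` X' \<longrightarrow> c i b = 0) \<and>
       (\<forall>x\<in>X'. f x - f x0 \<le> (\<Sum>i\<le>n. c i (pi i x))) \<and>
       (\<Sum>i\<le>n. \<Sum>b\<in>pi i ` X'. c i b * \<kappa> i) \<le> (\<Sum>x\<in>X'. (f x - f x0) * \<mu> x)"
      by (intro less.hyps X(3))
    then obtain \<mu>' and c' :: "nat \<Rightarrow> 'b \<Rightarrow> real" where IH0: "\<forall>x\<in>X'. \<mu>' x \<ge> 0"
      "\<forall>i\<le>n. \<forall>b. (\<Sum>x\<in>{x\<in>X'. pi i x = b}. \<mu>' x) \<le> \<kappa> i"
      "\<forall>x\<in>X'. \<exists>i\<le>n. (\<Sum>y\<in>{y\<in>X'. pi i y = pi i x}. \<mu>' y) = \<kappa> i"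
      "\<forall>i b. c' i b \<ge> 0" "\<forall>i b. b \<notin> pi i ` X' \<longrightarrow> c' i b = 0"
      "\<forall>x\<in>X'. f x - f x0 \<le> (\<Sum>i\<le>n. c' i (pi i x))"
      "(\<Sum>i\<le>n. \<Sum>b\<in>pi i ` X'. c' i b * \<kappa> i) \<le> (\<Sum>x\<in>X'. (f x - f x0) * \<mu>' x)"
      by (elim exE conjE) (rule that; assumption)
    note IH = IH0(1-6)[rule_format] IH0(7)
    \<comment> \<open>The mass of x0 exhausts the smallest remaining capacity among the parts that contain it.\<close>
    define slack where "slack i = \<kappa> i - (\<Sum>x\<in>{x\<in>X'. pi i x = pi i x0}. \<mu>' x)" for i
    define w where "w = Min (slack ` {..n})"
    have w_le: "w \<le> slack i" if "i \<le> n" for i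
      unfolding w_def using that by (intro Min_le) auto
    have "w \<in> slack ` {..n}"
      unfolding w_def by (intro Min_in) auto
    then obtain i0 where i0: "i0 \<le> n" "w = slack i0" by auto
    have w0: "w \<ge> 0" using IH(2)[OF i0(1), of "pi i0 x0"] i0 by (simp add: slack_def)
    define \<mu> where "\<mu> = \<mu>'(x0 := w)"
    have sum_cell: "(\<Sum>x\<in>{x\<in>X. pi i x = b}. \<mu> x) = (\<Sum>x\<in>{x\<in>X'. pi i x = b}. \<mu>' x) + (if pi i x0 = b then w else 0)" for i b
    proof -
      have "(\<Sum>x\<in>{x\<in>X'. pi i x = b}. \<mu> x) = (\<Sum>x\<in>{x\<in>X'. pi i x = b}. \<mu>' x)"
        using X(2) by (intro sum.cong) (auto simp: \<mu>_def)
      moreover have "{x\<in>X. pi i x = b} = (if pi i x0 = b then insert x0 {x\<in>X'. pi i x = b} else {x\<in>X'. pi i x = b})"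
        using X by auto
      ultimately show ?thesis
        using X by (auto simp: \<mu>_def)
    qed
    have cap: "(\<Sum>x\<in>{x\<in>X. pi i x = b}. \<mu> x) \<le> \<kappa> i" if "i \<le> n" for i b
      using IH(2)[OF that, of b] w_le[OF that] unfolding sum_cell slack_def by auto
    have \<mu>0: "\<mu> x \<ge> 0" if "x \<in> X" for x
      using that IH(1) w0 X by (auto simp: \<mu>_def)
    define tight where "tight i x \<longleftrightarrow> i \<le> n \<and> (\<Sum>y\<in>{y\<in>X. pi i y = pi i x}. \<mu> y) = \<kappa> i" for i x
    have tight: "\<exists>i. tight i x" if "x \<in> X" for x
    proof (cases "x = x0")
      case True
      then show ?thesis unfolding tight_def sum_cell
        using i0 by (intro exI[of _ i0]) (auto simp: slack_def)
    next
      case False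
      then obtain i where i: "i \<le> n" "(\<Sum>y\<in>{y\<in>X'. pi i y = pi i x}. \<mu>' y) = \<kappa> i"
        using IH(3)[of x] \<open>x \<in> X\<close> X by auto
      then show ?thesis
        using cap[OF i(1), of "pi i x"] w0 unfolding tight_def sum_cell by (intro exI[of _ i]) (auto split: if_splits)
    qed
    \<comment> \<open>The part of x at this level is its member in the partition into maximal tight parts.\<close>
    define I where "I x = Max {i. tight i x}" for x
    have fin_tight: "finite {i. tight i x}" for x
      by (rule finite_subset[of _ "{..n}"]) (auto simp: tight_def)
    have I: "tight (I x) x" if "x \<in> X" for x
      using Max_in[OF fin_tight, of x] tight[OF that] by (auto simp: I_def)
    have I_max: "i \<le> I x" if "tight i x" for i x
      unfolding I_def using that fin_tight by (intro Max_ge) auto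
    have refine_mono: "pi j x = pi j y" if "pi i x = pi i y" "i \<le> j" for i j x y
      using that(2)
    proof (induction j rule: dec_induct)
      case base
      show ?case by (rule that(1))
    next
      case (step j)
      show ?case by (rule refine) (rule step.IH)
    qed
    have tight_cong: "tight j x \<longleftrightarrow> tight j y" if "pi j x = pi j y" for j x y
      using that by (simp add: tight_def)
    define g where "g x = (I x, pi (I x) x)" for x
    have g_eq: "{x\<in>X. g x = g y} = {x\<in>X. pi (I y) x = pi (I y) y}" if y: "y \<in> X" for y
    proof (intro Collect_cong conj_cong refl)
      fix x assume x: "x \<in> X"
      show "g x = g y \<longleftrightarrow> pi (I y) x = pi (I y) y"
      proof
        assume eq: "pi (I y) x = pi (I y) y"
        have "tight (I y) x" using tight_cong[OF eq] I[OF y] by simp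
        then have le: "I y \<le> I x" by (rule I_max)
        have "pi (I x) x = pi (I x) y" by (rule refine_mono[OF eq le])
        then have "tight (I x) y" using tight_cong I[OF x] by metis
        then have "I x = I y" using le I_max by fastforce
        then show "g x = g y" using eq by (simp add: g_def)
      qed (auto simp: g_def)
    qed
    define T where "T = g ` X"
    have sum_T: "(\<Sum>p\<in>T. \<kappa> (fst p)) = (\<Sum>x\<in>X. \<mu> x)"
    proof -
      have "(\<Sum>p\<in>T. \<kappa> (fst p)) = (\<Sum>p\<in>T. \<Sum>x\<in>{x\<in>X. g x = p}. \<mu> x)"
      proof (rule sum.cong[OF refl])
        fix p assume "p \<in> T"
        then obtain y where y: "y \<in> X" "p = g y" by (auto simp: T_def)
        show "\<kappa> (fst p) = (\<Sum>x\<in>{x\<in>X. g x = p}. \<mu> x)"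
          using I[OF y(1)] unfolding y(2) g_eq[OF y(1)] by (simp add: tight_def g_def)
      qed
      also have "\<dots> = (\<Sum>x\<in>X. \<mu> x)"
        unfolding T_def by (rule sum.group) (use fin in auto)
      finally show ?thesis .
    qed
    define c where "c i b = c' i b + (if (i, b) \<in> T then f x0 else 0)" for i b
    have fx0: "f x0 \<ge> 0" using f0 x0 by auto
    have c0: "c i b \<ge> 0" for i b using IH(4) fx0 by (auto simp: c_def)
    have c_supp: "c i b = 0" if "b \<notin> pi i ` X" for i b
      using that IH(5)[of b i] X by (auto simp: c_def T_def g_def)
    have cover: "f x \<le> (\<Sum>i\<le>n. c i (pi i x))" if x: "x \<in> X" for x
    proof -
      have "f x0 = (\<Sum>i\<in>{I x}. (if (i, pi i x) \<in> T then f x0 else 0))"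
        using x by (auto simp: T_def g_def)
      also have "\<dots> \<le> (\<Sum>i\<le>n. (if (i, pi i x) \<in> T then f x0 else 0))"
        using I[OF x] fx0 by (intro sum_mono2) (auto simp: tight_def)
      finally have 1: "f x0 \<le> (\<Sum>i\<le>n. (if (i, pi i x) \<in> T then f x0 else 0))" .
      have 2: "f x - f x0 \<le> (\<Sum>i\<le>n. c' i (pi i x))"
      proof (cases "x = x0")
        case True
        then show ?thesis using IH(4) by (simp add: sum_nonneg)
      qed (use IH(6) x X in auto)
      show ?thesis using 1 2 unfolding c_def sum.distrib by linarith
    qed
    have cost: "(\<Sum>i\<le>n. \<Sum>b\<in>pi i ` X. c i b * \<kappa> i) \<le> (\<Sum>x\<in>X. f x * \<mu> x)"
    proof -
      have "(\<Sum>i\<le>n. \<Sum>b\<in>pi i ` X. c i b * \<kappa> i) = (\<Sum>i\<le>n. \<Sum>b\<in>pi i ` X. c' i b * \<kappa> i) + (\<Sum>i\<le>n. \<Sum>b\<in>pi i ` X. (if (i, b) \<in> T then f x0 * \<kappa> i else 0))"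
        unfolding sum.distrib[symmetric] c_def by (intro sum.cong refl) (auto simp: distrib_right)
      also have "(\<Sum>i\<le>n. \<Sum>b\<in>pi i ` X. c' i b * \<kappa> i) = (\<Sum>i\<le>n. \<Sum>b\<in>pi i ` X'. c' i b * \<kappa> i)"
        using X fin IH(5) by (intro sum.cong refl sum.mono_neutral_right) auto
      also have "(\<Sum>i\<le>n. \<Sum>b\<in>pi i ` X. (if (i, b) \<in> T then f x0 * \<kappa> i else 0)) = (\<Sum>p\<in>(SIGMA i:{..n}. pi i ` X). (if p \<in> T then f x0 * \<kappa> (fst p) else 0))"
        using fin by (subst sum.Sigma) (auto simp: case_prod_beta')
      also have "\<dots> = (\<Sum>p\<in>T. f x0 * \<kappa> (fst p))"
      proof -
        have "T \<subseteq> (SIGMA i:{..n}. pi i ` X)"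
          using I by (auto simp: T_def g_def tight_def)
        then have "(SIGMA i:{..n}. pi i ` X) \<inter> T = T" by auto
        then show ?thesis using fin by (subst sum.inter_restrict[symmetric]) auto
      qed
      also have "\<dots> = f x0 * (\<Sum>x\<in>X. \<mu> x)"
        by (simp add: sum_distrib_left[symmetric] sum_T)
      also have "(\<Sum>i\<le>n. \<Sum>b\<in>pi i ` X'. c' i b * \<kappa> i) + f x0 * (\<Sum>x\<in>X. \<mu> x) \<le> (\<Sum>x\<in>X'. (f x - f x0) * \<mu>' x) + f x0 * (\<Sum>x\<in>X. \<mu> x)"
        using IH(7) by simp
      also have "(\<Sum>x\<in>X'. (f x - f x0) * \<mu>' x) = (\<Sum>x\<in>X. (f x - f x0) * \<mu> x)"
      proof -
        have "(\<Sum>x\<in>X. (f x - f x0) * \<mu> x) = (\<Sum>x\<in>X'. (f x - f x0) * \<mu> x)"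
          using X by simp
        also have "\<dots> = (\<Sum>x\<in>X'. (f x - f x0) * \<mu>' x)"
          using X(2) by (intro sum.cong) (auto simp: \<mu>_def)
        finally show ?thesis by simp
      qed
      also have "\<dots> + f x0 * (\<Sum>x\<in>X. \<mu> x) = (\<Sum>x\<in>X. f x * \<mu> x)"
        by (simp add: sum_distrib_left sum.distrib[symmetric] algebra_simps)
      finally show ?thesis .
    qed
    have tight': "\<forall>x\<in>X. \<exists>i\<le>n. (\<Sum>y\<in>{y\<in>X. pi i y = pi i x}. \<mu> y) = \<kappa> i"
      using tight by (auto simp: tight_def)
    show ?thesis
      by (intro exI[of _ \<mu>] exI[of _ c] conjI tight' cost) (use \<mu>0 cap c0 c_supp cover in auto)
  qed
qed

section \<open>The fractional maximal function\<close>

text \<open>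
  A closed ball around \<open>x\<close> that is heavy enough is contained in a slightly larger ball around every point
  near \<open>x\<close>, whose normalisation is only slightly worse. Hence \<open>M\<^sub>1\<mu>\<close> is lower semicontinuous.
\<close>

lemma frac_maximal_gt_open:
  fixes \<mu> :: "(real^'d::finite) measure"
  assumes sets: "sets \<mu> = sets borel"
  shows "open {x. a < frac_maximal \<mu> x}"
proof (rule openI)
  fix x assume "x \<in> {x. a < frac_maximal \<mu> x}"
  then obtain r where r: "r > 0" "a < ennreal (r powr (1 - real CARD('d))) * emeasure \<mu> (cball x r)"
    unfolding frac_maximal_def by (auto simp: less_SUP_iff)
  let ?m = "emeasure \<mu> (cball x r)"
  have "((\<lambda>h. (r + h) powr (1 - real CARD('d))) \<longlongrightarrow> (r + 0) powr (1 - real CARD('d))) (at_right 0)"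
    using r(1) by (intro tendsto_intros) auto
  then have lim: "((\<lambda>h. ennreal ((r + h) powr (1 - real CARD('d)))) \<longlongrightarrow> ennreal (r powr (1 - real CARD('d)))) (at_right 0)"
    by (intro tendsto_ennrealI) simp
  have "((\<lambda>h. ennreal ((r + h) powr (1 - real CARD('d))) * ?m) \<longlongrightarrow> ennreal (r powr (1 - real CARD('d))) * ?m) (at_right 0)"
    using lim r(1) by (intro tendsto_mult_ennreal tendsto_const) auto
  then have "\<forall>\<^sub>F h in at_right 0. a < ennreal ((r + h) powr (1 - real CARD('d))) * ?m"
    using r(2) by (rule order_tendstoD)
  then obtain \<delta> where \<delta>: "\<delta> > 0" "\<And>h. 0 < h \<Longrightarrow> h < \<delta> \<Longrightarrow> a < ennreal ((r + h) powr (1 - real CARD('d))) * ?m"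
    unfolding eventually_at_right_field by auto
  show "\<exists>e>0. ball x e \<subseteq> {x. a < frac_maximal \<mu> x}"
  proof (intro exI[of _ "\<delta> / 2"] conjI subsetI CollectI)
    fix y assume y: "y \<in> ball x (\<delta> / 2)"
    define h where "h = \<delta> / 2"
    have h: "0 < h" "h < \<delta>" using \<delta>(1) by (auto simp: h_def)
    have "cball x r \<subseteq> cball y (r + h)"
    proof
      fix u assume "u \<in> cball x r"
      then show "u \<in> cball y (r + h)"
        using y dist_triangle[of y u x] by (auto simp: h_def dist_commute)
    qed
    then have "?m \<le> emeasure \<mu> (cball y (r + h))"
      by (intro emeasure_mono) (auto simp: sets)
    then have "ennreal ((r + h) powr (1 - real CARD('d))) * ?m \<le> ennreal ((r + h) powr (1 - real CARD('d))) * emeasure \<mu> (cball y (r + h))"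
      by (intro mult_left_mono) auto
    also have "\<dots> \<le> frac_maximal \<mu> y"
      unfolding frac_maximal_def using r(1) h by (intro SUP_upper2[of "r + h"]) auto
    finally show "a < frac_maximal \<mu> y" using \<delta>(2)[OF h] by (rule less_le_trans[rotated])
  qed (use \<delta>(1) in auto)
qed

lemma frac_maximal_measurable:
  fixes \<mu> :: "(real^'d::finite) measure"
  assumes "sets \<mu> = sets borel"
  shows "frac_maximal \<mu> \<in> borel_measurable lborel"
proof (rule borel_measurableI_greater)
  fix a
  show "{x \<in> space lborel. a < frac_maximal \<mu> x} \<in> sets lborel"
    using frac_maximal_gt_open[OF assms, of a] by simp
qed

lemma open_null_empty:
  fixes U :: "(real^'d::finite) set"
  assumes "open U" "emeasure lborel U = 0"
  shows "U = {}"
proof (rule ccontr)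
  assume "U \<noteq> {}"
  then obtain x e where e: "e > 0" "ball x e \<subseteq> U"
    using assms(1) unfolding open_contains_ball by blast
  have "0 < emeasure lborel (ball x e)"
    using e by (simp add: emeasure_ball ennreal_zero_less_mult_iff unit_ball_vol_pos)
  also have "\<dots> \<le> emeasure lborel U" using e assms by (intro emeasure_mono) auto
  finally show False using assms(2) by simp
qed

lemma powr_one_minus_card: "r > 0 \<Longrightarrow> ennreal (r powr (1 - real CARD('d::finite))) * ennreal (r ^ (CARD('d) - 1)) = 1"
proof -
  assume r: "r > 0"
  have "r ^ (CARD('d) - 1) = r powr (real (CARD('d) - 1))" using r by (simp only: powr_realpow)
  also have "real (CARD('d) - 1) = real CARD('d) - 1" by (simp add: of_nat_diff Suc_leI)
  finally have "r powr (1 - real CARD('d)) * r ^ (CARD('d) - 1) = 1"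
    using r by (simp add: powr_add[symmetric])
  then show ?thesis using r by (subst ennreal_mult[symmetric]) auto
qed

text \<open>
  The essential supremum bounds \<open>M\<^sub>1\<mu>\<close> almost everywhere. The exceptional set is open by lower
  semicontinuity, and an open null set is empty.
\<close>

lemma growth_measure_frac_maximal_norm:
  fixes \<mu> :: "(real^'d::finite) measure"
  assumes \<mu>: "locally_finite_borel \<mu>" and fin: "frac_maximal_norm \<mu> \<noteq> \<infinity>"
  shows "growth_measure \<mu> (frac_maximal_norm \<mu>)"
proof
  show sets: "sets \<mu> = sets borel" using \<mu> by (simp add: locally_finite_borel_def)
  show "frac_maximal_norm \<mu> < \<infinity>" using fin by (simp add: less_top)
  fix x :: "real^'d" and r :: real assume r: "r > 0"
  let ?N = "frac_maximal_norm \<mu>"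
  have "AE x in lborel. frac_maximal \<mu> x \<le> ?N"
    unfolding frac_maximal_norm_def by (rule esssup_AE)
  then have "emeasure lborel {x. ?N < frac_maximal \<mu> x} = 0"
    using frac_maximal_gt_open[OF sets, of ?N] by (subst (asm) AE_iff_measurable[where N="{x. ?N < frac_maximal \<mu> x}"]) (auto simp: not_le)
  then have "{x. ?N < frac_maximal \<mu> x} = {}"
    by (rule open_null_empty[OF frac_maximal_gt_open[OF sets]])
  then have "ennreal (r powr (1 - real CARD('d))) * emeasure \<mu> (cball x r) \<le> ?N"
    using r unfolding frac_maximal_def by (auto simp: not_less SUP_le_iff set_eq_iff)
  then have "ennreal (r ^ (CARD('d) - 1)) * (ennreal (r powr (1 - real CARD('d))) * emeasure \<mu> (cball x r)) \<le> ennreal (r ^ (CARD('d) - 1)) * ?N"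
    by (rule mult_left_mono) simp
  moreover have "ennreal (r ^ (CARD('d) - 1)) * (ennreal (r powr (1 - real CARD('d))) * emeasure \<mu> (cball x r)) = emeasure \<mu> (cball x r)"
    using powr_one_minus_card[OF r, where 'd='d] by (metis mult.assoc mult.commute mult_1)
  ultimately show "emeasure \<mu> (cball x r) \<le> ?N * ennreal (r ^ (CARD('d) - 1))"
    by (simp add: mult.commute)
qed

lemma (in growth_measure) frac_maximal_norm_le: "frac_maximal_norm \<mu> \<le> N"
  unfolding frac_maximal_norm_def
proof (rule esssup_I)
  show "frac_maximal \<mu> \<in> borel_measurable lborel" by (rule frac_maximal_measurable[OF sets_mu])
  show "AE x in lborel. frac_maximal \<mu> x \<le> N"
  proof (rule AE_I2)
    fix x
    show "frac_maximal \<mu> x \<le> N"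
      unfolding frac_maximal_def
    proof (rule SUP_least)
      fix r :: real assume "r \<in> {0<..}"
      then have r: "r > 0" by simp
      have "ennreal (r powr (1 - real CARD('d))) * emeasure \<mu> (cball x r) \<le> ennreal (r powr (1 - real CARD('d))) * (N * ennreal (r ^ (CARD('d) - 1)))"
        by (intro mult_left_mono growth r) auto
      also have "\<dots> = (ennreal (r powr (1 - real CARD('d))) * ennreal (r ^ (CARD('d) - 1))) * N" by (simp only: mult_ac)
      also have "\<dots> = N" unfolding powr_one_minus_card[OF r] by simp
      finally show "ennreal (r powr (1 - real CARD('d))) * emeasure \<mu> (cball x r) \<le> N" .
    qed
  qed
qed

lemma (in growth_measure) locally_finite: "locally_finite_borel \<mu>"
  unfolding locally_finite_borel_def
proof (intro conjI ballI impI sets_mu)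
  fix S :: "(real^'d) set" assume S: "S \<in> sets borel" "bounded S"
  then obtain r where "S \<subseteq> cball 0 r" unfolding bounded_iff by (auto simp: subset_iff)
  then have "emeasure \<mu> S \<le> emeasure \<mu> (cball 0 r)" by (intro emeasure_mono) (auto simp: sets_mu)
  also have "\<dots> < \<infinity>" by (rule emeasure_cball_finite)
  finally show "emeasure \<mu> S < \<infinity>" .
qed

section \<open>Dyadic Frostman duality\<close>

lemma compact_support_uniform:
  fixes f :: "real^'d::finite \<Rightarrow> real"
  assumes f: "continuous_on UNIV f" and supp: "\<And>x. x \<notin> cball 0 \<rho> \<Longrightarrow> f x = 0" and w: "w > 0"
  obtains \<delta> where "\<delta> > 0" "\<And>x y. norm (x - y) < \<delta> \<Longrightarrow> \<bar>f x - f y\<bar> < w"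
proof -
  have "uniformly_continuous_on (cball 0 (\<rho> + 1)) f"
    by (intro compact_uniformly_continuous continuous_on_subset[OF f]) auto
  then obtain \<delta> where \<delta>: "\<delta> > 0" "\<And>x y. x \<in> cball 0 (\<rho> + 1) \<Longrightarrow> y \<in> cball 0 (\<rho> + 1) \<Longrightarrow> dist y x < \<delta> \<Longrightarrow> dist (f y) (f x) < w"
    unfolding uniformly_continuous_on_def using w by meson
  show ?thesis
  proof (rule that[of "min \<delta> 1"])
    fix x y :: "real^'d" assume xy: "norm (x - y) < min \<delta> 1"
    show "\<bar>f x - f y\<bar> < w"
    proof (cases "x \<in> cball 0 \<rho> \<or> y \<in> cball 0 \<rho>")
      case True
      then have "norm x \<le> \<rho> + 1" "norm y \<le> \<rho> + 1"
        using xy norm_triangle_sub[of x y] norm_triangle_sub[of y x] by (auto simp: norm_minus_commute)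
      then show ?thesis using \<delta>(2)[of y x] xy by (simp add: dist_norm)
    qed (use supp w in auto)
  qed (use \<delta> in auto)
qed

lemma compact_support_integrable:
  fixes f :: "real^'d::finite \<Rightarrow> 'b::{banach, second_countable_topology}"
  assumes f: "continuous_on UNIV f" and supp: "\<And>x. x \<notin> cball 0 \<rho> \<Longrightarrow> f x = 0"
    and sets: "sets \<mu> = sets borel" and fin: "emeasure \<mu> (cball 0 \<rho>) < \<infinity>"
  shows "integrable \<mu> f"
proof -
  have "bounded (f ` cball 0 \<rho>)"
    by (intro compact_imp_bounded compact_continuous_image continuous_on_subset[OF f]) auto
  then obtain M where "\<forall>v\<in>f ` cball 0 \<rho>. norm v \<le> M" unfolding bounded_iff by blast
  then have M: "norm (f x) \<le> M" if "x \<in> cball 0 \<rho>" for x using that by auto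
  show ?thesis
  proof (rule Bochner_Integration.integrable_bound)
    show "integrable \<mu> (\<lambda>x. M * indicator (cball 0 \<rho>) x)"
      using fin by (intro integrable_mult_right integrable_real_indicator) (auto simp: sets)
    show "f \<in> borel_measurable \<mu>"
      using borel_measurable_continuous_onI[OF f] by (simp add: measurable_cong_sets[OF sets refl])
    show "AE x in \<mu>. norm (f x) \<le> norm (M * indicator (cball 0 \<rho>) x)"
    proof (rule AE_I2)
      fix x show "norm (f x) \<le> norm (M * indicator (cball 0 \<rho>) x)"
        using M[of x] supp[of x] by (auto simp: indicator_def)
    qed
  qed
qed

lemma card_index_box:
  fixes a :: "'d::finite \<Rightarrow> int"
  shows "finite {n. \<forall>c. a c \<le> n c \<and> n c \<le> a c + 2}" "card {n. \<forall>c. a c \<le> n c \<and> n c \<le> a c + 2} = 3 ^ CARD('d)"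
proof -
  have eq: "{n. \<forall>c. a c \<le> n c \<and> n c \<le> a c + 2} = PiE UNIV (\<lambda>c. {a c..a c + 2})"
    by (auto simp: PiE_def Pi_def)
  show "finite {n. \<forall>c. a c \<le> n c \<and> n c \<le> a c + 2}" unfolding eq by (intro finite_PiE) auto
  show "card {n. \<forall>c. a c \<le> n c \<and> n c \<le> a c + 2} = 3 ^ CARD('d)" unfolding eq by (subst card_PiE) auto
qed

text \<open>
  A ball whose radius is at most the side length meets at most three cells in each coordinate direction.
\<close>

lemma cells_meeting_cball:
  fixes z :: "real^'d::finite"
  assumes r: "r \<le> 2 powi i" and x: "x \<in> cball z r"
  shows "\<lfloor>(z $ c - r) / 2 powi i\<rfloor> \<le> cell i x c" "cell i x c \<le> \<lfloor>(z $ c - r) / 2 powi i\<rfloor> + 2"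
proof -
  let ?s = "2 powi i :: real"
  have s: "?s > 0" by simp
  have "\<bar>(z - x) $ c\<bar> \<le> r" using x component_le_norm_cart[of "z - x" c] by (auto simp: dist_norm)
  then have b: "z $ c - r \<le> x $ c" "x $ c \<le> z $ c + r" by auto
  show "\<lfloor>(z $ c - r) / ?s\<rfloor> \<le> cell i x c"
    unfolding cell_def using b s by (intro floor_mono divide_right_mono) auto
  have "x $ c / ?s \<le> (z $ c - r) / ?s + 2"
  proof -
    have "x $ c \<le> (z $ c - r) + 2 * ?s" using b r by linarith
    then have "x $ c / ?s \<le> ((z $ c - r) + 2 * ?s) / ?s" using s by (intro divide_right_mono) auto
    then show ?thesis using s by (simp add: add_divide_distrib)
  qed
  then have "cell i x c \<le> \<lfloor>(z $ c - r) / ?s + 2\<rfloor>" unfolding cell_def by (rule floor_mono)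
  then show "cell i x c \<le> \<lfloor>(z $ c - r) / ?s\<rfloor> + 2" by linarith
qed

text \<open>
  Capacities on dyadic cells become growth on balls once the masses are spread evenly over the
  smallest cells. A ball of radius at least the smallest side and at most \<open>2\<^sup>M\<close> meets at most \<open>3\<^sup>d\<close> cells of the
  next larger side. A smaller ball is handled by the bounded density, a larger one by the total mass.
  The top cells have indices \<open>-1, 0, 1\<close> because the points lie in the cube of half side \<open>2\<^sup>M\<close>.
\<close>

lemma growth_measure_dyadic_density:
  fixes X :: "(real^'d::finite) set" and m :: "real^'d \<Rightarrow> real" and p M :: nat
  defines "lev \<equiv> \<lambda>i. int i - int p" and "g \<equiv> \<lambda>y. \<Sum>x\<in>X. m x / ((1/2) ^ p) ^ CARD('d) * indicator {y. cell (- int p) y = cell (- int p) x} y"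
  assumes fin: "finite X" and m: "\<And>x. x \<in> X \<Longrightarrow> m x \<ge> 0"
    and top: "\<And>x c. x \<in> X \<Longrightarrow> - 1 \<le> cell (int M) x c \<and> cell (int M) x c \<le> 1"
    and cap: "\<And>i b. i \<le> M + p \<Longrightarrow> (\<Sum>x\<in>{x\<in>X. cell (lev i) x = b}. m x) \<le> (2 powi lev i) ^ (CARD('d) - 1)"
  shows "growth_measure (density lborel (\<lambda>y. ennreal (g y))) (ennreal (6 ^ CARD('d)))"
    and "(\<Sum>x\<in>X. m x) \<le> 3 ^ CARD('d) * (2 ^ M) ^ (CARD('d) - 1)"
proof -
  let ?d = "CARD('d)"
  define s0 :: real where "s0 = (1/2) ^ p"
  have s0: "s0 > 0" by (simp add: s0_def)
  have lev0: "2 powi lev 0 = s0" "2 powi (- int p) = s0" by (simp_all add: lev_def s0_def power_int_minus power_one_over inverse_eq_divide)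
  have levM: "lev (M + p) = int M" by (simp add: lev_def)
  have count: "(\<Sum>x\<in>{x\<in>X. cell (lev i) x \<in> S}. m x) \<le> real (card S) * (2 powi lev i) ^ (?d - 1)"
    if i: "i \<le> M + p" and S: "finite S" for i S
  proof -
    have "(\<Sum>x\<in>{x\<in>X. cell (lev i) x \<in> S}. m x) = (\<Sum>b\<in>S. \<Sum>x\<in>{x\<in>{x\<in>X. cell (lev i) x \<in> S}. cell (lev i) x = b}. m x)"
      using fin S by (intro sum.group[symmetric]) auto
    also have "\<dots> \<le> (\<Sum>b\<in>S. (2 powi lev i) ^ (?d - 1))"
    proof (rule sum_mono)
      fix b assume "b \<in> S"
      then have "{x\<in>{x\<in>X. cell (lev i) x \<in> S}. cell (lev i) x = b} = {x\<in>X. cell (lev i) x = b}" by auto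
      then show "(\<Sum>x\<in>{x\<in>{x\<in>X. cell (lev i) x \<in> S}. cell (lev i) x = b}. m x) \<le> (2 powi lev i) ^ (?d - 1)"
        using cap[OF i, of b] by simp
    qed
    finally show ?thesis by simp
  qed
  have all_top: "{x\<in>X. cell (lev (M + p)) x \<in> {n. \<forall>c. - 1 \<le> n c \<and> n c \<le> - 1 + 2}} = X"
    using top by (auto simp: levM)
  have total: "(\<Sum>x\<in>X. m x) \<le> 3 ^ ?d * (2 ^ M) ^ (?d - 1)"
    using count[of "M + p" "{n. \<forall>c. - 1 \<le> n c \<and> n c \<le> - 1 + 2}"] card_index_box[of "\<lambda>_::'d. - 1"]
    unfolding all_top by (simp add: levM)
  then show "(\<Sum>x\<in>X. m x) \<le> 3 ^ ?d * (2 ^ M) ^ (?d - 1)" .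
  have cell_sets [measurable]: "{y :: real^'d. cell i y = b} \<in> sets borel" for i b
    using measurable_sets[OF cell_measurable, of "{b}" i] by (simp add: vimage_def)
  have g_meas [measurable]: "g \<in> borel_measurable borel" unfolding g_def by measurable
  let ?nu = "density lborel (\<lambda>y. ennreal (g y))"
  have nu_eq: "emeasure ?nu S = (\<Sum>x\<in>X. ennreal (m x / s0 ^ ?d) * emeasure lborel ({y. cell (- int p) y = cell (- int p) x} \<inter> S))"
    if [measurable]: "S \<in> sets borel" for S
  proof -
    have "emeasure ?nu S = (\<integral>\<^sup>+y. ennreal (g y) * indicator S y \<partial>lborel)"
      by (rule emeasure_density) auto
    also have "\<dots> = (\<integral>\<^sup>+y. (\<Sum>x\<in>X. ennreal (m x / s0 ^ ?d) * indicator ({y. cell (- int p) y = cell (- int p) x} \<inter> S) y) \<partial>lborel)"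
    proof (rule nn_integral_cong)
      fix y
      have "ennreal (g y) = (\<Sum>x\<in>X. ennreal (m x / s0 ^ ?d * indicator {y. cell (- int p) y = cell (- int p) x} y))"
        unfolding g_def s0_def[symmetric] using m s0 by (intro sum_ennreal[symmetric] mult_nonneg_nonneg) auto
      then show "ennreal (g y) * indicator S y = (\<Sum>x\<in>X. ennreal (m x / s0 ^ ?d) * indicator ({y. cell (- int p) y = cell (- int p) x} \<inter> S) y)"
        by (simp only: sum_distrib_right) (intro sum.cong refl, auto simp: indicator_def)
    qed
    also have "\<dots> = (\<Sum>x\<in>X. \<integral>\<^sup>+y. ennreal (m x / s0 ^ ?d) * indicator ({y. cell (- int p) y = cell (- int p) x} \<inter> S) y \<partial>lborel)"
      by (rule nn_integral_sum) measurable
    also have "\<dots> = (\<Sum>x\<in>X. ennreal (m x / s0 ^ ?d) * emeasure lborel ({y. cell (- int p) y = cell (- int p) x} \<inter> S))"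
      by (intro sum.cong refl nn_integral_cmult_indicator) measurable
    finally show ?thesis .
  qed
  have coarse: "emeasure ?nu S \<le> ennreal (\<Sum>x\<in>{x\<in>X. {y. cell (- int p) y = cell (- int p) x} \<inter> S \<noteq> {}}. m x)"
    if S: "S \<in> sets borel" for S
  proof -
    have "emeasure ?nu S \<le> (\<Sum>x\<in>X. ennreal (if {y. cell (- int p) y = cell (- int p) x} \<inter> S \<noteq> {} then m x else 0))"
      unfolding nu_eq[OF S]
    proof (rule sum_mono)
      fix x assume x: "x \<in> X"
      have "emeasure lborel ({y. cell (- int p) y = cell (- int p) x} \<inter> S) \<le> emeasure lborel {y :: real^'d. cell (- int p) y = cell (- int p) x}"
        by (intro emeasure_mono) auto
      also have "\<dots> = ennreal (s0 ^ ?d)" by (simp add: emeasure_cell lev0)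
      finally have "ennreal (m x / s0 ^ ?d) * emeasure lborel ({y. cell (- int p) y = cell (- int p) x} \<inter> S) \<le> ennreal (m x / s0 ^ ?d) * ennreal (s0 ^ ?d)"
        by (rule mult_left_mono) simp
      also have "\<dots> = ennreal (m x)" using m[OF x] s0 by (subst ennreal_mult[symmetric]) auto
      finally have le: "ennreal (m x / s0 ^ ?d) * emeasure lborel ({y. cell (- int p) y = cell (- int p) x} \<inter> S) \<le> ennreal (m x)" .
      show "ennreal (m x / s0 ^ ?d) * emeasure lborel ({y. cell (- int p) y = cell (- int p) x} \<inter> S) \<le> ennreal (if {y. cell (- int p) y = cell (- int p) x} \<inter> S \<noteq> {} then m x else 0)"
        using le by (cases "{y. cell (- int p) y = cell (- int p) x} \<inter> S = {}") simp_all
    qed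
    also have "\<dots> = ennreal (\<Sum>x\<in>X. if {y. cell (- int p) y = cell (- int p) x} \<inter> S \<noteq> {} then m x else 0)"
      using m by (intro sum_ennreal) auto
    also have "(\<Sum>x\<in>X. if {y. cell (- int p) y = cell (- int p) x} \<inter> S \<noteq> {} then m x else 0) = (\<Sum>x\<in>{x\<in>X. {y. cell (- int p) y = cell (- int p) x} \<inter> S \<noteq> {}}. m x)"
      using fin by (rule sum.inter_filter[symmetric])
    finally show ?thesis .
  qed
  show "growth_measure ?nu (ennreal (6 ^ ?d))"
  proof
    fix z :: "real^'d" and r :: real assume r: "r > 0"
    have rd: "r ^ ?d = r * r ^ (?d - 1)" by (cases ?d) auto
    have "emeasure ?nu (cball z r) \<le> ennreal (6 ^ ?d * r ^ (?d - 1))"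
    proof (cases "r \<le> s0")
      case True
      have g_le: "g y \<le> 1 / s0" for y
      proof -
        have "g y = (\<Sum>x\<in>X. if cell (lev 0) x = cell (- int p) y then m x / s0 ^ ?d else 0)"
          unfolding g_def s0_def[symmetric] by (intro sum.cong refl) (auto simp: indicator_def lev_def)
        also have "\<dots> = (\<Sum>x\<in>{x\<in>X. cell (lev 0) x = cell (- int p) y}. m x / s0 ^ ?d)"
          using fin by (rule sum.inter_filter[symmetric])
        also have "\<dots> = (\<Sum>x\<in>{x\<in>X. cell (lev 0) x = cell (- int p) y}. m x) / s0 ^ ?d"
          by (rule sum_divide_distrib[symmetric])
        also have "\<dots> \<le> s0 ^ (?d - 1) / s0 ^ ?d"
          using cap[of 0 "cell (- int p) y"] s0 by (intro divide_right_mono) (auto simp: lev0)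
        also have "\<dots> = 1 / s0" using s0 by (cases ?d) auto
        finally show ?thesis .
      qed
      have "emeasure ?nu (cball z r) = (\<integral>\<^sup>+y. ennreal (g y) * indicator (cball z r) y \<partial>lborel)"
        by (rule emeasure_density) auto
      also have "\<dots> \<le> (\<integral>\<^sup>+y. ennreal (1 / s0) * indicator (cball z r) y \<partial>lborel)"
        by (intro nn_integral_mono mult_right_mono ennreal_leI g_le) auto
      also have "\<dots> = ennreal (1 / s0) * emeasure lborel (cball z r)"
        by (rule nn_integral_cmult_indicator) auto
      also have "\<dots> \<le> ennreal (1 / s0) * ennreal ((2 * r) ^ ?d)"
        using r by (intro mult_left_mono emeasure_cball_le) auto
      also have "\<dots> = ennreal (1 / s0 * (2 * r) ^ ?d)"
        using r s0 by (subst ennreal_mult) auto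
      also have "\<dots> \<le> ennreal (6 ^ ?d * r ^ (?d - 1))"
      proof (rule ennreal_leI)
        have "1 / s0 * (2 * r) ^ ?d = (r / s0) * (2 ^ ?d * r ^ (?d - 1))"
          by (simp add: power_mult_distrib rd)
        also have "\<dots> \<le> 1 * (6 ^ ?d * r ^ (?d - 1))"
          using True s0 r by (intro mult_mono power_mono) auto
        finally show "1 / s0 * (2 * r) ^ ?d \<le> 6 ^ ?d * r ^ (?d - 1)" by simp
      qed
      finally show ?thesis .
    next
      case False
      have ball: "(\<Sum>x\<in>{x\<in>X. {y. cell (- int p) y = cell (- int p) x} \<inter> cball z r \<noteq> {}}. m x) \<le> 6 ^ ?d * r ^ (?d - 1)"
      proof (cases "r \<le> 2 ^ M")
        case True
        \<comment> \<open>The first level whose side is at least r; its side is at most 2 r.\<close>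
        define i where "i = (LEAST i. r \<le> 2 powi lev i)"
        have ex: "r \<le> 2 powi lev (M + p)" using True by (simp add: levM)
        have i: "r \<le> 2 powi lev i" unfolding i_def by (rule LeastI[of "\<lambda>i. r \<le> 2 powi lev i", OF ex])
        have iM: "i \<le> M + p" unfolding i_def by (rule Least_le[of "\<lambda>i. r \<le> 2 powi lev i", OF ex])
        have "i \<noteq> 0" using i False lev0 by (intro notI) simp
        then obtain i' where i': "i = Suc i'" by (cases i) auto
        have "\<not> r \<le> 2 powi lev i'" using not_less_Least[of i' "\<lambda>i. r \<le> 2 powi lev i"] i' by (simp add: i_def)
        moreover have "2 powi lev i = 2 * (2 powi lev i' :: real)"
        proof -
          have "lev i = 1 + lev i'" by (simp add: lev_def i')
          then show ?thesis by (simp add: power_int_add)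
        qed
        ultimately have ir: "2 powi lev i \<le> 2 * r" by simp
        define a :: "'d \<Rightarrow> int" where "a c = \<lfloor>(z $ c - r) / 2 powi lev i\<rfloor>" for c
        let ?S = "{n. \<forall>c. a c \<le> n c \<and> n c \<le> a c + 2}"
        have "{x\<in>X. {y. cell (- int p) y = cell (- int p) x} \<inter> cball z r \<noteq> {}} \<subseteq> {x\<in>X. cell (lev i) x \<in> ?S}"
        proof (safe)
          fix x y c assume x: "x \<in> X" "cell (- int p) y = cell (- int p) x" "y \<in> cball z r"
          have "cell (lev i) y = cell (lev i) x"
            by (rule cell_mono[OF x(2)]) (simp add: lev_def)
          then show "a c \<le> cell (lev i) x c" "cell (lev i) x c \<le> a c + 2"
            using cells_meeting_cball[OF i x(3), of c] by (auto simp: a_def)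
        qed
        then have "(\<Sum>x\<in>{x\<in>X. {y. cell (- int p) y = cell (- int p) x} \<inter> cball z r \<noteq> {}}. m x) \<le> (\<Sum>x\<in>{x\<in>X. cell (lev i) x \<in> ?S}. m x)"
          using fin m by (intro sum_mono2) auto
        also have "\<dots> \<le> real (card ?S) * (2 powi lev i) ^ (?d - 1)"
          by (rule count[OF iM card_index_box(1)])
        also have "\<dots> \<le> 3 ^ ?d * (2 * r) ^ (?d - 1)"
          unfolding card_index_box(2) using ir by (intro mult_mono power_mono) auto
        also have "\<dots> \<le> 3 ^ ?d * (2 ^ ?d * r ^ (?d - 1))"
          unfolding power_mult_distrib using r by (intro mult_left_mono mult_right_mono power_increasing) auto
        also have "\<dots> = 6 ^ ?d * r ^ (?d - 1)"
          by (simp add: power_mult_distrib[symmetric] mult.assoc[symmetric])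
        finally show ?thesis .
      next
        case False
        have "(\<Sum>x\<in>{x\<in>X. {y. cell (- int p) y = cell (- int p) x} \<inter> cball z r \<noteq> {}}. m x) \<le> (\<Sum>x\<in>X. m x)"
          using fin m by (intro sum_mono2) auto
        also note total
        also have "3 ^ ?d * (2 ^ M) ^ (?d - 1) \<le> 6 ^ ?d * r ^ (?d - 1)"
          using False by (intro mult_mono power_mono) auto
        finally show ?thesis .
      qed
      have "emeasure ?nu (cball z r) \<le> ennreal (\<Sum>x\<in>{x\<in>X. {y. cell (- int p) y = cell (- int p) x} \<inter> cball z r \<noteq> {}}. m x)"
        by (rule coarse) auto
      also have "\<dots> \<le> ennreal (6 ^ ?d * r ^ (?d - 1))" by (rule ennreal_leI[OF ball])
      finally show ?thesis .
    qed
    also have "\<dots> = ennreal (6 ^ ?d) * ennreal (r ^ (?d - 1))" using r by (subst ennreal_mult) auto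
    finally show "emeasure ?nu (cball z r) \<le> ennreal (6 ^ ?d) * ennreal (r ^ (?d - 1))" .
  qed auto
qed

text \<open>
  Tree duality for the function \<open>f + w\<close> at the corners of the smallest cells, restricted to the corners where it is
  positive. The cells are so small that \<open>f\<close> oscillates by less than \<open>w\<close> on each: adding \<open>w\<close> makes the
  cover valid on whole cells, and replacing the masses at corners by a density costs another \<open>w\<close> per unit of
  mass. The total mass is bounded independently of the mesh, so the error is \<open>w\<close> times a
  constant that depends on the support of \<open>f\<close> only. The cells are replaced by balls of radius \<open>d l\<close> around one of their points.
\<close>

lemma frostman_duality:
  fixes f :: "real^'d::finite \<Rightarrow> real"
  assumes f: "continuous_on UNIV f" and supp: "\<And>x. x \<notin> cball 0 \<rho> \<Longrightarrow> f x = 0" and M: "\<rho> < 2 ^ M" and w: "w > 0"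
  obtains \<nu> and I :: "(nat \<times> ('d \<Rightarrow> int)) set" and c l :: "nat \<times> ('d \<Rightarrow> int) \<Rightarrow> real" and z :: "nat \<times> ('d \<Rightarrow> int) \<Rightarrow> real^'d"
  where "finite I" "\<And>i. i \<in> I \<Longrightarrow> c i \<ge> 0" "\<And>i. i \<in> I \<Longrightarrow> l i > 0"
    "growth_measure \<nu> (ennreal (6 ^ CARD('d)))"
    "\<And>y. f y \<le> (\<Sum>i\<in>I. c i * (if norm (y - z i) \<le> real CARD('d) * l i then 1 else 0))"
    "(\<Sum>i\<in>I. c i * l i ^ (CARD('d) - 1)) \<le> (LINT y|\<nu>. f y) + w * (2 * (3 ^ CARD('d) * (2 ^ M) ^ (CARD('d) - 1)))"
proof -
  let ?d = "CARD('d)"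
  obtain \<delta> where \<delta>: "\<delta> > 0" "\<And>x y. norm (x - y) < \<delta> \<Longrightarrow> \<bar>f x - f y\<bar> < w"
    using compact_support_uniform[OF f supp w] by metis
  obtain p where p: "(1/2) ^ p < \<delta> / real ?d"
    using real_arch_pow_inv[of "\<delta> / real ?d" "1/2"] \<delta>(1) by auto
  define s0 :: real where "s0 = (1/2) ^ p"
  have s0: "s0 > 0" "real ?d * s0 < \<delta>" using p by (auto simp: s0_def pos_less_divide_eq mult.commute)
  define lev where "lev i = int i - int p" for i
  have lev0: "2 powi (- int p) = s0" by (simp add: s0_def power_int_minus power_one_over inverse_eq_divide)
  have sM: "s0 * 2 ^ (M + p) = 2 ^ M" by (simp add: s0_def power_add power_one_over)
  have close: "\<bar>f x - f y\<bar> < w" if "cell (- int p) x = cell (- int p) y" for x y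
    using norm_diff_le_of_cell_eq[OF that] s0 by (intro \<delta>(2)) (simp add: lev0)
  define corner :: "('d \<Rightarrow> int) \<Rightarrow> real^'d" where "corner n = (\<chi> c. s0 * real_of_int (n c))" for n
  have cell_corner: "cell (- int p) (corner n) = n" for n
    using s0 by (simp add: cell_def corner_def lev0)
  \<comment> \<open>Indices of the smallest cells in the cube of half side 2^M, which contains the support of f.\<close>
  define Bx :: "('d \<Rightarrow> int) set" where "Bx = PiE UNIV (\<lambda>_. {- (2 ^ (M + p))..<2 ^ (M + p)})"
  have "finite Bx" unfolding Bx_def by (intro finite_PiE) auto
  define X where "X = {x \<in> corner ` Bx. f x + w > 0}"
  have X: "finite X" using \<open>finite Bx\<close> by (simp add: X_def)
  have "\<exists>m c. (\<forall>x\<in>X. m x \<ge> 0) \<and> (\<forall>i\<le>M + p. \<forall>b. (\<Sum>x\<in>{x\<in>X. cell (lev i) x = b}. m x) \<le> (2 powi lev i) ^ (?d - 1)) \<and>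
     (\<forall>x\<in>X. \<exists>i\<le>M + p. (\<Sum>y\<in>{y\<in>X. cell (lev i) y = cell (lev i) x}. m y) = (2 powi lev i) ^ (?d - 1)) \<and>
     (\<forall>i b. c i b \<ge> (0::real)) \<and> (\<forall>i b. b \<notin> cell (lev i) ` X \<longrightarrow> c i b = 0) \<and>
     (\<forall>x\<in>X. f x + w \<le> (\<Sum>i\<le>M + p. c i (cell (lev i) x))) \<and>
     (\<Sum>i\<le>M + p. \<Sum>b\<in>cell (lev i) ` X. c i b * (2 powi lev i) ^ (?d - 1)) \<le> (\<Sum>x\<in>X. (f x + w) * m x)"
  proof (rule laminar_duality[OF X])
    show "cell (lev (Suc i)) x = cell (lev (Suc i)) y" if "cell (lev i) x = cell (lev i) y" for i x y
      by (rule cell_mono[OF that]) (simp add: lev_def)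
  qed (auto simp: X_def)
  then obtain m and k :: "nat \<Rightarrow> ('d \<Rightarrow> int) \<Rightarrow> real" where m: "\<forall>x\<in>X. m x \<ge> 0" "\<forall>i\<le>M + p. \<forall>b. (\<Sum>x\<in>{x\<in>X. cell (lev i) x = b}. m x) \<le> (2 powi lev i) ^ (?d - 1)"
     and k: "\<forall>i b. k i b \<ge> 0" "\<forall>x\<in>X. f x + w \<le> (\<Sum>i\<le>M + p. k i (cell (lev i) x))"
     "(\<Sum>i\<le>M + p. \<Sum>b\<in>cell (lev i) ` X. k i b * (2 powi lev i) ^ (?d - 1)) \<le> (\<Sum>x\<in>X. (f x + w) * m x)"
    by (elim exE conjE) (rule that; assumption)
  have top: "- 1 \<le> cell (int M) x c \<and> cell (int M) x c \<le> 1" if x: "x \<in> X" for x c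
  proof -
    obtain n where n: "x = corner n" "n \<in> Bx" using x by (auto simp: X_def)
    have "- (2 ^ (M + p)) \<le> n c" "n c < 2 ^ (M + p)" using n(2) by (auto simp: Bx_def)
    then have "real_of_int (- (2 ^ (M + p))) \<le> real_of_int (n c)" "real_of_int (n c) \<le> real_of_int (2 ^ (M + p))" by (simp_all only: of_int_le_iff less_imp_le)
    then have "s0 * (- (2 ^ (M + p))) \<le> s0 * real_of_int (n c)" "s0 * real_of_int (n c) \<le> s0 * 2 ^ (M + p)"
      using s0(1) by (intro mult_left_mono; simp)+
    then have "- (2 ^ M) \<le> x $ c" "x $ c \<le> 2 ^ M" using sM by (auto simp: n corner_def)
    then have "-1 \<le> x $ c / 2 ^ M" "x $ c / 2 ^ M \<le> 1" by (simp_all add: le_divide_eq divide_le_eq)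
    moreover define q where "q = x $ c / 2 ^ M"
    ultimately have "- 1 \<le> q" "q \<le> 1" by simp_all
    then have "- 1 \<le> \<lfloor>q\<rfloor> \<and> \<lfloor>q\<rfloor> \<le> 1" by linarith
    then show ?thesis by (simp add: cell_def q_def)
  qed
  define g where "g y = (\<Sum>x\<in>X. m x / ((1/2) ^ p) ^ ?d * indicator {y. cell (- int p) y = cell (- int p) x} y)" for y
  define \<nu> where "\<nu> = density lborel (\<lambda>y. ennreal (g y))"
  have growth: "growth_measure \<nu> (ennreal (6 ^ ?d))" and total: "(\<Sum>x\<in>X. m x) \<le> 3 ^ ?d * (2 ^ M) ^ (?d - 1)"
  proof -
    have cap: "(\<Sum>x\<in>{x\<in>X. cell (int i - int p) x = b}. m x) \<le> (2 powi (int i - int p)) ^ (?d - 1)" if "i \<le> M + p" for i b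
      using m(2) that unfolding lev_def by blast
    note dens = growth_measure_dyadic_density[where p=p and M=M, OF X m(1)[rule_format] top cap]
    show "growth_measure \<nu> (ennreal (6 ^ ?d))" unfolding \<nu>_def g_def by (rule dens(1))
    show "(\<Sum>x\<in>X. m x) \<le> 3 ^ ?d * (2 ^ M) ^ (?d - 1)" by (rule dens(2))
  qed
  have cell_sets [measurable]: "{y :: real^'d. cell i y = b} \<in> sets borel" for i b
    using measurable_sets[OF cell_measurable, of "{b}" i] by (simp add: vimage_def)
  have g_meas [measurable]: "g \<in> borel_measurable borel" unfolding g_def[abs_def] by measurable
  have g0: "g y \<ge> 0" for y unfolding g_def using m by (intro sum_nonneg mult_nonneg_nonneg) auto
  have f_meas: "f \<in> borel_measurable borel" using f by (rule borel_measurable_continuous_onI)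
  have f_int: "integrable lborel f"
    using emeasure_lborel_cball_finite[of 0 \<rho>] by (intro compact_support_integrable[OF f supp]) auto
  have lower: "(\<Sum>x\<in>X. m x * (f x - w)) \<le> (LINT y|\<nu>. f y)"
  proof -
    let ?ind = "\<lambda>x. indicator {y :: real^'d. cell (- int p) y = cell (- int p) x} :: real^'d \<Rightarrow> real"
    have fi: "integrable lborel (\<lambda>y. ?ind x y * f y)" for x
      using integrable_mult_indicator[OF _ f_int, of "{y. cell (- int p) y = cell (- int p) x}"] by simp
    have vol: "(LINT y|lborel. ?ind x y) = s0 ^ ?d" "integrable lborel (?ind x)" for x
    proof -
      have e: "emeasure lborel {y :: real^'d. cell (- int p) y = cell (- int p) x} = ennreal (s0 ^ ?d)"
        by (simp add: emeasure_cell lev0)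
      show "integrable lborel (?ind x)" using e by (intro integrable_real_indicator) auto
      show "(LINT y|lborel. ?ind x y) = s0 ^ ?d" using e s0 by (simp add: measure_def)
    qed
    have one: "(f x - w) * s0 ^ ?d \<le> (LINT y|lborel. ?ind x y * f y)" for x
    proof -
      have "(f x - w) * s0 ^ ?d = (LINT y|lborel. ?ind x y * (f x - w))"
        using vol(1)[of x] by (simp add: mult.commute)
      also have "\<dots> \<le> (LINT y|lborel. ?ind x y * f y)"
      proof (rule integral_mono[OF _ fi])
        show "integrable lborel (\<lambda>y. ?ind x y * (f x - w))" using vol(2)[of x] by (rule integrable_mult_left)
        fix y show "?ind x y * (f x - w) \<le> ?ind x y * f y"
          using close[of y x] by (auto simp: indicator_def)
      qed
      finally show ?thesis .
    qed
    have "(\<Sum>x\<in>X. m x * (f x - w)) \<le> (\<Sum>x\<in>X. m x / s0 ^ ?d * (LINT y|lborel. ?ind x y * f y))"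
    proof (rule sum_mono)
      fix x assume x: "x \<in> X"
      have "m x * (f x - w) = m x / s0 ^ ?d * ((f x - w) * s0 ^ ?d)" using s0 by simp
      also have "\<dots> \<le> m x / s0 ^ ?d * (LINT y|lborel. ?ind x y * f y)"
        using m(1) x s0 by (intro mult_left_mono one) auto
      finally show "m x * (f x - w) \<le> m x / s0 ^ ?d * (LINT y|lborel. ?ind x y * f y)" .
    qed
    also have "\<dots> = (LINT y|lborel. (\<Sum>x\<in>X. m x / s0 ^ ?d * (?ind x y * f y)))"
      using fi by (subst Bochner_Integration.integral_sum) auto
    also have "\<dots> = (LINT y|lborel. g y *\<^sub>R f y)"
      unfolding g_def s0_def by (simp add: sum_distrib_right mult.assoc)
    also have "\<dots> = (LINT y|\<nu>. f y)"
      unfolding \<nu>_def using f_meas g0 by (intro integral_density[symmetric]) auto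
    finally show ?thesis .
  qed
  define I where "I = (SIGMA i:{..M + p}. cell (lev i) ` X)"
  have finI: "finite I" unfolding I_def using X by auto
  define z where "z q = (SOME x. cell (lev (fst q)) x = snd q)" for q :: "nat \<times> ('d \<Rightarrow> int)"
  have z: "cell (lev (fst q)) (z q) = snd q" if "q \<in> I" for q
  proof -
    obtain x where "cell (lev (fst q)) x = snd q" using \<open>q \<in> I\<close> unfolding I_def by force
    then show ?thesis unfolding z_def by (rule someI)
  qed
  define c where "c q = k (fst q) (snd q)" for q
  define l :: "nat \<times> ('d \<Rightarrow> int) \<Rightarrow> real" where "l q = 2 powi lev (fst q)" for q
  have cover: "f y \<le> (\<Sum>q\<in>I. c q * (if norm (y - z q) \<le> real ?d * l q then 1 else 0))" for y
  proof (cases "f y > 0")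
    case True
    then have y: "norm y \<le> \<rho>" using supp[of y] by force
    define x where "x = corner (cell (- int p) y)"
    have xy: "cell (- int p) x = cell (- int p) y" by (simp add: x_def cell_corner)
    have fx: "f y \<le> f x + w" using close[OF xy] by linarith
    have "cell (- int p) y \<in> Bx"
    proof -
      have "cell (- int p) y c \<in> {- (2 ^ (M + p))..<2 ^ (M + p)}" for c
      proof -
        have "\<bar>y $ c\<bar> < s0 * 2 ^ (M + p)" using y M component_le_norm_cart[of y c] unfolding sM by linarith
        then have "- (2 ^ (M + p)) \<le> y $ c / s0" "y $ c / s0 < 2 ^ (M + p)"
          using s0(1) by (auto simp: pos_le_divide_eq pos_divide_less_eq mult.commute abs_less_iff)
        then have "- (2 ^ (M + p)) \<le> \<lfloor>y $ c / s0\<rfloor>" "\<lfloor>y $ c / s0\<rfloor> < 2 ^ (M + p)"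
          by (simp_all add: le_floor_iff floor_less_iff)
        then show ?thesis by (simp add: cell_def lev0)
      qed
      then show ?thesis by (auto simp: Bx_def)
    qed
    then have x: "x \<in> X" using fx True by (auto simp: X_def x_def)
    have lev_xy: "cell (lev i) x = cell (lev i) y" for i
      by (rule cell_mono[OF xy]) (simp add: lev_def)
    have "f y \<le> (\<Sum>i\<le>M + p. k i (cell (lev i) x))" using fx k(2) x by force
    also have "\<dots> \<le> (\<Sum>i\<le>M + p. \<Sum>b\<in>cell (lev i) ` X. c (i, b) * (if norm (y - z (i, b)) \<le> real ?d * l (i, b) then 1 else 0))"
    proof (rule sum_mono)
      fix i assume i: "i \<in> {..M + p}"
      let ?b = "cell (lev i) x"
      have "(i, ?b) \<in> I" using i x by (auto simp: I_def)
      then have "cell (lev i) (z (i, ?b)) = cell (lev i) y" using z[of "(i, ?b)"] lev_xy by simp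
      then have "norm (y - z (i, ?b)) \<le> real ?d * l (i, ?b)"
        using norm_diff_le_of_cell_eq[of "lev i" y "z (i, ?b)"] by (simp add: l_def)
      then have "k i ?b = c (i, ?b) * (if norm (y - z (i, ?b)) \<le> real ?d * l (i, ?b) then 1 else 0)" by (simp add: c_def)
      also have "\<dots> \<le> (\<Sum>b\<in>cell (lev i) ` X. c (i, b) * (if norm (y - z (i, b)) \<le> real ?d * l (i, b) then 1 else 0))"
        using x X k(1) by (intro member_le_sum[where f="\<lambda>b. c (i, b) * (if norm (y - z (i, b)) \<le> real ?d * l (i, b) then 1 else 0)"]) (auto simp: c_def)
      finally show "k i ?b \<le> (\<Sum>b\<in>cell (lev i) ` X. c (i, b) * (if norm (y - z (i, b)) \<le> real ?d * l (i, b) then 1 else 0))" .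
    qed
    also have "\<dots> = (\<Sum>q\<in>I. c q * (if norm (y - z q) \<le> real ?d * l q then 1 else 0))"
      unfolding I_def using X by (subst sum.Sigma) (auto simp: case_prod_beta')
    finally show ?thesis .
  next
    case False
    have "0 \<le> (\<Sum>q\<in>I. c q * (if norm (y - z q) \<le> real ?d * l q then 1 else 0))"
      using k(1) by (intro sum_nonneg) (auto simp: c_def)
    then show ?thesis using False by linarith
  qed
  \<comment> \<open>The factor 2: each unit of mass pays w in the objective f + w and w for the oscillation of f.\<close>
  have cost: "(\<Sum>q\<in>I. c q * l q ^ (?d - 1)) \<le> (LINT y|\<nu>. f y) + w * (2 * (3 ^ ?d * (2 ^ M) ^ (?d - 1)))"
  proof -
    have "(\<Sum>q\<in>I. c q * l q ^ (?d - 1)) = (\<Sum>i\<le>M + p. \<Sum>b\<in>cell (lev i) ` X. k i b * (2 powi lev i) ^ (?d - 1))"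
      unfolding I_def c_def l_def using X by (subst sum.Sigma) (auto simp: case_prod_beta')
    also have "\<dots> \<le> (\<Sum>x\<in>X. (f x + w) * m x)" by (rule k(3))
    also have "\<dots> = (\<Sum>x\<in>X. m x * (f x - w)) + w * (2 * (\<Sum>x\<in>X. m x))"
      unfolding sum_distrib_left sum.distrib[symmetric] by (intro sum.cong refl) (simp add: algebra_simps)
    also have "\<dots> \<le> (LINT y|\<nu>. f y) + w * (2 * (3 ^ ?d * (2 ^ M) ^ (?d - 1)))"
      using lower total w by (intro add_mono mult_left_mono) auto
    finally show ?thesis .
  qed
  show ?thesis
    by (rule that[OF finI _ _ growth cover cost]) (use k(1) in \<open>auto simp: c_def l_def\<close>)
qed

section \<open>Test functions and linear functionals\<close>

text \<open>
  The norm is only known to be homogeneous over \<open>\<complex>\<close>, and the comparison with coordinates is proved by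
  induction on the basis. By induction the span of \<open>B\<close> is complete, so a
  vector \<open>v\<close> outside the span has positive distance \<open>\<delta>\<close> from it, and \<open>\<delta>\<close> bounds the coefficient of \<open>v\<close>.
\<close>

lemma coordinates_bounded:
  fixes scaleE :: "complex \<Rightarrow> 'e::real_normed_vector \<Rightarrow> 'e"
  assumes vs: "vector_space scaleE" and nrm: "\<And>c x. norm (scaleE c x) = cmod c * norm x"
    and "finite B" and "\<not> module.dependent scaleE B"
  shows "\<exists>K>0. \<forall>c. (\<Sum>b\<in>B. cmod (c b)) \<le> K * norm (\<Sum>b\<in>B. scaleE (c b) b)"
  using assms(3,4)
proof (induction B rule: finite_induct)
  case empty
  show ?case by (intro exI[of _ 1]) auto
next
  case (insert v B)
  interpret vector_space scaleE by (rule vs)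
  have indB: "independent B" using insert.prems by (rule independent_mono) auto
  then obtain K where K: "K > 0" "\<And>c. (\<Sum>b\<in>B. cmod (c b)) \<le> K * norm (\<Sum>b\<in>B. scaleE (c b) b)"
    using insert.IH by blast
  have v: "v \<notin> span B"
    using insert.prems insert.hyps by (simp add: independent_insert)
  have "\<exists>\<delta>>0. \<forall>c. \<delta> \<le> norm (v - (\<Sum>b\<in>B. scaleE (c b) b))"
  proof (rule ccontr)
    assume "\<not> ?thesis"
    then have "\<forall>n::nat. \<exists>c. norm (v - (\<Sum>b\<in>B. scaleE (c b) b)) < 1 / real (Suc n)"
      by (metis not_less of_nat_0_less_iff zero_less_Suc zero_less_divide_1_iff)
    then obtain c where c: "\<And>n. norm (v - (\<Sum>b\<in>B. scaleE (c n b) b)) < 1 / real (Suc n)" by metis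
    have lim: "(\<lambda>n. \<Sum>b\<in>B. scaleE (c n b) b) \<longlonglongrightarrow> v"
    proof (rule LIMSEQ_I)
      fix e :: real assume "e > 0"
      then obtain N where N: "1 / real (Suc N) < e" using nat_approx_posE by metis
      show "\<exists>N. \<forall>n\<ge>N. norm ((\<Sum>b\<in>B. scaleE (c n b) b) - v) < e"
      proof (intro exI[of _ N] allI impI)
        fix n assume "n \<ge> N"
        then have "1 / real (Suc n) \<le> 1 / real (Suc N)" by (intro divide_left_mono) auto
        then show "norm ((\<Sum>b\<in>B. scaleE (c n b) b) - v) < e" using c[of n] N by (simp add: norm_minus_commute)
      qed
    qed
    have diff: "(\<Sum>b\<in>B. scaleE (c n b) b) - (\<Sum>b\<in>B. scaleE (c k b) b) = (\<Sum>b\<in>B. scaleE (c n b - c k b) b)" for n k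
      by (simp add: sum_subtractf[symmetric] scale_left_diff_distrib)
    have "convergent (\<lambda>n. c n b)" if b: "b \<in> B" for b
    proof (rule Cauchy_convergent, rule CauchyI)
      fix e :: real assume e: "e > 0"
      have "Cauchy (\<lambda>n. \<Sum>b\<in>B. scaleE (c n b) b)" using lim by (rule LIMSEQ_imp_Cauchy)
      from CauchyD[OF this, of "e / K"] e K(1) obtain N where N: "\<And>m n. m \<ge> N \<Longrightarrow> n \<ge> N \<Longrightarrow> norm ((\<Sum>b\<in>B. scaleE (c m b) b) - (\<Sum>b\<in>B. scaleE (c n b) b)) < e / K"
        by auto
      show "\<exists>N. \<forall>m\<ge>N. \<forall>n\<ge>N. norm (c m b - c n b) < e"
      proof (intro exI[of _ N] allI impI)
        fix m n assume mn: "m \<ge> N" "n \<ge> N"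
        have "norm (c m b - c n b) \<le> (\<Sum>b\<in>B. cmod (c m b - c n b))"
          using b insert.hyps(1) by (intro member_le_sum) auto
        also have "\<dots> \<le> K * norm (\<Sum>b\<in>B. scaleE (c m b - c n b) b)" by (rule K(2))
        also have "\<dots> < K * (e / K)"
          using N[OF mn] K(1) unfolding diff by (intro mult_strict_left_mono) auto
        finally show "norm (c m b - c n b) < e" using K(1) by simp
      qed
    qed
    then obtain a where a: "\<And>b. b \<in> B \<Longrightarrow> (\<lambda>n. c n b) \<longlonglongrightarrow> a b"
      unfolding convergent_def by metis
    have "(\<lambda>n. \<Sum>b\<in>B. scaleE (c n b) b) \<longlonglongrightarrow> (\<Sum>b\<in>B. scaleE (a b) b)"
    proof (rule tendsto_sum)
      fix b assume b: "b \<in> B"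
      have "(\<lambda>n. norm (c n b - a b) * norm b) \<longlonglongrightarrow> 0 * norm b"
        using a[OF b] by (intro tendsto_mult tendsto_const tendsto_norm_zero) (simp add: LIM_zero)
      moreover have "norm (scaleE (c n b) b - scaleE (a b) b) = norm (c n b - a b) * norm b" for n
        by (simp add: scale_left_diff_distrib[symmetric] nrm)
      ultimately have "(\<lambda>n. norm (scaleE (c n b) b - scaleE (a b) b)) \<longlonglongrightarrow> 0" by simp
      then show "(\<lambda>n. scaleE (c n b) b) \<longlonglongrightarrow> scaleE (a b) b"
        by (simp add: tendsto_norm_zero_iff LIM_zero_iff)
    qed
    then have "v = (\<Sum>b\<in>B. scaleE (a b) b)" using lim LIMSEQ_unique by blast
    also have "\<dots> \<in> span B" by (intro span_sum span_scale span_base)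
    finally show False using v by simp
  qed
  then obtain \<delta> where \<delta>: "\<delta> > 0" "\<And>c. \<delta> \<le> norm (v - (\<Sum>b\<in>B. scaleE (c b) b))" by blast
  define K' where "K' = K + (1 + K * norm v) / \<delta>"
  have K': "K' > 0" using K(1) \<delta>(1) by (simp add: K'_def add_pos_nonneg)
  show ?case
  proof (intro exI[of _ K'] conjI allI K')
    fix c
    let ?s = "\<Sum>b\<in>B. scaleE (c b) b"
    let ?t = "\<Sum>b\<in>insert v B. scaleE (c b) b"
    have t: "?t = scaleE (c v) v + ?s" using insert.hyps by simp
    have cv: "cmod (c v) * \<delta> \<le> norm ?t"
    proof (cases "c v = 0")
      case False
      have "?t = scaleE (c v) (v - (\<Sum>b\<in>B. scaleE (- (c b / c v)) b))"
        unfolding t using False by (simp add: scale_right_diff_distrib scale_right_distrib scale_sum_right sum_negf)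
      then have "norm ?t = cmod (c v) * norm (v - (\<Sum>b\<in>B. scaleE (- (c b / c v)) b))" by (simp add: nrm)
      then show ?thesis using \<delta>(2)[of "\<lambda>b. - (c b / c v)"] by (simp add: mult_left_mono)
    qed simp
    then have cv': "cmod (c v) \<le> norm ?t / \<delta>" using \<delta>(1) by (simp add: pos_le_divide_eq)
    have "norm ?s \<le> norm ?t + cmod (c v) * norm v"
      unfolding t using norm_triangle_ineq4[of "scaleE (c v) v + ?s" "scaleE (c v) v"] by (simp add: nrm)
    then have "(\<Sum>b\<in>B. cmod (c b)) \<le> K * (norm ?t + cmod (c v) * norm v)"
      using K(2)[of c] mult_left_mono[of _ _ K] K(1) by (smt (verit))
    then have "(\<Sum>b\<in>insert v B. cmod (c b)) \<le> cmod (c v) * (1 + K * norm v) + K * norm ?t"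
      using insert.hyps by (simp add: algebra_simps)
    also have "\<dots> \<le> norm ?t / \<delta> * (1 + K * norm v) + K * norm ?t"
      using K(1) by (intro add_right_mono mult_right_mono cv') auto
    also have "\<dots> = K' * norm ?t" by (simp add: K'_def algebra_simps)
    finally show "(\<Sum>b\<in>insert v B. cmod (c b)) \<le> K' * norm ?t" .
  qed
qed

lemma linear_functional_bounded:
  fixes scaleE :: "complex \<Rightarrow> 'e::real_normed_vector \<Rightarrow> 'e" and l :: "'e \<Rightarrow> complex"
  assumes E: "fin_dim_complex_normed scaleE" and l: "Vector_Spaces.linear scaleE (*) l"
  shows "bounded_linear l"
proof -
  have nrm: "\<And>c x. norm (scaleE c x) = cmod c * norm x" and real: "\<And>r x. scaleE (complex_of_real r) x = r *\<^sub>R x"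
    using E by (auto simp: fin_dim_complex_normed_def)
  obtain B where "finite_dimensional_vector_space scaleE B" using E by (auto simp: fin_dim_complex_normed_def)
  then interpret finite_dimensional_vector_space scaleE B .
  interpret l: Vector_Spaces.linear scaleE "(*)" l by (rule l)
  obtain K where K: "K > 0" "\<And>c. (\<Sum>b\<in>B. cmod (c b)) \<le> K * norm (\<Sum>b\<in>B. scaleE (c b) b)"
    using coordinates_bounded[OF vector_space_axioms nrm finite_Basis independent_Basis] by blast
  define M where "M = (\<Sum>b\<in>B. cmod (l b))"
  show ?thesis
  proof (rule bounded_linear_intro)
    show "l (x + y) = l x + l y" for x y by (rule l.add)
    show "l (r *\<^sub>R x) = r *\<^sub>R l x" for r x
      using l.scale[of "complex_of_real r" x] by (simp add: real scaleR_conv_of_real)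
    fix x
    have "x \<in> span B" by (simp add: span_Basis)
    then obtain c where x: "x = (\<Sum>b\<in>B. scaleE (c b) b)"
      using finite_Basis by (auto simp: span_finite)
    have "l x = (\<Sum>b\<in>B. c b * l b)" unfolding x by (simp add: l.sum l.scale)
    then have "cmod (l x) \<le> (\<Sum>b\<in>B. cmod (c b) * cmod (l b))"
      using norm_sum[of "\<lambda>b. c b * l b" B] by (simp add: norm_mult)
    also have "\<dots> \<le> (\<Sum>b\<in>B. cmod (c b) * M)"
      unfolding M_def using finite_Basis by (intro sum_mono mult_left_mono member_le_sum) auto
    also have "\<dots> = (\<Sum>b\<in>B. cmod (c b)) * M" by (rule sum_distrib_right[symmetric])
    also have "\<dots> \<le> (K * norm x) * M"
      unfolding x by (intro mult_right_mono K) (auto simp: M_def sum_nonneg)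
    finally show "norm (l x) \<le> norm x * (K * M)" by (simp add: mult_ac)
  qed
qed

lemma smooth_iterated_continuous:
  assumes "smooth \<phi>"
  shows "continuous_on UNIV ((partial j ^^ k) \<phi>)"
proof -
  have "foldr partial (replicate k j) \<phi> = (partial j ^^ k) \<phi>"
    by (simp add: foldr_replicate)
  then show ?thesis
    using assms unfolding smooth_def by (metis differentiable_imp_continuous_on)
qed

lemma partial_support:
  fixes f :: "real^'d::finite \<Rightarrow> 'a::real_normed_vector"
  assumes f: "\<And>x. x \<notin> S \<Longrightarrow> f x = 0" and S: "closed S" and x: "x \<notin> S"
  shows "partial i f x = 0"
proof -
  have "open (- S)" using S by auto
  then obtain e where e: "e > 0" "ball x e \<subseteq> - S" using x unfolding open_contains_ball by blast
  have "((\<lambda>t. f (x + t *\<^sub>R axis i 1)) has_vector_derivative 0) (at 0)"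
  proof (rule has_vector_derivative_transform_within[where d=e and f="\<lambda>_. 0"])
    fix t :: real assume "dist t 0 < e"
    then have "x + t *\<^sub>R axis i 1 \<in> ball x e" by (simp add: dist_norm norm_axis_1)
    then show "0 = f (x + t *\<^sub>R axis i 1)" using e(2) f by auto
  qed (use e in auto)
  then show ?thesis unfolding partial_def by (rule vector_derivative_at)
qed

lemma iterated_partial_support:
  fixes f :: "real^'d::finite \<Rightarrow> 'a::real_normed_vector"
  assumes f: "\<And>x. x \<notin> S \<Longrightarrow> f x = 0" and S: "closed S"
  shows "x \<notin> S \<Longrightarrow> (partial i ^^ k) f x = 0"
  by (induction k arbitrary: x) (auto intro: f partial_support[OF _ S])

lemma test_function_support:
  assumes "test_function f"
  obtains \<rho> where "\<rho> > 0" "\<And>x. x \<notin> cball 0 \<rho> \<Longrightarrow> f x = 0"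
proof -
  have "bounded (closure {x. f x \<noteq> 0})" using assms by (simp add: test_function_def compact_imp_bounded)
  then obtain r where r: "\<And>x. x \<in> closure {x. f x \<noteq> 0} \<Longrightarrow> norm x \<le> r" unfolding bounded_iff by blast
  show ?thesis
  proof (rule that[of "max r 1"])
    fix x :: "real^'a" assume "x \<notin> cball 0 (max r 1)"
    then have "x \<notin> closure {x. f x \<noteq> 0}" using r[of x] by auto
    then show "f x = 0" using closure_subset[of "{x. f x \<noteq> 0}"] by auto
  qed simp
qed

text \<open>
  The derivative is determined by its values on the axes, which are the partial derivatives, and
  every coordinate of \<open>h\<close> is at most its norm.
\<close>

lemma differentiable_partial_bound:
  fixes f :: "real^'d::finite \<Rightarrow> 'a::real_normed_vector"
  assumes f: "f differentiable (at x)"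
  shows "onorm (frechet_derivative f (at x)) \<le> (\<Sum>i\<in>UNIV. norm (partial i f x))"
proof -
  let ?D = "frechet_derivative f (at x)"
  have D: "(f has_derivative ?D) (at x)" using f by (simp add: frechet_derivative_works)
  then have bl: "bounded_linear ?D" by (rule has_derivative_bounded_linear)
  interpret bounded_linear ?D by (rule bl)
  have part: "partial i f x = ?D (axis i 1)" for i
  proof -
    have "((\<lambda>t. x + t *\<^sub>R axis i 1) has_derivative (\<lambda>t. t *\<^sub>R axis i 1)) (at (0::real))"
      by (auto intro!: derivative_eq_intros)
    then have "((\<lambda>t. f (x + t *\<^sub>R axis i 1)) has_derivative (\<lambda>t. ?D (t *\<^sub>R axis i 1))) (at 0)"
      using D by (intro has_derivative_compose[where f="\<lambda>t. x + t *\<^sub>R axis i 1" and g=f]) auto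
    then have "((\<lambda>t. f (x + t *\<^sub>R axis i 1)) has_vector_derivative ?D (axis i 1)) (at 0)"
      unfolding has_vector_derivative_def by (simp add: scaleR)
    then show ?thesis unfolding partial_def by (rule vector_derivative_at)
  qed
  show ?thesis
  proof (rule onorm_bound)
    fix h :: "real^'d"
    have "h = (\<Sum>i\<in>UNIV. (h $ i) *\<^sub>R axis i 1)"
      using basis_expansion[of h] by (simp add: scalar_mult_eq_scaleR)
    then have "?D h = (\<Sum>i\<in>UNIV. (h $ i) *\<^sub>R ?D (axis i 1))"
      by (metis (no_types, lifting) scaleR sum sum.cong)
    then have "norm (?D h) \<le> (\<Sum>i\<in>UNIV. \<bar>h $ i\<bar> * norm (partial i f x))"
      using norm_sum[of "\<lambda>i. (h $ i) *\<^sub>R ?D (axis i 1)" UNIV] by (simp add: part)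
    also have "\<dots> \<le> (\<Sum>i\<in>UNIV. norm h * norm (partial i f x))"
      by (intro sum_mono mult_right_mono component_le_norm_cart) auto
    also have "\<dots> = (\<Sum>i\<in>UNIV. norm (partial i f x)) * norm h"
      by (simp add: sum_distrib_left mult.commute)
    finally show "norm (?D h) \<le> (\<Sum>i\<in>UNIV. norm (partial i f x)) * norm h" .
  qed (auto intro: sum_nonneg)
qed

lemma test_function_hardy_kernel:
  fixes \<psi> :: "real^'d::finite \<Rightarrow> complex"
  assumes \<psi>: "test_function \<psi>"
  obtains K R where "hardy_kernel \<psi> K R"
proof -
  obtain R where R: "R > 0" "\<And>x. x \<notin> cball 0 R \<Longrightarrow> \<psi> x = 0" using test_function_support[OF \<psi>] by metis
  have sm: "smooth \<psi>" using \<psi> by (simp add: test_function_def)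
  have diff: "foldr partial is \<psi> differentiable_on UNIV" for "is" using sm by (simp add: smooth_def)
  have bdd: "\<exists>M\<ge>0. \<forall>x. norm (u x) \<le> M" if u: "continuous_on UNIV u" and z: "\<And>x. x \<notin> cball 0 R \<Longrightarrow> u x = 0" for u :: "real^'d \<Rightarrow> complex"
  proof -
    have "bounded (u ` cball 0 R)"
      by (intro compact_imp_bounded compact_continuous_image continuous_on_subset[OF u]) auto
    then obtain M where M: "\<forall>v\<in>u ` cball 0 R. norm v \<le> M" unfolding bounded_iff by blast
    have "norm (u x) \<le> max M 0" for x
      using M z[of x] by (cases "x \<in> cball 0 R") (auto simp: max.coboundedI1)
    then show ?thesis by (intro exI[of _ "max M 0"]) auto
  qed
  have cont: "continuous_on UNIV (foldr partial is \<psi>)" for "is" using diff by (rule differentiable_imp_continuous_on)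
  obtain M0 where M0: "M0 \<ge> 0" "\<And>x. norm (\<psi> x) \<le> M0" using bdd[of \<psi>] cont[of "[]"] R(2) by auto
  have "\<exists>M\<ge>0. \<forall>x. norm (partial i \<psi> x) \<le> M" for i
  proof (rule bdd)
    show "continuous_on UNIV (partial i \<psi>)" using cont[of "[i]"] by simp
    show "partial i \<psi> x = 0" if "x \<notin> cball 0 R" for x
      by (rule partial_support[OF R(2) closed_cball that])
  qed
  then obtain M where M: "\<And>i. M i \<ge> 0" "\<And>i x. norm (partial i \<psi> x) \<le> M i" by metis
  define K where "K = max M0 (\<Sum>i\<in>UNIV. M i)"
  have "hardy_kernel \<psi> K R"
  proof
    show "norm (\<psi> x) \<le> K" for x using M0(2)[of x] by (simp add: K_def max.coboundedI1)
    show "\<psi> x = 0" if "R < norm x" for x using R(2)[of x] that by simp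
    fix x y
    have d: "\<psi> differentiable (at u)" for u
      using diff[of "[]"] by (simp add: differentiable_on_def)
    show "norm (\<psi> x - \<psi> y) \<le> K * norm (x - y)"
    proof (rule differentiable_bound[where S=UNIV])
      show "(\<psi> has_derivative frechet_derivative \<psi> (at u)) (at u within UNIV)" for u
        using d[of u] by (simp add: frechet_derivative_works)
      show "onorm (frechet_derivative \<psi> (at u)) \<le> K" for u
      proof -
        have "onorm (frechet_derivative \<psi> (at u)) \<le> (\<Sum>i\<in>UNIV. norm (partial i \<psi> u))"
          by (rule differentiable_partial_bound[OF d])
        also have "\<dots> \<le> (\<Sum>i\<in>UNIV. M i)" by (intro sum_mono M)
        finally show ?thesis by (simp add: K_def max.coboundedI2)
      qed
    qed auto
  qed (use R in auto)
  then show ?thesis by (rule that)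
qed

section \<open>The equivalence\<close>

context hardy_kernel begin

lemma hardy_maximal_sum_le:
  fixes u :: "'i \<Rightarrow> real^'d \<Rightarrow> real"
  assumes I: "finite I" and c: "\<And>i. i \<in> I \<Longrightarrow> c i \<ge> 0" and u: "\<And>i. i \<in> I \<Longrightarrow> integrable lborel (u i)"
  shows "hardy_maximal \<psi> (\<lambda>y. \<Sum>i\<in>I. c i * u i y) x \<le> (\<Sum>i\<in>I. ennreal (c i) * hardy_maximal \<psi> (u i) x)"
  unfolding hardy_maximal_eq[of "\<lambda>y. \<Sum>i\<in>I. c i * u i y"]
proof (rule SUP_least)
  fix t :: real assume "t \<in> {0<..}"
  then have t: "t > 0" by simp
  let ?A = "\<lambda>i. LINT y|lborel. complex_of_real (u i y) * dil t (x - y)"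
  have "(LINT y|lborel. complex_of_real (\<Sum>i\<in>I. c i * u i y) * dil t (x - y)) =
     (LINT y|lborel. (\<Sum>i\<in>I. complex_of_real (c i) * (complex_of_real (u i y) * dil t (x - y))))"
    by (simp add: sum_distrib_right mult.assoc)
  also have "\<dots> = (\<Sum>i\<in>I. LINT y|lborel. complex_of_real (c i) * (complex_of_real (u i y) * dil t (x - y)))"
    by (intro Bochner_Integration.integral_sum integrable_mult_right integrable_mult_dil u)
  also have "\<dots> = (\<Sum>i\<in>I. complex_of_real (c i) * ?A i)"
    by (intro sum.cong refl integral_mult_right_zero)
  finally have "cmod (LINT y|lborel. complex_of_real (\<Sum>i\<in>I. c i * u i y) * dil t (x - y)) \<le> (\<Sum>i\<in>I. cmod (complex_of_real (c i) * ?A i))"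
    by (simp only: norm_sum)
  also have "\<dots> = (\<Sum>i\<in>I. c i * cmod (?A i))"
    using c by (intro sum.cong refl) (simp add: norm_mult)
  finally have "ennreal (cmod (LINT y|lborel. complex_of_real (\<Sum>i\<in>I. c i * u i y) * dil t (x - y))) \<le> ennreal (\<Sum>i\<in>I. c i * cmod (?A i))"
    by (rule ennreal_leI)
  also have "\<dots> = (\<Sum>i\<in>I. ennreal (c i * cmod (?A i)))"
    using c by (intro sum_ennreal[symmetric]) auto
  also have "\<dots> \<le> (\<Sum>i\<in>I. ennreal (c i) * hardy_maximal \<psi> (u i) x)"
  proof (rule sum_mono)
    fix i assume i: "i \<in> I"
    have "ennreal (c i * cmod (?A i)) = ennreal (c i) * ennreal (cmod (?A i))" using c[OF i] by (intro ennreal_mult) auto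
    also have "\<dots> \<le> ennreal (c i) * hardy_maximal \<psi> (u i) x" by (intro mult_left_mono hardy_maximal_ge t) auto
    finally show "ennreal (c i * cmod (?A i)) \<le> \<dots>" .
  qed
  finally show "ennreal (cmod (LINT y|lborel. complex_of_real (\<Sum>i\<in>I. c i * u i y) * dil t (x - y))) \<le> (\<Sum>i\<in>I. ennreal (c i) * hardy_maximal \<psi> (u i) x)" .
qed

text \<open>
  The weights of \<open>frostman_duality\<close> are transferred from cells to the bumps adapted to them. Nonnegativity of all
  potentials is essential here: the bumps of other cells must not spoil the lower bound.
\<close>

lemma hardy_majorant_from_measure:
  assumes d: "CARD('d) \<ge> 2"
  shows "\<exists>C>0. \<forall>(f :: real^'d \<Rightarrow> real) \<rho> M w. continuous_on UNIV f \<longrightarrow> (\<forall>x. x \<notin> cball 0 \<rho> \<longrightarrow> f x = 0) \<longrightarrow>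
      \<rho> < 2 ^ M \<longrightarrow> w > 0 \<longrightarrow>
      (\<exists>\<nu> \<Phi>. growth_measure \<nu> (ennreal (6 ^ CARD('d))) \<and> in_hardy \<psi> \<Phi> \<and> (\<forall>x. f x \<le> riesz_potential \<Phi> x) \<and>
        hardy_norm \<psi> \<Phi> \<le> ennreal C * ennreal ((LINT y|\<nu>. f y) + w * (2 * (3 ^ CARD('d) * (2 ^ M) ^ (CARD('d) - 1)))))"
proof -
  obtain C :: real and B :: "real^'d \<Rightarrow> real \<Rightarrow> real^'d \<Rightarrow> real" and G :: "real^'d \<Rightarrow> real \<Rightarrow> real^'d \<Rightarrow> ennreal"
    where C: "C > 0"
    and B: "\<And>z l. l > 0 \<Longrightarrow> integrable lborel (B z l)"
    "\<And>z l x. l > 0 \<Longrightarrow> integrable lborel (\<lambda>y. B z l y * (riesz_const CARD('d) * norm (x - y) powr (1 - real CARD('d))))"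
    "\<And>z l x. l > 0 \<Longrightarrow> riesz_potential (B z l) x \<ge> 0"
    "\<And>z l x. l > 0 \<Longrightarrow> norm (x - z) \<le> real CARD('d) * l \<Longrightarrow> riesz_potential (B z l) x \<ge> 1"
    "\<And>z l x. l > 0 \<Longrightarrow> hardy_maximal \<psi> (B z l) x \<le> G z l x"
    and G: "\<And>z l. G z l \<in> borel_measurable borel"
    "\<And>z l. l > 0 \<Longrightarrow> (\<integral>\<^sup>+x. G z l x \<partial>lborel) \<le> ennreal (C * l ^ (CARD('d) - 1))"
    by (rule hardy_bump_family[OF d]) (rule that; assumption)
  show ?thesis
  proof (intro exI[of _ C] conjI allI impI C)
    fix f :: "real^'d \<Rightarrow> real" and \<rho> w :: real and M :: nat
    assume f0: "continuous_on UNIV f" "\<forall>x. x \<notin> cball 0 \<rho> \<longrightarrow> f x = 0" "\<rho> < 2 ^ M" "w > 0"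
    note f = f0(1) f0(2)[rule_format] f0(3,4)
    let ?T = "2 * (3 ^ CARD('d) * (2 ^ M) ^ (CARD('d) - 1)) :: real"
    obtain \<nu> and I :: "(nat \<times> ('d \<Rightarrow> int)) set" and c l :: "nat \<times> ('d \<Rightarrow> int) \<Rightarrow> real" and z :: "nat \<times> ('d \<Rightarrow> int) \<Rightarrow> real^'d"
      where I: "finite I" and c: "\<And>i. i \<in> I \<Longrightarrow> c i \<ge> 0" and l: "\<And>i. i \<in> I \<Longrightarrow> l i > 0"
      and \<nu>: "growth_measure \<nu> (ennreal (6 ^ CARD('d)))"
      and cover: "\<And>y. f y \<le> (\<Sum>i\<in>I. c i * (if norm (y - z i) \<le> real CARD('d) * l i then 1 else 0))"
      and cost: "(\<Sum>i\<in>I. c i * l i ^ (CARD('d) - 1)) \<le> (LINT y|\<nu>. f y) + w * ?T"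
      by (rule frostman_duality[OF f]) (assumption, (rule that; assumption))
    define \<Phi> where "\<Phi> y = (\<Sum>i\<in>I. c i * B (z i) (l i) y)" for y
    have \<Phi>_eq: "\<Phi> = (\<lambda>y. \<Sum>i\<in>I. c i * B (z i) (l i) y)" by (auto simp: \<Phi>_def)
    have \<Phi>_int: "integrable lborel \<Phi>"
      unfolding \<Phi>_eq using B(1) l by (intro Bochner_Integration.integrable_sum integrable_mult_right) auto
    have riesz: "f x \<le> riesz_potential \<Phi> x" for x
    proof -
      let ?k = "\<lambda>y. riesz_const CARD('d) * norm (x - y) powr (1 - real CARD('d))"
      have "riesz_potential \<Phi> x = (LINT y|lborel. (\<Sum>i\<in>I. c i * (B (z i) (l i) y * ?k y)))"
        unfolding riesz_potential_def \<Phi>_def by (simp only: sum_distrib_right mult.assoc)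
      also have "\<dots> = (\<Sum>i\<in>I. LINT y|lborel. c i * (B (z i) (l i) y * ?k y))"
        using B(2) l by (intro Bochner_Integration.integral_sum integrable_mult_right) auto
      also have "\<dots> = (\<Sum>i\<in>I. c i * riesz_potential (B (z i) (l i)) x)"
        unfolding riesz_potential_def by (intro sum.cong refl integral_mult_right_zero)
      finally have eq: "riesz_potential \<Phi> x = (\<Sum>i\<in>I. c i * riesz_potential (B (z i) (l i)) x)" .
      have "f x \<le> (\<Sum>i\<in>I. c i * (if norm (x - z i) \<le> real CARD('d) * l i then 1 else 0))" by (rule cover)
      also have "\<dots> \<le> riesz_potential \<Phi> x"
        unfolding eq using c B(3,4) l by (intro sum_mono mult_left_mono) auto
      finally show ?thesis .
    qed
    have norm_le: "hardy_norm \<psi> \<Phi> \<le> ennreal C * ennreal (\<Sum>i\<in>I. c i * l i ^ (CARD('d) - 1))"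
    proof -
      have "hardy_norm \<psi> \<Phi> \<le> (\<integral>\<^sup>+x. (\<Sum>i\<in>I. ennreal (c i) * G (z i) (l i) x) \<partial>lborel)"
        unfolding hardy_norm_def
      proof (rule nn_integral_mono)
        fix x
        have "hardy_maximal \<psi> \<Phi> x \<le> (\<Sum>i\<in>I. ennreal (c i) * hardy_maximal \<psi> (B (z i) (l i)) x)"
          unfolding \<Phi>_eq using c B(1) l by (intro hardy_maximal_sum_le I) auto
        also have "\<dots> \<le> (\<Sum>i\<in>I. ennreal (c i) * G (z i) (l i) x)"
          using B(5) l by (intro sum_mono mult_left_mono) auto
        finally show "hardy_maximal \<psi> \<Phi> x \<le> \<dots>" .
      qed
      also have "\<dots> = (\<Sum>i\<in>I. \<integral>\<^sup>+x. ennreal (c i) * G (z i) (l i) x \<partial>lborel)"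
        using G(1) by (intro nn_integral_sum) auto
      also have "\<dots> = (\<Sum>i\<in>I. ennreal (c i) * (\<integral>\<^sup>+x. G (z i) (l i) x \<partial>lborel))"
        using G(1) by (intro sum.cong refl nn_integral_cmult) auto
      also have "\<dots> \<le> (\<Sum>i\<in>I. ennreal (c i) * ennreal (C * l i ^ (CARD('d) - 1)))"
        using G(2) l by (intro sum_mono mult_left_mono) auto
      also have "\<dots> = (\<Sum>i\<in>I. ennreal (C * (c i * l i ^ (CARD('d) - 1))))"
      proof (rule sum.cong[OF refl])
        fix i assume i: "i \<in> I"
        have "ennreal (c i) * ennreal (C * l i ^ (CARD('d) - 1)) = ennreal (c i * (C * l i ^ (CARD('d) - 1)))"
          using c[OF i] l[OF i] C by (intro ennreal_mult[symmetric]) auto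
        then show "ennreal (c i) * ennreal (C * l i ^ (CARD('d) - 1)) = ennreal (C * (c i * l i ^ (CARD('d) - 1)))"
          by (simp only: mult.left_commute)
      qed
      also have "\<dots> = ennreal (\<Sum>i\<in>I. C * (c i * l i ^ (CARD('d) - 1)))"
        using c l C by (intro sum_ennreal mult_nonneg_nonneg zero_le_power) (auto simp: less_imp_le)
      also have "\<dots> = ennreal C * ennreal (\<Sum>i\<in>I. c i * l i ^ (CARD('d) - 1))"
        unfolding sum_distrib_left[symmetric] using c l C
        by (intro ennreal_mult sum_nonneg mult_nonneg_nonneg zero_le_power) (auto simp: less_imp_le)
      finally show ?thesis .
    qed
    also have "\<dots> \<le> ennreal C * ennreal ((LINT y|\<nu>. f y) + w * ?T)"
      by (intro mult_left_mono ennreal_leI cost) auto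
    finally have bound: "hardy_norm \<psi> \<Phi> \<le> ennreal C * ennreal ((LINT y|\<nu>. f y) + w * ?T)" .
    have "in_hardy \<psi> \<Phi>"
      unfolding in_hardy_def using \<Phi>_int norm_le by (auto intro: le_less_trans simp: ennreal_mult_less_top)
    then show "\<exists>\<nu> \<Phi>. growth_measure \<nu> (ennreal (6 ^ CARD('d))) \<and> in_hardy \<psi> \<Phi> \<and> (\<forall>x. f x \<le> riesz_potential \<Phi> x) \<and>
        hardy_norm \<psi> \<Phi> \<le> ennreal C * ennreal ((LINT y|\<nu>. f y) + w * ?T)"
      using \<nu> riesz bound by blast
  qed
qed

lemma hardy_norm_zero: "in_hardy \<psi> (\<lambda>_. 0)" "hardy_norm \<psi> (\<lambda>_. 0) = 0"
proof -
  have "hardy_maximal \<psi> (\<lambda>_. 0) x = 0" for x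
    unfolding hardy_maximal_def by (simp add: SUP_constant)
  then show "hardy_norm \<psi> (\<lambda>_. 0) = 0" by (simp add: hardy_norm_def)
  then show "in_hardy \<psi> (\<lambda>_. 0)" by (simp add: in_hardy_def)
qed

end

lemma growth_measure_small_ball:
  fixes x :: "real^'d::finite"
  assumes \<delta>: "0 < \<delta>" "\<delta> \<le> 1"
  shows "growth_measure (density lborel (indicator (cball x \<delta>))) (ennreal (2 ^ CARD('d)))"
proof
  fix z :: "real^'d" and r :: real assume r: "r > 0"
  have rd: "r ^ CARD('d) = r * r ^ (CARD('d) - 1)" by (cases "CARD('d)") auto
  have "emeasure (density lborel (indicator (cball x \<delta>))) (cball z r) = (\<integral>\<^sup>+y. indicator (cball x \<delta>) y * indicator (cball z r) y \<partial>lborel)"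
    by (intro emeasure_density) (simp_all add: borel_measurable_indicator)
  also have "\<dots> = (\<integral>\<^sup>+y. indicator (cball x \<delta> \<inter> cball z r) y \<partial>lborel)"
    by (intro nn_integral_cong) (auto simp: indicator_def)
  also have "\<dots> = emeasure lborel (cball x \<delta> \<inter> cball z r)"
    by (rule nn_integral_indicator) auto
  finally have eq: "emeasure (density lborel (indicator (cball x \<delta>))) (cball z r) = emeasure lborel (cball x \<delta> \<inter> cball z r)" .
  have "\<dots> \<le> ennreal (2 ^ CARD('d) * r ^ (CARD('d) - 1))"
  proof (cases "r \<le> 1")
    case True
    have "emeasure lborel (cball x \<delta> \<inter> cball z r) \<le> emeasure lborel (cball z r)"
      by (intro emeasure_mono) auto
    also have "\<dots> \<le> ennreal ((2 * r) ^ CARD('d))" using r by (intro emeasure_cball_le) auto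
    also have "\<dots> \<le> ennreal (2 ^ CARD('d) * r ^ (CARD('d) - 1))"
      using True r by (intro ennreal_leI) (auto simp: power_mult_distrib rd mult_left_le_one_le)
    finally show ?thesis .
  next
    case False
    have "emeasure lborel (cball x \<delta> \<inter> cball z r) \<le> emeasure lborel (cball x \<delta>)"
      by (intro emeasure_mono) auto
    also have "\<dots> \<le> ennreal ((2 * \<delta>) ^ CARD('d))" using \<delta> by (intro emeasure_cball_le) auto
    also have "\<dots> \<le> ennreal (2 ^ CARD('d) * r ^ (CARD('d) - 1))"
    proof (rule ennreal_leI)
      have "(2 * \<delta>) ^ CARD('d) \<le> 2 ^ CARD('d) * 1" using \<delta> by (simp add: power_mult_distrib power_le_one)
      also have "\<dots> \<le> 2 ^ CARD('d) * r ^ (CARD('d) - 1)" using False by (intro mult_left_mono one_le_power) auto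
      finally show "(2 * \<delta>) ^ CARD('d) \<le> 2 ^ CARD('d) * r ^ (CARD('d) - 1)" .
    qed
    finally show ?thesis .
  qed
  then show "emeasure (density lborel (indicator (cball x \<delta>))) (cball z r) \<le> ennreal (2 ^ CARD('d)) * ennreal (r ^ (CARD('d) - 1))"
    unfolding eq using r by (simp add: ennreal_mult)
qed auto

text \<open>
  Lebesgue measure on a small ball where \<open>f > f x / 2\<close>. Through the second statement this rules out
  \<open>\<parallel>A(\<partial>)\<phi>\<parallel> = 0\<close> when \<open>f\<close> is positive somewhere.
\<close>

lemma exists_growth_measure_integral_pos:
  fixes f :: "real^'d::finite \<Rightarrow> real"
  assumes f: "continuous_on UNIV f" and x: "f x > 0"
  obtains \<nu> where "growth_measure \<nu> (ennreal (2 ^ CARD('d)))" "(LINT y|\<nu>. f y) > 0"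
proof -
  have "isCont f x" using f by (simp add: continuous_on_eq_continuous_at)
  then obtain \<delta>0 where \<delta>0: "\<delta>0 > 0" "\<And>y. dist y x < \<delta>0 \<Longrightarrow> dist (f y) (f x) < f x / 2"
    using x unfolding continuous_at_eps_delta by (meson half_gt_zero)
  define \<delta> where "\<delta> = min (\<delta>0 / 2) 1"
  have \<delta>: "0 < \<delta>" "\<delta> < \<delta>0" "\<delta> \<le> 1" using \<delta>0(1) by (auto simp: \<delta>_def)
  have pos: "f y \<ge> f x / 2" if "y \<in> cball x \<delta>" for y
  proof -
    have "dist (f y) (f x) < f x / 2" using that \<delta> by (intro \<delta>0(2)) (auto simp: dist_commute)
    then have "\<bar>f y - f x\<bar> < f x / 2" by (simp add: dist_real_def)
    then show ?thesis by linarith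
  qed
  let ?ind = "indicator (cball x \<delta>) :: real^'d \<Rightarrow> real"
  have vol: "measure lborel (cball x \<delta>) > 0"
    using \<delta> by (simp add: content_cball)
  have int: "integrable lborel ?ind"
    using emeasure_lborel_cball_finite[of x \<delta>] by (intro integrable_real_indicator) auto
  have "integrable lborel (\<lambda>y. ?ind y *\<^sub>R f y)"
    using f by (intro borel_integrable_compact) (auto intro: continuous_on_subset)
  then have fint: "integrable lborel (\<lambda>y. ?ind y * f y)" by simp
  have "0 < f x / 2 * measure lborel (cball x \<delta>)" using x vol by simp
  also have "\<dots> = (LINT y|lborel. ?ind y * (f x / 2))" by simp
  also have "\<dots> \<le> (LINT y|lborel. ?ind y * f y)"
  proof (rule integral_mono[OF _ fint])
    show "integrable lborel (\<lambda>y. ?ind y * (f x / 2))" using int by (rule integrable_mult_left)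
    show "?ind y * (f x / 2) \<le> ?ind y * f y" for y using pos[of y] by (simp add: indicator_def)
  qed
  also have "\<dots> = (LINT y|density lborel (\<lambda>y. ennreal (?ind y)). f y)"
    using borel_measurable_continuous_onI[OF f]
    by (subst integral_density) (simp_all add: borel_measurable_indicator)
  also have "(\<lambda>y. ennreal (?ind y)) = indicator (cball x \<delta>)" by (auto simp: indicator_def)
  finally show ?thesis
    using growth_measure_small_ball[OF \<delta>(1,3)] by (intro that) auto
qed

lemma ereal_integral_le_nn_integral:
  assumes "integrable M f"
  shows "ereal (LINT x|M. f x) \<le> enn2ereal (\<integral>\<^sup>+x. ennreal (f x) \<partial>M)"
proof -
  have fin: "(\<integral>\<^sup>+x. ennreal (f x) \<partial>M) < \<infinity>"
  proof -
    have "(\<integral>\<^sup>+x. ennreal (f x) \<partial>M) \<le> (\<integral>\<^sup>+x. ennreal (norm (f x)) \<partial>M)"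
      by (intro nn_integral_mono ennreal_leI) auto
    also have "\<dots> < \<infinity>" using assms by (simp add: integrable_iff_bounded)
    finally show ?thesis .
  qed
  have "(LINT x|M. f x) \<le> enn2real (\<integral>\<^sup>+x. ennreal (f x) \<partial>M)"
    unfolding real_lebesgue_integral_def[OF assms] by simp
  then have "ereal (LINT x|M. f x) \<le> ereal (enn2real (\<integral>\<^sup>+x. ennreal (f x) \<partial>M))" by simp
  also have "\<dots> = enn2ereal (ennreal (enn2real (\<integral>\<^sup>+x. ennreal (f x) \<partial>M)))" by (simp add: enn2ereal_ennreal)
  also have "ennreal (enn2real (\<integral>\<^sup>+x. ennreal (f x) \<partial>M)) = (\<integral>\<^sup>+x. ennreal (f x) \<partial>M)"
    using fin by (simp add: ennreal_enn2real_if less_top)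
  finally show ?thesis .
qed

lemma ennreal_le_of_ereal_le: "ereal r \<le> enn2ereal e \<Longrightarrow> ennreal r \<le> e"
  by (metis e2ennreal_enn2ereal e2ennreal_ereal e2ennreal_mono)

lemma enn2ereal_mono: "a \<le> b \<Longrightarrow> enn2ereal a \<le> enn2ereal b"
  by (simp add: less_eq_ennreal.rep_eq)

theorem theorem3:
  fixes scaleE :: "complex \<Rightarrow> 'e::real_normed_vector \<Rightarrow> 'e"
    and scaleF :: "complex \<Rightarrow> 'f::real_normed_vector \<Rightarrow> 'f"
    and A :: "real^'d::finite \<Rightarrow> 'e \<Rightarrow> 'f"
    and l :: "'e \<Rightarrow> complex"
    and j :: 'd
    and m :: nat
    and \<psi> :: "real^'d \<Rightarrow> complex"
  assumes "CARD('d) \<ge> 2"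
    and "fin_dim_complex_normed scaleE"
    and "fin_dim_complex_normed scaleF"
    and "m \<ge> 1"
    and "is_symbol scaleE scaleF m A"
    and "Vector_Spaces.linear scaleE (*) l"
    and "l \<noteq> (\<lambda>_. 0)"
    and "test_function \<psi>"
    and "(LINT x|lborel. \<psi> x) \<noteq> 0"
  shows
    "(\<exists>C1>0. \<forall>\<phi> :: real^'d \<Rightarrow> 'e. test_function \<phi> \<longrightarrow>
        (\<exists>\<Phi> :: real^'d \<Rightarrow> real. in_hardy \<psi> \<Phi> \<and>
           (AE x in lborel. riesz_potential \<Phi> x \<ge> Re (l ((partial j ^^ (m - 1)) \<phi> x))) \<and>
           hardy_norm \<psi> \<Phi> \<le> ennreal C1 * L1_norm (diff_op m A \<phi>)))
     \<longleftrightarrow>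
     (\<exists>C2>0. \<forall>\<phi> :: real^'d \<Rightarrow> 'e. \<forall>\<mu> :: (real^'d) measure.
        test_function \<phi> \<longrightarrow> locally_finite_borel \<mu> \<longrightarrow> frac_maximal_norm \<mu> \<noteq> \<infinity> \<longrightarrow>
        ereal (Re (LINT x|\<mu>. l ((partial j ^^ (m - 1)) \<phi> x)))
          \<le> enn2ereal (ennreal C2 * L1_norm (diff_op m A \<phi>) * frac_maximal_norm \<mu>))"
proof -
  note d = assms(1) and c0 = assms(9)
  obtain K R where "hardy_kernel \<psi> K R" by (rule test_function_hardy_kernel[OF assms(8)])
  then interpret hardy_kernel \<psi> K R .
  have bl: "bounded_linear l" by (rule linear_functional_bounded[OF assms(2,6)])
  define g where "g \<phi> x = l ((partial j ^^ (m - 1)) \<phi> x)" for \<phi> :: "real^'d \<Rightarrow> 'e" and x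
  define f where "f \<phi> x = Re (g \<phi> x)" for \<phi> :: "real^'d \<Rightarrow> 'e" and x
  have g_cont: "continuous_on UNIV (g \<phi>)" if "test_function \<phi>" for \<phi>
    unfolding g_def using that
    by (intro bounded_linear.continuous_on[OF bl] smooth_iterated_continuous) (simp add: test_function_def)
  have f_cont: "continuous_on UNIV (f \<phi>)" if "test_function \<phi>" for \<phi>
    unfolding f_def by (intro continuous_intros g_cont that)
  have f_supp: "\<exists>\<rho>>0. \<forall>x. x \<notin> cball 0 \<rho> \<longrightarrow> g \<phi> x = 0" if \<phi>: "test_function \<phi>" for \<phi>
  proof -
    obtain \<rho> where \<rho>: "\<rho> > 0" "\<And>x. x \<notin> cball 0 \<rho> \<Longrightarrow> \<phi> x = 0" using test_function_support[OF \<phi>] by metis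
    have "g \<phi> x = 0" if "x \<notin> cball 0 \<rho>" for x
      unfolding g_def using iterated_partial_support[OF \<rho>(2) closed_cball that] linear_0[OF bounded_linear.linear[OF bl]] by simp
    then show ?thesis using \<rho>(1) by blast
  qed
  have int_f: "integrable \<mu> (f \<phi>)" "Re (LINT x|\<mu>. g \<phi> x) = (LINT x|\<mu>. f \<phi> x)"
    if \<phi>: "test_function \<phi>" and "growth_measure \<mu> N" for \<phi> \<mu> N
  proof -
    interpret \<mu>: growth_measure \<mu> N by (rule that)
    obtain \<rho> where \<rho>: "\<And>x. x \<notin> cball 0 \<rho> \<Longrightarrow> g \<phi> x = 0" using f_supp[OF \<phi>] by blast
    have int: "integrable \<mu> (g \<phi>)"
      by (rule compact_support_integrable[OF g_cont[OF \<phi>] \<rho> \<mu>.sets_mu \<mu>.emeasure_cball_finite])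
    then show "integrable \<mu> (f \<phi>)" by (simp add: f_def[abs_def])
    from int show "Re (LINT x|\<mu>. g \<phi> x) = (LINT x|\<mu>. f \<phi> x)" by (simp add: f_def)
  qed
  let ?L = "\<lambda>\<phi> :: real^'d \<Rightarrow> 'e. L1_norm (diff_op m A \<phi>)"
  let ?S1 = "\<exists>C1>0. \<forall>\<phi>. test_function \<phi> \<longrightarrow> (\<exists>\<Phi>. in_hardy \<psi> \<Phi> \<and> (AE x in lborel. riesz_potential \<Phi> x \<ge> f \<phi> x) \<and> hardy_norm \<psi> \<Phi> \<le> ennreal C1 * ?L \<phi>)"
  let ?S2 = "\<exists>C2>0. \<forall>\<phi> \<mu>. test_function \<phi> \<longrightarrow> locally_finite_borel \<mu> \<longrightarrow> frac_maximal_norm \<mu> \<noteq> \<infinity> \<longrightarrow>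
        ereal (Re (LINT x|\<mu>. g \<phi> x)) \<le> enn2ereal (ennreal C2 * ?L \<phi> * frac_maximal_norm \<mu>)"
  have "?S1 \<longleftrightarrow> ?S2"
  proof
    assume ?S1
    then obtain C1 where C1: "C1 > 0" "\<And>\<phi>. test_function \<phi> \<Longrightarrow> \<exists>\<Phi>. in_hardy \<psi> \<Phi> \<and> (AE x in lborel. riesz_potential \<Phi> x \<ge> f \<phi> x) \<and> hardy_norm \<psi> \<Phi> \<le> ennreal C1 * ?L \<phi>"
      by blast
    obtain C where C0: "C > 0" and trace: "\<forall>(\<mu> :: (real^'d) measure) N (\<Phi> :: real^'d \<Rightarrow> real) (f :: real^'d \<Rightarrow> real) \<rho>.
        growth_measure \<mu> N \<longrightarrow> integrable lborel \<Phi> \<longrightarrow> continuous_on UNIV f \<longrightarrow>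
        (\<forall>x. x \<notin> cball 0 \<rho> \<longrightarrow> f x = 0) \<longrightarrow> (AE x in lborel. f x \<le> riesz_potential \<Phi> x) \<longrightarrow>
        (\<integral>\<^sup>+y. ennreal (f y) \<partial>\<mu>) \<le> ennreal C * hardy_norm \<psi> \<Phi> * N"
      using trace_inequality[OF d c0] by blast
    note C = C0 trace[rule_format]
    show ?S2
    proof (intro exI[of _ "C * C1"] conjI allI impI)
      show "C * C1 > 0" using C(1) C1(1) by simp
      fix \<phi> :: "real^'d \<Rightarrow> 'e" and \<mu> :: "(real^'d) measure"
      assume \<phi>: "test_function \<phi>" and \<mu>: "locally_finite_borel \<mu>" "frac_maximal_norm \<mu> \<noteq> \<infinity>"
      let ?N = "frac_maximal_norm \<mu>"
      have gr: "growth_measure \<mu> ?N" by (rule growth_measure_frac_maximal_norm[OF \<mu>])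
      obtain \<Phi> where \<Phi>: "in_hardy \<psi> \<Phi>" "AE x in lborel. riesz_potential \<Phi> x \<ge> f \<phi> x" "hardy_norm \<psi> \<Phi> \<le> ennreal C1 * ?L \<phi>"
        using C1(2)[OF \<phi>] by blast
      obtain \<rho> where \<rho>: "\<And>x. x \<notin> cball 0 \<rho> \<Longrightarrow> g \<phi> x = 0" using f_supp[OF \<phi>] by blast
      have "(\<integral>\<^sup>+y. ennreal (f \<phi> y) \<partial>\<mu>) \<le> ennreal C * hardy_norm \<psi> \<Phi> * ?N"
        using \<Phi>(1,2) \<rho> by (intro C(2)[OF gr _ f_cont[OF \<phi>], where \<rho>=\<rho>]) (auto simp: in_hardy_def f_def)
      also have "\<dots> \<le> ennreal C * (ennreal C1 * ?L \<phi>) * ?N"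
        by (intro mult_right_mono mult_left_mono \<Phi>(3)) auto
      also have "\<dots> = ennreal (C * C1) * ?L \<phi> * ?N"
        using C(1) C1(1) by (simp add: ennreal_mult mult.assoc)
      finally have "(\<integral>\<^sup>+y. ennreal (f \<phi> y) \<partial>\<mu>) \<le> ennreal (C * C1) * ?L \<phi> * ?N" .
      then show "ereal (Re (LINT x|\<mu>. g \<phi> x)) \<le> enn2ereal (ennreal (C * C1) * ?L \<phi> * ?N)"
        unfolding int_f(2)[OF \<phi> gr]
        by (rule order_trans[OF ereal_integral_le_nn_integral[OF int_f(1)[OF \<phi> gr]] enn2ereal_mono])
    qed
  next
    assume ?S2
    then obtain C2 where C2: "C2 > 0" "\<And>\<phi> \<mu>. test_function \<phi> \<Longrightarrow> locally_finite_borel \<mu> \<Longrightarrow> frac_maximal_norm \<mu> \<noteq> \<infinity> \<Longrightarrow>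
        ereal (Re (LINT x|\<mu>. g \<phi> x)) \<le> enn2ereal (ennreal C2 * ?L \<phi> * frac_maximal_norm \<mu>)"
      by blast
    have S2: "ennreal (LINT x|\<mu>. f \<phi> x) \<le> ennreal C2 * ?L \<phi> * N"
      if \<phi>: "test_function \<phi>" and gr: "growth_measure \<mu> N" for \<phi> \<mu> N
    proof -
      interpret \<mu>: growth_measure \<mu> N by (rule gr)
      have N: "frac_maximal_norm \<mu> \<le> N" by (rule \<mu>.frac_maximal_norm_le)
      then have fin: "frac_maximal_norm \<mu> \<noteq> \<infinity>" using \<mu>.N_finite by (auto simp: top_unique)
      have "ennreal (LINT x|\<mu>. f \<phi> x) \<le> ennreal C2 * ?L \<phi> * frac_maximal_norm \<mu>"
        using C2(2)[OF \<phi> \<mu>.locally_finite fin] unfolding int_f(2)[OF \<phi> gr] by (rule ennreal_le_of_ereal_le)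
      also have "\<dots> \<le> ennreal C2 * ?L \<phi> * N" by (intro mult_left_mono N) auto
      finally show ?thesis .
    qed
    obtain C where C0: "C > 0" and major: "\<forall>(f :: real^'d \<Rightarrow> real) \<rho> M w. continuous_on UNIV f \<longrightarrow> (\<forall>x. x \<notin> cball 0 \<rho> \<longrightarrow> f x = 0) \<longrightarrow>
      \<rho> < 2 ^ M \<longrightarrow> w > 0 \<longrightarrow>
      (\<exists>\<nu> \<Phi>. growth_measure \<nu> (ennreal (6 ^ CARD('d))) \<and> in_hardy \<psi> \<Phi> \<and> (\<forall>x. f x \<le> riesz_potential \<Phi> x) \<and>
        hardy_norm \<psi> \<Phi> \<le> ennreal C * ennreal ((LINT y|\<nu>. f y) + w * (2 * (3 ^ CARD('d) * (2 ^ M) ^ (CARD('d) - 1)))))"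
      using hardy_majorant_from_measure[OF d] by blast
    note C = C0 major[rule_format]
    define C1 where "C1 = C * (C2 * 6 ^ CARD('d) + 1)"
    show ?S1
    proof (intro exI[of _ C1] conjI allI impI)
      show "C1 > 0" unfolding C1_def using C(1) C2(1) by (intro mult_pos_pos add_pos_pos) auto
      fix \<phi> :: "real^'d \<Rightarrow> 'e" assume \<phi>: "test_function \<phi>"
      show "\<exists>\<Phi>. in_hardy \<psi> \<Phi> \<and> (AE x in lborel. riesz_potential \<Phi> x \<ge> f \<phi> x) \<and> hardy_norm \<psi> \<Phi> \<le> ennreal C1 * ?L \<phi>"
      proof (cases "\<exists>x. f \<phi> x > 0")
        case False
        then have "f \<phi> x \<le> riesz_potential (\<lambda>_. 0) x" for x by (simp add: riesz_potential_def not_less)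
        then show ?thesis by (intro exI[of _ "\<lambda>_. 0"]) (simp add: hardy_norm_zero)
      next
        case True
        then obtain x where "f \<phi> x > 0" by blast
        then obtain \<nu>0 where \<nu>0: "growth_measure \<nu>0 (ennreal (2 ^ CARD('d)))" "(LINT y|\<nu>0. f \<phi> y) > 0"
          using exists_growth_measure_integral_pos[OF f_cont[OF \<phi>]] by metis
        \<comment> \<open>Needed for the choice of w below: the discretisation error must be positive and at most L.\<close>
        have L0: "?L \<phi> \<noteq> 0"
        proof
          assume "?L \<phi> = 0"
          then have "ennreal (LINT y|\<nu>0. f \<phi> y) \<le> 0" using S2[OF \<phi> \<nu>0(1)] by simp
          then show False using \<nu>0(2) by (simp add: ennreal_eq_0_iff)
        qed
        obtain \<rho> where \<rho>: "\<And>x. x \<notin> cball 0 \<rho> \<Longrightarrow> g \<phi> x = 0" using f_supp[OF \<phi>] by blast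
        obtain M where M: "\<rho> < 2 ^ M" using real_arch_pow[of 2 \<rho>] by auto
        define T where "T = (2 * (3 ^ CARD('d) * (2 ^ M) ^ (CARD('d) - 1)) :: real)"
        have T: "T > 0" by (simp add: T_def)
        \<comment> \<open>For infinite L any error is admissible.\<close>
        define w where "w = (if ?L \<phi> = \<infinity> then 1 else enn2real (?L \<phi>) / T)"
        have w: "w > 0" using L0 T by (simp add: w_def enn2real_positive_iff less_top zero_less_iff_neq_zero)
        have wT: "ennreal (w * T) \<le> ?L \<phi>"
          using T by (cases "?L \<phi> = \<infinity>") (auto simp: w_def ennreal_enn2real_if)
        obtain \<nu> \<Phi> where \<nu>: "growth_measure \<nu> (ennreal (6 ^ CARD('d)))" and \<Phi>: "in_hardy \<psi> \<Phi>" "\<And>x. f \<phi> x \<le> riesz_potential \<Phi> x"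
          "hardy_norm \<psi> \<Phi> \<le> ennreal C * ennreal ((LINT y|\<nu>. f \<phi> y) + w * T)"
          using C(2)[OF f_cont[OF \<phi>] _ M w] \<rho> unfolding T_def f_def by auto
        have "ennreal ((LINT y|\<nu>. f \<phi> y) + w * T) \<le> ennreal (LINT y|\<nu>. f \<phi> y) + ennreal (w * T)"
        proof -
          have "ennreal ((LINT y|\<nu>. f \<phi> y) + w * T) \<le> ennreal (max 0 (LINT y|\<nu>. f \<phi> y) + w * T)"
            by (intro ennreal_leI) auto
          also have "\<dots> = ennreal (max 0 (LINT y|\<nu>. f \<phi> y)) + ennreal (w * T)"
            using w T by (intro ennreal_plus) auto
          also have "ennreal (max 0 (LINT y|\<nu>. f \<phi> y)) = ennreal (LINT y|\<nu>. f \<phi> y)"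
            by (simp add: max_def ennreal_neg)
          finally show ?thesis .
        qed
        also have "\<dots> \<le> ennreal C2 * ?L \<phi> * ennreal (6 ^ CARD('d)) + ?L \<phi>"
          by (intro add_mono S2[OF \<phi> \<nu>] wT)
        also have "\<dots> = ennreal (C2 * 6 ^ CARD('d) + 1) * ?L \<phi>"
          using C2(1) by (simp add: ennreal_mult distrib_right distrib_left mult_ac)
        finally have le: "ennreal ((LINT y|\<nu>. f \<phi> y) + w * T) \<le> ennreal (C2 * 6 ^ CARD('d) + 1) * ?L \<phi>" .
        have "hardy_norm \<psi> \<Phi> \<le> ennreal C * (ennreal (C2 * 6 ^ CARD('d) + 1) * ?L \<phi>)"
          by (rule order_trans[OF \<Phi>(3)]) (intro mult_left_mono le, simp)
        also have "\<dots> = ennreal C1 * ?L \<phi>"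
        proof -
          have "ennreal C1 = ennreal C * ennreal (C2 * 6 ^ CARD('d) + 1)"
            unfolding C1_def using C(1) C2(1) by (intro ennreal_mult) auto
          then show ?thesis by (simp only: mult.assoc)
        qed
        finally show ?thesis using \<Phi>(1,2) by (intro exI[of _ \<Phi>]) auto
      qed
    qed
  qed
  then show ?thesis by (simp only: f_def g_def)
qed

end
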